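(* Let $\varphi[a_1,a_2,a_3,a_4](z)\in M_2(\Gamma_0(24),\chi_{24})$ be any of the 8 theta products with $(a_1,a_2,a_3,a_4)$ in the table below. Then $$\varphi[a_1,a_2,a_3,a_4](z)=b_1E_{24,1}(z)+b_2E_{1,24}(z)+b_3E_{-8,-3}(z)+b_4E_{-3,-8}(z)+x_1C_1(q)+x_2C_2(q),$$ where the coefficients are given by the corresponding row: $$\begin{array}{c|cccccc} (a_1,a_2,a_3,a_4)&b_1&b_2&b_3&b_4&x_1&x_2\\ \hline (1,1,1,6)&-1/3&4&1&-4/3&8&8/3\\ (1,1,2,3)&-1/3&4&-1&4/3&0&0\\ (1,2,2,6)&-1/3&2&1&-2/3&0&0\\ (1,3,3,6)&-1/3&4/3&-1/3&4/3&0&0\\ (1,6,6,6)&-1/3&2/3&-1/3&2/3&8/3&4/3\\ (2,2,2,3)&-1/3&2&-1&2/3&0&-4/3\\ (2,3,3,3)&-1/3&4/3&1/3&-4/3&-8/3&0\\ (2,3,6,6)&-1/3&2/3&1/3&-2/3&0&0 \end{array}$$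
   Context: Here $z\in\mathbb{H}$ (upper half plane) and $q=e^{2\pi i z}$; series in $q$ are regarded as functions of $z$. For $t\in\{-8,-3,1,24\}$, $\chi_t(m)=\left(\frac{t}{m}\right)$ (Kronecker symbol); $\chi_1$ is trivial. $M_2(\Gamma_0(24),\chi_{24})$ is the space of weight 2 modular forms for $\Gamma_0(24)$ with multiplier system $\chi_{24}$. Ramanujan's theta function is $\varphi(z)=\sum_{n=-\infty}^{\infty}q^{n^2}$, and $\varphi[a_1,a_2,a_3,a_4](z)=\varphi(a_1z)\varphi(a_2z)\varphi(a_3z)\varphi(a_4z)$. For Dirichlet characters $\chi,\psi$ and $n\in\mathbb{N}$, $\sigma_{(\chi,\psi)}(n)=\sum_{1\le m\mid n}\chi(m)\psi(n/m)\,m$. Define $$E_{t_1,t_2}(z)=C_{t_1,t_2}+\sum_{n=1}^\infty\sigma_{(\chi_{t_1},\chi_{t_2})}(n)q^n,$$ with $C_{24,1}=-3$ and $C_{1,24}=C_{-8,-3}=C_{-3,-8}=0$. With the Dedekind eta function $\eta(z)=e^{\pi i z/12}\prod_{n=1}^\infty(1-e^{2\pi i n z})$, $$C_1(q)=\frac{\eta(z)\eta(4z)\eta^4(6z)\eta^2(24z)}{\eta(2z)\eta(3z)\eta^2(12z)},\qquad C_2(q)=\frac{\eta^2(z)\eta^4(4z)\eta(6z)\eta(24z)}{\eta^2(2z)\eta(8z)\eta(12z)}.$$ *)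

theory Defs
  imports "HOL-Analysis.Analysis" "HOL-Number_Theory.Quadratic_Reciprocity"
begin

definition kronecker_prime :: "int \<Rightarrow> int \<Rightarrow> int" where
  "kronecker_prime t p =
     (if p = 2 then (if even t then 0 else if t mod 8 \<in> {1, 7} then 1 else - 1)
      else Legendre t p)"

definition kronecker :: "int \<Rightarrow> int \<Rightarrow> int" where
  "kronecker t m =
     (if m = 0 then (if \<bar>t\<bar> = 1 then 1 else 0)
      else (if m < 0 \<and> t < 0 then - 1 else 1) *
           (\<Prod>p\<in>prime_factors m. kronecker_prime t p ^ multiplicity p m))"

definition chi :: "int \<Rightarrow> int \<Rightarrow> complex" where
  "chi t m = of_int (kronecker t m)"

(* The third condition is holomorphy at all cusps, expressed as boundedness near i * infinity
   of the weight k slash action of every element of SL(2,Z). The character \<epsilon> is extended to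
   Gamma_0(N) as usual, by its value at the lower right entry. *)
definition modular_forms :: "nat \<Rightarrow> nat \<Rightarrow> (int \<Rightarrow> complex) \<Rightarrow> (complex \<Rightarrow> complex) set" where
  "modular_forms k N \<epsilon> = {f.
     f holomorphic_on {z. Im z > 0} \<and>
     (\<forall>a b c d :: int. \<forall>z. a * d - b * c = 1 \<longrightarrow> int N dvd c \<longrightarrow> Im z > 0 \<longrightarrow>
        f ((of_int a * z + of_int b) / (of_int c * z + of_int d)) =
          \<epsilon> d * (of_int c * z + of_int d) ^ k * f z) \<and>
     (\<forall>a b c d :: int. a * d - b * c = 1 \<longrightarrow>
        (\<exists>B Y. Y > 0 \<and> (\<forall>z. Im z > Y \<longrightarrow>
           norm (f ((of_int a * z + of_int b) / (of_int c * z + of_int d)) /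
                 (of_int c * z + of_int d) ^ k) \<le> B)))}"

definition qq :: "complex \<Rightarrow> complex" where
  "qq z = exp (2 * of_real pi * \<i> * z)"

definition phi :: "complex \<Rightarrow> complex" where
  "phi z = (\<Sum>\<^sub>\<infinity>n::int. qq z ^ nat (n\<^sup>2))"

definition phi4 :: "nat \<Rightarrow> nat \<Rightarrow> nat \<Rightarrow> nat \<Rightarrow> complex \<Rightarrow> complex" where
  "phi4 a1 a2 a3 a4 z =
     phi (of_nat a1 * z) * phi (of_nat a2 * z) * phi (of_nat a3 * z) * phi (of_nat a4 * z)"

definition sigma :: "(int \<Rightarrow> complex) \<Rightarrow> (int \<Rightarrow> complex) \<Rightarrow> nat \<Rightarrow> complex" where
  "sigma \<epsilon> \<delta> n = (\<Sum>m | 1 \<le> m \<and> m dvd n. \<epsilon> (int m) * \<delta> (int (n div m)) * of_nat m)"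

(* Only the pairs (24,1), (1,24), (-8,-3), (-3,-8) are meant. *)
definition eisenstein_const :: "int \<Rightarrow> int \<Rightarrow> complex" where
  "eisenstein_const t1 t2 = (if (t1, t2) = (24, 1) then - 3 else 0)"

definition eisenstein :: "int \<Rightarrow> int \<Rightarrow> complex \<Rightarrow> complex" where
  "eisenstein t1 t2 z =
     eisenstein_const t1 t2 + (\<Sum>n. sigma (chi t1) (chi t2) (Suc n) * qq z ^ Suc n)"

definition eta :: "complex \<Rightarrow> complex" where
  "eta z = exp (of_real pi * \<i> * z / 12) *
     (\<Prod>n. 1 - exp (2 * of_real pi * \<i> * of_nat (Suc n) * z))"

definition C1 :: "complex \<Rightarrow> complex" where
  "C1 z = eta z * eta (4 * z) * eta (6 * z) ^ 4 * eta (24 * z) ^ 2 /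
          (eta (2 * z) * eta (3 * z) * eta (12 * z) ^ 2)"

definition C2 :: "complex \<Rightarrow> complex" where
  "C2 z = eta z ^ 2 * eta (4 * z) ^ 4 * eta (6 * z) * eta (24 * z) /
          (eta (2 * z) ^ 2 * eta (8 * z) * eta (12 * z))"

end

theory Submission
  imports Defs "HOL-Complex_Analysis.Complex_Analysis" "HOL-Probability.Probability" "HOL-Real_Asymp.Real_Asymp"
begin

text \<open>
  Both sides of each identity are modular forms of weight 2 for Gamma0(24) with character
  \<open>chi 24\<close>, and such a form vanishes as soon as its expansion in \<open>q\<close> starts at
  \<open>q ^ 9\<close>. Hence each identity reduces to a comparison of the coefficients of
  \<open>q ^ 0, \<dots>, q ^ 8\<close>. The theta product is modular by hypothesis; the rest is as follows.

  Vanishing (\<open>valence_bound_24\<close>). For a form \<open>F\<close> of this kind \<open>\<bar>F z\<bar> * Im z\<close> is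
  invariant under Gamma0(24), so its conjugates under \<open>SL(2,\<int>)\<close> are indexed by bottom rows
  modulo 24, of which there are at most 384. For the product \<open>P\<close> of the corresponding
  holomorphic functions, \<open>\<bar>P z\<bar>\<close> times a power of \<open>Im z\<close> is invariant under the full modular
  group. Eight of the factors have the absolute value of \<open>F\<close> itself, so \<open>F = O(q ^ 9)\<close> makes
  \<open>P = O(q ^ 72)\<close>, and the maximum principle (\<open>siegel_vanishing\<close>) forces \<open>P = 0\<close>, because
  \<open>384 < 71 * pi * sqrt 3\<close>.

  Eisenstein series (\<open>eisenstein_modular\<close>). In weight 2 the series of \<open>h x y / (x * z + y)\<^sup>2\<close>
  is not absolutely convergent, but if \<open>h\<close> is periodic modulo 24 with mean value zero, then the
  sums over blocks of \<open>24 * 24\<close> terms are. Grouped in this way the series may be summed by rows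
  or by columns, and this yields the exact transformation law under \<open>SL(2,\<int>)\<close> (\<open>Eis_mob\<close>).
  If \<open>h\<close> is a product of two characters, then Lipschitz's formula turns the rows into the
  Lambert series of \<open>sigma\<close> (\<open>Eis_twist_qexp\<close>).

  Eta quotients (\<open>C_modular\<close>). Jacobi's triple product rewrites \<open>C1\<close> and \<open>C2\<close> as products of
  four unary theta series \<open>\<Sum> f n * q ^ (\<alpha> * n\<^sup>2)\<close> with periodic \<open>f\<close>
  (\<open>theta_eq_eta_quotients\<close>). Poisson summation and completion of the square show that each of
  them is multiplied under Gamma0(24) by a root of unity, a quadratic Gauss sum and a square root
  of \<open>c * z + d\<close> that does not depend on the series (\<open>theta_gamma0\<close>). In a product of four
  series the roots of unity cancel, and the Gauss sums combine to a Kronecker symbol, since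
  \<open>gs (a * b) d = kronecker a d * gs b d\<close> and \<open>gs b d ^ 4 = d\<^sup>2\<close>. The growth at the other cusps
  is controlled by the closure of theta series of a fixed level under the generators of
  \<open>SL(2,\<int>)\<close> (\<open>weil_slash\<close>).
\<close>

section \<open>The modular group and a vanishing criterion\<close>

text \<open>Induction along words in the generators \<open>T\<close> and \<open>S\<close>,
  multiplied from the left. It is the Euclidean algorithm on the left column, and allows
  transformation laws to be checked on generators only.\<close>

lemma SL2_induct [consumes 1, case_names one T T' S]:
  fixes P :: "int \<Rightarrow> int \<Rightarrow> int \<Rightarrow> int \<Rightarrow> bool"
  assumes det: "a * d - b * c = 1"
    and one: "P 1 0 0 1"
    and T: "\<And>a b c d. a * d - b * c = 1 \<Longrightarrow> P a b c d \<Longrightarrow> P (a + c) (b + d) c d"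
    and T': "\<And>a b c d. a * d - b * c = 1 \<Longrightarrow> P a b c d \<Longrightarrow> P (a - c) (b - d) c d"
    and S: "\<And>a b c d. a * d - b * c = 1 \<Longrightarrow> P a b c d \<Longrightarrow> P (- c) (- d) a b"
  shows "P a b c d"
proof -
  have neg: "P (-a) (-b) (-c) (-d)" if "a * d - b * c = 1" "P a b c d" for a b c d
    using S[OF _ S[OF that]] that by (simp add: algebra_simps)
  have Snv: "P a b c d" if "a * d - b * c = 1" "P (- c) (- d) a b" for a b c d
    using neg[OF _ S[OF _ that(2)]] that by (simp add: algebra_simps)
  have Tnv: "P a b c d" if "a * d - b * c = 1" "P (a - c) (b - d) c d" for a b c d
    using T[OF _ that(2)] that by (simp add: algebra_simps)
  have Tnv': "P a b c d" if "a * d - b * c = 1" "P (a + c) (b + d) c d" for a b c d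
    using T'[OF _ that(2)] that by (simp add: algebra_simps)
  have up: "P 1 (int n) 0 1" for n
  proof (induction n)
    case (Suc n)
    show ?case using T[OF _ Suc] by (simp add: algebra_simps)
  qed (use one in simp)
  have dn: "P 1 (- int n) 0 1" for n
  proof (induction n)
    case (Suc n)
    have "P 1 (- int n - 1) 0 1" using T'[OF _ Suc] by simp
    moreover have "- int n - 1 = - int (Suc n)" by simp
    ultimately show ?case by metis
  qed (use one in simp)
  have tr: "P 1 b 0 1" for b
    using up[of "nat b"] dn[of "nat (-b)"] by (cases "b \<ge> 0") auto
  show ?thesis
    using det
  proof (induction "nat (2 * \<bar>c\<bar> + \<bar>a\<bar>)" arbitrary: a b c d rule: less_induct)
    case less
    show ?case
    proof (cases "c = 0")
      case True
      then have "a = 1 \<and> d = 1 \<or> a = -1 \<and> d = -1"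
        using less.prems by (simp add: zmult_eq_1_iff)
      then show ?thesis
        using True tr[of b] neg[OF _ tr[of "-b"]] by auto
    next
      case c: False
      show ?thesis
      proof (cases "\<bar>a\<bar> < \<bar>c\<bar>")
        case True
        have "P (- c) (- d) a b"
          by (rule less.hyps) (use True less.prems in \<open>auto simp: algebra_simps\<close>)
        then show ?thesis using Snv less.prems by blast
      next
        case False
        show ?thesis
        proof (cases "a * c > 0")
          case True
          then have "\<bar>a - c\<bar> < \<bar>a\<bar>" using c False by (auto simp: zero_less_mult_iff)
          then have "P (a - c) (b - d) c d"
            by (intro less.hyps) (use less.prems in \<open>auto simp: algebra_simps\<close>)
          then show ?thesis using Tnv less.prems by blast
        next
          case f: False
          then have "\<bar>a + c\<bar> < \<bar>a\<bar>" using c False by (auto simp: zero_less_mult_iff not_less mult_le_0_iff)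
          then have "P (a + c) (b + d) c d"
            by (intro less.hyps) (use less.prems in \<open>auto simp: algebra_simps\<close>)
          then show ?thesis using Tnv' less.prems by blast
        qed
      qed
    qed
  qed
qed

definition mob :: "int \<Rightarrow> int \<Rightarrow> int \<Rightarrow> int \<Rightarrow> complex \<Rightarrow> complex" where
  "mob a b c d z = (of_int a * z + of_int b) / (of_int c * z + of_int d)"

lemma mob_denom_nz:
  assumes "a * d - b * c = (1::int)" "Im z > 0"
  shows "of_int c * z + of_int d \<noteq> 0"
proof
  assume *: "of_int c * z + of_int d = 0"
  have "Im (of_int c * z + of_int d) = of_int c * Im z" "Re (of_int c * z + of_int d) = of_int c * Re z + of_int d"
    by simp_all
  then have "c = 0" "d = 0" using * assms(2) by auto
  then show False using assms(1) by simp
qed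

lemma mob_mult:
  assumes "a' * d' - b' * c' = (1::int)" "Im z > 0"
  shows "mob a b c d (mob a' b' c' d' z) =
    mob (a * a' + b * c') (a * b' + b * d') (c * a' + d * c') (c * b' + d * d') z"
proof -
  have nz: "of_int c' * z + of_int d' \<noteq> 0" using mob_denom_nz assms by blast
  let ?D = "of_int c' * z + of_int d' :: complex"
  have "mob a b c d (mob a' b' c' d' z) =
     ((of_int a * mob a' b' c' d' z + of_int b) * ?D) / ((of_int c * mob a' b' c' d' z + of_int d) * ?D)"
    using nz by (simp add: mob_def)
  also have "(of_int a * mob a' b' c' d' z + of_int b) * ?D = of_int a * (of_int a' * z + of_int b') + of_int b * ?D"
    using nz by (simp add: mob_def field_simps)
  also have "(of_int c * mob a' b' c' d' z + of_int d) * ?D = of_int c * (of_int a' * z + of_int b') + of_int d * ?D"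
    using nz by (simp add: mob_def field_simps)
  finally show ?thesis by (simp add: mob_def algebra_simps)
qed

lemma Im_mob:
  assumes "a * d - b * c = (1::int)" "Im z > 0"
  shows "Im (mob a b c d z) = Im z / (norm (of_int c * z + of_int d))\<^sup>2"
proof -
  have "Im (mob a b c d z) = (of_int a * d - of_int b * c) * Im z / (norm (of_int c * z + of_int d))\<^sup>2"
    unfolding mob_def by (simp add: Im_divide cmod_power2 algebra_simps)
  also have "of_int a * d - of_int b * c = real_of_int (a * d - b * c)" by simp
  finally show ?thesis using assms(1) by simp
qed

lemma Im_mob_pos:
  assumes "a * d - b * c = (1::int)" "Im z > 0"
  shows "Im (mob a b c d z) > 0"
  using Im_mob[OF assms] mob_denom_nz[OF assms] assms(2) by simp

lemma mob_holomorphic [holomorphic_intros]: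
  assumes "a * d - b * c = (1::int)"
  shows "mob a b c d holomorphic_on {z. Im z > 0}"
  unfolding mob_def using mob_denom_nz[OF assms] by (intro holomorphic_intros) auto

text \<open>Reduction to the standard fundamental domain: among the coprime pairs \<open>(c,
  d)\<close> one with minimal \<open>\<bar>c * z + d\<bar>\<close> gives an image of maximal
  height, and after a translation such a point cannot lie strictly inside the unit circle.\<close>

lemma exists_high_point:
  assumes "Im z > 0"
  obtains a b c d where "a * d - b * c = (1::int)" "\<bar>Re (mob a b c d z)\<bar> \<le> 1/2"
    "Im (mob a b c d z) \<ge> sqrt 3 / 2"
proof -
  define Sp where "Sp = {(c::int, d::int). \<exists>a b. a * d - b * c = 1}"
  define r where "r = (\<lambda>(c::int, d::int). norm (of_int c * z + of_int d))"
  have fin: "finite {p \<in> Sp. r p \<le> 1}"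
  proof -
    define K where "K = \<lceil>1 / Im z\<rceil>"
    define L where "L = \<lceil>1 + of_int K * \<bar>Re z\<bar>\<rceil>"
    have "{p \<in> Sp. r p \<le> 1} \<subseteq> {-K..K} \<times> {-L..L}"
    proof (clarsimp simp: r_def)
      fix c d :: int assume n: "norm (of_int c * z + of_int d) \<le> 1"
      have "\<bar>of_int c * Im z\<bar> \<le> 1" using abs_Im_le_cmod[of "of_int c * z + of_int d"] n by simp
      then have c1: "of_int \<bar>c\<bar> \<le> 1 / Im z" using assms by (simp add: abs_mult field_simps)
      then have c: "\<bar>c\<bar> \<le> K" unfolding K_def by linarith
      have "\<bar>of_int c * Re z + of_int d\<bar> \<le> 1" using abs_Re_le_cmod[of "of_int c * z + of_int d"] n by simp
      then have "\<bar>of_int d\<bar> \<le> 1 + \<bar>of_int c\<bar> * \<bar>Re z\<bar>" unfolding abs_mult[symmetric] by linarith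
      also have "\<dots> \<le> 1 + of_int K * \<bar>Re z\<bar>" using c by (intro add_left_mono mult_right_mono) linarith+
      finally have "\<bar>d\<bar> \<le> L" unfolding L_def by linarith
      then show "- K \<le> c \<and> c \<le> K \<and> - L \<le> d \<and> d \<le> L" using c by linarith
    qed
    then show ?thesis by (rule finite_subset) auto
  qed
  have mem: "(0, 1) \<in> {p \<in> Sp. r p \<le> 1}" by (auto simp: Sp_def r_def intro: exI[of _ 1])
  obtain p where p: "p \<in> {p \<in> Sp. r p \<le> 1}" "\<And>q. q \<in> {p \<in> Sp. r p \<le> 1} \<Longrightarrow> r p \<le> r q"
    using ex_is_arg_min_if_finite[OF fin, of r] mem by (auto simp: is_arg_min_linorder)
  obtain a b c d where abcd: "p = (c, d)" "a * d - b * c = 1"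
    using p(1) by (auto simp: Sp_def)
  have minim: "r p \<le> r q" if "q \<in> Sp" for q
    using p that by (cases "r q \<le> 1") (auto simp del: split_paired_All)
  define n where "n = \<lfloor>Re (mob a b c d z) + 1/2\<rfloor>"
  have det: "(a - n * c) * d - (b - n * d) * c = 1" using abcd by (simp add: algebra_simps)
  have nz: "of_int c * z + of_int d \<noteq> 0" by (rule mob_denom_nz[OF abcd(2) assms])
  define w where "w = mob (a - n * c) (b - n * d) c d z"
  have w: "w = mob a b c d z - of_int n"
    using nz by (simp add: w_def mob_def field_simps)
  have re: "\<bar>Re w\<bar> \<le> 1/2"
  proof -
    have "Re w = Re (mob a b c d z) - of_int n" by (simp add: w)
    then show ?thesis unfolding n_def abs_le_iff by linarith
  qed
  have im: "Im w \<ge> sqrt 3 / 2"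
  proof (rule ccontr)
    assume "\<not> ?thesis"
    moreover have ipos: "Im w > 0" unfolding w_def by (rule Im_mob_pos[OF det assms])
    ultimately have "(Im w)\<^sup>2 < (sqrt 3 / 2)\<^sup>2" by (intro power_strict_mono) auto
    moreover have "(Re w)\<^sup>2 \<le> (1/2)\<^sup>2" using re by (metis abs_ge_zero power2_abs power_mono)
    ultimately have "(norm w)\<^sup>2 < 1" by (simp add: cmod_power2 power_divide)
    then have n1: "norm w < 1" by (simp add: power_less_one_iff abs_square_less_1)
    have "r (a - n * c, b - n * d) = norm w * r p"
      using nz unfolding w_def mob_def r_def abcd by (simp add: norm_divide)
    also have "\<dots> < r p" using n1 nz by (simp add: r_def abcd)
    finally have "r (a - n * c, b - n * d) < r p" .
    moreover have "(a - n * c, b - n * d) \<in> Sp"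
    proof -
      have "(- c) * (b - n * d) - (- d) * (a - n * c) = 1" using det by (simp add: algebra_simps)
      then show ?thesis unfolding Sp_def by blast
    qed
    ultimately show False using minim by force
  qed
  show ?thesis using that[OF det] re im unfolding w_def by blast
qed

text \<open>A nonzero \<open>P\<close> would make \<open>\<bar>P z\<bar> * Im z ^ k\<close> attain
  its maximum at some \<open>z0\<close> with \<open>Im z0 \<ge> sqrt 3 / 2\<close>. The function
  \<open>P z * exp (- 2 * pi * \<i> * n * z)\<close> still tends to 0 at \<open>\<i> *
  \<infinity>\<close>, so on a half plane \<open>Im z \<ge> y1\<close> it is largest on the line
  \<open>Im z = y1\<close>. Comparison of the two extremal properties for \<open>y1\<close>
  slightly below \<open>sqrt 3 / 2\<close> contradicts \<open>k < pi * sqrt 3 * n\<close>.\<close>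

lemma siegel_vanishing:
  fixes P :: "complex \<Rightarrow> complex" and k :: nat and n N :: real
  assumes hol: "P holomorphic_on {z. Im z > 0}"
    and inv: "\<And>a b c d z. a * d - b * c = (1::int) \<Longrightarrow> Im z > 0 \<Longrightarrow>
       norm (P (mob a b c d z)) * Im (mob a b c d z) ^ k = norm (P z) * Im z ^ k"
    and decay: "\<And>z. Im z \<ge> Y \<Longrightarrow> norm (P z) \<le> B * exp (- (2 * pi * N * Im z))"
    and nN: "0 < n" "n < N" "real k < pi * sqrt 3 * n"
    and w: "Im w > 0"
  shows "P w = 0"
proof (rule ccontr)
  assume Pw: "P w \<noteq> 0"
  define h where "h = (\<lambda>z. norm (P z) * Im z ^ k)"
  define R where "R = {z. \<bar>Re z\<bar> \<le> 1/2 \<and> Im z \<ge> sqrt 3 / 2}"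
  have Hop: "open {z. Im z > 0}" using open_halfspace_Im_gt[of 0] by simp
  have contP: "continuous_on A P" if "A \<subseteq> {z. Im z > 0}" for A
    using hol holomorphic_on_imp_continuous_on continuous_on_subset that by blast
  have per: "norm (P (z + of_int m)) = norm (P z)" if "Im z > 0" for z and m :: int
    using inv[of 1 1 m 0 z] that by (simp add: mob_def)
  have B: "B \<ge> 0"
  proof -
    have "0 \<le> B * exp (- (2 * pi * N * Y))"
      using order_trans[OF norm_ge_zero decay[of "\<i> * of_real Y"]] by simp
    then show ?thesis by (simp add: zero_le_mult_iff)
  qed
  have s3: "sqrt 3 / 2 > 0" by simp
  have Rsub: "R \<subseteq> {z. Im z > 0}" proof
    fix z assume "z \<in> R"
    then have "Im z \<ge> sqrt 3 / 2" by (simp add: R_def)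
    then have "Im z > 0" using s3 by linarith
    then show "z \<in> {z. Im z > 0}" by simp
  qed
  have toR: "\<exists>z'\<in>R. h z' = h z" if zpos: "Im z > 0" for z
  proof -
    obtain a b c d where g: "a * d - b * c = (1::int)" "\<bar>Re (mob a b c d z)\<bar> \<le> 1/2"
      "Im (mob a b c d z) \<ge> sqrt 3 / 2" by (rule exists_high_point[OF zpos])
    then show ?thesis using inv[OF g(1) zpos] unfolding h_def R_def by blast
  qed
  obtain w' where w': "w' \<in> R" "h w' > 0"
    using toR[OF w] Pw w by (auto simp: h_def)
  have hlim: "((\<lambda>y. B * exp (- (2 * pi * N * y)) * y ^ k) \<longlongrightarrow> 0) at_top"
  proof -
    define c where "c = 2 * pi * N"
    have c: "c > 0" using nN by (simp add: c_def)
    have "filterlim (\<lambda>y. c * y) at_top at_top"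
      by (rule filterlim_tendsto_pos_mult_at_top[OF tendsto_const c filterlim_ident])
    from filterlim_compose[OF tendsto_power_div_exp_0[of k] this]
    have "((\<lambda>y. B / c ^ k * ((c * y) ^ k / exp (c * y))) \<longlongrightarrow> B / c ^ k * 0) at_top"
      by (intro tendsto_mult tendsto_const)
    moreover have "B / c ^ k * ((c * y) ^ k / exp (c * y)) = B * exp (- (2 * pi * N * y)) * y ^ k" for y
    proof -
      have "2 * pi * N * y = c * y" by (simp add: c_def)
      then show ?thesis using c by (simp only:) (simp add: power_mult_distrib exp_minus field_simps)
    qed
    ultimately show ?thesis by simp
  qed
  have "\<forall>\<^sub>F y in at_top. B * exp (- (2 * pi * N * y)) * y ^ k < h w'"
    using hlim w'(2) by (rule order_tendstoD)
  then obtain Y1 where Y1: "\<And>y. y \<ge> Y1 \<Longrightarrow> B * exp (- (2 * pi * N * y)) * y ^ k < h w'"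
    by (auto simp: eventually_at_top_linorder)
  define Y2 where "Y2 = max (max Y Y1) (Im w')"
  define K where "K = cbox (Complex (-1/2) (sqrt 3 / 2)) (Complex (1/2) Y2)"
  have Kmem: "z \<in> K \<longleftrightarrow> z \<in> R \<and> Im z \<le> Y2" for z
    by (auto simp: K_def R_def in_cbox_complex_iff abs_le_iff)
  have w'K: "w' \<in> K" using w' by (simp add: Kmem Y2_def)
  have "\<exists>z0\<in>K. \<forall>z\<in>K. h z \<le> h z0"
  proof (rule continuous_attains_sup)
    show "compact K" by (simp add: K_def)
    show "K \<noteq> {}" using w'K by blast
    show "continuous_on K h" unfolding h_def using Kmem Rsub
      by (intro continuous_intros contP) auto
  qed
  then obtain z0 where z0: "z0 \<in> K" "\<And>z. z \<in> K \<Longrightarrow> h z \<le> h z0" by blast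
  have maxR: "h z \<le> h z0" if "z \<in> R" for z
  proof (cases "Im z \<le> Y2")
    case True
    then show ?thesis using z0 that Kmem by blast
  next
    case False
    then have ge: "Im z \<ge> Y" "Im z \<ge> Y1" by (auto simp: Y2_def)
    have ip: "Im z > 0" using that Rsub by auto
    have "h z \<le> B * exp (- (2 * pi * N * Im z)) * Im z ^ k"
      unfolding h_def using decay[OF ge(1)] ip by (intro mult_right_mono) auto
    also have "\<dots> < h w'" using Y1 ge by blast
    also have "\<dots> \<le> h z0" using z0 w'K by blast
    finally show ?thesis by simp
  qed
  have maxH: "h z \<le> h z0" if "Im z > 0" for z
    using toR[OF that] maxR by force
  have z0R: "z0 \<in> R" using z0 Kmem by blast
  define y0 where "y0 = Im z0"
  have y0: "y0 \<ge> sqrt 3 / 2" "y0 > 0" using z0R Rsub by (auto simp: y0_def R_def)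
  have hz0: "h z0 > 0" using maxR[OF w'(1)] w'(2) by simp
  then have Pz0: "P z0 \<noteq> 0" by (auto simp: h_def)
  have "real k / (2 * pi * n) < sqrt 3 / 2"
    using nN by (simp add: field_simps)
  then obtain y1 where y1: "real k / (2 * pi * n) < y1" "y1 < sqrt 3 / 2"
    using dense by blast
  have y1pos: "y1 > 0" using y1(1) nN by (smt (verit) divide_nonneg_pos of_nat_0_le_iff pi_gt_zero mult_pos_pos)
  have y10: "y1 < y0" using y1 y0 by simp
  \<comment> \<open>multiplication by \<open>q\<close> to the power \<open>- n\<close> with \<open>n < N\<close> keeps the decay at \<open>\<i> * \<infinity>\<close>\<close>
  define g where "g = (\<lambda>z. P z * exp (- (2 * pi * \<i> * of_real n * z)))"
  have ng: "norm (g z) = norm (P z) * exp (2 * pi * n * Im z)" for z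
    by (simp add: g_def norm_mult mult_ac)
  have ghol: "g holomorphic_on {z. Im z > 0}" unfolding g_def by (intro holomorphic_intros hol)
  have gper: "norm (g (z + of_int m)) = norm (g z)" if "Im z > 0" for z and m :: int
    using per[OF that] by (simp add: ng)
  have gdec: "norm (g z) \<le> B * exp (- (2 * pi * (N - n) * Im z))" if "Im z \<ge> Y" for z
  proof -
    have "norm (g z) \<le> B * exp (- (2 * pi * N * Im z)) * exp (2 * pi * n * Im z)"
      unfolding ng using decay[OF that] by (intro mult_right_mono) auto
    also have "\<dots> = B * exp (- (2 * pi * (N - n) * Im z))"
      by (simp add: exp_add[symmetric] algebra_simps)
    finally show ?thesis .
  qed
  have glim: "((\<lambda>y. B * exp (- (2 * pi * (N - n) * y))) \<longlongrightarrow> 0) at_top"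
  proof -
    have p: "2 * pi * (N - n) > 0" using nN by simp
    define c where "c = 2 * pi * (N - n)"
    have "((\<lambda>y. B * exp (- (c * y))) \<longlongrightarrow> B * 0) at_top"
      using p[folded c_def] by (intro tendsto_mult tendsto_const) (real_asymp)
    then show ?thesis by (simp add: c_def)
  qed
  have gz0: "norm (g z0) > 0" using Pz0 by (simp add: g_def)
  obtain Y3 where Y3: "\<And>y. y \<ge> Y3 \<Longrightarrow> B * exp (- (2 * pi * (N - n) * y)) < norm (g z0)"
    using order_tendstoD(2)[OF glim gz0] by (auto simp: eventually_at_top_linorder)
  define Y4 where "Y4 = max (max Y Y3) y0"
  define L where "L = cbox (Complex (-1/2) y1) (Complex (1/2) Y4)"
  have Lmem: "z \<in> L \<longleftrightarrow> \<bar>Re z\<bar> \<le> 1/2 \<and> y1 \<le> Im z \<and> Im z \<le> Y4" for z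
    by (auto simp: L_def in_cbox_complex_iff abs_le_iff)
  have z0L: "z0 \<in> L" using z0R y10 by (auto simp: Lmem R_def y0_def Y4_def)
  have "\<exists>z2\<in>L. \<forall>z\<in>L. norm (g z) \<le> norm (g z2)"
  proof (rule continuous_attains_sup)
    show "compact L" by (simp add: L_def)
    show "L \<noteq> {}" using z0L by auto
    have "L \<subseteq> {z. Im z > 0}" using y1pos by (auto simp: Lmem)
    then show "continuous_on L (\<lambda>z. norm (g z))"
      using ghol by (intro continuous_intros)
        (meson continuous_on_subset holomorphic_on_imp_continuous_on)
  qed
  then obtain z2 where z2: "z2 \<in> L" "\<And>z. z \<in> L \<Longrightarrow> norm (g z) \<le> norm (g z2)" by blast
  have gmax: "norm (g z) \<le> norm (g z2)" if z: "Im z \<ge> y1" for z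
  proof -
    define m where "m = - \<lfloor>Re z + 1/2\<rfloor>"
    define z' where "z' = z + of_int m"
    have eq: "norm (g z') = norm (g z)" unfolding z'_def using gper z y1pos by auto
    have "Re z' = Re z - of_int \<lfloor>Re z + 1/2\<rfloor>" by (simp add: z'_def m_def)
    then have re: "\<bar>Re z'\<bar> \<le> 1/2" unfolding abs_le_iff by linarith
    show ?thesis
    proof (cases "Im z \<le> Y4")
      case True
      then have "z' \<in> L" using re z by (auto simp: Lmem z'_def)
      then show ?thesis using z2 eq by metis
    next
      case False
      then have ge: "Im z \<ge> Y" "Im z \<ge> Y3" by (auto simp: Y4_def)
      have "norm (g z) \<le> norm (g z0)" using gdec[OF ge(1)] Y3[OF ge(2)] by linarith
      also have "\<dots> \<le> norm (g z2)" using z2 z0L by blast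
      finally show ?thesis .
    qed
  qed
  have Imz2: "Im z2 = y1"
  proof (rule ccontr)
    assume "Im z2 \<noteq> y1"
    then have gt: "Im z2 > y1" using z2(1) by (simp add: Lmem)
    define U where "U = {z. Im z > y1}"
    have "g constant_on U"
    proof (rule maximum_modulus_principle[where U = U and \<xi> = z2])
      show "g holomorphic_on U" using ghol by (rule holomorphic_on_subset) (use y1pos in \<open>auto simp: U_def\<close>)
      show "open U" unfolding U_def by (rule open_halfspace_Im_gt)
      show "connected U" unfolding U_def by (intro convex_connected convex_halfspace_Im_gt)
      show "open U" by fact
      show "z2 \<in> U" using gt by (simp add: U_def)
      show "\<And>z. z \<in> U \<Longrightarrow> norm (g z) \<le> norm (g z2)" using gmax by (simp add: U_def)
    qed auto
    then obtain C where C: "\<And>z. z \<in> U \<Longrightarrow> g z = C" by (auto simp: constant_on_def)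
    define v where "v = Complex 0 (max (max Y Y3) (y1 + 1))"
    have "norm (g v) < norm (g z0)"
    proof -
      have "Im v \<ge> Y" "Im v \<ge> Y3" by (simp_all add: v_def)
      then show ?thesis using gdec[of v] Y3[of "Im v"] by linarith
    qed
    moreover have "g v = C" "g z0 = C" using y10 by (auto intro!: C simp: U_def v_def y0_def)
    ultimately show False by simp
  qed
  have i1: "norm (P z0) * exp (2 * pi * n * y0) \<le> norm (P z2) * exp (2 * pi * n * y1)"
    using gmax[of z0] y10 by (simp add: ng y0_def Imz2)
  have i2: "norm (P z2) * y1 ^ k \<le> norm (P z0) * y0 ^ k"
    using maxH[of z2] y1pos by (simp add: h_def Imz2 y0_def)
  have "norm (P z0) * exp (2 * pi * n * y0) * y1 ^ k \<le> norm (P z2) * y1 ^ k * exp (2 * pi * n * y1)"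
    using mult_right_mono[OF i1, of "y1 ^ k"] y1pos by (simp add: mult_ac)
  also have "\<dots> \<le> norm (P z0) * y0 ^ k * exp (2 * pi * n * y1)"
    by (intro mult_right_mono i2) auto
  finally have "norm (P z0) * (exp (2 * pi * n * y0) * y1 ^ k) \<le> norm (P z0) * (y0 ^ k * exp (2 * pi * n * y1))"
    by (simp add: mult_ac)
  then have "exp (2 * pi * n * y0) * y1 ^ k \<le> y0 ^ k * exp (2 * pi * n * y1)"
    using Pz0 by simp
  then have "ln (exp (2 * pi * n * y0) * y1 ^ k) \<le> ln (y0 ^ k * exp (2 * pi * n * y1))"
    using y1pos y0 by (subst ln_le_cancel_iff) auto
  then have "2 * pi * n * y0 + k * ln y1 \<le> k * ln y0 + 2 * pi * n * y1"
    using y1pos y0 by (simp add: ln_mult ln_realpow)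
  then have "2 * pi * n * (y0 - y1) \<le> k * (ln y0 - ln y1)" by (simp add: algebra_simps)
  also have "ln y0 - ln y1 = ln (y0 / y1)" using y1pos y0 by (simp add: ln_div)
  also have "\<dots> \<le> y0 / y1 - 1" using y1pos y0 by (intro ln_le_minus_one) auto
  also have "y0 / y1 - 1 = (y0 - y1) / y1" using y1pos by (simp add: field_simps)
  finally have "2 * pi * n * (y0 - y1) \<le> k * ((y0 - y1) / y1)" by (simp add: mult_left_mono)
  then have "2 * pi * n * y1 * (y0 - y1) \<le> k * (y0 - y1)" using y1pos by (simp add: field_simps)
  then have "2 * pi * n * y1 \<le> k" using y10 by simp
  moreover have "k < 2 * pi * n * y1" using y1(1) nN by (simp add: field_simps)
  ultimately show False by simp
qed

section \<open>Weight two forms for Gamma0(24) of order nine at infinity\<close>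

text \<open>The bottom rows modulo 24 of matrices of determinant 1 are not both divisible by 2 and
  not both divisible by 3.\<close>

definition primitive_pairs :: "(int \<times> int) set" where
  "primitive_pairs = {0..23} \<times> {0..23} -
     ({x\<in>{0..23}. 2 dvd x} \<times> {x\<in>{0..23}. 2 dvd x} \<union> {x\<in>{0..23}. 3 dvd x} \<times> {x\<in>{0..23}. 3 dvd x})"

lemma card_primitive_pairs: "card primitive_pairs = 384"
proof -
  let ?A = "{x\<in>{0..23::int}. 2 dvd x}" and ?B = "{x\<in>{0..23::int}. 3 dvd x}"
  have A: "?A = (\<lambda>k. 2 * k) ` {0..11}" by (auto elim!: dvdE)
  have B: "?B = (\<lambda>k. 3 * k) ` {0..7}" by (auto elim!: dvdE)
  have "?A \<inter> ?B = {x\<in>{0..23}. 6 dvd x}" by (auto; presburger)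
  also have "\<dots> = (\<lambda>k. 6 * k) ` {0..3}" by (auto elim!: dvdE)
  finally have AB: "?A \<inter> ?B = (\<lambda>k. 6 * k) ` {0..3}" .
  have fin: "finite ?A" "finite ?B" unfolding A B by simp_all
  have c: "card ?A = 12" "card ?B = 8" "card (?A \<inter> ?B) = 4"
    unfolding AB unfolding A B by (simp_all add: card_image inj_on_def)
  have "card (?A \<times> ?A) + card (?B \<times> ?B) = card (?A \<times> ?A \<union> ?B \<times> ?B) + card ((?A \<times> ?A) \<inter> (?B \<times> ?B))"
    by (intro card_Un_Int finite_cartesian_product fin)
  moreover have "(?A \<times> ?A) \<inter> (?B \<times> ?B) = (?A \<inter> ?B) \<times> (?A \<inter> ?B)" by (rule Times_Int_Times)
  ultimately have "card (?A \<times> ?A \<union> ?B \<times> ?B) = 192"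
    by (simp only: card_cartesian_product c)
  moreover have "card primitive_pairs = card ({0..23::int} \<times> {0..23::int}) - card (?A \<times> ?A \<union> ?B \<times> ?B)"
    unfolding primitive_pairs_def by (rule card_Diff_subset) (intro finite_UnI finite_cartesian_product fin, intro Un_least Sigma_mono, auto)
  ultimately show ?thesis by (simp add: card_cartesian_product)
qed

text \<open>The product argument below needs \<open>pi * sqrt 3 * 71 > 384\<close>, for which
  \<open>pi > 3\<close> is too weak.\<close>

lemma pi_gt_3125: "pi > 3.125"
proof (rule ccontr)
  assume "\<not> ?thesis"
  then have p: "pi / 6 \<le> 3.125 / 6" by simp
  let ?x = "3.125 / 6 :: real"
  have "sin (pi / 6) \<le> sin ?x" using p pi_ge_two by (intro sin_monotone_2pi_le) auto
  moreover have "\<bar>sin ?x - (\<Sum>m<5. sin_coeff m * ?x ^ m)\<bar> \<le> inverse (fact 5) * \<bar>?x\<bar> ^ 5"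
    by (rule Maclaurin_sin_bound)
  then have "sin ?x < 1 / 2"
    by (simp add: sin_coeff_def lessThan_nat_numeral fact_numeral abs_if divide_simps split: if_splits)
  ultimately show False by (simp add: sin_30)
qed

text \<open>On a connected open set the ring of holomorphic functions has no zero
  divisors.\<close>

lemma prod_holomorphic_eq_0:
  assumes "finite D" "open S" "connected S" "S \<noteq> {}"
    and "\<And>p. p \<in> D \<Longrightarrow> G p holomorphic_on S"
    and "\<And>z. z \<in> S \<Longrightarrow> (\<Prod>p\<in>D. G p z) = 0"
  shows "\<exists>p\<in>D. \<forall>z\<in>S. G p z = (0::complex)"
  using assms(1,5,6)
proof (induction D rule: finite_induct)
  case empty
  then show ?case using assms(4) by auto
next
  case (insert q D)
  show ?case
  proof (cases "\<forall>z\<in>S. G q z = 0")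
    case False
    then obtain z0 where z0: "z0 \<in> S" "G q z0 \<noteq> 0" by blast
    define U where "U = {z\<in>S. G q z \<noteq> 0}"
    have "open U" unfolding U_def
      using insert.prems(1)[of q] assms(2)
        continuous_open_preimage[of S "G q" "- {0}"]
      by (auto simp: vimage_def Int_def holomorphic_on_imp_continuous_on)
    have hol: "(\<lambda>z. \<Prod>p\<in>D. G p z) holomorphic_on S"
      by (intro holomorphic_intros insert.prems) auto
    have "(\<Prod>p\<in>D. G p z) = 0" if "z \<in> S" for z
    proof (rule analytic_continuation_open[of U S "\<lambda>z. \<Prod>p\<in>D. G p z" "\<lambda>_. 0"])
      fix z assume "z \<in> U"
      then show "(\<Prod>p\<in>D. G p z) = 0" using insert.prems(2)[of z] insert.hyps by (auto simp: U_def)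
    qed (use \<open>open U\<close> assms z0 hol that in \<open>auto simp: U_def\<close>)
    then show ?thesis using insert by blast
  qed blast
qed

text \<open>The analytic substitute for the valence formula; the argument is the product over
  cosets described at the beginning.\<close>

lemma valence_bound_24:
  fixes F :: "complex \<Rightarrow> complex"
  assumes hol: "F holomorphic_on {z. Im z > 0}"
    and inv: "\<And>a b c d z. a * d - b * c = (1::int) \<Longrightarrow> 24 dvd c \<Longrightarrow> Im z > 0 \<Longrightarrow>
       norm (F (mob a b c d z)) = (norm (of_int c * z + of_int d))\<^sup>2 * norm (F z)"
    and bdd: "\<And>a b c d. a * d - b * c = (1::int) \<Longrightarrow>
       \<exists>B Y. \<forall>z. Im z > Y \<longrightarrow> norm (F (mob a b c d z) / (of_int c * z + of_int d)\<^sup>2) \<le> B"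
    and ord: "\<And>z. Im z > Y0 \<Longrightarrow> norm (F z) \<le> B0 * exp (- (2 * pi * 9 * Im z))"
    and w: "Im w > 0"
  shows "F w = 0"
proof -
  define H where "H = (\<lambda>z. norm (F z) * Im z)"
  have Hinv: "H (mob a b c d z) = H z" if "a * d - b * c = (1::int)" "24 dvd c" "Im z > 0" for a b c d z
    using inv[OF that] Im_mob[OF that(1,3)] mob_denom_nz[OF that(1,3)]
    by (simp add: H_def)
  \<comment> \<open>the conjugate depends only on the bottom row modulo 24\<close>
  have Hrow: "H (mob a' b' c' d' z) = H (mob a b c d z)"
    if g: "a * d - b * c = (1::int)" "a' * d' - b' * c' = (1::int)" "Im z > 0"
      and cc: "c' mod 24 = c mod 24" and dd: "d' mod 24 = d mod 24" for a b c d a' b' c' d' z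
  proof -
    define A B C E where "A = a' * d - b' * c" "B = b' * a - a' * b" "C = c' * d - d' * c" "E = d' * a - c' * b"
    note defs = this
    have "A * E - B * C = (a' * d' - b' * c') * (a * d - b * c)"
      unfolding defs by (simp add: algebra_simps)
    then have det: "A * E - B * C = 1" using g by simp
    have "[c' * d - d' * c = c * d - d * c] (mod 24)"
      using cc dd by (intro cong_diff cong_mult) (auto simp: cong_def)
    then have C: "24 dvd C" unfolding defs by (simp add: cong_0_iff mult.commute)
    have "mob A B C E (mob a b c d z) = mob (A * a + B * c) (A * b + B * d) (C * a + E * c) (C * b + E * d) z"
      by (rule mob_mult[OF g(1,3)])
    moreover have "A * a + B * c = a' * (a * d - b * c)" "A * b + B * d = b' * (a * d - b * c)"
      "C * a + E * c = c' * (a * d - b * c)" "C * b + E * d = d' * (a * d - b * c)"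
      unfolding defs by (simp_all add: algebra_simps)
    ultimately have "mob A B C E (mob a b c d z) = mob a' b' c' d' z" using g by simp
    then show ?thesis using Hinv[OF det C Im_mob_pos[OF g(1,3)]] by simp
  qed
  define D where "D = {(c mod 24, d mod 24) |c d. \<exists>a b. a * d - b * c = (1::int)}"
  have Dsub: "D \<subseteq> primitive_pairs"
  proof
    fix p assume "p \<in> D"
    then obtain a b c d where p: "p = (c mod 24, d mod 24)" and det: "a * d - b * c = (1::int)"
      by (auto simp: D_def)
    have k: "\<not> (k dvd c mod 24 \<and> k dvd d mod 24)" if k: "k > 1" "k dvd 24" for k
    proof
      assume "k dvd c mod 24 \<and> k dvd d mod 24"
      then have "k dvd c" "k dvd d" using k(2) by (auto simp: dvd_mod_iff)
      then have "k dvd a * d - b * c" by simp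
      then show False using det that by simp
    qed
    have "p \<in> {0..23} \<times> {0..23}" unfolding p by (simp, presburger)
    then show "p \<in> primitive_pairs"
      using k[of 2] k[of 3] unfolding p primitive_pairs_def by simp
  qed
  have finprim: "finite primitive_pairs" unfolding primitive_pairs_def by (intro finite_Diff) simp
  have finD: "finite D" using Dsub finprim by (rule finite_subset)
  have cardD: "card D \<le> 384"
    using card_mono[OF finprim Dsub] card_primitive_pairs by simp
  have "\<forall>p\<in>D. \<exists>a b c d. a * d - b * c = (1::int) \<and> p = (c mod 24, d mod 24)"
    by (auto simp: D_def)
  then obtain ra rb rc rd where rep: "\<And>p. p \<in> D \<Longrightarrow> ra p * rd p - rb p * rc p = (1::int)"
     "\<And>p. p \<in> D \<Longrightarrow> p = (rc p mod 24, rd p mod 24)" by metis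
  define M where "M = (\<lambda>p. mob (ra p) (rb p) (rc p) (rd p))"
  define G where "G = (\<lambda>p z. F (M p z) / (of_int (rc p) * z + of_int (rd p))\<^sup>2)"
  define P where "P = (\<lambda>z. \<Prod>p\<in>D. G p z)"
  have GH: "norm (G p z) * Im z = H (M p z)" if "p \<in> D" "Im z > 0" for p z
    using Im_mob[OF rep(1)[OF that(1)] that(2)] by (simp add: G_def H_def M_def norm_divide norm_power)
  have Ghol: "G p holomorphic_on {z. Im z > 0}" if "p \<in> D" for p
  proof -
    have "F \<circ> M p holomorphic_on {z. Im z > 0}"
      using rep(1)[OF that] Im_mob_pos unfolding M_def
      by (intro holomorphic_on_compose_gen[OF mob_holomorphic hol]) auto
    then show ?thesis unfolding G_def using mob_denom_nz[OF rep(1)[OF that]]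
      by (intro holomorphic_intros) (auto simp: o_def)
  qed
  have Phol: "P holomorphic_on {z. Im z > 0}"
    unfolding P_def by (intro holomorphic_intros Ghol)
  have PH: "norm (P z) * Im z ^ card D = (\<Prod>p\<in>D. H (M p z))" if "Im z > 0" for z
  proof -
    have "(\<Prod>p\<in>D. H (M p z)) = (\<Prod>p\<in>D. norm (G p z) * Im z)"
      using GH that by (intro prod.cong) auto
    also have "\<dots> = norm (P z) * Im z ^ card D" by (simp add: prod.distrib P_def prod_norm)
    finally show ?thesis by simp
  qed
  \<comment> \<open>right multiplication by a matrix permutes the bottom rows\<close>
  have Pinv: "norm (P (mob a b c d z)) * Im (mob a b c d z) ^ card D = norm (P z) * Im z ^ card D"
    if g: "a * d - b * c = (1::int)" and z: "Im z > 0" for a b c d z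
  proof -
    define \<pi> where "\<pi> = (\<lambda>p::int\<times>int. ((fst p * a + snd p * c) mod 24, (fst p * b + snd p * d) mod 24))"
    have red: "(fst p * x + snd p * y) mod 24 = (rc p * x + rd p * y) mod 24" if "p \<in> D" for p x y
    proof -
      have "fst p = rc p mod 24" "snd p = rd p mod 24"
        using rep(2)[OF that] fst_conv snd_conv by metis+
      then have "[fst p = rc p] (mod 24)" "[snd p = rd p] (mod 24)" by (simp_all add: cong_def)
      then have "[fst p * x + snd p * y = rc p * x + rd p * y] (mod 24)"
        by (intro cong_add cong_mult) auto
      then show ?thesis by (simp add: cong_def)
    qed
    have mem: "\<pi> p \<in> D" if "p \<in> D" for p
    proof -
      have "\<pi> p = ((rc p * a + rd p * c) mod 24, (rc p * b + rd p * d) mod 24)"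
        using red[OF that] by (simp add: \<pi>_def)
      moreover have "(ra p * a + rb p * c) * (rc p * b + rd p * d) - (ra p * b + rb p * d) * (rc p * a + rd p * c) =
        (ra p * rd p - rb p * rc p) * (a * d - b * c)" by (simp add: algebra_simps)
      then have "(ra p * a + rb p * c) * (rc p * b + rd p * d) - (ra p * b + rb p * d) * (rc p * a + rd p * c) = 1"
        using g rep(1)[OF that] by simp
      ultimately show ?thesis unfolding D_def by blast
    qed
    have inj: "inj_on \<pi> D"
    proof (rule inj_onI)
      fix p q assume pq: "p \<in> D" "q \<in> D" "\<pi> p = \<pi> q"
      have e: "[fst p * a + snd p * c = fst q * a + snd q * c] (mod 24)"
              "[fst p * b + snd p * d = fst q * b + snd q * d] (mod 24)"
        using pq(3) by (auto simp: \<pi>_def cong_def)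
      have "[(fst p * a + snd p * c) * d - (fst p * b + snd p * d) * c =
             (fst q * a + snd q * c) * d - (fst q * b + snd q * d) * c] (mod 24)"
        using e by (intro cong_diff cong_mult) auto
      moreover have "(fst p * a + snd p * c) * d - (fst p * b + snd p * d) * c = fst p * (a * d - b * c)" for p
        by (simp add: algebra_simps)
      ultimately have 1: "[fst p = fst q] (mod 24)" using g by simp
      have "[(fst p * b + snd p * d) * a - (fst p * a + snd p * c) * b =
             (fst q * b + snd q * d) * a - (fst q * a + snd q * c) * b] (mod 24)"
        using e by (intro cong_diff cong_mult) auto
      moreover have "(fst p * b + snd p * d) * a - (fst p * a + snd p * c) * b = snd p * (a * d - b * c)" for p
        by (simp add: algebra_simps)
      ultimately have 2: "[snd p = snd q] (mod 24)" using g by simp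
      have r: "fst p mod 24 = fst p \<and> snd p mod 24 = snd p" if "p \<in> D" for p
        using that by (auto simp: D_def)
      show "p = q" using 1 2 r[OF pq(1)] r[OF pq(2)] by (auto simp: cong_def prod_eq_iff)
    qed
    have bij: "bij_betw \<pi> D D"
      using endo_inj_surj[OF finD _ inj] mem inj by (simp add: bij_betw_def image_subset_iff)
    have eq: "H (M p (mob a b c d z)) = H (M (\<pi> p) z)" if "p \<in> D" for p
    proof -
      have "M p (mob a b c d z) = mob (ra p * a + rb p * c) (ra p * b + rb p * d) (rc p * a + rd p * c) (rc p * b + rd p * d) z"
        unfolding M_def by (rule mob_mult[OF g z])
      moreover have "(ra p * a + rb p * c) * (rc p * b + rd p * d) - (ra p * b + rb p * d) * (rc p * a + rd p * c) =
        (ra p * rd p - rb p * rc p) * (a * d - b * c)" by (simp add: algebra_simps)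
      then have "(ra p * a + rb p * c) * (rc p * b + rd p * d) - (ra p * b + rb p * d) * (rc p * a + rd p * c) = 1"
        using g rep(1)[OF that] by simp
      moreover have "\<pi> p = ((rc p * a + rd p * c) mod 24, (rc p * b + rd p * d) mod 24)"
        using red[OF that] by (simp add: \<pi>_def)
      then have "(rc p * a + rd p * c) mod 24 = rc (\<pi> p) mod 24" "(rc p * b + rd p * d) mod 24 = rd (\<pi> p) mod 24"
        using rep(2)[OF mem[OF that]] by (simp_all add: prod_eq_iff)
      ultimately show ?thesis using Hrow[OF rep(1)[OF mem[OF that]] _ z] unfolding M_def by presburger
    qed
    have "norm (P (mob a b c d z)) * Im (mob a b c d z) ^ card D = (\<Prod>p\<in>D. H (M (\<pi> p) z))"
      using eq by (subst PH[OF Im_mob_pos[OF g z]]) (auto intro: prod.cong)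
    also have "\<dots> = (\<Prod>p\<in>D. H (M p z))" by (rule prod.reindex_bij_betw[OF bij])
    finally show ?thesis using PH[OF z] by simp
  qed
  \<comment> \<open>the bottom rows \<open>(0, u)\<close> belong to Gamma0(24); they contribute the factors of absolute value \<open>\<bar>F z\<bar>\<close>\<close>
  define U8 where "U8 = {1,5,7,11,13,17,19,23::int}"
  define U where "U = {0::int} \<times> U8"
  have UD: "U \<subseteq> D"
  proof -
    have mem: "(0, u) \<in> D" if "u * u - v * 24 = 1" "u mod 24 = u" for u v :: int
    proof -
      have "(24 mod 24, u mod 24) \<in> D" unfolding D_def
        by (intro CollectI exI[of _ 24] exI[of _ u] conjI refl exI[of _ v]) (rule that)
      then show ?thesis using that(2) by simp
    qed
    have "(0, u) \<in> D" if "u \<in> U8" for u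
      by (rule mem[of u "u * u div 24"]) (use that in \<open>unfold U8_def, elim insertE; simp\<close>)+
    then show ?thesis unfolding U_def by auto
  qed
  have cardU: "card U = 8" unfolding U_def U8_def by (simp add: card_cartesian_product)
  have GU: "norm (G p z) = norm (F z)" if "p \<in> U" "Im z > 0" for p z
  proof -
    have pD: "p \<in> D" using that UD by auto
    have "fst p = 0" using that(1) unfolding U_def mem_Times_iff by blast
    then have "rc p mod 24 = 0" using rep(2)[OF pD] by (metis fst_conv)
    then have "24 dvd rc p" by presburger
    then have "norm (G p z) * Im z = H z"
      using GH[OF pD that(2)] Hinv[OF rep(1)[OF pD] _ that(2)] by (simp add: M_def)
    then show ?thesis using that(2) by (simp add: H_def)
  qed
  have "\<forall>p\<in>D. \<exists>B Y. \<forall>z. Im z > Y \<longrightarrow> norm (G p z) \<le> B"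
    using bdd[OF rep(1)] unfolding G_def M_def by blast
  then obtain BB YY where BY: "\<And>p z. p \<in> D \<Longrightarrow> Im z > YY p \<Longrightarrow> norm (G p z) \<le> BB p" by metis
  define Y where "Y = 1 + max (max 0 Y0) (Max (YY ` D))"
  define B where "B = (\<Prod>p\<in>D - U. BB p) * B0 ^ 8"
  have decay: "norm (P z) \<le> B * exp (- (2 * pi * 72 * Im z))" if "Im z \<ge> Y" for z
  proof -
    have z: "Im z > 0" "Im z > Y0" using that by (auto simp: Y_def)
    have zp: "Im z > YY p" if p: "p \<in> D" for p
    proof -
      have "YY p \<le> Max (YY ` D)" using p finD by simp
      then show ?thesis using \<open>Im z \<ge> Y\<close> by (simp add: Y_def)
    qed
    have B1: "(\<Prod>p\<in>D - U. norm (G p z)) \<le> (\<Prod>p\<in>D - U. BB p)"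
      using BY zp by (intro prod_mono) auto
    have B2: "(\<Prod>p\<in>U. norm (G p z)) \<le> (B0 * exp (- (2 * pi * 9 * Im z))) ^ 8"
    proof -
      have "(\<Prod>p\<in>U. norm (G p z)) = (\<Prod>p\<in>U. norm (F z))" using GU z by (intro prod.cong) auto
      also have "\<dots> = norm (F z) ^ 8" by (simp add: cardU)
      also have "\<dots> \<le> (B0 * exp (- (2 * pi * 9 * Im z))) ^ 8" using ord[OF z(2)] by (intro power_mono) auto
      finally show ?thesis .
    qed
    have "norm (P z) = (\<Prod>p\<in>D - U. norm (G p z)) * (\<Prod>p\<in>U. norm (G p z))"
      unfolding P_def prod_norm[symmetric] using finD UD by (rule prod.subset_diff[rotated])
    also have "\<dots> \<le> (\<Prod>p\<in>D - U. BB p) * (B0 * exp (- (2 * pi * 9 * Im z))) ^ 8"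
      using B1 B2 by (intro mult_mono) (auto intro!: prod_nonneg order_trans[OF norm_ge_zero BY] zp)
    also have "\<dots> = B * exp (- (2 * pi * 72 * Im z))"
      unfolding B_def power_mult_distrib by (simp add: exp_of_nat_mult[symmetric])
    finally show ?thesis .
  qed
  have s3: "sqrt 3 > 1.732" by (rule real_less_rsqrt) (simp add: power2_eq_square)
  have "384 < 3.125 * 1.732 * (71::real)" by simp
  also have "\<dots> < pi * sqrt 3 * 71" using s3 pi_gt_3125
    by (intro mult_strict_right_mono mult_strict_mono) auto
  finally have num: "real (card D) < pi * sqrt 3 * 71" using cardD by linarith
  have Pzero: "P z = 0" if "Im z > 0" for z
    by (rule siegel_vanishing[where n = 71 and N = 72 and k = "card D", OF Phol Pinv decay]) (use num that in auto)
  show ?thesis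
  proof (rule ccontr)
    assume Fw: "F w \<noteq> 0"
    have op: "open {z. Im z > 0}" by (rule open_halfspace_Im_gt)
    have conn: "connected {z. Im z > 0}" by (intro convex_connected convex_halfspace_Im_gt)
    obtain p where p: "p \<in> D" "\<And>z. Im z > 0 \<Longrightarrow> G p z = 0"
      using prod_holomorphic_eq_0[where G = G, OF finD op conn] Ghol Pzero w unfolding P_def by blast
    have det: "rd p * ra p - (- rb p) * (- rc p) = 1" using rep(1)[OF p(1)] by (simp add: algebra_simps)
    define z where "z = mob (rd p) (- rb p) (- rc p) (ra p) w"
    have z: "Im z > 0" unfolding z_def by (rule Im_mob_pos[OF det w])
    have "M p z = mob (ra p * rd p + rb p * - rc p) (ra p * - rb p + rb p * ra p)
      (rc p * rd p + rd p * - rc p) (rc p * - rb p + rd p * ra p) w"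
      unfolding M_def z_def by (rule mob_mult[OF det w])
    also have "\<dots> = w" using rep(1)[OF p(1)] by (simp add: mob_def algebra_simps)
    finally have "M p z = w" .
    then have "F w = 0" using p(2)[OF z] mob_denom_nz[OF rep(1)[OF p(1)] z] by (simp add: G_def)
    then show False using Fw by simp
  qed
qed

section \<open>Lipschitz's formula\<close>

lemma has_sum_int_split:
  fixes f :: "int \<Rightarrow> 'a :: {topological_comm_monoid_add, t2_space}"
  assumes "((\<lambda>k. f (int k)) has_sum a) UNIV" "((\<lambda>k. f (- int k - 1)) has_sum b) UNIV"
  shows "(f has_sum (a + b)) UNIV"
proof -
  have 1: "(f has_sum a) (range int)"
    using assms(1) by (subst has_sum_reindex) (auto simp: o_def)
  have 2: "(f has_sum b) (range (\<lambda>k. - int k - 1))"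
    using assms(2) by (subst has_sum_reindex) (auto simp: o_def inj_on_def)
  have "range int \<union> range (\<lambda>k. - int k - 1) = UNIV"
  proof (rule UNIV_eq_I[symmetric])
    fix x :: int
    show "x \<in> range int \<union> range (\<lambda>k. - int k - 1)"
    proof (cases "x \<ge> 0")
      case True
      then have "x = int (nat x)" by simp
      then show ?thesis by blast
    next
      case False
      then have "x = - int (nat (- x - 1)) - 1" by simp
      then show ?thesis by blast
    qed
  qed
  moreover have "range int \<inter> range (\<lambda>k. - int k - 1) = {}" by (auto; linarith)
  ultimately show ?thesis using has_sum_Un_disjoint[OF 1 2] by simp
qed

lemma summable_on_int_split:
  fixes f :: "int \<Rightarrow> 'a :: {topological_comm_monoid_add, t2_space}"
  assumes "(\<lambda>k. f (int k)) summable_on UNIV" "(\<lambda>k. f (- int k - 1)) summable_on UNIV"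
  shows "f summable_on UNIV"
  using assms has_sum_int_split unfolding summable_on_def by blast

lemma summable_norm_inverse_square_nat:
  fixes w :: complex
  shows "summable (\<lambda>k. norm (1 / (w + of_nat k)\<^sup>2))"
proof (rule summable_comparison_test_ev)
  obtain K :: nat where K: "2 * norm w < K" using reals_Archimedean2 by blast
  show "\<forall>\<^sub>F k in sequentially. norm (norm (1 / (w + of_nat k)\<^sup>2)) \<le> 4 * inverse (real k ^ 2)"
    using eventually_ge_at_top[of "max 1 K"]
  proof eventually_elim
    case (elim k)
    have "norm (of_nat k :: complex) - norm w \<le> norm (w + of_nat k)"
      by (metis add.commute norm_diff_ineq)
    then have "norm (w + of_nat k) \<ge> k / 2" using elim K by simp
    then have "norm (w + of_nat k) ^ 2 \<ge> (k / 2)\<^sup>2" by (intro power_mono) auto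
    moreover have "real k ^ 2 > 0" using elim by simp
    ultimately have "1 / norm (w + of_nat k) ^ 2 \<le> 1 / (real k / 2) ^ 2"
      by (intro divide_left_mono) (auto intro!: mult_pos_pos elim: order.strict_trans2[rotated])
    then show ?case by (simp add: norm_divide norm_power field_simps)
  qed
  show "summable (\<lambda>k. 4 * inverse (real k ^ 2))"
    by (intro summable_mult inverse_power_summable) simp
qed

lemma abs_summable_inverse_square_int:
  fixes w :: complex
  shows "(\<lambda>k. norm (1 / (w + of_int k)\<^sup>2)) summable_on (UNIV :: int set)"
proof (rule summable_on_int_split)
  have *: "(\<lambda>k. norm (1 / (w + of_nat k)\<^sup>2)) summable_on UNIV" for w :: complex
    by (rule norm_summable_imp_summable_on) (use summable_norm_inverse_square_nat in simp)
  show "(\<lambda>k. norm (1 / (w + of_int (int k))\<^sup>2)) summable_on UNIV" using *[of w] by simp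
  have "(w + of_int (- int k - 1))\<^sup>2 = ((1 - w) + of_nat k)\<^sup>2" for k
    by (simp add: power2_eq_square algebra_simps)
  then show "(\<lambda>k. norm (1 / (w + of_int (- int k - 1))\<^sup>2)) summable_on UNIV" using *[of "1 - w"] by simp
qed

lemma Polygamma_1_reflection:
  fixes w :: complex
  assumes "w \<notin> \<int>"
  shows "Polygamma 1 w + Polygamma 1 (1 - w) = of_real (pi\<^sup>2) / sin (of_real pi * w) ^ 2"
proof -
  have dig: "Digamma (1 - z) - Digamma z = of_real pi * cot (of_real pi * z)" if z: "z \<notin> \<int>" for z :: complex
  proof -
    have z': "1 - z \<notin> \<int>" using z by (metis Ints_1 Ints_diff diff_diff_eq2 add_diff_cancel_left')
    have np: "z \<notin> \<int>\<^sub>\<le>\<^sub>0" "1 - z \<notin> \<int>\<^sub>\<le>\<^sub>0" using z z' by (auto dest: nonpos_Ints_Int)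
    have s: "sin (of_real pi * z) \<noteq> 0" using z by (auto simp: sin_eq_0 mult.commute)
    define G where "G = Gamma z * Gamma (1 - z)"
    have G: "G = of_real pi / sin (of_real pi * z)" unfolding G_def by (rule Gamma_reflection_complex)
    have 1: "((\<lambda>z. Gamma z * Gamma (1 - z)) has_field_derivative
        (Gamma z * Digamma z * Gamma (1 - z) - Gamma (1 - z) * Digamma (1 - z) * Gamma z)) (at z)"
      using np by (auto intro!: derivative_eq_intros)
    have "((\<lambda>z. of_real pi / sin (of_real pi * z)) has_field_derivative
        (- of_real pi * of_real pi * cos (of_real pi * z) / sin (of_real pi * z) ^ 2)) (at z)"
      using s by (auto intro!: derivative_eq_intros simp: power2_eq_square)
    then have 2: "((\<lambda>z. Gamma z * Gamma (1 - z)) has_field_derivative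
        (- of_real pi * of_real pi * cos (of_real pi * z) / sin (of_real pi * z) ^ 2)) (at z)"
      by (simp only: Gamma_reflection_complex)
    have "G * (Digamma z - Digamma (1 - z)) = - of_real pi * of_real pi * cos (of_real pi * z) / sin (of_real pi * z) ^ 2"
      using DERIV_unique[OF 1 2] by (simp add: G_def algebra_simps)
    then have "(sin (of_real pi * z) / of_real pi) * (G * (Digamma z - Digamma (1 - z))) =
        - of_real pi * cos (of_real pi * z) / sin (of_real pi * z)"
      using s by (simp add: power2_eq_square)
    then have "Digamma z - Digamma (1 - z) = - of_real pi * cos (of_real pi * z) / sin (of_real pi * z)"
      unfolding G using s by simp
    then have "Digamma (1 - z) - Digamma z = of_real pi * cos (of_real pi * z) / sin (of_real pi * z)"
      by (simp add: algebra_simps)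
    then show ?thesis by (simp add: cot_def)
  qed
  have np: "w \<notin> \<int>\<^sub>\<le>\<^sub>0" "1 - w \<notin> \<int>\<^sub>\<le>\<^sub>0"
    using assms by (auto dest: nonpos_Ints_Int)
  have s: "sin (of_real pi * w) \<noteq> 0" using assms by (auto simp: sin_eq_0 mult.commute)
  have 1: "((\<lambda>z. Digamma (1 - z) - Digamma z) has_field_derivative (- Polygamma 1 (1 - w) - Polygamma 1 w)) (at w)"
    using np by (auto intro!: derivative_eq_intros)
  have "((\<lambda>z. of_real pi * cot (of_real pi * z)) has_field_derivative
      (of_real pi * (- inverse (sin (of_real pi * w) ^ 2) * of_real pi))) (at w)"
    by (intro DERIV_cmult DERIV_chain2[of cot] DERIV_cot s) (auto intro!: derivative_eq_intros)
  then have 2: "((\<lambda>z. Digamma (1 - z) - Digamma z) has_field_derivative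
      (of_real pi * (- inverse (sin (of_real pi * w) ^ 2) * of_real pi))) (at w)"
    by (rule has_field_derivative_transform_within_open[where S = "- \<int>"]) (use assms dig in \<open>auto simp: open_Compl\<close>)
  have "- (Polygamma 1 w + Polygamma 1 (1 - w)) = - (of_real (pi\<^sup>2) / sin (of_real pi * w) ^ 2)"
    using DERIV_unique[OF 1 2] by (simp add: field_simps power2_eq_square)
  then show ?thesis by (simp only: neg_equal_iff_equal)
qed

text \<open>Differentiation of the reflection formula of the Gamma function gives the partial
  fraction expansion of the squared cosecant; the trigamma function sums the two halves.\<close>

lemma has_sum_inverse_square_int:
  fixes w :: complex
  assumes w: "w \<notin> \<int>"
  shows "((\<lambda>k. 1 / (w + of_int k)\<^sup>2) has_sum (of_real (pi\<^sup>2) / sin (of_real pi * w) ^ 2)) (UNIV :: int set)"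
proof -
  have *: "((\<lambda>k. 1 / (w + of_nat k)\<^sup>2) has_sum Polygamma 1 w) UNIV" if "w \<notin> \<int>" for w :: complex
  proof (rule norm_summable_imp_has_sum)
    show "summable (\<lambda>k. norm (1 / (w + of_nat k)\<^sup>2))" by (rule summable_norm_inverse_square_nat)
    have "w \<noteq> 0" using that by auto
    then have "(\<lambda>k. inverse ((w + of_nat k)\<^sup>2)) sums (\<Sum>k. inverse ((w + of_nat k)\<^sup>2))"
      by (intro summable_sums Polygamma_converges') auto
    then show "(\<lambda>k. 1 / (w + of_nat k)\<^sup>2) sums Polygamma 1 w"
      by (simp add: Polygamma_def inverse_eq_divide numeral_2_eq_2)
  qed
  have "1 - w \<notin> \<int>" using w by (metis Ints_1 Ints_diff diff_diff_eq2 add_diff_cancel_left')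
  moreover have "(w + of_int (- int k - 1))\<^sup>2 = ((1 - w) + of_nat k)\<^sup>2" for k
    by (simp add: power2_eq_square algebra_simps)
  ultimately have "((\<lambda>k. 1 / (w + of_int (- int k - 1))\<^sup>2) has_sum Polygamma 1 (1 - w)) UNIV"
    using *[of "1 - w"] by simp
  moreover have "((\<lambda>k. 1 / (w + of_int (int k))\<^sup>2) has_sum Polygamma 1 w) UNIV"
    using *[OF w] by simp
  ultimately show ?thesis
    using has_sum_int_split[of "\<lambda>k. 1 / (w + of_int k)\<^sup>2" "Polygamma 1 w" "Polygamma 1 (1 - w)"]
    by (simp only: Polygamma_1_reflection[OF w])
qed

text \<open>In the upper half plane the squared cosecant becomes a rational function of
  \<open>q\<close>, whose geometric expansion is Lipschitz's formula.\<close>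

lemma csc_square_eq_exp:
  fixes w :: complex
  assumes "Im w > 0"
  shows "of_real (pi\<^sup>2) / sin (of_real pi * w) ^ 2 =
    - 4 * of_real pi ^ 2 * qq w / (1 - qq w)\<^sup>2"
proof -
  define E where "E = exp (\<i> * (of_real pi * w))"
  have E: "E \<noteq> 0" by (simp add: E_def)
  have q: "qq w = E\<^sup>2" by (simp add: qq_def E_def exp_double[symmetric] power2_eq_square exp_add[symmetric] algebra_simps)
  have "norm (qq w) < 1" using assms by (simp add: qq_def)
  then have ne: "E\<^sup>2 \<noteq> 1" unfolding q[symmetric] by auto
  have "sin (of_real pi * w) = (E - inverse E) / (2 * \<i>)"
    by (simp add: sin_exp_eq E_def exp_minus)
  moreover have "(E - inverse E) / (2 * \<i>) = (E\<^sup>2 - 1) / (2 * \<i> * E)"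
    using E by (simp add: field_simps power2_eq_square)
  ultimately have "sin (of_real pi * w) ^ 2 = ((E\<^sup>2 - 1) / (2 * \<i> * E))\<^sup>2" by simp
  also have "\<dots> = - ((1 - E\<^sup>2)\<^sup>2 / (4 * E\<^sup>2))"
    by (simp add: power_divide power_mult_distrib power2_commute)
  finally have "sin (of_real pi * w) ^ 2 = - ((1 - E\<^sup>2)\<^sup>2 / (4 * E\<^sup>2))" .
  then show ?thesis unfolding q by (simp add: field_simps)
qed

lemma not_Ints_if_Im_pos: "Im w > 0 \<Longrightarrow> w \<notin> \<int>"
  by (auto elim!: Ints_cases)

lemma lipschitz_bound:
  assumes "y > 0"
  obtains C where "\<And>w. Im w \<ge> y \<Longrightarrow> norm (\<Sum>\<^sub>\<infinity>k::int. 1 / (w + of_int k)\<^sup>2) \<le> C * exp (- (2 * pi * Im w))"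
proof -
  define r where "r = exp (- (2 * pi * y))"
  have r: "0 < r" "r < 1" using assms by (simp_all add: r_def)
  show ?thesis
  proof (rule that[of "4 * pi ^ 2 / (1 - r)\<^sup>2"])
    fix w assume w: "Im w \<ge> y"
    then have wp: "Im w > 0" using assms by simp
    have nq: "norm (qq w) = exp (- (2 * pi * Im w))" by (simp add: qq_def)
    also have "\<dots> \<le> r" using w by (simp add: r_def)
    finally have "1 - r \<le> norm (1 - qq w)" using norm_triangle_ineq2[of 1 "qq w"] by simp
    then have "(1 - r)\<^sup>2 \<le> norm (1 - qq w) ^ 2" using r by (intro power_mono) auto
    then have "4 * pi\<^sup>2 * norm (qq w) / norm (1 - qq w) ^ 2 \<le> 4 * pi\<^sup>2 * norm (qq w) / (1 - r)\<^sup>2"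
      using r by (intro divide_left_mono) (auto intro!: mult_pos_pos)
    moreover have "(\<Sum>\<^sub>\<infinity>k::int. 1 / (w + of_int k)\<^sup>2) = - 4 * of_real pi ^ 2 * qq w / (1 - qq w)\<^sup>2"
      using has_sum_inverse_square_int[OF not_Ints_if_Im_pos[OF wp]] csc_square_eq_exp[OF wp]
      by (simp add: infsumI)
    ultimately show "norm (\<Sum>\<^sub>\<infinity>k::int. 1 / (w + of_int k)\<^sup>2) \<le> 4 * pi ^ 2 / (1 - r)\<^sup>2 * exp (- (2 * pi * Im w))"
      by (simp add: norm_divide norm_mult norm_power nq)
  qed
qed

section \<open>Eisenstein series of weight two with periodic coefficients\<close>

text \<open>The mean value zero is what makes the sums over blocks absolutely convergent.\<close>

definition per24 :: "(int \<Rightarrow> int \<Rightarrow> complex) \<Rightarrow> bool" where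
  "per24 h \<longleftrightarrow> (\<forall>x y. h (x + 24) y = h x y \<and> h x (y + 24) = h x y) \<and>
     (\<Sum>r\<in>{0..<24}. \<Sum>s\<in>{0..<24}. h r s) = 0"

definition lterm :: "(int \<Rightarrow> int \<Rightarrow> complex) \<Rightarrow> complex \<Rightarrow> int \<Rightarrow> int \<Rightarrow> complex" where
  "lterm h z x y = h x y / (of_int x * z + of_int y)\<^sup>2"

definition block :: "(int \<Rightarrow> int \<Rightarrow> complex) \<Rightarrow> complex \<Rightarrow> int \<times> int \<Rightarrow> complex" where
  "block h z = (\<lambda>(i, j). \<Sum>r\<in>{0..<24}. \<Sum>s\<in>{0..<24}. lterm h z (24 * i + r) (24 * j + s))"

definition Eis :: "(int \<Rightarrow> int \<Rightarrow> complex) \<Rightarrow> complex \<Rightarrow> complex" where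
  "Eis h z = (\<Sum>\<^sub>\<infinity>p. block h z p)"

lemma per24_mult:
  assumes "per24 h"
  shows "h (24 * i + x) (24 * j + y) = h x y"
proof -
  have px: "h (x + 24) y = h x y" and py: "h x (y + 24) = h x y" for x y
    using assms by (auto simp: per24_def)
  have nx: "h (x + 24 * int n) y = h x y" "h x (y + 24 * int n) = h x y" for n x y
  proof (induction n)
    case (Suc n)
    { case 1
      show ?case using px[of "x + 24 * int n" y] Suc(1) by (simp add: algebra_simps) }
    { case 2
      show ?case using py[of x "y + 24 * int n"] Suc(2) by (simp add: algebra_simps) }
  qed auto
  have ix: "h (x + 24 * i) y = h x y" for x y i
    using nx(1)[of x "nat i" y] nx(1)[of "x + 24 * i" "nat (-i)" y] by (cases "i \<ge> 0") auto
  have iy: "h x (y + 24 * i) = h x y" for x y i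
    using nx(2)[of x y "nat i"] nx(2)[of x "y + 24 * i" "nat (-i)"] by (cases "i \<ge> 0") auto
  show ?thesis using ix[of x i "24 * j + y"] iy[of x y j] by (simp add: add_ac)
qed

lemma per24_bounded:
  assumes "per24 h"
  obtains C where "C \<ge> 0" "\<And>x y. norm (h x y) \<le> C"
proof (rule that)
  let ?C = "\<Sum>r\<in>{0..<24}. \<Sum>s\<in>{0..<24}. norm (h r s)"
  show "?C \<ge> 0" by (intro sum_nonneg) auto
  fix x y
  have "h x y = h (24 * (x div 24) + x mod 24) (24 * (y div 24) + y mod 24)" by simp
  also have "\<dots> = h (x mod 24) (y mod 24)" by (rule per24_mult[OF assms])
  finally have "norm (h x y) = norm (h (x mod 24) (y mod 24))" by simp
  also have "\<dots> \<le> (\<Sum>s\<in>{0..<24}. norm (h (x mod 24) s))"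
    by (rule member_le_sum) auto
  also have "\<dots> \<le> ?C"
    by (rule member_le_sum[where f = "\<lambda>r. \<Sum>s\<in>{0..<24}. norm (h r s)"]) (auto intro: sum_nonneg)
  finally show "norm (h x y) \<le> ?C" .
qed

lemma sum_periodic_24_shift:
  fixes f :: "int \<Rightarrow> 'a :: ab_group_add"
  assumes "\<And>x. f (x + 24) = f x"
  shows "(\<Sum>s\<in>{0..<24}. f (s + k)) = (\<Sum>s\<in>{0..<24}. f s)"
proof -
  have "(\<Sum>s\<in>{0..<24}. f (s + k)) = (\<Sum>s\<in>{k..<k + 24}. f s)" for k
    by (rule sum.reindex_bij_witness[of _ "\<lambda>s. s - k" "\<lambda>s. s + k"]) auto
  note 0 = this
  have 1: "(\<Sum>s\<in>{k + 1..<k + 1 + 24}. f s) = (\<Sum>s\<in>{k..<k + 24}. f s)" for k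
  proof -
    have "{k..<k + 1 + 24} = insert k {k + 1..<k + 1 + 24}" "{k..<k + 1 + 24} = insert (k + 24) {k..<k + 24}" by auto
    then have "f k + (\<Sum>s\<in>{k + 1..<k + 1 + 24}. f s) = f (k + 24) + (\<Sum>s\<in>{k..<k + 24}. f s)"
      by (metis (no_types, lifting) sum.insert finite_atLeastLessThan_int atLeastLessThan_iff add_le_same_cancel1 less_irrefl not_one_le_zero)
    then show ?thesis using assms by simp
  qed
  have 2: "(\<Sum>s\<in>{int n..<int n + 24}. f s) = (\<Sum>s\<in>{0..<24}. f s)" for n
  proof (induction n)
    case (Suc n) then show ?case using 1[of "int n"] by (simp add: add_ac)
  qed simp
  have 3: "(\<Sum>s\<in>{- int n..<- int n + 24}. f s) = (\<Sum>s\<in>{0..<24}. f s)" for n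
  proof (induction n)
    case (Suc n)
    have "- int n - 1 + 1 = - int n" "- int n - 1 = - int (Suc n)" by simp_all
    then show ?case using 1[of "- int n - 1"] Suc by metis
  qed simp
  show ?thesis unfolding 0 using 2[of "nat k"] 3[of "nat (-k)"] by (cases "k \<ge> 0") auto
qed

lemma sum_periodic_24_minus:
  fixes f :: "int \<Rightarrow> 'a :: ab_group_add"
  assumes "\<And>x. f (x + 24) = f x"
  shows "(\<Sum>s\<in>{0..<24}. f (- s)) = (\<Sum>s\<in>{0..<24}. f s)"
proof -
  have "(\<Sum>s\<in>{0..<24}. f (- s)) = (\<Sum>s\<in>{0..<24}. f (s + (- 23)))"
    by (rule sum.reindex_bij_witness[of _ "\<lambda>s. 23 - s" "\<lambda>s. 23 - s"]) auto
  also have "\<dots> = (\<Sum>s\<in>{0..<24}. f s)" by (rule sum_periodic_24_shift) (rule assms)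
  finally show ?thesis .
qed

lemma per24_S: "per24 h \<Longrightarrow> per24 (\<lambda>x y. h (- y) x)"
proof -
  assume h: "per24 h"
  have p: "h (- (y + 24)) x = h (- y) x" for x y
    using per24_mult[OF h, of "-1" "-y" 0 x] by (simp add: algebra_simps)
  have "(\<Sum>r\<in>{0..<24}. \<Sum>s\<in>{0..<24}. h (- s) r) = (\<Sum>s\<in>{0..<24}. \<Sum>r\<in>{0..<24}. h (- s) r)"
    by (rule sum.swap)
  also have "\<dots> = (\<Sum>s\<in>{0..<24}. \<Sum>r\<in>{0..<24}. h s r)"
    by (rule sum_periodic_24_minus) (use h in \<open>simp add: per24_def\<close>)
  also have "\<dots> = 0" using h by (simp add: per24_def)
  finally show "per24 (\<lambda>x y. h (- y) x)" using h p by (simp add: per24_def)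
qed

lemma per24_T: "per24 h \<Longrightarrow> per24 (\<lambda>x y. h x (y + k * x))"
proof -
  assume h: "per24 h"
  have p: "h (x + 24) (y + k * (x + 24)) = h x (y + k * x)" for x y
    using per24_mult[OF h, of 1 x k "y + k * x"] by (simp add: algebra_simps)
  have p': "h x (y + 24 + k * x) = h x (y + k * x)" for x y
    using per24_mult[OF h, of 0 x 1 "y + k * x"] by (simp add: algebra_simps)
  have "(\<Sum>r\<in>{0..<24}. \<Sum>s\<in>{0..<24}. h r (s + k * r)) = (\<Sum>r\<in>{0..<24}. \<Sum>s\<in>{0..<24}. h r s)"
    by (intro sum.cong refl sum_periodic_24_shift) (use h in \<open>simp add: per24_def\<close>)
  also have "\<dots> = 0" using h by (simp add: per24_def)
  finally show "per24 (\<lambda>x y. h x (y + k * x))" using p p' by (simp add: per24_def)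
qed

text \<open>A norm on the plane is bounded below by the sum norm in the basis \<open>(z,
  1)\<close>.\<close>

lemma lattice_lower_bound:
  assumes "Im z > 0"
  obtains K where "K > 0" "\<And>i j :: int. K * (\<bar>of_int i\<bar> + \<bar>of_int j\<bar>) \<le> norm (of_int i * z + of_int j)"
proof
  define L where "L = 1 / Im z + 1 + norm z / Im z"
  have L: "L > 0" using assms by (simp add: L_def add_pos_nonneg)
  show "1 / L > 0" using L by simp
  fix i j :: int
  let ?n = "norm (of_int i * z + of_int j)"
  have "\<bar>of_int i * Im z\<bar> \<le> ?n" using abs_Im_le_cmod[of "of_int i * z + of_int j"] by simp
  then have i: "\<bar>of_int i\<bar> \<le> ?n / Im z" using assms by (simp add: abs_mult field_simps)
  have "\<bar>of_int j\<bar> = norm ((of_int i * z + of_int j) - of_int i * z)" by simp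
  also have "\<dots> \<le> ?n + norm (of_int i * z)" by (rule norm_triangle_ineq4)
  also have "norm (of_int i * z) = \<bar>of_int i\<bar> * norm z" by (simp add: norm_mult)
  also have "\<dots> \<le> ?n / Im z * norm z" by (intro mult_right_mono i) auto
  finally have "\<bar>of_int i\<bar> + \<bar>of_int j\<bar> \<le> ?n * L" using i by (simp add: L_def algebra_simps)
  then show "1 / L * (\<bar>of_int i\<bar> + \<bar>of_int j\<bar>) \<le> ?n" using L by (simp add: field_simps)
qed

text \<open>Inside a block the leading terms cancel because of the mean value zero, and what
  remains decays like the inverse cube; that is summable over a plane lattice.\<close>

lemma inverse_square_diff_bound:
  fixes w v :: complex
  assumes "norm v \<le> V" "2 * V \<le> norm w" "w \<noteq> 0"
  shows "norm (1 / (w + v)\<^sup>2 - 1 / w\<^sup>2) \<le> 10 * V / norm w ^ 3"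
proof -
  have nw: "norm w > 0" using assms by simp
  have V0: "V \<ge> 0" using assms(1) norm_ge_zero order_trans by blast
  have wv: "norm (w + v) \<ge> norm w / 2" using norm_diff_ineq[of w v] assms by simp
  then have nz: "w + v \<noteq> 0" using nw by auto
  have "1 / (w + v)\<^sup>2 - 1 / w\<^sup>2 = (w\<^sup>2 - (w + v)\<^sup>2) / ((w + v)\<^sup>2 * w\<^sup>2)"
    using nz assms(3) by (simp add: diff_frac_eq)
  also have "w\<^sup>2 - (w + v)\<^sup>2 = - (v * (2 * w + v))" by (simp add: power2_eq_square algebra_simps)
  finally have "1 / (w + v)\<^sup>2 - 1 / w\<^sup>2 = - (v * (2 * w + v)) / ((w + v)\<^sup>2 * w\<^sup>2)" .
  then have "norm (1 / (w + v)\<^sup>2 - 1 / w\<^sup>2) = norm v * norm (2 * w + v) / (norm (w + v) ^ 2 * norm w ^ 2)"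
    by (simp add: norm_divide norm_mult norm_power)
  also have "\<dots> \<le> V * (5 / 2 * norm w) / ((norm w / 2) ^ 2 * norm w ^ 2)"
  proof (intro frac_le mult_mono power_mono)
    show "norm (2 * w + v) \<le> 5 / 2 * norm w" using norm_triangle_ineq[of "2 * w" v] assms by (simp add: norm_mult)
  qed (use assms wv nw V0 in auto)
  also have "\<dots> = 10 * V / norm w ^ 3" using nw by (simp add: field_simps power2_eq_square power3_eq_cube)
  finally show ?thesis .
qed

lemma summable_on_int_powr: "(\<lambda>i::int. (1 + \<bar>real_of_int i\<bar>) powr (-3/2)) summable_on UNIV"
proof (rule summable_on_int_split)
  have s: "summable (\<lambda>k. (1 + real k) powr (-3/2))"
    using summable_Suc_iff[of "\<lambda>k. real k powr (-3/2)"] by (simp add: summable_real_powr_iff add.commute)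
  then show "(\<lambda>k. (1 + \<bar>real_of_int (int k)\<bar>) powr (-3/2)) summable_on UNIV"
    by (intro norm_summable_imp_summable_on) simp
  have "summable (\<lambda>k. (2 + real k) powr (-3/2))"
    using s[folded summable_Suc_iff[of "\<lambda>k. (1 + real k) powr (-3/2)"]] by (simp add: add_ac)
  moreover have "1 + \<bar>real_of_int (- int k - 1)\<bar> = 2 + real k" for k by simp
  ultimately show "(\<lambda>k. (1 + \<bar>real_of_int (- int k - 1)\<bar>) powr (-3/2)) summable_on UNIV"
    by (intro norm_summable_imp_summable_on) (simp only: real_norm_def, simp)
qed

lemma block_abs_summable:
  assumes h: "per24 h" and z: "Im z > 0"
  shows "(\<lambda>p. norm (block h z p)) summable_on UNIV"
proof -
  obtain K where K: "K > 0" "\<And>i j :: int. K * (\<bar>of_int i\<bar> + \<bar>of_int j\<bar>) \<le> norm (of_int i * z + of_int j)"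
    using lattice_lower_bound[OF z] by blast
  obtain C where C: "C \<ge> 0" "\<And>x y. norm (h x y) \<le> C" using per24_bounded[OF h] by blast
  define V where "V = 24 * (norm z + 1)"
  define g where "g = (\<lambda>(i::int, j::int). (1 + \<bar>of_int i\<bar>) powr (-3/2) * (1 + \<bar>of_int j\<bar> :: real) powr (-3/2))"
  \<comment> \<open>finitely many blocks near the origin are exempt from the estimate\<close>
  define X where "X = {p :: int \<times> int. 24 * (K * (\<bar>of_int (fst p)\<bar> + \<bar>of_int (snd p)\<bar>)) < 2 * V \<or> p = 0}"
  define D where "D = 576 * C * (10 * V / (24 * K) ^ 3) * 8"
  have V: "V > 0" by (simp add: V_def add_nonneg_pos)
  have g: "g summable_on UNIV"
  proof -
    have "(\<lambda>(x, y). (1 + \<bar>of_int x\<bar>) powr (-3/2) * (1 + \<bar>of_int y\<bar> :: real) powr (-3/2)) summable_on (UNIV :: int set) \<times> (UNIV :: int set)"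
      by (rule summable_on_SigmaI[where g = "\<lambda>x. (1 + \<bar>of_int x\<bar>) powr (-3/2) * infsum (\<lambda>y::int. (1 + \<bar>of_int y\<bar> :: real) powr (-3/2)) UNIV"])
         (use summable_on_int_powr in \<open>auto intro!: has_sum_cmult_right summable_on_cmult_left has_sum_infsum\<close>)
    then show ?thesis by (simp add: g_def)
  qed
  have fX: "finite X"
  proof -
    define N where "N = \<lceil>2 * V / (24 * K)\<rceil> + 1"
    have "X \<subseteq> {-N..N} \<times> {-N..N}"
    proof
      fix p assume "p \<in> X"
      then consider "24 * (K * (\<bar>of_int (fst p)\<bar> + \<bar>of_int (snd p)\<bar>)) < 2 * V" | "p = 0" by (auto simp: X_def)
      then show "p \<in> {-N..N} \<times> {-N..N}"
      proof cases
        case 1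
        then have "\<bar>of_int (fst p)\<bar> + \<bar>of_int (snd p)\<bar> < 2 * V / (24 * K)" using K by (simp add: field_simps)
        then have "\<bar>fst p\<bar> \<le> N \<and> \<bar>snd p\<bar> \<le> N" unfolding N_def by linarith
        then show ?thesis by (auto simp: mem_Times_iff)
      next
        case 2
        have "2 * V / (24 * K) > 0" using V K by simp
        then have "N \<ge> 0" unfolding N_def by linarith
        then show ?thesis using 2 by (simp add: zero_prod_def)
      qed
    qed
    then show ?thesis by (rule finite_subset) auto
  qed
  have bound: "norm (block h z p) \<le> D * g p" if p: "p \<notin> X" for p
  proof -
    obtain i j where ij: "p = (i, j)" by (cases p)
    define w where "w = 24 * (of_int i * z + of_int j)"
    define S where "S = \<bar>real_of_int i\<bar> + \<bar>real_of_int j\<bar>"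
    have big: "2 * V \<le> 24 * (K * S)" "p \<noteq> 0" using p by (auto simp: X_def ij S_def)
    have "\<bar>i\<bar> + \<bar>j\<bar> \<ge> 1" using big(2) by (auto simp: ij zero_prod_def)
    then have S1: "S \<ge> 1" unfolding S_def by linarith
    have "norm w = 24 * norm (of_int i * z + of_int j)" unfolding w_def by (simp only: norm_mult) simp
    then have wK: "24 * K * S \<le> norm w" using K(2)[of i j] by (simp add: S_def)
    have w0: "w \<noteq> 0" using wK K S1 by (auto simp: mult_le_0_iff)
    have lt: "lterm h z (24 * i + r) (24 * j + s) = h r s * (1 / (w + (of_int r * z + of_int s))\<^sup>2)" for r s
      unfolding lterm_def per24_mult[OF h] by (simp add: w_def algebra_simps)
    have "block h z p = (\<Sum>r\<in>{0..<24}. \<Sum>s\<in>{0..<24}. h r s * (1 / (w + (of_int r * z + of_int s))\<^sup>2 - 1 / w\<^sup>2))"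
    proof -
      have "(\<Sum>r\<in>{0..<24}. \<Sum>s\<in>{0..<24}. h r s * (1 / w\<^sup>2)) = 0"
        unfolding sum_distrib_right[symmetric] using h by (simp add: per24_def)
      then show ?thesis
        by (simp add: block_def ij lt right_diff_distrib sum_subtractf)
    qed
    also have "norm \<dots> \<le> (\<Sum>r\<in>{0..<24::int}. \<Sum>s\<in>{0..<24::int}. C * (10 * V / norm w ^ 3))"
    proof (intro sum_norm_le)
      fix r s :: int assume rs: "r \<in> {0..<24}" "s \<in> {0..<24}"
      have "norm (of_int r * z + of_int s) \<le> \<bar>of_int r\<bar> * norm z + \<bar>of_int s\<bar>"
        by (rule order_trans[OF norm_triangle_ineq]) (simp add: norm_mult)
      also have "\<dots> \<le> 24 * norm z + 24" using rs by (intro add_mono mult_right_mono) auto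
      finally have "norm (of_int r * z + of_int s) \<le> V" by (simp add: V_def)
      then have "norm (1 / (w + (of_int r * z + of_int s))\<^sup>2 - 1 / w\<^sup>2) \<le> 10 * V / norm w ^ 3"
        using big(1) wK w0 by (intro inverse_square_diff_bound) auto
      then show "norm (h r s * (1 / (w + (of_int r * z + of_int s))\<^sup>2 - 1 / w\<^sup>2)) \<le> C * (10 * V / norm w ^ 3)"
        unfolding norm_mult by (intro mult_mono C) auto
    qed
    also have "\<dots> = 576 * C * (10 * V / norm w ^ 3)" by simp
    also have "\<dots> \<le> 576 * C * (10 * V / (24 * K * S) ^ 3)"
      using wK K S1 V C w0 by (intro mult_left_mono divide_left_mono power_mono mult_pos_pos zero_less_power) auto
    also have "\<dots> = D / 8 * (1 / S ^ 3)" by (simp add: D_def power_mult_distrib)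
    also have "\<dots> \<le> D / 8 * (8 * g p)"
    proof (intro mult_left_mono)
      have a: "(1 + \<bar>real_of_int i\<bar>) * (1 + \<bar>real_of_int j\<bar>) \<le> (2 * S) * (2 * S)"
        using S1 by (intro mult_mono) (auto simp: S_def)
      have "g p = ((1 + \<bar>real_of_int i\<bar>) * (1 + \<bar>real_of_int j\<bar>)) powr (-3/2)"
        by (simp add: g_def ij powr_mult)
      also have "\<dots> \<ge> ((2 * S) * (2 * S)) powr (-3/2)"
        by (rule powr_mono2') (use a in \<open>auto intro: mult_pos_pos\<close>)
      also have "((2 * S) * (2 * S)) powr (-3/2) = 1 / (2 * S) ^ 3"
      proof -
        have "((2 * S) * (2 * S)) powr (-3/2) = ((2 * S) powr 2) powr (-3/2)" using S1 by (simp add: power2_eq_square)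
        also have "\<dots> = (2 * S) powr (-3)" by (simp add: powr_powr)
        also have "\<dots> = 1 / (2 * S) ^ 3" using S1 by (simp add: powr_minus_divide)
        finally show ?thesis .
      qed
      finally show "1 / S ^ 3 \<le> 8 * g p" by (simp add: power_mult_distrib)
    qed (use C V K in \<open>auto simp: D_def\<close>)
    finally show ?thesis by simp
  qed
  have "(\<lambda>p. norm (block h z p)) summable_on (UNIV - X)"
    by (rule summable_on_comparison_test[where f = "\<lambda>p. D * g p"])
       (use bound in \<open>auto intro!: summable_on_cmult_right summable_on_subset_banach[OF g]\<close>)
  moreover have "(\<lambda>p. norm (block h z p)) summable_on X" using fX by simp
  ultimately have "(\<lambda>p. norm (block h z p)) summable_on ((UNIV - X) \<union> X)"
    by (intro summable_on_Un_disjoint) auto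
  then show ?thesis by simp
qed

section \<open>Eisenstein series under the modular group\<close>

lemma has_sum_sum:
  fixes f :: "'a \<Rightarrow> 'b \<Rightarrow> 'c :: topological_comm_monoid_add"
  assumes "finite A" "\<And>i. i \<in> A \<Longrightarrow> (f i has_sum S i) B"
  shows "((\<lambda>x. \<Sum>i\<in>A. f i x) has_sum (\<Sum>i\<in>A. S i)) B"
  using assms by (induction A rule: finite_induct) (auto intro!: has_sum_add)

lemma has_sum_int_blocks:
  fixes f :: "int \<Rightarrow> complex"
  assumes "(f has_sum S) UNIV"
  shows "((\<lambda>j. \<Sum>s\<in>{0..<24}. f (24 * j + s)) has_sum S) UNIV"
proof -
  have "((\<lambda>(j, s). f (24 * j + s)) has_sum S) (UNIV \<times> {0..<24})"
    by (rule iffD2[OF has_sum_reindex_bij_witness[where i = "\<lambda>x. (x div 24, x mod 24)" and j = "\<lambda>(j, s). 24 * j + s"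
        and T = UNIV and h = f and s' = S]]) (use assms in auto)
  then show ?thesis
    by (rule has_sum_SigmaD) (auto intro: has_sum_finiteI)
qed

definition row :: "(int \<Rightarrow> int \<Rightarrow> complex) \<Rightarrow> complex \<Rightarrow> int \<Rightarrow> complex" where
  "row h z x = (\<Sum>\<^sub>\<infinity>y. lterm h z x y)"

lemma summable_on_row:
  assumes h: "per24 h"
  shows "lterm h z x summable_on UNIV"
proof -
  obtain C where C: "C \<ge> 0" "\<And>x y. norm (h x y) \<le> C" using per24_bounded[OF h] by blast
  show ?thesis
  proof (rule abs_summable_summable, rule summable_on_comparison_test)
    show "(\<lambda>y. C * norm (1 / (of_int x * z + of_int y)\<^sup>2)) summable_on UNIV"
      by (intro summable_on_cmult_right abs_summable_inverse_square_int)
    show "norm (lterm h z x y) \<le> C * norm (1 / (of_int x * z + of_int y)\<^sup>2)" for y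
      using C(2)[of x y] by (simp add: lterm_def norm_divide divide_right_mono)
  qed auto
qed

lemma summable_on_col:
  assumes h: "per24 h" and z: "Im z > 0"
  shows "(\<lambda>x. lterm h z x y) summable_on UNIV"
proof -
  have z0: "z \<noteq> 0" using z by auto
  obtain C where C: "C \<ge> 0" "\<And>x y. norm (h x y) \<le> C" using per24_bounded[OF h] by blast
  show ?thesis
  proof (rule abs_summable_summable, rule summable_on_comparison_test)
    show "(\<lambda>x. C / norm z ^ 2 * norm (1 / (of_int y / z + of_int x)\<^sup>2)) summable_on UNIV"
      by (intro summable_on_cmult_right abs_summable_inverse_square_int)
    show "norm (lterm h z x y) \<le> C / norm z ^ 2 * norm (1 / (of_int y / z + of_int x)\<^sup>2)" for x
    proof -
      have e: "of_int x * z + of_int y = z * (of_int y / z + of_int x)" using z0 by (simp add: field_simps)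
      have "norm (lterm h z x y) = norm (h x y) / (norm z ^ 2 * norm (of_int y / z + of_int x) ^ 2)"
        unfolding lterm_def e by (simp only: norm_divide norm_power norm_mult power_mult_distrib)
      also have "\<dots> \<le> C / (norm z ^ 2 * norm (of_int y / z + of_int x) ^ 2)"
        by (intro divide_right_mono C) auto
      finally show ?thesis by (simp add: norm_divide norm_power)
    qed
  qed auto
qed

lemma Eis_rows:
  assumes h: "per24 h" and z: "Im z > 0"
  shows "((\<lambda>i. \<Sum>r\<in>{0..<24}. row h z (24 * i + r)) has_sum Eis h z) UNIV"
proof -
  have "(block h z has_sum Eis h z) (UNIV \<times> UNIV)"
    unfolding Eis_def using abs_summable_summable[OF block_abs_summable[OF h z]] by simp
  then show ?thesis
  proof (rule has_sum_SigmaD)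
    fix i :: int
    have "((\<lambda>j. \<Sum>s\<in>{0..<24}. lterm h z (24 * i + r) (24 * j + s)) has_sum row h z (24 * i + r)) UNIV" for r
      unfolding row_def by (intro has_sum_int_blocks has_sum_infsum summable_on_row h)
    then have "((\<lambda>j. \<Sum>r\<in>{0..<24}. \<Sum>s\<in>{0..<24}. lterm h z (24 * i + r) (24 * j + s)) has_sum
        (\<Sum>r\<in>{0..<24}. row h z (24 * i + r))) UNIV"
      by (intro has_sum_sum) auto
    then show "((\<lambda>j. block h z (i, j)) has_sum (\<Sum>r\<in>{0..<24}. row h z (24 * i + r))) UNIV"
      by (simp add: block_def)
  qed
qed

lemma Eis_cols:
  assumes h: "per24 h" and z: "Im z > 0"
  shows "((\<lambda>j. \<Sum>s\<in>{0..<24}. \<Sum>\<^sub>\<infinity>x. lterm h z x (24 * j + s)) has_sum Eis h z) UNIV"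
proof -
  have "(block h z has_sum Eis h z) (UNIV \<times> UNIV)"
    unfolding Eis_def using abs_summable_summable[OF block_abs_summable[OF h z]] by simp
  then have "((\<lambda>(j, i). block h z (i, j)) has_sum Eis h z) (UNIV \<times> UNIV)"
    by (subst has_sum_reindex_bij_witness[where i = prod.swap and j = prod.swap
        and T = "UNIV \<times> UNIV" and h = "block h z" and s' = "Eis h z"]) auto
  then show ?thesis
  proof (rule has_sum_SigmaD)
    fix j :: int
    have "((\<lambda>i. \<Sum>r\<in>{0..<24}. lterm h z (24 * i + r) (24 * j + s)) has_sum (\<Sum>\<^sub>\<infinity>x. lterm h z x (24 * j + s))) UNIV" for s
      by (rule has_sum_int_blocks[of "\<lambda>x. lterm h z x (24 * j + s)"]) (intro has_sum_infsum summable_on_col h z)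
    then have "((\<lambda>i. \<Sum>s\<in>{0..<24}. \<Sum>r\<in>{0..<24}. lterm h z (24 * i + r) (24 * j + s)) has_sum
        (\<Sum>s\<in>{0..<24}. \<Sum>\<^sub>\<infinity>x. lterm h z x (24 * j + s))) UNIV"
      by (intro has_sum_sum) auto
    then show "((\<lambda>i. case (j, i) of (j, i) \<Rightarrow> block h z (i, j)) has_sum (\<Sum>s\<in>{0..<24}. \<Sum>\<^sub>\<infinity>x. lterm h z x (24 * j + s))) UNIV"
      unfolding block_def prod.case by (subst (1) sum.swap) simp
  qed
qed

text \<open>The substitution \<open>z \<mapsto> - 1 / z\<close> exchanges rows and columns, and by
  absolute convergence of the blocks both orders of summation give the same value. This step fails
  for the full weight two series, whose quasi-modular defect is caused by the conditional
  convergence.\<close>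

lemma Eis_S:
  assumes h: "per24 h" and z: "Im z > 0"
  shows "Eis h (- 1 / z) = z\<^sup>2 * Eis (\<lambda>x y. h (- y) x) z"
proof -
  have z0: "z \<noteq> 0" using z by auto
  have z': "Im (- 1 / z) > 0" using z z0 by (simp add: Im_divide cmod_power2[symmetric])
  have lt: "lterm h (- 1 / z) (- x) y = z\<^sup>2 * lterm (\<lambda>x y. h (- y) x) z y x" for x y
  proof -
    have "(of_int (- x) * (- 1 / z) + of_int y) = (of_int y * z + of_int x) / z" using z0 by (simp add: field_simps)
    then show ?thesis unfolding lterm_def using z0 by (simp add: power_divide)
  qed
  have col: "(\<Sum>\<^sub>\<infinity>x. lterm h (- 1 / z) x y) = z\<^sup>2 * row (\<lambda>x y. h (- y) x) z y" for y
  proof -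
    have "(\<Sum>\<^sub>\<infinity>x. lterm h (- 1 / z) x y) = (\<Sum>\<^sub>\<infinity>x. lterm h (- 1 / z) (- x) y)"
      by (rule infsum_reindex_bij_witness[of _ uminus uminus]) auto
    then show ?thesis unfolding lt row_def by (simp add: infsum_cmult_right')
  qed
  have "((\<lambda>j. \<Sum>s\<in>{0..<24}. z\<^sup>2 * row (\<lambda>x y. h (- y) x) z (24 * j + s)) has_sum Eis h (- 1 / z)) UNIV"
    using Eis_cols[OF h z'] unfolding col .
  moreover have "((\<lambda>j. \<Sum>s\<in>{0..<24}. z\<^sup>2 * row (\<lambda>x y. h (- y) x) z (24 * j + s)) has_sum z\<^sup>2 * Eis (\<lambda>x y. h (- y) x) z) UNIV"
    unfolding sum_distrib_left[symmetric] by (intro has_sum_cmult_right Eis_rows per24_S h z)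
  ultimately show ?thesis by (rule has_sum_unique)
qed

lemma Eis_T:
  assumes h: "per24 h" and z: "Im z > 0"
  shows "Eis h (z + of_int k) = Eis (\<lambda>x y. h x (y - k * x)) z"
proof -
  have h': "per24 (\<lambda>x y. h x (y - k * x))" using per24_T[OF h, of "- k"] by simp
  have row: "row h (z + of_int k) x = row (\<lambda>x y. h x (y - k * x)) z x" for x
    unfolding row_def lterm_def
    by (rule infsum_reindex_bij_witness[of _ "\<lambda>y. y - k * x" "\<lambda>y. y + k * x"]) (auto simp: algebra_simps)
  have "Im (z + of_int k) > 0" using z by simp
  from has_sum_unique[OF Eis_rows[OF h this]] Eis_rows[OF h' z] show ?thesis unfolding row by blast
qed

text \<open>The inverse matrix acts on the index pairs, hence on the coefficient function.\<close>

lemma Eis_mob: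
  assumes "a * d - b * c = 1" "per24 h" "Im z > 0"
  shows "per24 (\<lambda>x y. h (d * x - c * y) (a * y - b * x)) \<and>
    Eis h (mob a b c d z) = (of_int c * z + of_int d)\<^sup>2 * Eis (\<lambda>x y. h (d * x - c * y) (a * y - b * x)) z"
  using assms
proof (induction a b c d arbitrary: h rule: SL2_induct)
  case one
  then show ?case by (simp add: mob_def)
next
  case (T a b c d)
  let ?h = "\<lambda>x y. h x (y - x)"
  have h: "per24 ?h" using per24_T[OF T.prems(1), of "-1"] by simp
  have nz: "of_int c * z + of_int d \<noteq> 0" by (rule mob_denom_nz[OF T.hyps T.prems(2)])
  have "mob (a + c) (b + d) c d z = mob a b c d z + of_int 1"
    using nz by (simp add: mob_def field_simps)
  then have "Eis h (mob (a + c) (b + d) c d z) = Eis ?h (mob a b c d z)"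
    using Eis_T[OF T.prems(1) Im_mob_pos[OF T.hyps T.prems(2)], of 1] by simp
  then show ?case using T.IH[OF h T.prems(2)] by (simp add: algebra_simps)
next
  case (T' a b c d)
  let ?h = "\<lambda>x y. h x (y + x)"
  have h: "per24 ?h" using per24_T[OF T'.prems(1), of "1"] by simp
  have nz: "of_int c * z + of_int d \<noteq> 0" by (rule mob_denom_nz[OF T'.hyps T'.prems(2)])
  have "mob (a - c) (b - d) c d z = mob a b c d z + of_int (-1)"
    using nz by (simp add: mob_def field_simps)
  then have "Eis h (mob (a - c) (b - d) c d z) = Eis ?h (mob a b c d z)"
    using Eis_T[OF T'.prems(1) Im_mob_pos[OF T'.hyps T'.prems(2)], of "-1"] by simp
  then show ?case using T'.IH[OF h T'.prems(2)] by (simp add: algebra_simps)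
next
  case (S a b c d)
  let ?h = "\<lambda>x y. h (- y) x" and ?w = "mob a b c d z"
  have h: "per24 ?h" by (rule per24_S[OF S.prems(1)])
  have nz: "of_int c * z + of_int d \<noteq> 0" by (rule mob_denom_nz[OF S.hyps S.prems(2)])
  have w: "Im ?w > 0" by (rule Im_mob_pos[OF S.hyps S.prems(2)])
  then have "?w \<noteq> 0" by auto
  then have "mob (- c) (- d) a b z = - 1 / ?w"
    using nz by (auto simp: mob_def field_simps)
  then have "Eis h (mob (- c) (- d) a b z) = ?w\<^sup>2 * Eis ?h ?w"
    using Eis_S[OF S.prems(1) w] by simp
  also have "\<dots> = ?w\<^sup>2 * (of_int c * z + of_int d)\<^sup>2 * Eis (\<lambda>x y. ?h (d * x - c * y) (a * y - b * x)) z"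
    using S.IH[OF h S.prems(2)] by simp
  also have "?w\<^sup>2 * (of_int c * z + of_int d)\<^sup>2 = (of_int a * z + of_int b)\<^sup>2"
    using nz by (simp add: mob_def power_divide)
  finally show ?case using S.IH[OF h S.prems(2)] by (simp add: algebra_simps)
qed

section \<open>Eisenstein series near the cusps\<close>

lemma has_sum_int_blocks_general:
  fixes f :: "int \<Rightarrow> 'a :: {topological_comm_monoid_add,t3_space}"
  assumes "(f has_sum S) UNIV" "M > 0"
  shows "((\<lambda>j. \<Sum>s\<in>{0..<M}. f (M * j + s)) has_sum S) UNIV"
proof -
  have "((\<lambda>(j, s). f (M * j + s)) has_sum S) (UNIV \<times> {0..<M})"
    by (rule iffD2[OF has_sum_reindex_bij_witness[where i = "\<lambda>x. (x div M, x mod M)" and j = "\<lambda>(j, s). M * j + s"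
        and T = UNIV and h = f and s' = S]]) (use assms in auto)
  then show ?thesis
    by (rule has_sum_SigmaD) (auto intro: has_sum_finiteI)
qed

lemma infsum_inverse_square_neg:
  fixes w :: complex
  shows "(\<Sum>\<^sub>\<infinity>k::int. 1 / (- w + of_int k)\<^sup>2) = (\<Sum>\<^sub>\<infinity>k::int. 1 / (w + of_int k)\<^sup>2)"
proof (rule infsum_reindex_bij_witness[of _ uminus uminus])
  fix k :: int
  have "w + of_int (- k) = - (- w + of_int k)" by simp
  then show "1 / (w + of_int (- k))\<^sup>2 = 1 / (- w + of_int k)\<^sup>2" by (metis power2_minus)
qed auto

text \<open>A row splits into residue classes modulo \<open>M\<close>, each of which is a sum to
  which Lipschitz's formula applies.\<close>

lemma row_eq_lipschitz:
  assumes per: "\<And>y. h x (y + M) = h x y" and M: "M > 0" and s: "lterm h z x summable_on UNIV"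
  shows "row h z x = (\<Sum>s\<in>{0..<M}. h x s / of_int M ^ 2 * (\<Sum>\<^sub>\<infinity>k::int. 1 / ((of_int x * z + of_int s) / of_int M + of_int k)\<^sup>2))"
proof -
  have nx: "h x (y + M * int n) = h x y" for n y
  proof (induction n)
    case (Suc n)
    then show ?case using per[of "y + M * int n"] by (simp add: algebra_simps)
  qed auto
  have px: "h x (M * j + y) = h x y" for y j
    using nx[of y "nat j"] nx[of "y + M * j" "nat (-j)"] by (cases "j \<ge> 0") (auto simp: add_ac)
  have M0: "(of_int M :: complex) \<noteq> 0" using M by simp
  have lt: "lterm h z x (M * j + s) = h x s / of_int M ^ 2 * (1 / ((of_int x * z + of_int s) / of_int M + of_int j)\<^sup>2)" for j s
  proof -
    have "of_int x * z + of_int (M * j + s) = of_int M * ((of_int x * z + of_int s) / of_int M + of_int j)"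
      using M0 by (simp add: field_simps)
    then show ?thesis by (simp only: lterm_def px power_mult_distrib) simp
  qed
  have "(lterm h z x has_sum row h z x) UNIV" unfolding row_def using s by simp
  from has_sum_int_blocks_general[OF this M]
  have "((\<lambda>j. \<Sum>s\<in>{0..<M}. h x s / of_int M ^ 2 * (1 / ((of_int x * z + of_int s) / of_int M + of_int j)\<^sup>2)) has_sum row h z x) UNIV"
    unfolding lt .
  moreover have "((\<lambda>j. \<Sum>s\<in>{0..<M}. h x s / of_int M ^ 2 * (1 / ((of_int x * z + of_int s) / of_int M + of_int j)\<^sup>2)) has_sum
     (\<Sum>s\<in>{0..<M}. h x s / of_int M ^ 2 * (\<Sum>\<^sub>\<infinity>k::int. 1 / ((of_int x * z + of_int s) / of_int M + of_int k)\<^sup>2))) UNIV"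
    by (intro has_sum_sum has_sum_cmult_right has_sum_infsum abs_summable_summable[OF abs_summable_inverse_square_int]) auto
  ultimately show ?thesis by (rule has_sum_unique)
qed

lemma summable_on_int_geometric:
  fixes r :: real
  assumes "0 \<le> r" "r < 1"
  shows "(\<lambda>x::int. r ^ nat \<bar>x\<bar>) summable_on UNIV"
proof (rule summable_on_int_split)
  show "(\<lambda>k. r ^ nat \<bar>int k\<bar>) summable_on UNIV"
    using assms by (intro norm_summable_imp_summable_on) (simp add: summable_geometric)
  have "nat \<bar>- int k - 1\<bar> = Suc k" for k by simp
  then show "(\<lambda>k. r ^ nat \<bar>- int k - 1\<bar>) summable_on UNIV"
    using assms by (intro norm_summable_imp_summable_on) (simp add: summable_geometric summable_mult norm_mult)
qed

text \<open>The rows decay exponentially, so that only the row \<open>x = 0\<close> survives at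
  \<open>\<i> * \<infinity>\<close>.\<close>

lemma row_bound:
  assumes h: "per24 h" and y0: "y0 > 0"
  obtains C where "C \<ge> 0" "\<And>z x. x \<noteq> 0 \<Longrightarrow> Im z \<ge> y0 \<Longrightarrow> norm (row h z x) \<le> C * exp (- (pi * Im z / 12)) ^ nat \<bar>x\<bar>"
proof -
  obtain C where C: "C \<ge> 0" "\<And>x y. norm (h x y) \<le> C" using per24_bounded[OF h] by blast
  obtain L where L: "\<And>w. Im w \<ge> y0 / 24 \<Longrightarrow> norm (\<Sum>\<^sub>\<infinity>k::int. 1 / (w + of_int k)\<^sup>2) \<le> L * exp (- (2 * pi * Im w))"
    using lipschitz_bound[of "y0 / 24"] y0 by auto
  have L0: "L \<ge> 0"
  proof -
    have "0 \<le> L * exp (- (2 * pi * Im (\<i> * of_real (y0 / 24))))"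
      by (rule order_trans[OF norm_ge_zero L]) simp
    then show ?thesis by (simp add: zero_le_mult_iff)
  qed
  show ?thesis
  proof (rule that[of "24 * (C / 576 * L)"])
    fix z x assume x: "x \<noteq> (0::int)" and z: "Im z \<ge> y0"
    have one: "norm (\<Sum>\<^sub>\<infinity>k::int. 1 / ((of_int x * z + of_int s) / 24 + of_int k)\<^sup>2) \<le> L * exp (- (pi * Im z / 12)) ^ nat \<bar>x\<bar>" for s :: int
    proof -
      define w where "w = (of_int x * z + of_int s) / 24"
      define w' where "w' = (if x > 0 then w else - w)"
      have im: "Im w' = of_int \<bar>x\<bar> * Im z / 24" by (auto simp: w'_def w_def abs_if)
      have "1 * y0 \<le> of_int \<bar>x\<bar> * Im z" using x z y0 by (intro mult_mono) auto
      then have "Im w' \<ge> y0 / 24" using im by simp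
      then have "norm (\<Sum>\<^sub>\<infinity>k::int. 1 / (w' + of_int k)\<^sup>2) \<le> L * exp (- (2 * pi * Im w'))" by (rule L)
      moreover have "(\<Sum>\<^sub>\<infinity>k::int. 1 / (w' + of_int k)\<^sup>2) = (\<Sum>\<^sub>\<infinity>k::int. 1 / (w + of_int k)\<^sup>2)"
        by (simp only: w'_def infsum_inverse_square_neg split: if_split) simp
      moreover have "exp (- (2 * pi * Im w')) = exp (- (pi * Im z / 12)) ^ nat \<bar>x\<bar>"
        unfolding im by (simp add: exp_of_nat_mult[symmetric])
      ultimately show ?thesis unfolding w_def by simp
    qed
    have "norm (row h z x) \<le> (\<Sum>s\<in>{0..<24::int}. C / 576 * (L * exp (- (pi * Im z / 12)) ^ nat \<bar>x\<bar>))"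
    proof -
      have "h x (y + 24) = h x y" for y using h by (simp add: per24_def)
      from row_eq_lipschitz[of h x 24 z, OF this _ summable_on_row[OF h]]
      have "row h z x = (\<Sum>s\<in>{0..<24}. h x s / 24\<^sup>2 * (\<Sum>\<^sub>\<infinity>k::int. 1 / ((of_int x * z + of_int s) / 24 + of_int k)\<^sup>2))"
        by simp
      also have "norm \<dots> \<le> (\<Sum>s\<in>{0..<24::int}. C / 576 * (L * exp (- (pi * Im z / 12)) ^ nat \<bar>x\<bar>))"
        unfolding norm_mult by (intro sum_norm_le) (auto simp: norm_mult norm_divide intro!: mult_mono one C divide_right_mono)
      finally show ?thesis .
    qed
    then show "norm (row h z x) \<le> 24 * (C / 576 * L) * exp (- (pi * Im z / 12)) ^ nat \<bar>x\<bar>"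
      by simp
  qed (use C L0 in simp)
qed

lemma has_sum_rows:
  assumes h: "per24 h" and z: "Im z > 0"
  shows "(row h z has_sum Eis h z) UNIV"
proof -
  obtain C where C: "C \<ge> 0" "\<And>z' x. x \<noteq> 0 \<Longrightarrow> Im z' \<ge> Im z \<Longrightarrow> norm (row h z' x) \<le> C * exp (- (pi * Im z' / 12)) ^ nat \<bar>x\<bar>"
    using row_bound[OF h z] by blast
  have "row h z summable_on UNIV"
  proof (rule abs_summable_summable, rule summable_on_comparison_test)
    show "(\<lambda>x. (C + norm (row h z 0)) * exp (- (pi * Im z / 12)) ^ nat \<bar>x\<bar>) summable_on UNIV"
      by (intro summable_on_cmult_right summable_on_int_geometric) (use z in auto)
    show "norm (row h z x) \<le> (C + norm (row h z 0)) * exp (- (pi * Im z / 12)) ^ nat \<bar>x\<bar>" for x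
      using C(2)[of x z] C(1) by (cases "x = 0") (auto intro: order_trans simp: distrib_right)
  qed auto
  then have "(row h z has_sum infsum (row h z) UNIV) UNIV" by simp
  from has_sum_unique[OF Eis_rows[OF h z] has_sum_int_blocks[OF this]] this show ?thesis by simp
qed

lemma Eis_bounded:
  assumes h: "per24 h"
  shows "\<exists>B. \<forall>z. Im z > 1 \<longrightarrow> norm (Eis h z) \<le> B"
proof -
  obtain C where C: "C \<ge> 0" "\<And>z x. x \<noteq> 0 \<Longrightarrow> Im z \<ge> 1 \<Longrightarrow> norm (row h z x) \<le> C * exp (- (pi * Im z / 12)) ^ nat \<bar>x\<bar>"
    using row_bound[OF h, of 1] by auto
  define D where "D = C + norm (row h 0 0)"
  define T where "T = (\<Sum>\<^sub>\<infinity>x::int. D * exp (- (pi / 12)) ^ nat \<bar>x\<bar>)"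
  have T: "((\<lambda>x::int. D * exp (- (pi / 12)) ^ nat \<bar>x\<bar>) has_sum T) UNIV"
    unfolding T_def by (intro has_sum_infsum summable_on_cmult_right summable_on_int_geometric) auto
  have "norm (Eis h z) \<le> T" if z: "Im z > 1" for z
  proof (rule norm_infsum_le[OF has_sum_rows[OF h] T])
    fix x :: int
    show "norm (row h z x) \<le> D * exp (- (pi / 12)) ^ nat \<bar>x\<bar>"
    proof (cases "x = 0")
      case True
      have "row h z 0 = row h 0 0" by (simp add: row_def lterm_def)
      then show ?thesis using True C by (simp add: D_def)
    next
      case False
      have "norm (row h z x) \<le> C * exp (- (pi * Im z / 12)) ^ nat \<bar>x\<bar>" using C(2) False z by simp
      also have "\<dots> \<le> D * exp (- (pi / 12)) ^ nat \<bar>x\<bar>"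
        using z C by (intro mult_mono power_mono) (auto simp: D_def)
      finally show ?thesis .
    qed
  qed (use z in auto)
  then show ?thesis by blast
qed

section \<open>Fourier expansion of the Eisenstein series of two characters\<close>

text \<open>The coefficient function whose series has the divisor sums \<open>sigma \<xi>
  \<psi>\<close> as Fourier coefficients: \<open>\<psi>\<close> lives on the multiples of the
  period \<open>M\<close> of \<open>\<xi>\<close>.\<close>

definition twist :: "int \<Rightarrow> (int \<Rightarrow> complex) \<Rightarrow> (int \<Rightarrow> complex) \<Rightarrow> int \<Rightarrow> int \<Rightarrow> complex" where
  "twist M \<xi> \<psi> x y = (if M dvd x then \<psi> (x div M) * \<xi> y else 0)"

lemma has_sum_Suc_shift:
  fixes f :: "nat \<Rightarrow> 'a :: topological_comm_monoid_add"
  shows "((\<lambda>n. f (Suc n)) has_sum S) UNIV \<longleftrightarrow> (f has_sum S) {1..}"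
proof -
  have "{1..} = range Suc" by (auto simp: image_iff Suc_le_eq gr0_conv_Suc)
  then show ?thesis by (simp add: has_sum_reindex o_def)
qed

lemma has_sum_geometric_deriv:
  fixes x :: complex
  assumes "norm x < 1"
  shows "((\<lambda>m. of_nat m * x ^ m) has_sum (x / (1 - x)\<^sup>2)) {1..}"
proof -
  have s: "(\<lambda>n. x * (of_nat (Suc n) * x ^ n)) sums (x * (1 / (1 - x)\<^sup>2))"
    by (intro sums_mult geometric_deriv_sums assms)
  have "summable (\<lambda>n. norm x * (of_nat (Suc n) * norm x ^ n))"
    using sums_mult[OF geometric_deriv_sums[of "norm x"], of "norm x"] assms by (simp add: sums_iff)
  then have "summable (\<lambda>n. norm (x * (of_nat (Suc n) * x ^ n)))"
    by (simp add: norm_mult norm_power del: of_nat_Suc)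
  from norm_summable_imp_has_sum[OF this s]
  have "((\<lambda>n. of_nat (Suc n) * x ^ Suc n) has_sum (x / (1 - x)\<^sup>2)) UNIV"
    by (simp add: mult_ac del: of_nat_Suc)
  then show ?thesis unfolding has_sum_Suc_shift[of "\<lambda>m. of_nat m * x ^ m"] .
qed

text \<open>Absolute convergence of the double series justifies its regrouping by the product of
  the indices.\<close>

lemma lambert_abs_summable:
  fixes q :: complex
  assumes q: "norm q < 1" and a: "\<And>l m. norm (a l m) \<le> 1"
  shows "(\<lambda>(l, m). norm (a l m * (of_nat m * q ^ (l * m)))) summable_on ({1..} \<times> {1::nat..})"
proof (rule summable_on_comparison_test)
  define r where "r = norm q"
  have r: "0 \<le> r" "r < 1" using q by (auto simp: r_def)
  have r1: "r ^ l < 1" if "l \<ge> 1" for l using that r by (simp add: power_Suc_less_one power_less_one_iff)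
  have geo: "((\<lambda>m. of_nat m * x ^ m) has_sum (x / (1 - x)\<^sup>2)) {1..}" if "0 \<le> x" "x < 1" for x :: real
  proof -
    have "((\<lambda>m. complex_of_real (of_nat m * x ^ m)) has_sum complex_of_real (x / (1 - x)\<^sup>2)) {1..}"
      using has_sum_geometric_deriv[of "of_real x"] that by simp
    then show ?thesis by (simp only: has_sum_of_real_iff)
  qed
  show "(\<lambda>(l, m). real m * r ^ (l * m)) summable_on ({1..} \<times> {1..})"
  proof (rule summable_on_SigmaI)
    fix l :: nat assume l: "l \<in> {1..}"
    have "((\<lambda>m. of_nat m * (r ^ l) ^ m) has_sum (r ^ l / (1 - r ^ l)\<^sup>2)) {1..}"
      by (rule geo) (use l r r1 in auto)
    then show "((\<lambda>m. case (l, m) of (l, m) \<Rightarrow> real m * r ^ (l * m)) has_sum (r ^ l / (1 - r ^ l)\<^sup>2)) {1..}"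
      by (simp add: power_mult)
  next
    show "(\<lambda>l. r ^ l / (1 - r ^ l)\<^sup>2) summable_on {1..}"
    proof (rule summable_on_comparison_test)
      show "(\<lambda>l. r ^ l / (1 - r)\<^sup>2) summable_on {1..}"
        using r unfolding divide_inverse by (intro summable_on_cmult_left) (auto intro!: summable_on_subset_banach[of _ UNIV] norm_summable_imp_summable_on simp: summable_geometric)
      fix l :: nat assume l: "l \<in> {1..}"
      have "r ^ l \<le> r ^ 1" using r l by (intro power_decreasing) auto
      then have "(1 - r)\<^sup>2 \<le> (1 - r ^ l)\<^sup>2" using r by (intro power_mono) auto
      then show "r ^ l / (1 - r ^ l)\<^sup>2 \<le> r ^ l / (1 - r)\<^sup>2"
        using r r1[of l] l by (intro divide_left_mono mult_pos_pos zero_less_power) auto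
    qed (use r in auto)
  qed (use r in auto)
  show "(case p of (l, m) \<Rightarrow> norm (a l m * (of_nat m * q ^ (l * m)))) \<le> (case p of (l, m) \<Rightarrow> real m * r ^ (l * m))" for p
    using a mult_right_mono[OF a, of "real m * r ^ (l * m)" for l m] r
    by (cases p) (auto simp: norm_mult norm_power r_def)
qed auto

lemma lambert_regroup:
  fixes q :: complex
  assumes S: "((\<lambda>(l, m). \<psi> (int l) * \<xi> (int m) * (of_nat m * q ^ (l * m))) has_sum S) ({1..} \<times> {1::nat..})"
  shows "((\<lambda>n. sigma \<xi> \<psi> n * q ^ n) has_sum S) {1..}"
proof -
  have "((\<lambda>(n, m). \<psi> (int (n div m)) * \<xi> (int m) * (of_nat m * q ^ n)) has_sum S) (Sigma {1..} (\<lambda>n. {m. 1 \<le> m \<and> m dvd n}))"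
    by (rule iffD2[OF has_sum_reindex_bij_witness[where i = "\<lambda>(l, m). (l * m, m)" and j = "\<lambda>(n, m). (n div m, m)"
        and T = "{1..} \<times> {1..}" and h = "\<lambda>(l, m). \<psi> (int l) * \<xi> (int m) * (of_nat m * q ^ (l * m))" and s' = S]])
       (use S in \<open>auto simp: Suc_le_eq div_greater_zero_iff dvd_imp_le\<close>)
  then show ?thesis
  proof (rule has_sum_SigmaD)
    fix n :: nat assume n: "n \<in> {1..}"
    have "finite {m. 1 \<le> m \<and> m dvd n}" using n by (intro finite_subset[OF _ finite_atMost[of n]]) (auto dest: dvd_imp_le)
    then show "((\<lambda>m. case (n, m) of (n, m) \<Rightarrow> \<psi> (int (n div m)) * \<xi> (int m) * (of_nat m * q ^ n)) has_sum sigma \<xi> \<psi> n * q ^ n) {m. 1 \<le> m \<and> m dvd n}"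
      by (intro has_sum_finiteI) (auto simp: sigma_def sum_distrib_left mult_ac)
  qed
qed

lemma row_minus:
  assumes "\<And>y. h (- x) (- y) = h x y"
  shows "row h z (- x) = row h z x"
  unfolding row_def
proof (rule infsum_reindex_bij_witness[of _ uminus uminus])
  fix y :: int
  have "of_int x * z + of_int (- y) = - (of_int (- x) * z + of_int y)" by simp
  then have "(of_int x * z + of_int (- y))\<^sup>2 = (of_int (- x) * z + of_int y)\<^sup>2" by (metis power2_minus)
  then show "lterm h z x (- y) = lterm h z (- x) y"
    using assms[of "-y"] by (simp add: lterm_def)
qed auto

lemma row_twist:
  assumes M: "M > 0" and per: "\<And>y. \<xi> (y + M) = \<xi> y"
    and gauss: "\<And>m :: nat. (\<Sum>s\<in>{0..<M}. \<xi> s * exp (2 * of_real pi * \<i> * (of_nat m * of_int s / of_int M))) = g * \<xi> (int m)"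
    and h: "per24 (twist M \<xi> \<psi>)" and z: "Im z > 0" and l: "l \<ge> 1"
  shows "((\<lambda>m. - 4 * of_real pi ^ 2 * g / of_int M ^ 2 * (\<psi> (int l) * \<xi> (int m) * (of_nat m * qq z ^ (l * m)))) has_sum
     row (twist M \<xi> \<psi>) z (M * int l)) {1..}"
proof -
  define Q where "Q = (\<lambda>s::int. qq (of_nat l * z + of_int s / of_int M))"
  have M0: "(of_int M :: complex) \<noteq> 0" using M by simp
  have tw: "twist M \<xi> \<psi> (M * int l) y = \<psi> (int l) * \<xi> y" for y using M by (simp add: twist_def)
  have Qn: "norm (Q s) < 1" for s using z l M by (simp add: Q_def qq_def)
  have Qm: "Q s ^ m = qq z ^ (l * m) * exp (2 * of_real pi * \<i> * (of_nat m * of_int s / of_int M))" for s m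
    unfolding Q_def qq_def exp_of_nat_mult[symmetric] exp_add[symmetric] by (rule arg_cong[of _ _ exp]) (simp add: algebra_simps)
  have lip: "(\<Sum>\<^sub>\<infinity>k::int. 1 / ((of_int (M * int l) * z + of_int s) / of_int M + of_int k)\<^sup>2) = - 4 * of_real pi ^ 2 * (Q s / (1 - Q s)\<^sup>2)" for s
  proof -
    have e: "(of_int (M * int l) * z + of_int s) / of_int M = of_nat l * z + of_int s / of_int M"
      using M0 by (simp add: field_simps)
    have im: "Im (of_nat l * z + of_int s / of_int M) > 0" using z l by simp
    show ?thesis unfolding e
      using has_sum_inverse_square_int[OF not_Ints_if_Im_pos[OF im]] csc_square_eq_exp[OF im]
      by (simp add: infsumI Q_def)
  qed
  have row: "row (twist M \<xi> \<psi>) z (M * int l) = (\<Sum>s\<in>{0..<M}. (\<psi> (int l) * \<xi> s / of_int M ^ 2 * (- 4 * of_real pi ^ 2)) * (Q s / (1 - Q s)\<^sup>2))"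
  proof -
    have "twist M \<xi> \<psi> (M * int l) (y + M) = twist M \<xi> \<psi> (M * int l) y" for y by (simp only: tw per)
    from row_eq_lipschitz[OF this M summable_on_row[OF h], of z] show ?thesis
      unfolding lip tw by (simp only: mult.assoc)
  qed
  have "((\<lambda>m. \<Sum>s\<in>{0..<M}. (\<psi> (int l) * \<xi> s / of_int M ^ 2 * (- 4 * of_real pi ^ 2)) * (of_nat m * Q s ^ m)) has_sum
      row (twist M \<xi> \<psi>) z (M * int l)) {1..}"
    unfolding row by (intro has_sum_sum has_sum_cmult_right has_sum_geometric_deriv Qn) auto
  moreover have "(\<Sum>s\<in>{0..<M}. (\<psi> (int l) * \<xi> s / of_int M ^ 2 * (- 4 * of_real pi ^ 2)) * (of_nat m * Q s ^ m)) =
     - 4 * of_real pi ^ 2 * g / of_int M ^ 2 * (\<psi> (int l) * \<xi> (int m) * (of_nat m * qq z ^ (l * m)))" for m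
  proof -
    have "(\<Sum>s\<in>{0..<M}. (\<psi> (int l) * \<xi> s / of_int M ^ 2 * (- 4 * of_real pi ^ 2)) * (of_nat m * Q s ^ m)) =
       - 4 * of_real pi ^ 2 / of_int M ^ 2 * \<psi> (int l) * of_nat m * qq z ^ (l * m) *
         (\<Sum>s\<in>{0..<M}. \<xi> s * exp (2 * of_real pi * \<i> * (of_nat m * of_int s / of_int M)))"
      unfolding Qm sum_distrib_left by (intro sum.cong) (auto simp: mult_ac)
    then show ?thesis unfolding gauss by (simp add: mult_ac)
  qed
  ultimately show ?thesis by simp
qed

text \<open>Lipschitz's formula produces the finite Fourier transform of \<open>\<xi>\<close>,
  which is \<open>g\<close> times \<open>\<xi>\<close>. The parity condition makes the rows
  \<open>x\<close> and \<open>- x\<close> equal, whence the factor 2.\<close>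

lemma Eis_twist_qexp:
  assumes M: "M > 0" and per: "\<And>y. \<xi> (y + M) = \<xi> y"
    and gauss: "\<And>m :: nat. (\<Sum>s\<in>{0..<M}. \<xi> s * exp (2 * of_real pi * \<i> * (of_nat m * of_int s / of_int M))) = g * \<xi> (int m)"
    and h: "per24 (twist M \<xi> \<psi>)" and z: "Im z > 0"
    and bd: "\<And>y. norm (\<xi> y) \<le> 1" "\<And>y. norm (\<psi> y) \<le> 1"
    and par: "\<And>x y. \<psi> (- x) * \<xi> (- y) = \<psi> x * \<xi> y"
  shows "Eis (twist M \<xi> \<psi>) z = row (twist M \<xi> \<psi>) z 0 +
     2 * (- 4 * of_real pi ^ 2 * g / of_int M ^ 2) * (\<Sum>n. sigma \<xi> \<psi> (Suc n) * qq z ^ Suc n)"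
    "summable (\<lambda>n. sigma \<xi> \<psi> (Suc n) * qq z ^ Suc n)"
proof -
  define K where "K = - 4 * of_real pi ^ 2 * g / of_int M ^ 2"
  let ?h = "twist M \<xi> \<psi>"
  have q: "norm (qq z) < 1" using z by (simp add: qq_def)
  have "(\<lambda>(l, m). \<psi> (int l) * \<xi> (int m) * (of_nat m * qq z ^ (l * m))) summable_on ({1..} \<times> {1::nat..})"
    by (rule abs_summable_summable)
       (use lambert_abs_summable[OF q, of "\<lambda>l m. \<psi> (int l) * \<xi> (int m)"] bd in
        \<open>simp add: norm_mult mult_le_one case_prod_unfold\<close>)
  then obtain S where S: "((\<lambda>(l, m). \<psi> (int l) * \<xi> (int m) * (of_nat m * qq z ^ (l * m))) has_sum S) ({1..} \<times> {1::nat..})"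
    by (auto simp: summable_on_def)
  have "((\<lambda>n. sigma \<xi> \<psi> (Suc n) * qq z ^ Suc n) has_sum S) UNIV"
    unfolding has_sum_Suc_shift[of "\<lambda>n. sigma \<xi> \<psi> n * qq z ^ n"] by (rule lambert_regroup[OF S])
  then have sums: "(\<lambda>n. sigma \<xi> \<psi> (Suc n) * qq z ^ Suc n) sums S" by (rule has_sum_imp_sums)
  then show "summable (\<lambda>n. sigma \<xi> \<psi> (Suc n) * qq z ^ Suc n)" by (rule sums_summable)
  have "((\<lambda>(l, m). K * (\<psi> (int l) * \<xi> (int m) * (of_nat m * qq z ^ (l * m)))) has_sum K * S) ({1..} \<times> {1::nat..})"
    using has_sum_cmult_right[OF S, of K] by (simp add: case_prod_unfold)
  then have "((\<lambda>l. row ?h z (M * int l)) has_sum K * S) {1..}"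
  proof (rule has_sum_SigmaD)
    fix l :: nat assume "l \<in> {1..}"
    then show "((\<lambda>m. case (l, m) of (l, m) \<Rightarrow> K * (\<psi> (int l) * \<xi> (int m) * (of_nat m * qq z ^ (l * m)))) has_sum row ?h z (M * int l)) {1..}"
      using row_twist[OF M per gauss h z, of l] by (simp add: K_def)
  qed
  then have pos: "((\<lambda>l. row ?h z (M * int (Suc l))) has_sum K * S) UNIV"
    unfolding has_sum_Suc_shift[of "\<lambda>l. row ?h z (M * int l)"] .
  have "((\<lambda>l. row ?h z (M * int l)) has_sum row ?h z 0 + K * S) UNIV"
  proof -
    have "((\<lambda>l. row ?h z (M * int l)) has_sum row ?h z 0) {0}" by (rule has_sum_finiteI) auto
    moreover have "((\<lambda>l. row ?h z (M * int l)) has_sum K * S) {1..}" by fact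
    ultimately have "((\<lambda>l. row ?h z (M * int l)) has_sum row ?h z 0 + K * S) ({0} \<union> {1..})"
      by (rule has_sum_Un_disjoint) auto
    moreover have "{0} \<union> {1::nat..} = UNIV" by auto
    ultimately show ?thesis by simp
  qed
  moreover have "((\<lambda>l. row ?h z (M * (- int l - 1))) has_sum K * S) UNIV"
  proof -
    have "row ?h z (M * (- int l - 1)) = row ?h z (M * int (Suc l))" for l
    proof -
      have "?h (- x) (- y) = ?h x y" for x y using par by (auto simp: twist_def dvd_neg_div)
      then have "row ?h z (- (M * int (Suc l))) = row ?h z (M * int (Suc l))" by (rule row_minus)
      moreover have "- (M * int (Suc l)) = M * (- int l - 1)" by (simp add: algebra_simps)
      ultimately show ?thesis by simp
    qed
    then show ?thesis using pos by simp
  qed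
  ultimately have 1: "((\<lambda>l. row ?h z (M * l)) has_sum (row ?h z 0 + K * S) + K * S) UNIV"
    by (rule has_sum_int_split)
  have "(row ?h z has_sum Eis ?h z) (range (\<lambda>l. M * l))"
  proof (rule iffD1[OF has_sum_cong_neutral has_sum_rows[OF h z]])
    fix x assume "x \<in> UNIV - range (\<lambda>l. M * l)"
    then have "\<not> M dvd x" by (auto elim!: dvdE)
    then show "row ?h z x = 0" by (simp add: row_def lterm_def twist_def)
  qed auto
  then have 2: "((\<lambda>l. row ?h z (M * l)) has_sum Eis ?h z) UNIV"
    using M by (subst (asm) has_sum_reindex) (auto simp: inj_on_def o_def)
  have "Eis ?h z = row ?h z 0 + 2 * K * S"
    using has_sum_unique[OF 1 2] by (simp add: algebra_simps)
  then show "Eis ?h z = row ?h z 0 + 2 * (- 4 * of_real pi ^ 2 * g / of_int M ^ 2) * (\<Sum>n. sigma \<xi> \<psi> (Suc n) * qq z ^ Suc n)"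
    using sums by (simp add: K_def sums_iff)
qed

section \<open>Kronecker symbols as periodic characters\<close>

lemma kronecker_1: "kronecker t 1 = 1" by (simp add: kronecker_def)

lemma kronecker_mult:
  assumes "m > 0" "n > 0"
  shows "kronecker t (m * n) = kronecker t m * kronecker t n"
proof -
  have pf: "(\<Prod>p\<in>prime_factors k. kronecker_prime t p ^ multiplicity p k) = (\<Prod>p\<in>A. kronecker_prime t p ^ multiplicity p k)"
    if "prime_factors k \<subseteq> A" "finite A" "\<And>p. p \<in> A \<Longrightarrow> prime p" "k > 0" for A :: "int set" and k
  proof (rule prod.mono_neutral_left)
    show "\<forall>p\<in>A - prime_factors k. kronecker_prime t p ^ multiplicity p k = 1"
    proof
      fix p assume p: "p \<in> A - prime_factors k"
      then have "\<not> p dvd k" using that by (auto simp: prime_factors_dvd)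
      then show "kronecker_prime t p ^ multiplicity p k = 1" by (simp add: not_dvd_imp_multiplicity_0)
    qed
  qed (use that in auto)
  define A where "A = prime_factors (m * n)"
  have A: "A = prime_factors m \<union> prime_factors n" "finite A" "\<And>p. p \<in> A \<Longrightarrow> prime p"
    using assms by (auto simp: A_def prime_factors_product)
  have "(\<Prod>p\<in>A. kronecker_prime t p ^ multiplicity p (m * n)) =
     (\<Prod>p\<in>A. kronecker_prime t p ^ multiplicity p m * kronecker_prime t p ^ multiplicity p n)"
  proof (rule prod.cong)
    fix p assume "p \<in> A"
    then have "prime_elem p" using A(3) prime_imp_prime_elem by blast
    then have "multiplicity p (m * n) = multiplicity p m + multiplicity p n"
      using assms by (intro prime_elem_multiplicity_mult_distrib) auto
    then show "kronecker_prime t p ^ multiplicity p (m * n) = kronecker_prime t p ^ multiplicity p m * kronecker_prime t p ^ multiplicity p n"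
      by (simp add: power_add)
  qed auto
  also have "\<dots> = (\<Prod>p\<in>A. kronecker_prime t p ^ multiplicity p m) * (\<Prod>p\<in>A. kronecker_prime t p ^ multiplicity p n)"
    by (rule prod.distrib)
  moreover have k: "kronecker t x = (\<Prod>p\<in>prime_factors x. kronecker_prime t p ^ multiplicity p x)" if "x > 0" for x
    using that by (simp add: kronecker_def)
  ultimately show ?thesis
    using pf[of m A] pf[of n A] A assms
    unfolding k[OF assms(1)] k[OF assms(2)] k[OF mult_pos_pos[OF assms]] A_def[symmetric] by simp
qed

lemma kronecker_prime_eq:
  assumes "prime p"
  shows "kronecker t p = kronecker_prime t p"
proof -
  have "p > 0" using assms prime_gt_0_int by blast
  then show ?thesis using assms by (simp add: kronecker_def prime_prime_factors multiplicity_self)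
qed

text \<open>A completely multiplicative function is determined by its values at primes; this
  reduces each table below to quadratic reciprocity.\<close>

lemma kronecker_eq_multiplicative:
  fixes f :: "int \<Rightarrow> int"
  assumes f1: "f 1 = 1" and fm: "\<And>m n. m > 0 \<Longrightarrow> n > 0 \<Longrightarrow> f (m * n) = f m * f n"
    and fp: "\<And>p. prime p \<Longrightarrow> p > 0 \<Longrightarrow> kronecker_prime t p = f p" and m: "m > 0"
  shows "kronecker t m = f m"
  using m
proof (induction "nat m" arbitrary: m rule: less_induct)
  case less
  show ?case
  proof (cases "m = 1")
    case False
    then obtain p where p: "prime p" "p dvd m" using less.prems by (metis abs_of_pos prime_factor_int)
    then obtain k where k: "m = p * k" by (auto elim: dvdE)
    have pp: "p > 1" using p by (simp add: prime_gt_1_int)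
    then have kp: "k > 0" using k less.prems by (auto simp: zero_less_mult_iff)
    have "nat k < nat m" using k kp pp by (auto simp: nat_less_iff)
    then have "kronecker t k = f k" using less.hyps kp by blast
    then show ?thesis using k kp pp kronecker_mult[of p k t] fm[of p k] kronecker_prime_eq[OF p(1), of t] fp[OF p(1)] by simp
  qed (simp add: f1 kronecker_1)
qed

subsection \<open>Legendre symbols\<close>

lemma Legendre_values: "Legendre a p \<in> {-1, 0, 1}"
  by (auto simp: Legendre_def)

text \<open>Congruent elements of \<open>{- 1, 0, 1}\<close> are equal modulo an odd prime; with
  Euler's criterion this gives the multiplicativity of the Legendre symbol.\<close>

lemma small_cong_eq:
  assumes "[x = y] (mod p)" "x \<in> {-1, 0, 1}" "y \<in> {-1, 0, 1::int}" "p > 2"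
  shows "x = y"
proof (rule ccontr)
  assume "x \<noteq> y"
  moreover have "p dvd x - y" using assms(1) by (simp add: cong_iff_dvd_diff)
  ultimately have "p \<le> \<bar>x - y\<bar>" by (intro zdvd_imp_le) auto
  then show False using assms by auto
qed

lemma Legendre_mult:
  assumes "prime p" "p > 2"
  shows "Legendre (a * b) p = Legendre a p * Legendre b p"
proof -
  define n where "n = nat p"
  have n: "prime n" "2 < n" "p = int n" using assms by (auto simp: n_def prime_int_iff')
  have e: "[Legendre x p = x ^ ((n - 1) div 2)] (mod p)" for x
    using euler_criterion[OF n(1,2)] by (simp add: n(3))
  have "[Legendre a p * Legendre b p = (a * b) ^ ((n - 1) div 2)] (mod p)"
    unfolding power_mult_distrib by (intro cong_mult e)
  then have "[Legendre (a * b) p = Legendre a p * Legendre b p] (mod p)"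
    using e[of "a * b"] cong_sym cong_trans by blast
  moreover have "Legendre a p * Legendre b p \<in> {-1, 0, 1}"
    using Legendre_values[of a p] Legendre_values[of b p] by auto
  ultimately show ?thesis using small_cong_eq Legendre_values assms(2) by blast
qed

lemma Legendre_cong:
  assumes "[a = b] (mod p)"
  shows "Legendre a p = Legendre b p"
proof -
  have "[a = 0] (mod p) \<longleftrightarrow> [b = 0] (mod p)" "QuadRes p a \<longleftrightarrow> QuadRes p b"
    using assms unfolding QuadRes_def by (meson cong_sym cong_trans)+
  then show ?thesis by (simp add: Legendre_def)
qed

definition chi3 :: "int \<Rightarrow> int" where
  "chi3 n = (if n mod 3 = 1 then 1 else if n mod 3 = 2 then - 1 else 0)"
definition chi4 :: "int \<Rightarrow> int" where
  "chi4 n = (if n mod 4 = 1 then 1 else if n mod 4 = 3 then - 1 else 0)"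
definition chi8 :: "int \<Rightarrow> int" where
  "chi8 n = (if n mod 8 \<in> {1, 7} then 1 else if n mod 8 \<in> {3, 5} then - 1 else 0)"

lemma mod_3_cases: "(n::int) mod 3 \<in> {0, 1, 2}" by auto
lemma mod_4_cases: "(n::int) mod 4 \<in> {0, 1, 2, 3}" by auto
lemma mod_8_cases: "(n::int) mod 8 \<in> {0, 1, 2, 3, 4, 5, 6, 7}" by auto

lemma chi3_mult: "chi3 (m * n) = chi3 m * chi3 n"
proof -
  have r: "chi3 k = chi3 (k mod 3)" for k by (simp add: chi3_def)
  have "chi3 (m * n) = chi3 ((m mod 3) * (n mod 3))"
    unfolding r[of "m * n"] r[of "(m mod 3) * (n mod 3)"] by (simp only: mod_mult_eq)
  moreover have "chi3 (a * b) = chi3 a * chi3 b" if "a = m mod 3" "b = n mod 3" for a b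
    using mod_3_cases[of m] mod_3_cases[of n] unfolding that[symmetric]
    by (elim insertE emptyE) (simp_all add: chi3_def)
  ultimately show ?thesis using r[of m] r[of n] by simp
qed

lemma chi4_mult: "chi4 (m * n) = chi4 m * chi4 n"
proof -
  have r: "chi4 k = chi4 (k mod 4)" for k by (simp add: chi4_def)
  have "chi4 (m * n) = chi4 ((m mod 4) * (n mod 4))"
    unfolding r[of "m * n"] r[of "(m mod 4) * (n mod 4)"] by (simp only: mod_mult_eq)
  moreover have "chi4 (a * b) = chi4 a * chi4 b" if "a = m mod 4" "b = n mod 4" for a b
    using mod_4_cases[of m] mod_4_cases[of n] unfolding that[symmetric]
    by (elim insertE emptyE) (simp_all add: chi4_def)
  ultimately show ?thesis using r[of m] r[of n] by simp
qed

lemma chi8_mult: "chi8 (m * n) = chi8 m * chi8 n"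
proof -
  have r: "chi8 k = chi8 (k mod 8)" for k by (simp add: chi8_def)
  have "chi8 (m * n) = chi8 ((m mod 8) * (n mod 8))"
    unfolding r[of "m * n"] r[of "(m mod 8) * (n mod 8)"] by (simp only: mod_mult_eq)
  moreover have "chi8 (a * b) = chi8 a * chi8 b" if "a = m mod 8" "b = n mod 8" for a b
    using mod_8_cases[of m] mod_8_cases[of n] unfolding that[symmetric]
    by (elim insertE emptyE) (simp_all add: chi8_def)
  ultimately show ?thesis using r[of m] r[of n] by simp
qed

lemma chi8_square: "odd n \<Longrightarrow> chi8 n * chi8 n = 1"
proof -
  assume "odd n"
  then have "odd (n mod 8)" by presburger
  then show ?thesis using mod_8_cases[of n] by (auto simp: chi8_def)
qed

lemma chi4_square: "odd n \<Longrightarrow> chi4 n * chi4 n = 1"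
proof -
  assume "odd n"
  then have "odd (n mod 4)" by presburger
  then show ?thesis using mod_4_cases[of n] by (auto simp: chi4_def)
qed

lemma odd_prime_int: "prime (p::int) \<Longrightarrow> p \<noteq> 2 \<Longrightarrow> odd p \<and> p > 2"
  using prime_odd_int prime_ge_2_int[of p] by force

lemma Legendre_minus_1:
  assumes "prime p" "p \<noteq> (2::int)"
  shows "Legendre (- 1) p = chi4 p"
proof -
  have p: "odd p" "p > 2" using odd_prime_int assms by auto
  define n where "n = nat p"
  have n: "prime n" "2 < n" "p = int n" using assms p by (auto simp: n_def prime_int_iff')
  have "[Legendre (-1) p = (-1) ^ ((n - 1) div 2)] (mod p)"
    using euler_criterion[OF n(1,2)] by (simp add: n(3))
  moreover have "(-1) ^ ((n - 1) div 2) = chi4 p"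
  proof -
    have "n mod 4 = 1 \<or> n mod 4 = 3" using p n(3) by presburger
    moreover have "even ((n - 1) div 2) \<longleftrightarrow> n mod 4 = 1" if "n mod 4 = 1 \<or> n mod 4 = 3" using that by presburger
    moreover have "p mod 4 = 1 \<longleftrightarrow> n mod 4 = 1" "p mod 4 = 3 \<longleftrightarrow> n mod 4 = 3" unfolding n(3) by presburger+
    ultimately show ?thesis by (auto simp: chi4_def)
  qed
  ultimately show ?thesis using small_cong_eq[OF _ Legendre_values _ p(2)] by (auto simp: chi4_def split: if_splits)
qed

text \<open>Gauss's lemma: the multiples \<open>2 * x\<close> exceeding \<open>(p - 1) / 2\<close>
  are counted by residues modulo 8.\<close>

lemma Legendre_2:
  assumes "prime p" "p \<noteq> (2::int)"
  shows "Legendre 2 p = chi8 p"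
proof -
  have p: "odd p" "p > 2" using odd_prime_int assms by auto
  define n where "n = nat p"
  have n: "prime n" "2 < n" "p = int n" using assms p by (auto simp: n_def prime_int_iff')
  interpret GAUSS n 2
  proof
    show "[2 \<noteq> 0] (mod int n)" using n by (auto simp: cong_0_iff dest: zdvd_imp_le)
  qed (use n in auto)
  have "E = (\<lambda>x. 2 * x) ` {(p - 1) div 4 <.. (p - 1) div 2}"
  proof -
    have "C = (\<lambda>x. 2 * x) ` A"
      unfolding C_def B_def image_image A_def by (rule image_cong) (use n(3) in auto)
    then have E: "E = (\<lambda>x. 2 * x) ` {x \<in> A. (p - 1) div 2 < 2 * x}"
      unfolding E_def n(3)[symmetric] by auto
    have "(p - 1) div 4 = (p - 1) div 2 div 2" by (simp add: zdiv_zmult2_eq[symmetric])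
    moreover have "q < 2 * x \<longleftrightarrow> q div 2 < x" for q x :: int by presburger
    moreover have "(p - 1) div 2 div 2 \<ge> 0" using p by (simp add: pos_imp_zdiv_nonneg_iff)
    ultimately have "{x \<in> A. (p - 1) div 2 < 2 * x} = {(p - 1) div 4 <.. (p - 1) div 2}"
      unfolding A_def n(3)[symmetric] by auto
    then show ?thesis unfolding E by simp
  qed
  then have "card E = nat ((p - 1) div 2 - (p - 1) div 4)"
    by (simp add: card_image inj_on_def)
  moreover have "even (nat ((p - 1) div 2 - (p - 1) div 4)) \<longleftrightarrow> p mod 8 \<in> {1, 7}"
  proof -
    have "(p - 1) div 2 - (p - 1) div 4 \<ge> 0" using p by (simp add: zdiv_mono2)
    then have "even (nat ((p - 1) div 2 - (p - 1) div 4)) \<longleftrightarrow> even ((p - 1) div 2 - (p - 1) div 4)"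
      by (simp add: even_nat_iff)
    also have "\<dots> \<longleftrightarrow> p mod 8 = 1 \<or> p mod 8 = 7"
    proof -
      define k where "k = p div 8"
      have "odd (p mod 8)" using p(1) by presburger
      then consider "p = 8 * k + 1" | "p = 8 * k + 3" | "p = 8 * k + 5" | "p = 8 * k + 7"
        using mod_8_cases[of p] mult_div_mod_eq[of 8 p] unfolding k_def by fastforce
      moreover have "(8 * k) div 4 = 2 * k" "(2 + 8 * k) div 4 = 2 * k" "(8 * k + 4) div 4 = 2 * k + 1" "(6 + 8 * k) div 4 = 2 * k + 1"
        by presburger+
      ultimately show ?thesis by cases simp_all
    qed
    finally show ?thesis by simp
  qed
  moreover have "p mod 8 \<in> {1, 7} \<or> p mod 8 \<in> {3, 5}" 
  proof -
    have "odd (p mod 8)" using p(1) by presburger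
    then show ?thesis using mod_8_cases[of p] by auto
  qed
  ultimately show ?thesis using gauss_lemma by (auto simp: chi8_def n(3)[symmetric])
qed

lemma Legendre_mod_3: "Legendre n 3 = chi3 n"
proof -
  have q1: "QuadRes 3 1" unfolding QuadRes_def by (intro exI[of _ 1]) (simp add: cong_def)
  have q2: "\<not> QuadRes 3 2"
  proof
    assume "QuadRes 3 2"
    then obtain y :: int where y: "y\<^sup>2 mod 3 = 2" by (auto simp: QuadRes_def cong_def)
    have "y\<^sup>2 mod 3 = (y mod 3)\<^sup>2 mod 3" by (simp add: power_mod)
    then show False using y mod_3_cases[of y] by auto
  qed
  have "Legendre n 3 = Legendre (n mod 3) 3" by (rule Legendre_cong) (simp add: cong_def)
  also have "\<dots> = chi3 n" using mod_3_cases[of n] q1 q2 by (auto simp: Legendre_def chi3_def cong_def)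
  finally show ?thesis .
qed

text \<open>Quadratic reciprocity against the prime 3.\<close>

lemma Legendre_3:
  assumes "prime p" "p \<noteq> (2::int)"
  shows "Legendre 3 p = chi4 p * chi3 p"
proof (cases "p = 3")
  case True
  then show ?thesis by (simp add: Legendre_mod_3 chi3_def)
next
  case False
  have p: "odd p" "p > 2" using odd_prime_int assms by auto
  define n where "n = nat p"
  have n: "prime n" "2 < n" "p = int n" using assms p by (auto simp: n_def prime_int_iff')
  have "n \<noteq> 3" using False n by auto
  then have "Legendre (int n) 3 * Legendre 3 (int n) = (-1) ^ ((n - 1) div 2 * ((3 - 1) div 2))"
    using Quadratic_Reciprocity[of n 3] n by simp
  moreover have "(-1) ^ ((n - 1) div 2 * ((3 - 1) div 2)) = chi4 p"
  proof -
    have "n mod 4 = 1 \<or> n mod 4 = 3" using p n(3) by presburger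
    moreover have "even ((n - 1) div 2) \<longleftrightarrow> n mod 4 = 1" if "n mod 4 = 1 \<or> n mod 4 = 3" using that by presburger
    moreover have "p mod 4 = 1 \<longleftrightarrow> n mod 4 = 1" "p mod 4 = 3 \<longleftrightarrow> n mod 4 = 3" unfolding n(3) by presburger+
    ultimately show ?thesis by (auto simp: chi4_def)
  qed
  ultimately have e: "chi3 p * Legendre 3 p = chi4 p" by (simp add: n(3)[symmetric] Legendre_mod_3)
  have "\<not> 3 dvd p"
  proof
    assume "3 dvd p"
    moreover have "prime (3 :: int)" by simp
    ultimately have "3 = p" using assms(1) primes_dvd_imp_eq by blast
    then show False using False by simp
  qed
  then have "p mod 3 = 1 \<or> p mod 3 = 2" by presburger
  then have "chi3 p * chi3 p = 1" by (auto simp: chi3_def)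
  then have "Legendre 3 p = chi3 p * (chi3 p * Legendre 3 p)" by (simp add: mult.assoc[symmetric])
  then show ?thesis unfolding e by simp
qed

lemma kronecker_24:
  assumes "m > 0" shows "kronecker 24 m = chi8 m * chi4 m * chi3 m"
proof (rule kronecker_eq_multiplicative[where f = "\<lambda>m. chi8 m * chi4 m * chi3 m"])
  fix p :: int assume p: "prime p" "p > 0"
  show "kronecker_prime 24 p = chi8 p * chi4 p * chi3 p"
  proof (cases "p = 2")
    case False
    then have p2: "p > 2" using odd_prime_int p by auto
    have "Legendre 24 p = Legendre (2 * (2 * (2 * 3))) p" by simp
    also have "\<dots> = (Legendre 2 p * Legendre 2 p) * (Legendre 2 p * Legendre 3 p)"
      by (simp only: Legendre_mult[OF p(1) p2] mult.assoc)
    also have "Legendre 2 p * Legendre 2 p = 1"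
      using odd_prime_int[OF p(1) False] chi8_square unfolding Legendre_2[OF p(1) False] by blast
    finally show ?thesis using False
      by (simp add: kronecker_prime_def Legendre_2[OF p(1)] Legendre_3[OF p(1)])
  qed (simp add: kronecker_prime_def chi8_def)
next
  show "chi8 1 * chi4 1 * chi3 1 = 1" by (simp add: chi3_def chi4_def chi8_def)
  show "m > 0" by (rule assms)
  fix m n :: int
  show "chi8 (m * n) * chi4 (m * n) * chi3 (m * n) = (chi8 m * chi4 m * chi3 m) * (chi8 n * chi4 n * chi3 n)" unfolding chi3_mult chi4_mult chi8_mult by (simp only: mult_ac)
qed

lemma kronecker_minus_8:
  assumes "m > 0" shows "kronecker (- 8) m = chi8 m * chi4 m"
proof (rule kronecker_eq_multiplicative[where f = "\<lambda>m. chi8 m * chi4 m"])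
  fix p :: int assume p: "prime p" "p > 0"
  show "kronecker_prime (- 8) p = chi8 p * chi4 p"
  proof (cases "p = 2")
    case False
    then have p2: "p > 2" using odd_prime_int p by auto
    have "Legendre (- 8) p = Legendre (2 * (2 * (2 * (- 1)))) p" by simp
    also have "\<dots> = (Legendre 2 p * Legendre 2 p) * (Legendre 2 p * Legendre (- 1) p)"
      by (simp only: Legendre_mult[OF p(1) p2] mult.assoc)
    also have "Legendre 2 p * Legendre 2 p = 1"
      using odd_prime_int[OF p(1) False] chi8_square unfolding Legendre_2[OF p(1) False] by blast
    finally show ?thesis using False
      by (simp add: kronecker_prime_def Legendre_2[OF p(1)] Legendre_minus_1[OF p(1)])
  qed (simp add: kronecker_prime_def chi8_def)
next
  show "chi8 1 * chi4 1 = 1" by (simp add: chi3_def chi4_def chi8_def)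
  show "m > 0" by (rule assms)
  fix m n :: int
  show "chi8 (m * n) * chi4 (m * n) = (chi8 m * chi4 m) * (chi8 n * chi4 n)" unfolding chi3_mult chi4_mult chi8_mult by (simp only: mult_ac)
qed

lemma kronecker_minus_3:
  assumes "m > 0" shows "kronecker (- 3) m = chi3 m"
proof (rule kronecker_eq_multiplicative[where f = "\<lambda>m. chi3 m"])
  fix p :: int assume p: "prime p" "p > 0"
  show "kronecker_prime (- 3) p = chi3 p"
  proof (cases "p = 2")
    case False
    then have p2: "p > 2" using odd_prime_int p by auto
    have "Legendre (- 3) p = Legendre ((- 1) * 3) p" by simp
    also have "\<dots> = chi4 p * (chi4 p * chi3 p)"
      by (simp only: Legendre_mult[OF p(1) p2] Legendre_minus_1[OF p(1) False] Legendre_3[OF p(1) False])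
    also have "chi4 p * (chi4 p * chi3 p) = (chi4 p * chi4 p) * chi3 p" by simp
    also have "chi4 p * chi4 p = 1"
      using odd_prime_int[OF p(1) False] chi4_square by blast
    finally show ?thesis using False by (simp add: kronecker_prime_def)
  qed (simp add: kronecker_prime_def chi3_def)
next
  show "chi3 1 = 1" by (simp add: chi3_def chi4_def chi8_def)
  show "m > 0" by (rule assms)
  fix m n :: int
  show "chi3 (m * n) = (chi3 m) * (chi3 n)" unfolding chi3_mult chi4_mult chi8_mult by (simp only: mult_ac)
qed

lemma kronecker_of_1: "m > 0 \<Longrightarrow> kronecker 1 m = 1"
proof (rule kronecker_eq_multiplicative[where f = "\<lambda>_. 1"])
  fix p :: int assume p: "prime p" "p > 0"
  have "QuadRes p 1" unfolding QuadRes_def by (intro exI[of _ 1]) auto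
  moreover have "\<not> [1 = 0] (mod p)" using prime_gt_1_int[OF p(1)] by (auto simp: cong_0_iff dest: zdvd_imp_le)
  ultimately show "kronecker_prime 1 p = 1" by (simp add: kronecker_prime_def Legendre_def)
qed auto

lemma kronecker_minus_arg: "t > 0 \<Longrightarrow> kronecker t (- m) = kronecker t m"
proof -
  have "prime_factorization (- m) = prime_factorization m"
    using prime_factorization_normalize[of m] prime_factorization_normalize[of "- m"] by simp
  moreover have "multiplicity p (- m) = multiplicity p m" for p
    using multiplicity_times_unit_right[of "- 1" p m] by simp
  ultimately show "t > 0 \<Longrightarrow> kronecker t (- m) = kronecker t m" by (simp add: kronecker_def)
qed

lemma kronecker_24': "kronecker 24 m = chi8 m * chi4 m * chi3 m"
proof (cases "m > 0")
  case False
  show ?thesis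
  proof (cases "m = 0")
    case False
    then have m: "- m > 0" using \<open>\<not> m > 0\<close> by simp
    have "chi8 (- 1 * m) = chi8 m" "chi4 (- 1 * m) = - chi4 m" "chi3 (- 1 * m) = - chi3 m"
      unfolding chi8_mult chi4_mult chi3_mult by (simp_all add: chi8_def chi4_def chi3_def)
    then show ?thesis using kronecker_24[OF m] kronecker_minus_arg[of 24 m] by simp
  qed (simp add: kronecker_def chi8_def)
qed (rule kronecker_24)

section \<open>Quadratic Gauss sums\<close>

text \<open>The additive character \<open>e(a / d)\<close>.\<close>

definition ep :: "int \<Rightarrow> int \<Rightarrow> complex" where
  "ep a d = exp (2 * of_real pi * \<i> * (of_int a / of_int d))"

lemma ep_add: "ep (a + b) d = ep a d * ep b d"
  by (simp add: ep_def add_divide_distrib distrib_left exp_add)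

lemma ep_0 [simp]: "ep 0 d = 1" by (simp add: ep_def)

lemma ep_mult_self [simp]: "d \<noteq> 0 \<Longrightarrow> ep (d * k) d = 1"
  using exp_integer_2pi[of "of_int k"] by (simp add: ep_def mult_ac)

lemma ep_cancel: "k \<noteq> 0 \<Longrightarrow> ep (k * a) (k * d) = ep a d"
  by (simp add: ep_def)

lemma ep_cong:
  assumes "[a = b] (mod d)" "d \<noteq> 0"
  shows "ep a d = ep b d"
proof -
  obtain k where "a = d * k + b" using assms(1) by (metis cong_iff_lin cong_sym add.commute)
  then show ?thesis using assms(2) by (simp add: ep_add)
qed

lemma ep_eq_1_iff: "d \<noteq> 0 \<Longrightarrow> ep a d = 1 \<longleftrightarrow> d dvd a"
proof
  assume d: "d \<noteq> 0" and "ep a d = 1"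
  then obtain n :: int where "Im (2 * of_real pi * \<i> * (of_int a / of_int d)) = of_int (2 * n) * pi"
    unfolding ep_def exp_eq_1 by blast
  then have "(2 * pi) * (of_int a / of_int d) = (2 * pi) * of_int n" by (simp add: mult_ac)
  then have "of_int a / of_int d = (of_int n :: real)"
    by (subst (asm) mult_left_cancel) simp_all
  then have "(of_int a :: real) = of_int (d * n)" using d by (simp add: field_simps)
  then have "a = d * n" by (simp only: of_int_eq_iff)
  then show "d dvd a" by simp
qed (auto elim!: dvdE)

lemma norm_ep [simp]: "norm (ep a d) = 1"
proof -
  have "ep a d = exp (\<i> * of_real (2 * pi * (of_int a / of_int d)))" by (simp add: ep_def mult_ac)
  then show ?thesis by (simp only: norm_exp_i_times)
qed

lemma sum_ep_linear:
  assumes "d > 0"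
  shows "(\<Sum>x\<in>{0..<d}. ep (a * x) d) = (if d dvd a then of_int d else 0)"
proof (cases "d dvd a")
  case True
  then obtain k where "a = d * k" by (elim dvdE)
  then have "(\<Sum>x\<in>{0..<d}. ep (a * x) d) = (\<Sum>x\<in>{0..<d}. 1)"
    using assms by (intro sum.cong) (simp_all add: mult.assoc)
  then show ?thesis using True assms by simp
next
  case False
  have e: "ep (a * int x) d = ep a d ^ x" for x
    by (induction x) (simp_all add: ep_add distrib_left)
  have "(\<Sum>x\<in>{0..<d}. ep (a * x) d) = (\<Sum>x<nat d. ep (a * int x) d)"
    by (rule sum.reindex_bij_witness[of _ int nat]) (use assms in auto)
  also have "\<dots> = (\<Sum>x<nat d. ep a d ^ x)" by (simp add: e)
  also have "\<dots> = (1 - ep a d ^ nat d) / (1 - ep a d)"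
    using False assms by (subst sum_gp_strict) (auto simp: ep_eq_1_iff)
  also have "ep a d ^ nat d = ep (d * a) d" using e[of "nat d"] assms by (simp add: mult.commute)
  also have "\<dots> = 1" using assms by simp
  finally show ?thesis using False by simp
qed

lemma periodic_mod:
  fixes f :: "int \<Rightarrow> 'a"
  assumes "\<And>x. f (x + d) = f x"
  shows "f (x mod d) = f x"
proof -
  have n: "f (x + d * int n) = f x" for n x
  proof (induction n)
    case (Suc n) then show ?case using assms[of "x + d * int n"] by (simp add: algebra_simps)
  qed auto
  have "f (x + d * k) = f x" for x k
    using n[of x "nat k"] n[of "x + d * k" "nat (- k)"] by (cases "k \<ge> 0") auto
  from this[of "x mod d" "x div d"] show ?thesis by simp
qed

lemma sum_periodic_affine:
  fixes f :: "int \<Rightarrow> complex"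
  assumes per: "\<And>x. f (x + d) = f x" and d: "d > 0" and u: "coprime u d"
  shows "(\<Sum>x\<in>{0..<d}. f (u * x + v)) = (\<Sum>x\<in>{0..<d}. f x)"
proof -
  let ?g = "\<lambda>x. (u * x + v) mod d"
  have inj: "inj_on ?g {0..<d}"
  proof (rule inj_onI)
    fix x y assume xy: "x \<in> {0..<d}" "y \<in> {0..<d}" "?g x = ?g y"
    then have "[u * x + v = u * y + v] (mod d)" by (simp add: cong_def)
    then have "[u * x = u * y] (mod d)" by (simp add: cong_add_rcancel)
    then have "[x = y] (mod d)" using u by (simp add: cong_mult_lcancel)
    then show "x = y" using xy by (simp add: cong_def)
  qed
  have "bij_betw ?g {0..<d} {0..<d}"
    using inj d by (intro bij_betw_imageI endo_inj_surj) auto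
  from sum.reindex_bij_betw[OF this, of f]
  show ?thesis using periodic_mod[of f d, OF per] by simp
qed

text \<open>By the Chinese remainder theorem \<open>m * v + n * t\<close> runs through a complete
  system of residues.\<close>

lemma sum_periodic_crt:
  fixes f :: "int \<Rightarrow> complex"
  assumes per: "\<And>x. f (x + m * n) = f x" and mn: "m > 0" "n > 0" "coprime m n"
  shows "(\<Sum>x\<in>{0..<m * n}. f x) = (\<Sum>v\<in>{0..<n}. \<Sum>t\<in>{0..<m}. f (m * v + n * t))"
proof -
  let ?g = "\<lambda>(y, w). (m * y + n * w) mod (m * n)"
  have inj: "inj_on ?g ({0..<n} \<times> {0..<m})"
  proof (rule inj_onI, clarify)
    fix y w y' w' assume h: "y \<in> {0..<n}" "w \<in> {0..<m}" "y' \<in> {0..<n}" "w' \<in> {0..<m}"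
      and e: "(m * y + n * w) mod (m * n) = (m * y' + n * w') mod (m * n)"
    have c: "[m * y + n * w = m * y' + n * w'] (mod m * n)" using e by (simp add: cong_def)
    have "[m * y + n * w = m * y' + n * w'] (mod n)" using c by (rule cong_dvd_modulus) simp
    then have "[m * y = m * y'] (mod n)" by (simp add: cong_def mod_simps)
    then have "[y = y'] (mod n)" using mn by (simp add: cong_mult_lcancel)
    then have 1: "y = y'" using h by (simp add: cong_def)
    have "[m * y + n * w = m * y' + n * w'] (mod m)" using c by (rule cong_dvd_modulus) simp
    then have "[n * w = n * w'] (mod m)" by (simp add: cong_def mod_simps)
    then have "[w = w'] (mod m)" using mn by (simp add: cong_mult_lcancel coprime_commute)
    then have 2: "w = w'" using h by (simp add: cong_def)
    show "y = y' \<and> w = w'" using 1 2 by simp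
  qed
  have "card (?g ` ({0..<n} \<times> {0..<m})) = card {0..<m * n}"
    using card_image[OF inj] mn by (simp add: card_cartesian_product nat_mult_distrib mult.commute)
  then have "?g ` ({0..<n} \<times> {0..<m}) = {0..<m * n}"
    using mn by (intro card_subset_eq) auto
  then have bij: "bij_betw ?g ({0..<n} \<times> {0..<m}) {0..<m * n}" using inj by (simp add: bij_betw_def)
  have "(\<Sum>x\<in>{0..<m * n}. f x) = (\<Sum>p\<in>{0..<n} \<times> {0..<m}. f (?g p))"
    by (rule sum.reindex_bij_betw[OF bij, symmetric])
  also have "\<dots> = (\<Sum>p\<in>{0..<n} \<times> {0..<m}. case p of (v, t) \<Rightarrow> f (m * v + n * t))"
    by (intro sum.cong refl) (auto simp: periodic_mod[of f "m * n", OF per])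
  finally show ?thesis by (simp add: sum.cartesian_product)
qed

text \<open>The quadratic Gauss sum.\<close>

definition gs :: "int \<Rightarrow> int \<Rightarrow> complex" where
  "gs a d = (\<Sum>x\<in>{0..<d}. ep (a * x\<^sup>2) d)"

lemma gs_1 [simp]: "gs a 1 = 1"
proof -
  have "{0..<1} = {0::int}" by auto
  then show ?thesis by (simp add: gs_def)
qed

lemma gs_crt:
  assumes mn: "m > 0" "n > 0" "coprime m n"
  shows "gs a (m * n) = gs (a * m) n * gs (a * n) m"
proof -
  have "gs a (m * n) = (\<Sum>v\<in>{0..<n}. \<Sum>t\<in>{0..<m}. ep (a * (m * v + n * t)\<^sup>2) (m * n))"
    unfolding gs_def
  proof (rule sum_periodic_crt[OF _ mn])
    show "ep (a * (x + m * n)\<^sup>2) (m * n) = ep (a * x\<^sup>2) (m * n)" for x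
      using mn by (intro ep_cong cong_mult cong_pow) (auto simp: cong_def)
  qed
  also have "\<dots> = (\<Sum>v\<in>{0..<n}. \<Sum>t\<in>{0..<m}. ep (a * m * v\<^sup>2) n * ep (a * n * t\<^sup>2) m)"
  proof (intro sum.cong refl)
    fix v t
    have "a * (m * v + n * t)\<^sup>2 = m * (a * m * v\<^sup>2) + n * (a * n * t\<^sup>2) + (m * n) * (2 * a * v * t)"
      by (simp add: power2_eq_square algebra_simps)
    moreover have "ep (m * (a * m * v\<^sup>2)) (m * n) = ep (a * m * v\<^sup>2) n" using mn by (simp add: ep_cancel)
    moreover have "ep (n * (a * n * t\<^sup>2)) (m * n) = ep (a * n * t\<^sup>2) m"
      using mn ep_cancel[of n "a * n * t\<^sup>2" m] by (simp add: mult.commute[of m n])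
    moreover have "ep ((m * n) * (2 * a * v * t)) (m * n) = 1" using mn by (intro ep_mult_self) simp
    ultimately show "ep (a * (m * v + n * t)\<^sup>2) (m * n) = ep (a * m * v\<^sup>2) n * ep (a * n * t\<^sup>2) m"
      by (simp only: ep_add mult_1_right)
  qed
  finally show ?thesis by (simp only: gs_def sum_product)
qed

text \<open>Writing \<open>x = y + p * q * t\<close>, the sum over \<open>t\<close> vanishes
  unless \<open>p\<close> divides \<open>y\<close>.\<close>

lemma gs_prime_square_factor:
  assumes p: "prime p" "odd p" "\<not> p dvd a" and q: "q = p ^ k"
  shows "gs a (p\<^sup>2 * q) = of_int p * gs a q"
proof -
  have p0: "p > 1" using prime_gt_1_int[OF p(1)] .
  have q0: "q > 0" using p0 q by simp
  let ?g = "\<lambda>(y, t). y + p * q * t"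
  have bij: "bij_betw ?g ({0..<p * q} \<times> {0..<p}) {0..<p\<^sup>2 * q}"
  proof (rule bij_betw_byWitness[where f' = "\<lambda>x. (x mod (p * q), x div (p * q))"])
    have pq: "p * q > 0" using p0 q0 by simp
    have dm: "(y + p * q * t) mod (p * q) = y" "(y + p * q * t) div (p * q) = t" if "0 \<le> y" "y < p * q" for y t
      using that pq div_mult_self2[of "p * q" y t] mod_mult_self2[of y "p * q" t] p0 q0
      by (simp_all add: div_pos_pos_trivial del: div_mult_self2 mod_mult_self2)
    show "\<forall>a\<in>{0..<p * q} \<times> {0..<p}. ((case a of (y, t) \<Rightarrow> y + p * q * t) mod (p * q), (case a of (y, t) \<Rightarrow> y + p * q * t) div (p * q)) = a"
      using dm by auto
    show "\<forall>x\<in>{0..<p\<^sup>2 * q}. (case (x mod (p * q), x div (p * q)) of (y, t) \<Rightarrow> y + p * q * t) = x"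
      by simp
    show "?g ` ({0..<p * q} \<times> {0..<p}) \<subseteq> {0..<p\<^sup>2 * q}"
    proof (rule image_subsetI, clarify)
      fix y t :: int assume "y \<in> {0..<p * q}" "t \<in> {0..<p}"
      then have h: "0 \<le> y" "y < p * q" "0 \<le> t" "t < p" by auto
      have "p * q * t \<le> p * q * (p - 1)" using h p0 q0 by (intro mult_left_mono) auto
      then have "y + p * q * t < p * q * p" using h by (simp add: algebra_simps)
      then show "y + p * q * t \<in> {0..<p\<^sup>2 * q}"
        using h p0 q0 by (simp add: power2_eq_square mult_ac)
    qed
    show "(\<lambda>x. (x mod (p * q), x div (p * q))) ` {0..<p\<^sup>2 * q} \<subseteq> {0..<p * q} \<times> {0..<p}"
    proof (rule image_subsetI)
      fix x assume "x \<in> {0..<p\<^sup>2 * q}"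
      then have x: "0 \<le> x" "x < p\<^sup>2 * q" by auto
      have lt: "x < p * (p * q)" using x by (simp add: power2_eq_square mult_ac)
      have "x div (p * q) < p"
      proof (rule ccontr)
        assume "\<not> ?thesis"
        then have "p * (p * q) \<le> x div (p * q) * (p * q)" using pq by (intro mult_right_mono) auto
        also have "\<dots> \<le> x" using div_mult_mod_eq[of x "p * q"] pos_mod_sign[OF pq, of x] by linarith
        finally show False using lt by simp
      qed
      then show "(x mod (p * q), x div (p * q)) \<in> {0..<p * q} \<times> {0..<p}"
        using x pq by (simp add: pos_imp_zdiv_nonneg_iff)
    qed
  qed
  have "gs a (p\<^sup>2 * q) = (\<Sum>(y, t)\<in>{0..<p * q} \<times> {0..<p}. ep (a * (y + p * q * t)\<^sup>2) (p\<^sup>2 * q))"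
    unfolding gs_def using sum.reindex_bij_betw[OF bij, of "\<lambda>x. ep (a * x\<^sup>2) (p\<^sup>2 * q)"]
    by (simp add: case_prod_unfold)
  also have "\<dots> = (\<Sum>y\<in>{0..<p * q}. \<Sum>t\<in>{0..<p}. ep (a * y\<^sup>2) (p\<^sup>2 * q) * ep (2 * a * y * t) p)"
  proof (subst sum.cartesian_product[symmetric], intro sum.cong refl)
    fix y t
    have "ep (a * (y + p * q * t)\<^sup>2) (p\<^sup>2 * q) = ep (a * y\<^sup>2 + p * q * (2 * a * y * t)) (p\<^sup>2 * q)"
      by (rule ep_cong) (use p0 q0 in \<open>auto simp: cong_iff_dvd_diff intro!: dvdI[of _ _ "a * q * t\<^sup>2"] simp: power2_eq_square algebra_simps\<close>)
    also have "\<dots> = ep (a * y\<^sup>2) (p\<^sup>2 * q) * ep (p * q * (2 * a * y * t)) (p * q * p)"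
      by (simp add: ep_add power2_eq_square mult_ac)
    also have "ep (p * q * (2 * a * y * t)) (p * q * p) = ep (2 * a * y * t) p"
      using p0 q0 by (intro ep_cancel) auto
    finally show "ep (a * (y + p * q * t)\<^sup>2) (p\<^sup>2 * q) = ep (a * y\<^sup>2) (p\<^sup>2 * q) * ep (2 * a * y * t) p" .
  qed
  also have "\<dots> = (\<Sum>y\<in>{0..<p * q}. ep (a * y\<^sup>2) (p\<^sup>2 * q) * (if p dvd y then of_int p else 0))"
  proof (intro sum.cong refl)
    fix y
    have "\<not> p dvd 2"
    proof
      assume "p dvd 2"
      then have "p \<le> 2" by (rule zdvd_imp_le) simp
      then show False using p0 p(2) by (cases "p = 2") auto
    qed
    then have "p dvd 2 * a * y \<longleftrightarrow> p dvd y" using p by (simp add: prime_dvd_mult_iff)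
    then show "(\<Sum>t\<in>{0..<p}. ep (a * y\<^sup>2) (p\<^sup>2 * q) * ep (2 * a * y * t) p) = ep (a * y\<^sup>2) (p\<^sup>2 * q) * (if p dvd y then of_int p else 0)"
      using p0 by (simp add: sum_distrib_left[symmetric] sum_ep_linear)
  qed
  also have "\<dots> = (\<Sum>y\<in>(\<lambda>w. p * w) ` {0..<q}. ep (a * y\<^sup>2) (p\<^sup>2 * q) * of_int p)"
  proof (rule sum.mono_neutral_cong_right)
    show "(\<lambda>w. p * w) ` {0..<q} \<subseteq> {0..<p * q}" using p0 by auto
    show "\<forall>y\<in>{0..<p * q} - (\<lambda>w. p * w) ` {0..<q}. ep (a * y\<^sup>2) (p\<^sup>2 * q) * (if p dvd y then of_int p else 0) = 0"
      using p0 by (auto elim!: dvdE simp: zero_le_mult_iff)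
  qed auto
  also have "\<dots> = (\<Sum>w\<in>{0..<q}. ep (a * (p * w)\<^sup>2) (p\<^sup>2 * q) * of_int p)"
    using p0 by (subst sum.reindex) (auto simp: inj_on_def)
  also have "\<dots> = (\<Sum>w\<in>{0..<q}. ep (a * w\<^sup>2) q * of_int p)"
  proof (intro sum.cong refl)
    fix w
    have aw: "a * (p * w)\<^sup>2 = p\<^sup>2 * (a * w\<^sup>2)" by (simp add: power2_eq_square mult_ac)
    have "ep (a * (p * w)\<^sup>2) (p\<^sup>2 * q) = ep (a * w\<^sup>2) q"
      unfolding aw by (rule ep_cancel) (use p0 in simp)
    then show "ep (a * (p * w)\<^sup>2) (p\<^sup>2 * q) * of_int p = ep (a * w\<^sup>2) q * of_int p" by simp
  qed
  finally show ?thesis by (simp add: gs_def sum_distrib_left mult.commute)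
qed

lemma card_square_roots_mod_prime:
  assumes p: "prime p" "odd p"
  shows "int (card {x\<in>{0..<p}. [x\<^sup>2 = r] (mod p)}) = 1 + Legendre r p"
proof -
  have p0: "p > 2" using odd_prime_int[OF p(1)] p(2) by (cases "p = 2") auto
  have p2: "\<not> p dvd 2" using p0 by (auto dest: zdvd_imp_le)
  show ?thesis
  proof (cases "[r = 0] (mod p)")
    case True
    have "{x\<in>{0..<p}. [x\<^sup>2 = r] (mod p)} = {0}"
    proof (rule equalityI; rule subsetI)
      fix x assume "x \<in> {x\<in>{0..<p}. [x\<^sup>2 = r] (mod p)}"
      then have x: "0 \<le> x" "x < p" "[x\<^sup>2 = r] (mod p)" by auto
      then have "p dvd x\<^sup>2" using True cong_trans cong_0_iff by blast
      then have "p dvd x" using p(1) prime_dvd_power by blast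
      then show "x \<in> {0}" using x by (metis zdvd_not_zless less_le singletonI)
    next
      fix x assume "x \<in> {0::int}"
      then show "x \<in> {x\<in>{0..<p}. [x\<^sup>2 = r] (mod p)}" using True p0 by (simp add: cong_sym)
    qed
    then show ?thesis using True by (simp add: Legendre_def)
  next
    case F: False
    show ?thesis
    proof (cases "QuadRes p r")
      case True
      then obtain t where t: "[t\<^sup>2 = r] (mod p)" by (auto simp: QuadRes_def)
      have nt: "\<not> p dvd t"
      proof
        assume "p dvd t"
        then have "[t\<^sup>2 = 0] (mod p)" by (simp add: cong_0_iff power2_eq_square)
        then show False using F t cong_sym cong_trans by blast
      qed
      have "{x\<in>{0..<p}. [x\<^sup>2 = r] (mod p)} = {t mod p, (- t) mod p}"
      proof (rule equalityI; rule subsetI)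
        fix x assume "x \<in> {x\<in>{0..<p}. [x\<^sup>2 = r] (mod p)}"
        then have x: "0 \<le> x" "x < p" "[x\<^sup>2 = r] (mod p)" by auto
        have "[x\<^sup>2 = t\<^sup>2] (mod p)" using x(3) t cong_sym cong_trans by blast
        then have "p dvd (x - t) * (x + t)" by (simp add: cong_iff_dvd_diff power2_eq_square algebra_simps)
        then consider "p dvd x - t" | "p dvd x - (- t)" using p(1) by (auto simp: prime_dvd_mult_iff)
        then show "x \<in> {t mod p, (- t) mod p}"
          unfolding cong_iff_dvd_diff[symmetric] using x by cases (auto simp: cong_def)
      next
        fix x assume "x \<in> {t mod p, (- t) mod p}"
        then have "[x = t] (mod p) \<or> [x = - t] (mod p)" "0 \<le> x" "x < p" using p0 by (auto simp: cong_def)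
        then have "[x\<^sup>2 = t\<^sup>2] (mod p)" by (metis cong_pow power2_minus)
        then show "x \<in> {x\<in>{0..<p}. [x\<^sup>2 = r] (mod p)}" using t cong_trans \<open>0 \<le> x\<close> \<open>x < p\<close> by auto
      qed
      moreover have "t mod p \<noteq> (- t) mod p"
      proof
        assume "t mod p = (- t) mod p"
        then have "p dvd t - (- t)" by (simp only: cong_def[symmetric] cong_iff_dvd_diff)
        then have "p dvd 2 * t" by simp
        then show False using p(1) p2 nt by (simp add: prime_dvd_mult_iff)
      qed
      ultimately show ?thesis using True F by (simp add: Legendre_def)
    next
      case False
      then have e: "{x\<in>{0..<p}. [x\<^sup>2 = r] (mod p)} = {}" by (auto simp: QuadRes_def)
      show ?thesis unfolding e using False F by (simp add: Legendre_def)
    qed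
  qed
qed

text \<open>A residue \<open>r\<close> has \<open>1 + Legendre r p\<close> square roots, and the
  constant 1 contributes nothing to the sum.\<close>

lemma gs_prime_eq_Legendre:
  assumes p: "prime p" "odd p" "\<not> p dvd b"
  shows "gs b p = (\<Sum>r\<in>{0..<p}. of_int (Legendre r p) * ep (b * r) p)"
proof -
  have p0: "p > 2" using odd_prime_int[OF p(1)] p(2) by (cases "p = 2") auto
  have "gs b p = (\<Sum>x\<in>{0..<p}. \<Sum>r\<in>{0..<p}. if [x\<^sup>2 = r] (mod p) then ep (b * r) p else 0)"
    unfolding gs_def
  proof (intro sum.cong refl)
    fix x
    have "(\<Sum>r\<in>{0..<p}. if [x\<^sup>2 = r] (mod p) then ep (b * r) p else 0) =
       (\<Sum>r\<in>{0..<p}. if r = x\<^sup>2 mod p then ep (b * (x\<^sup>2 mod p)) p else 0)"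
      by (intro sum.cong refl) (auto simp: cong_def)
    also have "\<dots> = ep (b * (x\<^sup>2 mod p)) p" using p0 by (simp add: sum.delta)
    also have "\<dots> = ep (b * x\<^sup>2) p" using p0 by (intro ep_cong cong_mult) (auto simp: cong_def)
    finally show "ep (b * x\<^sup>2) p = (\<Sum>r\<in>{0..<p}. if [x\<^sup>2 = r] (mod p) then ep (b * r) p else 0)" by simp
  qed
  also have "\<dots> = (\<Sum>r\<in>{0..<p}. \<Sum>x\<in>{0..<p}. if [x\<^sup>2 = r] (mod p) then ep (b * r) p else 0)"
    by (rule sum.swap)
  also have "\<dots> = (\<Sum>r\<in>{0..<p}. of_int (1 + Legendre r p) * ep (b * r) p)"
  proof (intro sum.cong refl)
    fix r
    have "(\<Sum>x\<in>{0..<p}. if [x\<^sup>2 = r] (mod p) then ep (b * r) p else 0) =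
        of_nat (card {x\<in>{0..<p}. [x\<^sup>2 = r] (mod p)}) * ep (b * r) p"
      by (subst sum.inter_filter[symmetric]) auto
    also have "of_nat (card {x\<in>{0..<p}. [x\<^sup>2 = r] (mod p)}) = (of_int (int (card {x\<in>{0..<p}. [x\<^sup>2 = r] (mod p)})) :: complex)"
      by simp
    finally show "(\<Sum>x\<in>{0..<p}. if [x\<^sup>2 = r] (mod p) then ep (b * r) p else 0) = of_int (1 + Legendre r p) * ep (b * r) p"
      unfolding card_square_roots_mod_prime[OF p(1,2)] .
  qed
  also have "\<dots> = (\<Sum>r\<in>{0..<p}. ep (b * r) p) + (\<Sum>r\<in>{0..<p}. of_int (Legendre r p) * ep (b * r) p)"
    by (simp add: distrib_right sum.distrib)
  also have "(\<Sum>r\<in>{0..<p}. ep (b * r) p) = 0" using p0 p(3) by (simp add: sum_ep_linear)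
  finally show ?thesis by simp
qed

lemma gs_prime:
  assumes p: "prime p" "odd p" "\<not> p dvd a" "\<not> p dvd b"
  shows "gs (a * b) p = of_int (Legendre a p) * gs b p"
proof -
  have p0: "p > 2" using odd_prime_int[OF p(1)] p(2) by (cases "p = 2") auto
  have ab: "\<not> p dvd a * b" using p by (simp add: prime_dvd_mult_iff)
  have L1: "Legendre a p * Legendre a p = 1"
    using p(3) by (auto simp: Legendre_def cong_0_iff)
  have "gs b p = (\<Sum>r\<in>{0..<p}. of_int (Legendre r p) * ep (b * r) p)"
    by (rule gs_prime_eq_Legendre[OF p(1,2,4)])
  also have "\<dots> = (\<Sum>r\<in>{0..<p}. of_int (Legendre (a * r + 0) p) * ep (b * (a * r + 0)) p)"
  proof (rule sum_periodic_affine[symmetric])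
    show "of_int (Legendre (x + p) p) * ep (b * (x + p)) p = of_int (Legendre x p) * ep (b * x) p" for x
    proof -
      have "Legendre (x + p) p = Legendre x p" by (rule Legendre_cong) (simp add: cong_def)
      moreover have "ep (b * (x + p)) p = ep (b * x) p" using p0 by (intro ep_cong) (auto simp: cong_iff_dvd_diff algebra_simps)
      ultimately show ?thesis by simp
    qed
    show "coprime a p" using p by (metis prime_imp_coprime coprime_commute)
  qed (use p0 in auto)
  also have "\<dots> = (\<Sum>r\<in>{0..<p}. of_int (Legendre a p) * (of_int (Legendre r p) * ep (a * b * r) p))"
    by (intro sum.cong refl) (simp add: Legendre_mult[OF p(1) p0] mult_ac)
  also have "\<dots> = of_int (Legendre a p) * gs (a * b) p"
    by (simp add: gs_prime_eq_Legendre[OF p(1,2) ab] sum_distrib_left)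
  finally have "of_int (Legendre a p) * gs b p = of_int (Legendre a p * Legendre a p) * gs (a * b) p"
    by (simp add: mult.assoc)
  then show ?thesis by (simp add: L1)
qed

lemma kronecker_odd_prime:
  assumes "prime p" "odd p" shows "kronecker a p = Legendre a p"
  using assms by (auto simp: kronecker_prime_eq kronecker_prime_def)

text \<open>The twofold reduction, to prime powers by \<open>gs_crt\<close> and from
  \<open>p\<^sup>2 * q\<close> to \<open>q\<close>, ends at primes, where the substitution
  \<open>r \<mapsto> a * r\<close> brings out the Legendre symbol.\<close>

lemma gs_mult:
  assumes "d > 0" "odd d" "coprime a d" "coprime b d"
  shows "gs (a * b) d = of_int (kronecker a d) * gs b d"
  using assms
proof (induction "nat d" arbitrary: d a b rule: less_induct)
  case less
  show ?case
  proof (cases "d = 1")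
    case True
    then show ?thesis by (simp add: kronecker_1)
  next
    case False
    then obtain p where p: "prime p" "p dvd d" using less.prems(1) by (metis abs_of_pos prime_factor_int)
    have p1: "p > 1" using p(1) by (rule prime_gt_1_int)
    have po: "odd p" using p(2) less.prems(2) dvd_trans by blast
    define k where "k = multiplicity p d"
    obtain m where m: "d = p ^ k * m" "\<not> p dvd m"
      using multiplicity_decompose'[of d p] less.prems(1) p1 unfolding k_def by (auto simp: zdvd1_eq)
    have k1: "k \<ge> 1" using p m by (cases k) auto
    have m0: "m > 0" using m(1) less.prems(1) p1 by (simp add: zero_less_mult_iff)
    have pk: "p ^ k > 1" using p1 k1 by (simp add: one_less_power)
    have npa: "\<not> p dvd a" "\<not> p dvd b"
      using less.prems(3,4) p p1 by (auto simp: coprime_def dest: zdvd1_eq[THEN iffD1])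
    show ?thesis
    proof (cases "m = 1")
      case False
      have cp: "coprime (p ^ k) m" using p(1) m(2) by (simp add: prime_imp_coprime)
      have lt: "nat m < nat d" "nat (p ^ k) < nat d"
        using m(1) m0 pk False by (auto simp: nat_less_iff)
      have odd: "odd m" "odd (p ^ k)" using less.prems(2) m(1) by auto
      have ca: "coprime a m" "coprime a (p ^ k)" "coprime b m" "coprime b (p ^ k)"
        using less.prems(3,4) unfolding m(1) by (simp_all only: coprime_mult_right_iff)
      have "gs (a * b) d = gs (a * (b * p ^ k)) m * gs (a * (b * m)) (p ^ k)"
        unfolding m(1) using gs_crt[OF _ m0 cp, of "a * b"] pk by (simp add: mult_ac)
      also have "gs (a * (b * p ^ k)) m = of_int (kronecker a m) * gs (b * p ^ k) m"
        by (rule less.hyps[OF lt(1) m0 odd(1) ca(1)]) (use ca cp in simp)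
      also have "gs (a * (b * m)) (p ^ k) = of_int (kronecker a (p ^ k)) * gs (b * m) (p ^ k)"
        by (rule less.hyps[OF lt(2) _ odd(2) ca(2)]) (use ca cp pk in \<open>auto simp: coprime_commute\<close>)
      also have "of_int (kronecker a m) * gs (b * p ^ k) m * (of_int (kronecker a (p ^ k)) * gs (b * m) (p ^ k)) =
         of_int (kronecker a (p ^ k * m)) * gs b (p ^ k * m)"
        using gs_crt[OF _ m0 cp, of b] kronecker_mult[OF _ m0, of "p ^ k" a] pk by (simp add: mult_ac)
      finally show ?thesis unfolding m(1) .
    next
      case True
      then have d: "d = p ^ k" using m by simp
      show ?thesis
      proof (cases "k = 1")
        case True
        then show ?thesis using d gs_prime[OF p(1) po npa] kronecker_odd_prime[OF p(1) po] by simp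
      next
        case False
        define q where "q = p ^ (k - 2)"
        have "k = 2 + (k - 2)" using False k1 by simp
        then have dq: "d = p\<^sup>2 * q" unfolding d q_def by (metis power_add)
        have q0: "q > 0" using p1 by (simp add: q_def)
        have "q * 1 < q * p\<^sup>2" using q0 p1 by (intro mult_strict_left_mono) (auto simp: one_less_power)
        then have "q < d" by (simp add: dq mult.commute)
        then have lt: "nat q < nat d" using q0 by simp
        have nab: "\<not> p dvd a * b" using npa p(1) by (simp add: prime_dvd_mult_iff)
        have "kronecker a d = kronecker a p * kronecker a p * kronecker a q"
          unfolding dq power2_eq_square using p1 q0 by (simp add: kronecker_mult)
        also have "kronecker a p * kronecker a p = 1"
          using npa by (auto simp: kronecker_odd_prime[OF p(1) po] Legendre_def cong_0_iff)
        finally have kq: "kronecker a d = kronecker a q" by simp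
        have "gs (a * b) d = of_int p * gs (a * b) q"
          unfolding dq by (rule gs_prime_square_factor[OF p(1) po nab q_def])
        also have "gs (a * b) q = of_int (kronecker a q) * gs b q"
          by (rule less.hyps[OF lt q0]) (use less.prems in \<open>auto simp: dq\<close>)
        also have "of_int p * (of_int (kronecker a q) * gs b q) = of_int (kronecker a d) * gs b d"
          unfolding kq unfolding dq by (simp add: gs_prime_square_factor[OF p(1) po npa(2) q_def])
        finally show ?thesis .
      qed
    qed
  qed
qed

text \<open>The product is the squared absolute value; after a shift of one variable the sum over
  the other one is linear in the exponent.\<close>

lemma gs_norm_square:
  assumes d: "d > 0" "odd d" "coprime b d"
  shows "gs b d * gs (- b) d = of_int d"
proof -
  have "gs b d * gs (- b) d = (\<Sum>y\<in>{0..<d}. (\<Sum>x\<in>{0..<d}. ep (b * x\<^sup>2) d) * ep (- b * y\<^sup>2) d)"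
    by (simp add: gs_def sum_distrib_left)
  also have "\<dots> = (\<Sum>y\<in>{0..<d}. (\<Sum>x\<in>{0..<d}. ep (b * (1 * x + y)\<^sup>2) d) * ep (- b * y\<^sup>2) d)"
  proof (intro sum.cong refl)
    fix y
    have "ep (b * (x + d)\<^sup>2) d = ep (b * x\<^sup>2) d" for x
      using d by (intro ep_cong) (auto simp: cong_iff_dvd_diff power2_eq_square algebra_simps)
    from sum_periodic_affine[of "\<lambda>x. ep (b * x\<^sup>2) d" d 1 y, OF this]
    show "(\<Sum>x\<in>{0..<d}. ep (b * x\<^sup>2) d) * ep (- b * y\<^sup>2) d = (\<Sum>x\<in>{0..<d}. ep (b * (1 * x + y)\<^sup>2) d) * ep (- b * y\<^sup>2) d"
      using d by simp
  qed
  also have "\<dots> = (\<Sum>y\<in>{0..<d}. \<Sum>x\<in>{0..<d}. ep (b * x\<^sup>2) d * ep (2 * b * x * y) d)"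
    unfolding sum_distrib_right
    by (intro sum.cong refl) (simp add: ep_add[symmetric] power2_eq_square algebra_simps)
  also have "\<dots> = (\<Sum>x\<in>{0..<d}. \<Sum>y\<in>{0..<d}. ep (b * x\<^sup>2) d * ep (2 * b * x * y) d)"
    by (rule sum.swap)
  also have "\<dots> = (\<Sum>x\<in>{0..<d}. ep (b * x\<^sup>2) d * (if x = 0 then of_int d else 0))"
  proof (intro sum.cong refl)
    fix x assume x: "x \<in> {0..<d}"
    have "coprime (2 * b) d" using d by simp
    then have "d dvd 2 * b * x \<longleftrightarrow> d dvd x" by (simp add: coprime_dvd_mult_right_iff coprime_commute)
    also have "\<dots> \<longleftrightarrow> x = 0" using x by (auto dest: zdvd_imp_le)
    finally show "(\<Sum>y\<in>{0..<d}. ep (b * x\<^sup>2) d * ep (2 * b * x * y) d) = ep (b * x\<^sup>2) d * (if x = 0 then of_int d else 0)"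
      using d by (simp add: sum_distrib_left[symmetric] sum_ep_linear)
  qed
  also have "\<dots> = (\<Sum>x\<in>{0..<d}. if x = 0 then of_int d else 0)" by (intro sum.cong) auto
  also have "\<dots> = of_int d" using d by (simp add: sum.delta)
  finally show ?thesis .
qed

text \<open>The sign in \<open>gs b d\<^sup>2 = \<plusminus> d\<close> depends on \<open>d\<close>
  modulo 4, but it disappears in the fourth power, the only one that is needed for products of
  four theta series.\<close>

lemma gs_pow4:
  assumes d: "d > 0" "odd d" "coprime b d"
  shows "gs b d ^ 4 = of_int d ^ 2"
proof -
  define \<epsilon> where "\<epsilon> = (of_int (kronecker (- 1) d) :: complex)"
  have m: "gs (- b) d = \<epsilon> * gs b d" using gs_mult[OF d(1,2), of "-1" b] d(3) by (simp add: \<epsilon>_def)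
  have 1: "\<epsilon> * gs b d ^ 2 = of_int d" using gs_norm_square[OF d] unfolding m by (simp add: power2_eq_square mult_ac)
  then have nz: "gs b d \<noteq> 0" using d by auto
  have "gs b d = \<epsilon> * gs (- b) d" using gs_mult[OF d(1,2), of "-1" "- b"] d(3) by (simp add: \<epsilon>_def)
  then have "\<epsilon> * \<epsilon> = 1" unfolding m using nz by (simp add: mult.assoc[symmetric])
  then have "gs b d ^ 4 = (\<epsilon> * gs b d ^ 2) ^ 2" by (simp add: power_mult_distrib power2_eq_square[of \<epsilon>] power_mult[symmetric])
  then show ?thesis unfolding 1 .
qed

section \<open>Modularity of the four Eisenstein series\<close>

text \<open>The characters \<open>chi t\<close> for \<open>t = 24, -8, -3, 1\<close> as products
  of the primitive characters modulo 8, 4 and 3.\<close>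

definition c24 :: "int \<Rightarrow> complex" where "c24 n = of_int (chi8 n * chi4 n * chi3 n)"
definition cm8 :: "int \<Rightarrow> complex" where "cm8 n = of_int (chi8 n * chi4 n)"
definition cm3 :: "int \<Rightarrow> complex" where "cm3 n = of_int (chi3 n)"
definition c1 :: "int \<Rightarrow> complex" where "c1 n = 1"

lemma chi_3_per: "chi3 (n + 3) = chi3 n" by (simp add: chi3_def)
lemma chi_8_per: "chi8 (n + 8) = chi8 n" by (simp add: chi8_def)
lemma chi_minus: "chi3 (- n) = - chi3 n" "chi4 (- n) = - chi4 n" "chi8 (- n) = chi8 n"
  using chi3_mult[of "-1" n] chi4_mult[of "-1" n] chi8_mult[of "-1" n] by (simp_all add: chi3_def chi4_def chi8_def)

lemma c_per: "c24 (n + 24) = c24 n" "cm8 (n + 8) = cm8 n" "cm3 (n + 3) = cm3 n" "c1 (n + 1) = c1 n"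
proof -
  have "chi3 (n + 24) = chi3 n" "chi4 (n + 24) = chi4 n" "chi8 (n + 24) = chi8 n" "chi4 (n + 8) = chi4 n"
  proof -
    have "(n + 24) mod 3 = n mod 3" "(n + 24) mod 4 = n mod 4" "(n + 24) mod 8 = n mod 8" "(n + 8) mod 4 = n mod 4"
      by presburger+
    then show "chi3 (n + 24) = chi3 n" "chi4 (n + 24) = chi4 n" "chi8 (n + 24) = chi8 n" "chi4 (n + 8) = chi4 n"
      by (simp_all only: chi3_def chi4_def chi8_def)
  qed
  then show "c24 (n + 24) = c24 n" "cm8 (n + 8) = cm8 n" "cm3 (n + 3) = cm3 n" "c1 (n + 1) = c1 n"
    by (simp_all only: c24_def cm8_def cm3_def c1_def chi_3_per chi_8_per)
qed

lemma c_mult: "c24 (m * n) = c24 m * c24 n" "cm8 (m * n) = cm8 m * cm8 n" "cm3 (m * n) = cm3 m * cm3 n" "c1 (m * n) = c1 m * c1 n"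
  by (simp_all add: c24_def cm8_def cm3_def c1_def chi3_mult chi4_mult chi8_mult)

lemma c_minus: "c24 (- n) = c24 n" "cm8 (- n) = - cm8 n" "cm3 (- n) = - cm3 n" "c1 (- n) = c1 n"
  by (simp_all add: c24_def cm8_def cm3_def c1_def chi_minus)

lemma abs_chi: "\<bar>chi3 n\<bar> \<le> 1" "\<bar>chi4 n\<bar> \<le> 1" "\<bar>chi8 n\<bar> \<le> 1"
  by (simp_all add: chi3_def chi4_def chi8_def)

lemma norm_c_le: "norm (c24 n) \<le> 1" "norm (cm8 n) \<le> 1" "norm (cm3 n) \<le> 1" "norm (c1 n) \<le> 1"
proof -
  have "\<bar>chi8 n * chi4 n\<bar> \<le> 1" "\<bar>chi8 n * chi4 n * chi3 n\<bar> \<le> 1"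
    using abs_chi[of n] by (simp_all add: abs_mult mult_le_one)
  then show "norm (c24 n) \<le> 1" "norm (cm8 n) \<le> 1" "norm (cm3 n) \<le> 1" "norm (c1 n) \<le> 1"
    using abs_chi[of n] unfolding c24_def cm8_def cm3_def c1_def norm_of_int
    by (simp_all only: of_int_le_1_iff of_int_abs[symmetric] norm_one order_refl)
qed

lemma chi_eq_c: "m > 0 \<Longrightarrow> chi 24 m = c24 m" "m > 0 \<Longrightarrow> chi (- 8) m = cm8 m" "m > 0 \<Longrightarrow> chi (- 3) m = cm3 m"
  "m > 0 \<Longrightarrow> chi 1 m = c1 m"
  by (simp_all add: chi_def kronecker_24 kronecker_minus_8 kronecker_minus_3 kronecker_of_1 c24_def cm8_def cm3_def c1_def)

lemma chi_24_eq: "chi 24 = c24" by (auto simp: chi_def kronecker_24' c24_def)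

lemma sigma_cong:
  assumes "\<And>m. m > 0 \<Longrightarrow> a m = a' m" "\<And>m. m > 0 \<Longrightarrow> b m = b' m"
  shows "sigma a b n = sigma a' b' n"
proof (cases "n = 0")
  case True
  have "infinite {m::nat. 1 \<le> m \<and> m dvd 0}"
  proof -
    have "{m::nat. 1 \<le> m \<and> m dvd 0} = {1..}" by auto
    then show ?thesis using infinite_Ici[of "1::nat"] by simp
  qed
  then have z: "sum F {m::nat. 1 \<le> m \<and> m dvd 0} = 0" for F :: "nat \<Rightarrow> complex" by (rule sum.infinite)
  show ?thesis unfolding sigma_def True z ..
next
  case False
  then show ?thesis unfolding sigma_def using assms
    by (intro sum.cong refl) (auto simp: div_greater_zero_iff dvd_imp_le)
qed

lemma ep_pow: "ep (a * int n) d = ep a d ^ n"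
  by (induction n) (simp_all add: ep_add distrib_left)

definition zeta8 :: complex where "zeta8 = ep 1 8"
definition omega3 :: complex where "omega3 = ep 1 3"

lemma zeta8_eq: "zeta8 = (1 + \<i>) / of_real (sqrt 2)"
proof -
  have "zeta8 = cis (pi / 4)" by (simp add: zeta8_def ep_def cis_conv_exp)
  also have "\<dots> = (1 + \<i>) / of_real (sqrt 2)" by (simp add: complex_eq_iff cos_45 sin_45 Re_divide Im_divide field_simps real_sqrt_divide)
  finally show ?thesis .
qed

lemma zeta8_sq: "zeta8\<^sup>2 = \<i>"
  by (simp add: zeta8_eq power_divide power2_eq_square algebra_simps of_real_mult[symmetric] del: of_real_mult)

lemma omega3_eq: "omega3 = (- 1 + \<i> * of_real (sqrt 3)) / 2"
proof -
  have "omega3 = cis (2 * pi / 3)" by (simp add: omega3_def ep_def cis_conv_exp mult_ac)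
  moreover have "cos (2 * pi / 3) = - 1 / 2" "sin (2 * pi / 3) = sqrt 3 / 2"
    using cos_120 sin_120 by (simp_all add: mult.commute)
  ultimately show ?thesis by (simp add: complex_eq_iff)
qed

lemma omega3_cube: "omega3 ^ 3 = 1"
  using ep_pow[of 1 3 3] by (simp add: omega3_def ep_mult_self[of 3 1, simplified])

definition g8 :: complex where "g8 = 2 * of_real (sqrt 2) * \<i>"
definition g3 :: complex where "g3 = of_real (sqrt 3) * \<i>"

lemma gauss_3: "(omega3 ^ m) - (omega3 ^ m) ^ 2 = g3 * cm3 (int m)"
proof -
  define r where "r = m mod 3"
  have "omega3 ^ m = omega3 ^ (3 * (m div 3) + r)" by (simp add: r_def)
  then have e: "omega3 ^ m = omega3 ^ r" by (simp only: power_add power_mult omega3_cube) simp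
  have w2: "omega3 - omega3\<^sup>2 = g3"
    by (simp add: omega3_eq g3_def power2_eq_square field_simps of_real_mult[symmetric] del: of_real_mult)
  have w4: "(omega3\<^sup>2)\<^sup>2 = omega3" using omega3_cube by (simp add: power_mult[symmetric] power3_eq_cube numeral_eq_Suc)
  have c: "cm3 (int m) = (if r = 1 then 1 else if r = 2 then - 1 else 0)"
  proof -
    have "int m mod 3 = int r" by (simp add: r_def zmod_int)
    then show ?thesis by (simp add: cm3_def chi3_def)
  qed
  have "r < 3" by (simp add: r_def)
  then consider "r = 0" | "r = 1" | "r = 2" by linarith
  then show ?thesis unfolding e c using w2 w4 by cases (simp_all, simp add: algebra_simps)
qed

text \<open>The left-hand side factors as \<open>\<zeta> ^ m * (1 + \<i> ^ m) * (1 - (- 1) ^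
  m)\<close>.\<close>

lemma gauss_8: "zeta8 ^ m + (zeta8 ^ m) ^ 3 - (zeta8 ^ m) ^ 5 - (zeta8 ^ m) ^ 7 = g8 * cm8 (int m)"
proof -
  define r where "r = m mod 8"
  have z8: "zeta8 ^ 8 = 1" using ep_pow[of 1 8 8] by (simp add: zeta8_def ep_mult_self[of 8 1, simplified])
  have "zeta8 ^ m = zeta8 ^ (8 * (m div 8) + r)" by (simp add: r_def)
  then have e: "zeta8 ^ m = zeta8 ^ r" by (simp only: power_add power_mult z8) simp
  have zi: "zeta8 * \<i> + zeta8 = g8 / 2"
    by (simp add: zeta8_eq g8_def field_simps of_real_mult[symmetric] complex_eq_iff)
  have c: "cm8 (int m) = (if r = 1 \<or> r = 3 then 1 else if r = 5 \<or> r = 7 then - 1 else 0)"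
  proof -
    have "int m mod 8 = int r" "int m mod 4 = int (r mod 4)" by (simp_all add: r_def zmod_int mod_mod_cancel)
    moreover have "r < 8" by (simp add: r_def)
    then have "r \<in> {0,1,2,3,4,5,6,7}" by auto
    ultimately show ?thesis unfolding cm8_def chi8_def chi4_def by (elim insertE emptyE) simp_all
  qed
  define z where "z = zeta8 ^ r"
  have z2: "z ^ 2 = \<i> ^ r" unfolding z_def by (metis power_mult mult.commute zeta8_sq)
  have z4: "z ^ 4 = (- 1) ^ r"
  proof -
    have "z ^ 4 = (z ^ 2) ^ 2" by (simp add: power_mult[symmetric])
    then show ?thesis unfolding z2 by (metis power_mult mult.commute power2_i)
  qed
  have "z + z ^ 3 - z ^ 5 - z ^ 7 = z * (1 + z ^ 2) * (1 - z ^ 4)"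
    by (simp add: algebra_simps numeral_eq_Suc)
  also have "\<dots> = z * (1 + \<i> ^ r) * (1 - (- 1) ^ r)" by (simp only: z2 z4)
  also have "\<dots> = g8 * (if r = 1 \<or> r = 3 then 1 else if r = 5 \<or> r = 7 then - 1 else 0)"
  proof -
    have "r < 8" by (simp add: r_def)
    then have "r \<in> {0,1,2,3,4,5,6,7}" by auto
    moreover have zp: "zeta8 ^ 3 = \<i> * zeta8" "zeta8 ^ 5 = - zeta8" "zeta8 ^ 7 = - (\<i> * zeta8)"
      using zeta8_sq by (simp_all add: numeral_eq_Suc mult.assoc[symmetric])
    moreover have "\<i> ^ 3 = - \<i>" "\<i> ^ 5 = \<i>" "\<i> ^ 7 = - \<i>" by (simp_all add: numeral_eq_Suc)
    ultimately show ?thesis unfolding z_def using zi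
      by (elim insertE emptyE) (simp_all add: algebra_simps)
  qed
  finally show ?thesis unfolding e c z_def .
qed

lemma set_0_24: "{0..<24::int} = {0,1,2,3,4,5,6,7,8,9,10,11,12,13,14,15,16,17,18,19,20,21,22,23}"
proof -
  have "{0..<24::int} = {0..23}" by auto
  also have "\<dots> = set [0..23]" by simp
  finally show ?thesis by (simp add: upto.simps)
qed

text \<open>Modulo 24 the sum factors into those modulo 8 and modulo 3, since \<open>e(m /
  24)\<close> has its cube and its eighth power equal to \<open>e(m / 8)\<close> and \<open>e(m /
  3)\<close>.\<close>

lemma gauss_sums:
  fixes m :: nat
  shows "(\<Sum>s\<in>{0..<24}. c24 s * exp (2 * of_real pi * \<i> * (of_nat m * of_int s / of_int 24))) = 2 * of_real (sqrt 6) * c24 (int m)"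
    "(\<Sum>s\<in>{0..<8}. cm8 s * exp (2 * of_real pi * \<i> * (of_nat m * of_int s / of_int 8))) = g8 * cm8 (int m)"
    "(\<Sum>s\<in>{0..<3}. cm3 s * exp (2 * of_real pi * \<i> * (of_nat m * of_int s / of_int 3))) = g3 * cm3 (int m)"
    "(\<Sum>s\<in>{0..<1}. c1 s * exp (2 * of_real pi * \<i> * (of_nat m * of_int s / of_int 1))) = 1 * c1 (int m)"
proof -
  have ee: "exp (2 * of_real pi * \<i> * (of_nat m * of_int s / of_int d)) = ep (int m) d ^ nat s" if "s \<ge> 0" for s d
  proof -
    have "exp (2 * of_real pi * \<i> * (of_nat m * of_int s / of_int d)) = ep (int m * int (nat s)) d"
      using that by (simp add: ep_def)
    then show ?thesis by (simp only: ep_pow)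
  qed
  have e8: "ep (int m) 8 = zeta8 ^ m" and e3: "ep (int m) 3 = omega3 ^ m"
    using ep_pow[of 1 m 8] ep_pow[of 1 m 3] by (simp_all add: zeta8_def omega3_def)
  have s8: "{0..<8::int} = {0,1,2,3,4,5,6,7}" "{0..<3::int} = {0,1,2}" "{0..<1::int} = {0}" by auto
  show "(\<Sum>s\<in>{0..<8}. cm8 s * exp (2 * of_real pi * \<i> * (of_nat m * of_int s / of_int 8))) = g8 * cm8 (int m)"
  proof -
    have "(\<Sum>s\<in>{0..<8}. cm8 s * exp (2 * of_real pi * \<i> * (of_nat m * of_int s / of_int 8))) = (\<Sum>s\<in>{0..<8}. cm8 s * (zeta8 ^ m) ^ nat s)"
      by (intro sum.cong refl) (simp only: ee e8 atLeastLessThan_iff)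
    also have "\<dots> = zeta8 ^ m + (zeta8 ^ m) ^ 3 - (zeta8 ^ m) ^ 5 - (zeta8 ^ m) ^ 7"
      unfolding s8 by (simp add: cm8_def chi8_def chi4_def)
    finally show ?thesis by (simp only: gauss_8)
  qed
  show "(\<Sum>s\<in>{0..<3}. cm3 s * exp (2 * of_real pi * \<i> * (of_nat m * of_int s / of_int 3))) = g3 * cm3 (int m)"
  proof -
    have "(\<Sum>s\<in>{0..<3}. cm3 s * exp (2 * of_real pi * \<i> * (of_nat m * of_int s / of_int 3))) = (\<Sum>s\<in>{0..<3}. cm3 s * (omega3 ^ m) ^ nat s)"
      by (intro sum.cong refl) (simp only: ee e3 atLeastLessThan_iff)
    also have "\<dots> = omega3 ^ m - (omega3 ^ m) ^ 2"
      unfolding s8 by (simp add: cm3_def chi3_def)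
    finally show ?thesis by (simp only: gauss_3)
  qed
  show "(\<Sum>s\<in>{0..<1}. c1 s * exp (2 * of_real pi * \<i> * (of_nat m * of_int s / of_int 1))) = 1 * c1 (int m)"
    unfolding s8 by (simp add: c1_def)
  show "(\<Sum>s\<in>{0..<24}. c24 s * exp (2 * of_real pi * \<i> * (of_nat m * of_int s / of_int 24))) = 2 * of_real (sqrt 6) * c24 (int m)"
  proof -
    define z where "z = ep (int m) 24"
    define A where "A = zeta8 ^ m"
    define B where "B = omega3 ^ m"
    have A: "A = z ^ 3"
      using ep_cancel[of 3 "int m" 8] ep_pow[of "int m" 3 24] by (simp add: A_def z_def e8[symmetric] mult.commute)
    have B: "B = z ^ 8"
      using ep_cancel[of 8 "int m" 3] ep_pow[of "int m" 8 24] by (simp add: B_def z_def e3[symmetric] mult.commute)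
    have z24: "z ^ 24 = 1"
      using ep_pow[of "int m" 24 24] by (simp add: z_def mult.commute[of "int m"])
    have zz: "z ^ (24 + k) = z ^ k" for k by (simp only: power_add z24) simp
    have "(\<Sum>s\<in>{0..<24}. c24 s * exp (2 * of_real pi * \<i> * (of_nat m * of_int s / of_int 24))) = (\<Sum>s\<in>{0..<24}. c24 s * z ^ nat s)"
      by (intro sum.cong refl) (simp only: ee z_def[symmetric] atLeastLessThan_iff)
    also have "\<dots> = z + z ^ 5 - z ^ 7 - z ^ 11 - z ^ 13 - z ^ 17 + z ^ 19 + z ^ 23"
      unfolding set_0_24 by (simp add: c24_def chi8_def chi4_def chi3_def)
    also have "\<dots> = (B ^ 2 - B) * (A + A ^ 3 - A ^ 5 - A ^ 7)"
      unfolding A B power_mult[symmetric]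
      using zz[of 1] zz[of 5] zz[of 7] zz[of 13]
      by (simp add: algebra_simps power_add[symmetric])
    also have "\<dots> = - (g3 * cm3 (int m)) * (g8 * cm8 (int m))"
    proof -
      have "B ^ 2 - B = - (g3 * cm3 (int m))" using gauss_3[of m] by (simp add: B_def algebra_simps)
      moreover have "A + A ^ 3 - A ^ 5 - A ^ 7 = g8 * cm8 (int m)" using gauss_8[of m] by (simp add: A_def)
      ultimately show ?thesis by simp
    qed
    also have "\<dots> = 2 * of_real (sqrt 6) * c24 (int m)"
    proof -
      have "sqrt 6 = sqrt 2 * sqrt 3" by (simp add: real_sqrt_mult[symmetric])
      then have "of_real (sqrt 6) = complex_of_real (sqrt 2) * of_real (sqrt 3)" by simp
      moreover have "- (a * \<i> * u) * (2 * b * \<i> * v) = 2 * (b * a) * (v * u)" for a b u v :: complex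
      proof -
        have "(a * \<i> * u) * (2 * b * \<i> * v) = (\<i> * \<i>) * (2 * (b * a) * (v * u))" by (simp only: mult_ac)
        then show ?thesis by (simp only: mult_minus_left) simp
      qed
      ultimately show ?thesis by (simp only: g3_def g8_def c24_def cm8_def cm3_def of_int_mult)
    qed
    finally show ?thesis .
  qed
qed

lemma periodic_mult:
  fixes f :: "int \<Rightarrow> 'a"
  assumes "\<And>x. f (x + d) = f x"
  shows "f (x + d * k) = f x"
  using periodic_mod[of f d "x + d * k", OF assms] periodic_mod[of f d x, OF assms] by simp

lemma per24_twist:
  assumes MN: "M > 0" "M * N = 24" and c: "\<And>y. \<xi> (y + M) = \<xi> y" and p: "\<And>x. \<psi> (x + N) = \<psi> x"
    and z: "(\<Sum>x\<in>{0..<24}. if M dvd x then \<psi> (x div M) else 0) = 0 \<or> (\<Sum>y\<in>{0..<24}. \<xi> y) = 0"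
  shows "per24 (twist M \<xi> \<psi>)"
proof -
  have "(\<Sum>r\<in>{0..<24}. \<Sum>s\<in>{0..<24}. twist M \<xi> \<psi> r s) =
      (\<Sum>x\<in>{0..<24}. if M dvd x then \<psi> (x div M) else 0) * (\<Sum>y\<in>{0..<24}. \<xi> y)"
    unfolding sum_product by (intro sum.cong refl) (simp add: twist_def)
  then have z': "(\<Sum>r\<in>{0..<24}. \<Sum>s\<in>{0..<24}. twist M \<xi> \<psi> r s) = 0" using z by auto
  have "\<xi> (y + M * N) = \<xi> y" for y by (rule periodic_mult[of \<xi> M, OF c])
  then have c': "\<xi> (y + 24) = \<xi> y" for y using MN by simp
  have "twist M \<xi> \<psi> (x + 24) y = twist M \<xi> \<psi> x y" for x y
  proof -
    have "M dvd x + M * N \<longleftrightarrow> M dvd x" by (simp add: dvd_add_left_iff)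
    moreover have "(x + M * N) div M = x div M + N" using MN(1) by simp
    ultimately show ?thesis unfolding MN(2) by (simp add: twist_def p)
  qed
  moreover have "twist M \<xi> \<psi> x (y + 24) = twist M \<xi> \<psi> x y" for x y by (simp add: twist_def c')
  ultimately show ?thesis using z' by (simp add: per24_def)
qed

lemma Eis_cmult: "Eis (\<lambda>x y. k * h x y) z = k * Eis h z"
proof -
  have "block (\<lambda>x y. k * h x y) z p = k * block h z p" for p
    by (cases p) (simp add: block_def lterm_def sum_distrib_left)
  then show ?thesis by (simp add: Eis_def infsum_cmult_right')
qed

text \<open>For \<open>24 dvd k\<close> the matrix acts diagonally on the arguments, modulo the
  two periods \<open>M\<close> and \<open>N\<close>.\<close>

lemma twist_transform:
  assumes MN: "M > 0" "M * N = 24" and c: "\<And>y. \<xi> (y + M) = \<xi> y" and p: "\<And>x. \<psi> (x + N) = \<psi> x"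
    and cm: "\<And>x y. \<xi> (x * y) = \<xi> x * \<xi> y" and pm: "\<And>x y. \<psi> (x * y) = \<psi> x * \<psi> y"
    and det: "a * d - b * k = (1::int)" and k: "24 dvd k"
  shows "twist M \<xi> \<psi> (d * x - k * y) (a * y - b * x) = \<xi> a * \<psi> d * twist M \<xi> \<psi> x y"
proof -
  obtain k' where k': "k = M * (N * k')" using k MN(2) by (metis dvdE mult.assoc)
  have dd: "M dvd d * x - k * y \<longleftrightarrow> M dvd x"
  proof -
    have "M dvd d * x - k * y \<longleftrightarrow> M dvd d * x" unfolding k' by (simp add: mult.assoc dvd_diff_left_iff)
    also have "\<dots> \<longleftrightarrow> M dvd x"
    proof
      assume "M dvd d * x"
      then have "M dvd a * (d * x) - (b * (N * k') * x) * M" by simp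
      also have "a * (d * x) - (b * (N * k') * x) * M = (a * d - b * k) * x" by (simp add: k' algebra_simps)
      finally show "M dvd x" using det by simp
    qed simp
    finally show ?thesis .
  qed
  show ?thesis
  proof (cases "M dvd x")
    case True
    then obtain x' where x': "x = M * x'" by (elim dvdE)
    have "(d * x - k * y) div M = d * x' + N * (- k' * y)"
    proof -
      have "d * x - k * y = M * (d * x' + N * (- k' * y))" by (simp add: x' k' algebra_simps)
      then show ?thesis using MN(1) by simp
    qed
    moreover have "\<xi> (a * y - b * x) = \<xi> (a * y)"
      using periodic_mult[of \<xi> M "a * y" "- b * x'", OF c] by (simp add: x' algebra_simps)
    ultimately show ?thesis
      using True dd MN(1) periodic_mult[of \<psi> N "d * x'" "- k' * y", OF p]
      by (simp add: twist_def cm pm x')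
  qed (use dd in \<open>simp add: twist_def\<close>)
qed

text \<open>The expansions are stated in the half plane, but holomorphy and coefficient bounds are
  obtained in the unit disc.\<close>

lemma qq_surj:
  assumes "q \<noteq> 0" "norm q < 1"
  obtains z where "Im z > 0" "qq z = q"
proof
  let ?z = "Ln q / (2 * of_real pi * \<i>)"
  have "Im ?z = - ln (norm q) / (2 * pi)" 
  proof -
    have "?z = Ln q * (- \<i> * of_real (1 / (2 * pi)))" by (simp add: field_simps)
    then show ?thesis using assms by (simp add: Re_Ln)
  qed
  moreover have "- ln (norm q) / (2 * pi) > 0" by (rule divide_pos_pos) (use assms ln_less_zero_iff[of "norm q"] in auto)
  ultimately show "Im ?z > 0" by (simp only:)
  show "qq ?z = q" using assms by (simp add: qq_def)
qed

lemma modular_form_of_Eis: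
  assumes K: "K \<noteq> 0" and h: "per24 h"
    and inv: "\<And>a b c d x y. a * d - b * c = 1 \<Longrightarrow> 24 dvd c \<Longrightarrow> h (d * x - c * y) (a * y - b * x) = c24 d * h x y"
    and E: "\<And>z. Im z > 0 \<Longrightarrow> eisenstein t1 t2 z = K * Eis h z"
    and s: "\<And>z. Im z > 0 \<Longrightarrow> summable (\<lambda>n. sigma (chi t1) (chi t2) (Suc n) * qq z ^ Suc n)"
  shows "eisenstein t1 t2 \<in> modular_forms 2 24 (chi 24)"
proof -
  define f where "f = (\<lambda>q. \<Sum>n. sigma (chi t1) (chi t2) (Suc n) * q ^ Suc n)"
  define A where "A = (\<lambda>n. if n = 0 then 0 else sigma (chi t1) (chi t2) n)"
  have "(\<lambda>n. A n * (q - 0) ^ n) sums f q" if "q \<in> ball 0 1" for q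
  proof -
    from that have q: "norm q < 1" by simp
    have sm: "summable (\<lambda>n. sigma (chi t1) (chi t2) (Suc n) * q ^ Suc n)"
    proof (cases "q = 0")
      case False
      then obtain z where "Im z > 0" "qq z = q" using q qq_surj by blast
      then show ?thesis using s[of z] by simp
    qed simp
    then have "(\<lambda>n. A (Suc n) * q ^ Suc n) sums f q" by (simp add: f_def A_def summable_sums)
    then have "(\<lambda>n. A n * q ^ n) sums (f q + A 0 * q ^ 0)"
      using sums_Suc_iff[of "\<lambda>n. A n * q ^ n" "f q"] by simp
    then show ?thesis by (simp add: A_def)
  qed
  then have f: "f holomorphic_on ball 0 1"
    by (rule power_series_holomorphic[of 0 1 A f])
  have "qq holomorphic_on {z. Im z > 0}" unfolding qq_def[abs_def] by (intro holomorphic_intros)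
  moreover have "qq ` {z. Im z > 0} \<subseteq> ball 0 1" by (auto simp: qq_def)
  ultimately have "f \<circ> qq holomorphic_on {z. Im z > 0}"
    using holomorphic_on_compose_gen[OF _ f] by blast
  then have "(\<lambda>z. eisenstein_const t1 t2 + (f \<circ> qq) z) holomorphic_on {z. Im z > 0}" by (intro holomorphic_intros)
  then have hol: "eisenstein t1 t2 holomorphic_on {z. Im z > 0}" by (simp add: eisenstein_def[abs_def] f_def o_def)
  have slash: "eisenstein t1 t2 (mob a b c d z) = (of_int c * z + of_int d)\<^sup>2 * (K * Eis (\<lambda>x y. h (d * x - c * y) (a * y - b * x)) z)"
    if "a * d - b * c = 1" "Im z > 0" for a b c d z
    using E[OF Im_mob_pos[OF that]] Eis_mob[OF that(1) h that(2)] by simp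
  show ?thesis
    unfolding modular_forms_def mem_Collect_eq
  proof (intro conjI allI impI hol)
    fix a b c d :: int and z :: complex
    assume det: "a * d - b * c = 1" and c: "int 24 dvd c" and z: "Im z > 0"
    have "Eis (\<lambda>x y. h (d * x - c * y) (a * y - b * x)) z = c24 d * Eis h z"
      using inv[OF det] c by (simp add: Eis_cmult)
    then show "eisenstein t1 t2 ((of_int a * z + of_int b) / (of_int c * z + of_int d)) = chi 24 d * (of_int c * z + of_int d)\<^sup>2 * eisenstein t1 t2 z"
      using slash[OF det z] E[OF z] by (simp add: mob_def chi_24_eq)
  next
    fix a b c d :: int
    assume det: "a * d - b * c = 1"
    let ?h = "\<lambda>x y. h (d * x - c * y) (a * y - b * x)"
    have "per24 ?h" using Eis_mob[OF det h, of \<i>] by simp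
    then obtain B where B: "\<And>z. Im z > 1 \<Longrightarrow> norm (Eis ?h z) \<le> B" using Eis_bounded by blast
    show "\<exists>B Y. Y > 0 \<and> (\<forall>z. Im z > Y \<longrightarrow> norm (eisenstein t1 t2 ((of_int a * z + of_int b) / (of_int c * z + of_int d)) / (of_int c * z + of_int d)\<^sup>2) \<le> B)"
    proof (rule exI[of _ "norm K * B"], rule exI[of _ "1::real"], intro conjI allI impI)
      fix z :: complex assume z: "Im z > 1"
      then have z0: "Im z > 0" by simp
      have nz: "(of_int c * z + of_int d)\<^sup>2 \<noteq> 0" using mob_denom_nz[OF det z0] by simp
      have "eisenstein t1 t2 ((of_int a * z + of_int b) / (of_int c * z + of_int d)) / (of_int c * z + of_int d)\<^sup>2 = K * Eis ?h z"
        using slash[OF det z0] nz by (simp add: mob_def)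
      then show "norm (eisenstein t1 t2 ((of_int a * z + of_int b) / (of_int c * z + of_int d)) / (of_int c * z + of_int d)\<^sup>2) \<le> norm K * B"
        using B[OF z] by (simp add: norm_mult mult_left_mono)
    qed simp
  qed
qed

lemma cos_multiples_pi_12:
  "cos (1 * pi / 12) = (sqrt 6 + sqrt 2) / 4" "cos (5 * pi / 12) = (sqrt 6 - sqrt 2) / 4"
  "cos (7 * pi / 12) = - (sqrt 6 - sqrt 2) / 4" "cos (11 * pi / 12) = - (sqrt 6 + sqrt 2) / 4"
  "cos (13 * pi / 12) = - (sqrt 6 + sqrt 2) / 4" "cos (17 * pi / 12) = - (sqrt 6 - sqrt 2) / 4"
  "cos (19 * pi / 12) = (sqrt 6 - sqrt 2) / 4" "cos (23 * pi / 12) = (sqrt 6 + sqrt 2) / 4"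
proof -
  have s6: "sqrt 6 = sqrt 2 * sqrt 3" by (simp add: real_sqrt_mult[symmetric])
  have c1: "cos (1 * pi / 12) = (sqrt 6 + sqrt 2) / 4"
    using cos_diff[of "pi / 3" "pi / 4"] by (simp add: cos_60 sin_60 cos_45 sin_45 s6 field_simps)
  have c5: "cos (5 * pi / 12) = (sqrt 6 - sqrt 2) / 4"
    using cos_add[of "pi / 4" "pi / 6"] by (simp add: cos_30 sin_30 cos_45 sin_45 s6 field_simps)
  have r: "cos (pi - x) = - cos x" "cos (pi + x) = - cos x" "cos (2 * pi - x) = cos x" for x :: real
    by (simp_all add: cos_diff cos_add)
  have e: "7 * pi / 12 = pi - 5 * pi / 12" "11 * pi / 12 = pi - 1 * pi / 12" "13 * pi / 12 = pi + 1 * pi / 12"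
    "17 * pi / 12 = pi + 5 * pi / 12" "19 * pi / 12 = 2 * pi - 5 * pi / 12" "23 * pi / 12 = 2 * pi - 1 * pi / 12"
    by simp_all
  show "cos (1 * pi / 12) = (sqrt 6 + sqrt 2) / 4" "cos (5 * pi / 12) = (sqrt 6 - sqrt 2) / 4"
    by (fact c1 c5)+
  show "cos (7 * pi / 12) = - (sqrt 6 - sqrt 2) / 4" "cos (11 * pi / 12) = - (sqrt 6 + sqrt 2) / 4"
    "cos (13 * pi / 12) = - (sqrt 6 + sqrt 2) / 4" "cos (17 * pi / 12) = - (sqrt 6 - sqrt 2) / 4"
    "cos (19 * pi / 12) = (sqrt 6 - sqrt 2) / 4" "cos (23 * pi / 12) = (sqrt 6 + sqrt 2) / 4"
    unfolding e r c1 c5 by (simp_all only: minus_divide_left)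
qed

text \<open>The value \<open>L(2, \<chi>)\<close> for the real character modulo 24, up to
  elementary factors; \<open>p\<close> and \<open>r\<close> are the cosines of \<open>pi /
  12\<close> and \<open>5 * pi / 12\<close>.\<close>

lemma cosecant_sum:
  defines "p \<equiv> (sqrt 6 + sqrt 2) / 4" and "r \<equiv> (sqrt 6 - sqrt 2) / 4"
  shows "1 / (1 - p) - 1 / (1 + p) + 1 / (1 - r) - 1 / (1 + r) = 12 * sqrt 6"
proof -
  have s6: "sqrt 6 = sqrt 2 * sqrt 3" by (simp add: real_sqrt_mult[symmetric])
  have s2: "sqrt 2 * sqrt 2 = 2" and s3: "sqrt 3 * sqrt 3 = 3" by simp_all
  have b: "1 < sqrt 3" "sqrt 3 < 2" using real_sqrt_less_iff[of 3 4] by simp_all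
  have p2: "(1 - p) * (1 + p) = (2 - sqrt 3) / 4" and r2: "(1 - r) * (1 + r) = (2 + sqrt 3) / 4"
  proof -
    have "(sqrt 2 * sqrt 3 + sqrt 2) * (sqrt 2 * sqrt 3 + sqrt 2) = (sqrt 2 * sqrt 2) * ((sqrt 3 * sqrt 3) + 2 * sqrt 3 + 1)"
      "(sqrt 2 * sqrt 3 - sqrt 2) * (sqrt 2 * sqrt 3 - sqrt 2) = (sqrt 2 * sqrt 2) * ((sqrt 3 * sqrt 3) - 2 * sqrt 3 + 1)"
      by (simp_all only: algebra_simps)
    then have sq: "(sqrt 6 + sqrt 2) * (sqrt 6 + sqrt 2) = 8 + 4 * sqrt 3" "(sqrt 6 - sqrt 2) * (sqrt 6 - sqrt 2) = 8 - 4 * sqrt 3"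
      unfolding s6 s2 s3 by simp_all
    have "(1 - x / 4) * (1 + x / 4) = 1 - x * x / 16" for x :: real by (simp add: field_simps)
    then show "(1 - p) * (1 + p) = (2 - sqrt 3) / 4" "(1 - r) * (1 + r) = (2 + sqrt 3) / 4"
      unfolding p_def r_def by (simp_all only: sq) (simp_all add: field_simps)
  qed
  have nz: "1 - p \<noteq> 0" "1 + p \<noteq> 0" "1 - r \<noteq> 0" "1 + r \<noteq> 0"
  proof -
    have "2 - sqrt 3 \<noteq> 0" "2 + sqrt 3 \<noteq> 0" using b by linarith+
    then have "(1 - p) * (1 + p) \<noteq> 0" "(1 - r) * (1 + r) \<noteq> 0" unfolding p2 r2 by simp_all
    then show "1 - p \<noteq> 0" "1 + p \<noteq> 0" "1 - r \<noteq> 0" "1 + r \<noteq> 0" by auto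
  qed
  have P: "1 / (1 - p) - 1 / (1 + p) = 2 * p / ((2 - sqrt 3) / 4)"
    unfolding p2[symmetric] using nz by (simp add: field_simps)
  have R: "1 / (1 - r) - 1 / (1 + r) = 2 * r / ((2 + sqrt 3) / 4)"
    unfolding r2[symmetric] using nz by (simp add: field_simps)
  have inv: "2 * y / (u / 4) = 8 * y * v" if "u * v = 1" for u v y :: real
  proof -
    have u: "u \<noteq> 0" using that by auto
    then have "v = 1 / u" using that by (simp add: field_simps)
    then show ?thesis using u by simp
  qed
  have "2 * p / ((2 - sqrt 3) / 4) = 8 * p * (2 + sqrt 3)" "2 * r / ((2 + sqrt 3) / 4) = 8 * r * (2 - sqrt 3)"
    by (rule inv; use s3 in \<open>simp add: algebra_simps\<close>)+
  moreover have "8 * p * (2 + sqrt 3) + 8 * r * (2 - sqrt 3) = 12 * sqrt 6"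
    unfolding p_def r_def s6 by (simp add: field_simps)
  ultimately show ?thesis using P R by simp
qed

lemma lipschitz_at_24th:
  assumes s: "0 < s" "s < 24"
  shows "(\<Sum>\<^sub>\<infinity>k::int. 1 / ((of_int 0 * z + of_int s) / of_int 24 + of_int k)\<^sup>2) =
    complex_of_real (2 * pi\<^sup>2 * (1 / (1 - cos (of_int s * pi / 12))))"
proof -
  have n: "(of_int s / 24 :: complex) \<notin> \<int>"
  proof
    assume "(of_int s / 24 :: complex) \<in> \<int>"
    then obtain k where "(of_int s / 24 :: complex) = of_int k" by (auto elim: Ints_cases)
    then have "(of_int s :: complex) = of_int (24 * k)" by (simp add: field_simps)
    then have "s = 24 * k" by (simp only: of_int_eq_iff)
    then show False using s by presburger
  qed
  have "sin (of_real pi * (of_int s / 24 :: complex)) = of_real (sin (pi * s / 24))"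
    by (simp add: sin_of_real[symmetric])
  moreover have "(sin (pi * s / 24))\<^sup>2 = (1 - cos (of_int s * pi / 12)) / 2"
    using cos_double_sin[of "pi * s / 24"] by (simp add: field_simps)
  moreover have "pi\<^sup>2 / x = 2 * pi\<^sup>2 * (1 / y)" if "x = y / 2" for x y :: real
  proof -
    have "y = 2 * x" using that by simp
    then show ?thesis by simp
  qed
  ultimately have "of_real (pi\<^sup>2) / sin (of_real pi * (of_int s / 24 :: complex)) ^ 2 = complex_of_real (2 * pi\<^sup>2 * (1 / (1 - cos (of_int s * pi / 12))))"
    by (simp only: of_real_power[symmetric] of_real_divide[symmetric])
  then show ?thesis using infsumI[OF has_sum_inverse_square_int[OF n]] by simp
qed

lemma c24_values: "c24 0 = 0" "c24 1 = 1" "c24 2 = 0" "c24 3 = 0" "c24 4 = 0" "c24 5 = 1" "c24 6 = 0" "c24 7 = - 1"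
  "c24 8 = 0" "c24 9 = 0" "c24 10 = 0" "c24 11 = - 1" "c24 12 = 0" "c24 13 = - 1" "c24 14 = 0" "c24 15 = 0"
  "c24 16 = 0" "c24 17 = - 1" "c24 18 = 0" "c24 19 = 1" "c24 20 = 0" "c24 21 = 0" "c24 22 = 0" "c24 23 = 1"
  by (simp_all add: c24_def chi8_def chi4_def chi3_def)

text \<open>This row is the constant Fourier coefficient; it is responsible for the value \<open>-
  3\<close> of \<open>eisenstein_const 24 1\<close>.\<close>

lemma row_zero_c24:
  assumes h: "per24 (twist 24 c24 c1)"
  shows "row (twist 24 c24 c1) z 0 = of_real (pi\<^sup>2 * sqrt 6 / 12)"
proof -
  have "row (twist 24 c24 c1) z 0 = (\<Sum>s\<in>{0..<24}. c24 s / of_int 24 ^ 2 * (\<Sum>\<^sub>\<infinity>k::int. 1 / ((of_int 0 * z + of_int s) / of_int 24 + of_int k)\<^sup>2))"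
    using row_eq_lipschitz[of "twist 24 c24 c1" 0 24 z, OF _ _ summable_on_row[OF h]]
    by (simp add: twist_def c1_def c_per)
  also have "\<dots> = (\<Sum>s\<in>{0..<24}. c24 s / of_int 24 ^ 2 * complex_of_real (2 * pi\<^sup>2 * (1 / (1 - cos (of_int s * pi / 12)))))"
  proof (intro sum.cong refl)
    fix s :: int assume "s \<in> {0..<24}"
    then show "c24 s / of_int 24 ^ 2 * (\<Sum>\<^sub>\<infinity>k::int. 1 / ((of_int 0 * z + of_int s) / of_int 24 + of_int k)\<^sup>2) =
       c24 s / of_int 24 ^ 2 * complex_of_real (2 * pi\<^sup>2 * (1 / (1 - cos (of_int s * pi / 12))))"
      using lipschitz_at_24th[of s z] c24_values(1) by (cases "s = 0") auto
  qed
  also have "\<dots> = complex_of_real (2 * pi\<^sup>2 / 576 * (2 * (1 / (1 - (sqrt 6 + sqrt 2) / 4) - 1 / (1 + (sqrt 6 + sqrt 2) / 4)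
       + 1 / (1 - (sqrt 6 - sqrt 2) / 4) - 1 / (1 + (sqrt 6 - sqrt 2) / 4))))"
    (is "_ = complex_of_real (_ * (2 * (?A - ?B + ?C - ?D)))")
  proof -
    define F where "F = (\<lambda>s::int. 1 / (1 - cos (of_int s * pi / 12)))"
    have F: "F 1 = ?A" "F 5 = ?C" "F 7 = ?D" "F 11 = ?B" "F 13 = ?B" "F 17 = ?D" "F 19 = ?C" "F 23 = ?A"
      unfolding F_def of_int_numeral of_int_1 cos_multiples_pi_12 by (simp_all only: minus_divide_left[symmetric] diff_minus_eq_add)
    have "(\<Sum>s\<in>{0..<24}. c24 s / of_int 24 ^ 2 * complex_of_real (2 * pi\<^sup>2 * F s)) =
       of_real (2 * pi\<^sup>2 / 576 * (F 1 + F 5 - F 7 - F 11 - F 13 - F 17 + F 19 + F 23))"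
      unfolding set_0_24 by (simp add: c24_values field_simps)
    also have "F 1 + F 5 - F 7 - F 11 - F 13 - F 17 + F 19 + F 23 = 2 * (?A - ?B + ?C - ?D)"
      unfolding F by simp
    finally show ?thesis by (simp only: F_def)
  qed
  also have "\<dots> = of_real (pi\<^sup>2 * sqrt 6 / 12)"
    unfolding cosecant_sum by simp
  finally show ?thesis .
qed

lemma sums_of_characters: "(\<Sum>y\<in>{0..<24}. c24 y) = 0" "(\<Sum>y\<in>{0..<24}. cm8 y) = 0" "(\<Sum>y\<in>{0..<24}. cm3 y) = 0"
  unfolding set_0_24 by (simp_all add: c24_values cm8_def cm3_def chi8_def chi4_def chi3_def)

lemma c_inverse:
  assumes "a * d - b * k = (1::int)" "24 dvd k"
  shows "c24 a = c24 d" "cm8 a = cm8 d" "cm3 a = cm3 d"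
proof -
  have *: "f a = f d" if mu: "\<And>m n. f (m * n) = f m * f n" and p: "\<And>n. f (n + M) = f n" and M: "M dvd 24" and one: "f 1 = 1"
    and v: "\<And>n. f n \<in> {0, 1, - 1}" for f :: "int \<Rightarrow> complex" and M
  proof -
    obtain j where "b * k = M * j" using M assms(2) by (metis dvdE dvd_mult dvd_trans)
    then have "a * d = 1 + M * j" using assms(1) by simp
    then have "f a * f d = 1" using periodic_mult[of f M 1 j, OF p] one by (simp add: mu[symmetric])
    then show ?thesis using v[of a] v[of d] by auto
  qed
  show "c24 a = c24 d" by (rule *[where M = 24, OF c_mult(1) c_per(1)]) (auto simp: c24_def chi3_def chi4_def chi8_def)
  show "cm8 a = cm8 d" by (rule *[where M = 8, OF c_mult(2) c_per(2)]) (auto simp: cm8_def chi4_def chi8_def)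
  show "cm3 a = cm3 d" by (rule *[where M = 3, OF c_mult(3) c_per(3)]) (auto simp: cm3_def chi3_def)
qed

lemma sigma_chi: "sigma (chi 24) (chi 1) = sigma c24 c1" "sigma (chi 1) (chi 24) = sigma c1 c24"
  "sigma (chi (- 8)) (chi (- 3)) = sigma cm8 cm3" "sigma (chi (- 3)) (chi (- 8)) = sigma cm3 cm8"
  by (intro ext sigma_cong; simp add: chi_eq_c)+

text \<open>In each of the four cases \<open>\<xi>\<close> has period \<open>M\<close> and
  \<open>\<psi>\<close> has period \<open>24 / M\<close>. The row \<open>x = 0\<close> vanishes
  unless \<open>\<psi>\<close> is trivial.\<close>

theorem eisenstein_modular:
  assumes "(t1, t2) \<in> {(24, 1), (1, 24), (- 8, - 3), (- 3, - 8)}"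
  shows "eisenstein t1 t2 \<in> modular_forms 2 24 (chi 24)"
    and "Im z > 0 \<Longrightarrow> summable (\<lambda>n. sigma (chi t1) (chi t2) (Suc n) * qq z ^ Suc n)"
proof -
  have *: "eisenstein t1 t2 \<in> modular_forms 2 24 (chi 24) \<and> (Im z > 0 \<longrightarrow> summable (\<lambda>n. sigma (chi t1) (chi t2) (Suc n) * qq z ^ Suc n))"
    if M: "M > 0" "M * N = 24" and sg: "sigma (chi t1) (chi t2) = sigma \<xi> \<psi>"
      and xi: "\<And>y. \<xi> (y + M) = \<xi> y" "\<And>x y. \<xi> (x * y) = \<xi> x * \<xi> y" "\<And>y. norm (\<xi> y) \<le> 1"
      and psi: "\<And>y. \<psi> (y + N) = \<psi> y" "\<And>x y. \<psi> (x * y) = \<psi> x * \<psi> y" "\<And>y. norm (\<psi> y) \<le> 1"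
      and par: "\<And>x y. \<psi> (- x) * \<xi> (- y) = \<psi> x * \<xi> y"
      and zs: "(\<Sum>x\<in>{0..<24}. if M dvd x then \<psi> (x div M) else 0) = 0 \<or> (\<Sum>y\<in>{0..<24}. \<xi> y) = 0"
      and gauss: "\<And>m :: nat. (\<Sum>s\<in>{0..<M}. \<xi> s * exp (2 * of_real pi * \<i> * (of_nat m * of_int s / of_int M))) = g * \<xi> (int m)"
      and g: "g \<noteq> 0" and prod: "\<And>a b d k. a * d - b * k = 1 \<Longrightarrow> 24 dvd k \<Longrightarrow> \<xi> a * \<psi> d = c24 d"
      and row0: "\<And>z. per24 (twist M \<xi> \<psi>) \<Longrightarrow> row (twist M \<xi> \<psi>) z 0 = 2 * (- 4 * of_real pi ^ 2 * g / of_int M ^ 2) * eisenstein_const t1 t2"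
    for M N \<xi> \<psi> g
  proof -
    have h: "per24 (twist M \<xi> \<psi>)" by (rule per24_twist[OF M xi(1) psi(1) zs])
    define L where "L = 2 * (- 4 * of_real pi ^ 2 * g / of_int M ^ 2)"
    have L0: "L \<noteq> 0" using g M by (simp add: L_def)
    have E: "eisenstein t1 t2 z = (1 / L) * Eis (twist M \<xi> \<psi>) z" if "Im z > 0" for z
    proof -
      have "Eis (twist M \<xi> \<psi>) z = L * eisenstein t1 t2 z"
        unfolding Eis_twist_qexp(1)[OF M(1) xi(1) gauss h that xi(3) psi(3) par] row0[OF h] L_def[symmetric] eisenstein_def sg
        by (simp add: distrib_left)
      then show ?thesis using L0 by simp
    qed
    have s: "summable (\<lambda>n. sigma (chi t1) (chi t2) (Suc n) * qq z ^ Suc n)" if "Im z > 0" for z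
      unfolding sg by (rule Eis_twist_qexp(2)[OF M(1) xi(1) gauss h that xi(3) psi(3) par])
    have "eisenstein t1 t2 \<in> modular_forms 2 24 (chi 24)"
    proof (rule modular_form_of_Eis[OF _ h _ E s])
      show "1 / L \<noteq> 0" using L0 by simp
      fix a b c d x y :: int
      assume det: "a * d - b * c = 1" and c: "24 dvd c"
      show "twist M \<xi> \<psi> (d * x - c * y) (a * y - b * x) = c24 d * twist M \<xi> \<psi> x y"
        unfolding twist_transform[OF M xi(1) psi(1) xi(2) psi(2) det c] prod[OF det c] ..
    qed
    then show ?thesis using s by blast
  qed
  have z0: "row (twist M \<xi> \<psi>) z 0 = 0" if "\<psi> 0 = 0" for M \<xi> \<psi> z
    using that by (simp add: row_def lterm_def twist_def)
  have r24: "row (twist 24 c24 c1) z 0 = 2 * (- 4 * of_real pi ^ 2 * (2 * of_real (sqrt 6)) / of_int 24 ^ 2) * eisenstein_const 24 1"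
    if "per24 (twist 24 c24 c1)" for z
    unfolding row_zero_c24[OF that] by (simp add: eisenstein_const_def)
  have s1: "(\<Sum>x\<in>{0..<24}. if 1 dvd x then c24 (x div 1) else 0) = 0" using sums_of_characters(1) by simp
  have zero: "c24 0 = 0" "cm3 0 = 0" "cm8 0 = 0" by (simp_all add: c24_values cm3_def cm8_def chi3_def chi8_def)
  have cc: "cm8 d * cm3 d = c24 d" for d by (simp add: cm8_def cm3_def c24_def)
  have g: "g8 \<noteq> 0" "g3 \<noteq> 0" "2 * complex_of_real (sqrt 6) \<noteq> 0" by (simp_all add: g8_def g3_def)
  have pr: "c24 a * c1 d = c24 d" "c1 a * c24 d = c24 d" "cm8 a * cm3 d = c24 d" "cm3 a * cm8 d = c24 d"
    if "a * d - b * k = 1" "24 dvd k" for a b d k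
    using c_inverse[OF that] cc[of d] by (simp_all add: c1_def mult.commute)
  have "eisenstein t1 t2 \<in> modular_forms 2 24 (chi 24) \<and> (Im z > 0 \<longrightarrow> summable (\<lambda>n. sigma (chi t1) (chi t2) (Suc n) * qq z ^ Suc n))"
    using assms
  proof (elim insertE emptyE)
    assume t: "(t1, t2) = (24, 1)"
    have sg: "sigma (chi t1) (chi t2) = sigma c24 c1" using t by (simp only: prod.inject sigma_chi)
    have row0: "row (twist 24 c24 c1) z 0 = 2 * (- 4 * of_real pi ^ 2 * (2 * of_real (sqrt 6)) / of_int 24 ^ 2) * eisenstein_const t1 t2"
      if "per24 (twist 24 c24 c1)" for z
      using t r24[OF that] by (simp only: prod.inject)
    show ?thesis
      by (rule *[where M = 24 and N = 1 and \<xi> = c24 and \<psi> = c1 and g = "2 * of_real (sqrt 6)",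
            OF _ _ sg c_per(1) c_mult(1) norm_c_le(1) c_per(4) c_mult(4) norm_c_le(4) _ disjI2[OF sums_of_characters(1)] gauss_sums(1) g(3) pr(1) row0])
         (simp_all add: c_minus)
  next
    assume t: "(t1, t2) = (1, 24)"
    have sg: "sigma (chi t1) (chi t2) = sigma c1 c24" using t by (simp only: prod.inject sigma_chi)
    have row0: "row (twist 1 c1 c24) z 0 = 2 * (- 4 * of_real pi ^ 2 * (1) / of_int 1 ^ 2) * eisenstein_const t1 t2"
      if "per24 (twist 1 c1 c24)" for z
      using t z0[of c24 1 c1] zero by (simp add: eisenstein_const_def)
    show ?thesis
      by (rule *[where M = 1 and N = 24 and \<xi> = c1 and \<psi> = c24 and g = "1",
            OF _ _ sg c_per(4) c_mult(4) norm_c_le(4) c_per(1) c_mult(1) norm_c_le(1) _ disjI1[OF s1] gauss_sums(4) one_neq_zero pr(2) row0])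
         (simp_all add: c_minus)
  next
    assume t: "(t1, t2) = (- 8, - 3)"
    have sg: "sigma (chi t1) (chi t2) = sigma cm8 cm3" using t by (simp only: prod.inject sigma_chi)
    have row0: "row (twist 8 cm8 cm3) z 0 = 2 * (- 4 * of_real pi ^ 2 * (g8) / of_int 8 ^ 2) * eisenstein_const t1 t2"
      if "per24 (twist 8 cm8 cm3)" for z
      using t z0[of cm3 8 cm8] zero by (simp add: eisenstein_const_def)
    show ?thesis
      by (rule *[where M = 8 and N = 3 and \<xi> = cm8 and \<psi> = cm3 and g = "g8",
            OF _ _ sg c_per(2) c_mult(2) norm_c_le(2) c_per(3) c_mult(3) norm_c_le(3) _ disjI2[OF sums_of_characters(2)] gauss_sums(2) g(1) pr(3) row0])
         (simp_all add: c_minus)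
  next
    assume t: "(t1, t2) = (- 3, - 8)"
    have sg: "sigma (chi t1) (chi t2) = sigma cm3 cm8" using t by (simp only: prod.inject sigma_chi)
    have row0: "row (twist 3 cm3 cm8) z 0 = 2 * (- 4 * of_real pi ^ 2 * (g3) / of_int 3 ^ 2) * eisenstein_const t1 t2"
      if "per24 (twist 3 cm3 cm8)" for z
      using t z0[of cm8 3 cm3] zero by (simp add: eisenstein_const_def)
    show ?thesis
      by (rule *[where M = 3 and N = 8 and \<xi> = cm3 and \<psi> = cm8 and g = "g3",
            OF _ _ sg c_per(3) c_mult(3) norm_c_le(3) c_per(2) c_mult(2) norm_c_le(2) _ disjI2[OF sums_of_characters(3)] gauss_sums(3) g(2) pr(4) row0])
         (simp_all add: c_minus)
  qed
  then show "eisenstein t1 t2 \<in> modular_forms 2 24 (chi 24)"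
    "Im z > 0 \<Longrightarrow> summable (\<lambda>n. sigma (chi t1) (chi t2) (Suc n) * qq z ^ Suc n)" by auto
qed

section \<open>Poisson summation and inversion of theta series\<close>

text \<open>The characters of the circle of length 1.\<close>

definition ec :: "int \<Rightarrow> real \<Rightarrow> complex" where "ec m x = exp (2 * of_real pi * \<i> * of_int m * of_real x)"

lemma ec_add: "ec (m + n) x = ec m x * ec n x" by (simp add: ec_def distrib_left distrib_right exp_add)
lemma ec_0 [simp]: "ec 0 x = 1" by (simp add: ec_def)
lemma norm_ec [simp]: "norm (ec m x) = 1"
proof -
  have "ec m x = exp (\<i> * of_real (2 * pi * of_int m * x))" by (simp add: ec_def mult_ac)
  then show ?thesis by (simp only: norm_exp_i_times)
qed
lemma ec_continuous [continuous_intros]: "continuous_on A (ec m)" unfolding ec_def by (intro continuous_intros)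

inductive trig :: "(real \<Rightarrow> complex) \<Rightarrow> bool" where
  trig_ec: "trig (\<lambda>x. c * ec m x)"
| trig_add: "trig f \<Longrightarrow> trig g \<Longrightarrow> trig (\<lambda>x. f x + g x)"

lemma trig_mult:
  assumes "trig f" "trig g" shows "trig (\<lambda>x. f x * g x)"
  using assms(1)
proof induction
  case (trig_ec c m)
  show ?case using assms(2)
  proof induction
    case (trig_ec c' m')
    have "(\<lambda>x. c * ec m x * (c' * ec m' x)) = (\<lambda>x. (c * c') * ec (m + m') x)" by (simp add: ec_add mult_ac)
    then show ?case using trig.trig_ec by metis
  next
    case (trig_add f g)
    then show ?case using trig.trig_add by (simp add: distrib_left)
  qed
next
  case (trig_add f g)
  then show ?case using trig.trig_add by (simp add: distrib_right)
qed

lemma trig_const: "trig (\<lambda>_. c)" using trig_ec[of c 0] by simp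

definition circ :: "real \<Rightarrow> complex" where "circ x = exp (2 * of_real pi * \<i> * of_real x)"

text \<open>Polynomials in the real and imaginary part of a point of the circle are trigonometric
  polynomials, so that the approximation theorem of Stone and Weierstrass applies to them.\<close>

lemma trig_real_polynomial:
  assumes "real_polynomial_function q"
  shows "trig (\<lambda>x. complex_of_real (q (circ x)))"
  using assms
proof induction
  case (linear q)
  have q: "q w = Re w * q 1 + Im w * q \<i>" for w
  proof -
    have "w = Re w *\<^sub>R 1 + Im w *\<^sub>R \<i>" by (simp add: complex_eq_iff)
    then have "q w = q (Re w *\<^sub>R 1 + Im w *\<^sub>R \<i>)" by simp
    also have "\<dots> = Re w * q 1 + Im w * q \<i>"
      using linear by (simp add: bounded_linear.linear linear_add linear_scale)
    finally show ?thesis .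
  qed
  have e: "ec 1 x = circ x" "ec (- 1) x = cnj (circ x)" for x
    by (simp_all add: ec_def circ_def exp_cnj)
  have "complex_of_real (q (circ x)) = (of_real (q 1) / 2 - \<i> * of_real (q \<i>) / 2) * ec 1 x + (of_real (q 1) / 2 + \<i> * of_real (q \<i>) / 2) * ec (- 1) x" for x
    unfolding e q[of "circ x"] by (simp add: complex_eq_iff algebra_simps)
  then show ?case using trig_add[OF trig_ec trig_ec] by presburger
next
  case (const c)
  show ?case by (rule trig_const)
next
  case (add f g)
  then show ?case using trig_add by simp
next
  case (mult f g)
  then show ?case using trig_mult by simp
qed

text \<open>The square integral of \<open>f\<close> is approximated by integrals of
  \<open>f\<close> against trigonometric polynomials, which vanish. The quotient of the interval
  by its end points is realised as the circle in the complex plane.\<close>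

lemma fourier_coeffs_zero_imp_zero:
  fixes f :: "real \<Rightarrow> complex"
  assumes cont: "continuous_on {0..1} f" and per: "f 0 = f 1"
    and coef: "\<And>m. integral {0..1} (\<lambda>x. f x * ec m x) = 0"
  shows "\<forall>x\<in>{0..1}. f x = 0"
proof -
  \<comment> \<open>the map from the interval to the circle identifies the end points only\<close>
  have circ_eq: "x = y \<or> {x, y} = {0, 1}" if "circ x = circ y" "x \<in> {0..1}" "y \<in> {0..1}" for x y
  proof -
    obtain n :: int where "2 * of_real pi * \<i> * of_real x = 2 * of_real pi * \<i> * of_real y + complex_of_real (real_of_int (2 * n) * pi) * \<i>"
      using \<open>circ x = circ y\<close> unfolding circ_def exp_eq by blast
    then have "2 * of_real pi * \<i> * of_real x = 2 * of_real pi * \<i> * (of_real y + of_int n :: complex)"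
      by (simp add: algebra_simps)
    then have "of_real x = (of_real y + of_int n :: complex)" by (subst (asm) mult_left_cancel) auto
    then have "of_real x = (of_real (y + of_int n) :: complex)" by simp
    then have xy: "x = y + of_int n" by (simp only: of_real_eq_iff)
    then have "n = 0 \<or> n = 1 \<or> n = - 1" using that(2,3) by auto
    then show ?thesis using xy that(2,3) by auto
  qed
  define S where "S = circ ` {0..1}"
  have cc: "continuous_on A circ" for A unfolding circ_def by (intro continuous_intros)
  have S: "compact S" unfolding S_def by (intro compact_continuous_image cc) auto
  define g where "g = (\<lambda>w. f (SOME x. x \<in> {0..1} \<and> circ x = w))"
  have g: "g (circ x) = f x" if x: "x \<in> {0..1}" for x
  proof -
    have "(SOME y. y \<in> {0..1} \<and> circ y = circ x) \<in> {0..1} \<and> circ (SOME y. y \<in> {0..1} \<and> circ y = circ x) = circ x"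
      by (rule someI[of _ x]) (use x in auto)
    then show ?thesis unfolding g_def using circ_eq[of "SOME y. y \<in> {0..1} \<and> circ y = circ x" x] x per
      by (auto simp: doubleton_eq_iff)
  qed
  have "continuous_on S g"
    unfolding continuous_on_closed_vimage[OF compact_imp_closed[OF S]]
  proof (intro allI impI)
    fix B :: "complex set" assume B: "closed B"
    have "g -` B \<inter> S = circ ` (f -` B \<inter> {0..1})" unfolding S_def using g by auto
    moreover have "closed (f -` B \<inter> {0..1})" using cont B continuous_on_closed_vimage[of "{0..1}" f] by simp
    then have "compact (f -` B \<inter> {0..1})" using compact_Int_closed[of "{0..1::real}"] by (metis Int_absorb Int_assoc compact_Icc inf_commute)
    ultimately show "closed (g -` B \<inter> S)" by (simp add: compact_imp_closed compact_continuous_image cc)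
  qed
  then have contg: "continuous_on S (\<lambda>w. Re (g w))" "continuous_on S (\<lambda>w. Im (g w))" by (auto intro: continuous_intros)
  have ti: "integral {0..1} (\<lambda>x. f x * h x) = 0 \<and> continuous_on {0..1} h" if "trig h" for h
    using that
  proof induction
    case (trig_ec c m)
    have "(\<lambda>x. f x * (c * ec m x)) = (\<lambda>x. c * (f x * ec m x))" by (simp add: mult_ac)
    then show ?case using coef[of m] by (auto intro!: continuous_intros)
  next
    case (trig_add h k)
    then show ?case
      by (simp add: distrib_left integral_add integrable_continuous_real continuous_on_mult cont continuous_on_add)
  qed
  define N where "N = integral {0..1} (\<lambda>x. (norm (f x))\<^sup>2)"
  define L where "L = integral {0..1} (\<lambda>x. norm (f x))"
  have bound: "N \<le> 2 * e * L" if e: "e > 0" for e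
  proof -
    obtain p where p: "real_polynomial_function p" "\<And>w. w \<in> S \<Longrightarrow> \<bar>Re (g w) - p w\<bar> < e"
      using Stone_Weierstrass_real_polynomial_function[OF S contg(1) e] by blast
    obtain r where r: "real_polynomial_function r" "\<And>w. w \<in> S \<Longrightarrow> \<bar>Im (g w) - r w\<bar> < e"
      using Stone_Weierstrass_real_polynomial_function[OF S contg(2) e] by blast
    define h where "h = (\<lambda>x. of_real (p (circ x)) + (- \<i>) * complex_of_real (r (circ x)))"
    have th: "trig h" unfolding h_def
      by (intro trig_add trig_mult trig_const trig_real_polynomial p r)
    have hb: "norm (cnj (f x) - h x) \<le> 2 * e" if "x \<in> {0..1}" for x
    proof -
      have "circ x \<in> S" using that by (simp add: S_def)
      then have "\<bar>Re (f x) - p (circ x)\<bar> < e" "\<bar>Im (f x) - r (circ x)\<bar> < e" using p(2) r(2) g[OF that] by metis+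
      moreover have "norm (cnj (f x) - h x) \<le> \<bar>Re (cnj (f x) - h x)\<bar> + \<bar>Im (cnj (f x) - h x)\<bar>" by (rule cmod_le)
      ultimately show ?thesis by (simp add: h_def)
    qed
    have ch: "continuous_on {0..1} h" using ti[OF th] by simp
    have "of_real N = integral {0..1} (\<lambda>x. complex_of_real ((norm (f x))\<^sup>2))"
    proof -
      have "(\<lambda>x. (norm (f x))\<^sup>2) integrable_on {0..1}" by (intro integrable_continuous_real continuous_intros cont)
      from integral_linear[OF this bounded_linear_of_real[where 'a = complex]] show ?thesis
        by (simp add: N_def o_def)
    qed
    also have "\<dots> = integral {0..1} (\<lambda>x. f x * (cnj (f x) - h x) + f x * h x)"
      by (intro integral_cong) (simp add: complex_norm_square[symmetric] algebra_simps del: of_real_power)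
    also have "\<dots> = integral {0..1} (\<lambda>x. f x * (cnj (f x) - h x)) + integral {0..1} (\<lambda>x. f x * h x)"
      by (intro integral_add integrable_continuous_real continuous_intros cont ch)
    also have "\<dots> = integral {0..1} (\<lambda>x. f x * (cnj (f x) - h x))" using ti[OF th] by simp
    finally have "of_real N = integral {0..1} (\<lambda>x. f x * (cnj (f x) - h x))" .
    then have "\<bar>N\<bar> = norm (integral {0..1} (\<lambda>x. f x * (cnj (f x) - h x)))" by (metis norm_of_real)
    also have "\<dots> \<le> integral {0..1} (\<lambda>x. norm (f x) * (2 * e))"
      by (intro integral_norm_bound_integral integrable_continuous_real continuous_intros cont ch)
         (auto simp: norm_mult intro!: mult_left_mono hb)
    also have "\<dots> = 2 * e * L" unfolding L_def by (simp add: mult.commute)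
    finally show ?thesis by simp
  qed
  have L0: "L \<ge> 0" unfolding L_def by (intro integral_nonneg integrable_continuous_real continuous_intros cont) auto
  have "N \<le> 0"
  proof (rule field_le_epsilon)
    fix e :: real assume "e > 0"
    then have "N \<le> 2 * (e / (2 * (L + 1))) * L" using L0 by (intro bound) simp
    also have "\<dots> \<le> e" using L0 \<open>e > 0\<close> by (simp add: field_simps)
    finally show "N \<le> 0 + e" by simp
  qed
  moreover have "N \<ge> 0" unfolding N_def by (intro integral_nonneg integrable_continuous_real continuous_intros cont) auto
  ultimately have "N = 0" by simp
  then have "\<forall>x\<in>{0..1}. (norm (f x))\<^sup>2 = 0"
    unfolding N_def by (subst (asm) integral_eq_0_iff) (auto intro!: continuous_intros cont)
  then show ?thesis by simp
qed

text \<open>The characteristic function of the standard normal distribution, rescaled.\<close>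

lemma gaussian_fourier:
  assumes t: "t > 0"
  shows "((\<lambda>x. complex_of_real (exp (- pi * t * x\<^sup>2)) * ec m x) has_integral
    (of_real (exp (- pi * of_int m ^ 2 / t) / sqrt t))) UNIV"
proof -
  define c where "c = sqrt (2 * pi * t)"
  have c: "c > 0" "c\<^sup>2 = 2 * pi * t" using t by (simp_all add: c_def)
  define s where "s = 2 * pi * of_int m / c"
  define f where "f = (\<lambda>x. std_normal_density x *\<^sub>R iexp (s * x))"
  have fi: "integrable lborel f"
  proof -
    have "integrable lborel std_normal_density" by (rule integrable_normal_density) simp
    moreover have "norm (f x) = norm (std_normal_density x)" for x
      by (simp add: f_def norm_exp_i_times)
    ultimately show ?thesis
      by (intro Bochner_Integration.integrable_bound[where f = std_normal_density and g = f]) (auto simp: f_def)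
  qed
  have "char std_normal_distribution s = integral\<^sup>L lborel f"
    unfolding char_def f_def by (subst integral_density) auto
  then have If: "integral\<^sup>L lborel f = of_real (exp (- (s\<^sup>2) / 2))"
    by (simp add: char_std_normal_distribution)
  have g: "f (0 + c * x) = of_real (1 / sqrt (2 * pi)) * (complex_of_real (exp (- pi * t * x\<^sup>2)) * ec m x)" for x
  proof -
    have 1: "(c * x)\<^sup>2 / 2 = pi * t * x\<^sup>2" using c(2) by (simp add: power_mult_distrib)
    have "iexp (s * (c * x)) = ec m x"
      using c by (simp add: ec_def s_def mult_ac)
    then show ?thesis by (simp add: f_def std_normal_density_def 1 scaleR_conv_of_real)
  qed
  have "integrable lborel (\<lambda>x. of_real (1 / sqrt (2 * pi)) * (complex_of_real (exp (- pi * t * x\<^sup>2)) * ec m x))"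
    using lborel_integrable_real_affine[OF fi, of c 0] c unfolding g by simp
  then have "integrable lborel (\<lambda>x. of_real (sqrt (2 * pi)) * (of_real (1 / sqrt (2 * pi)) * (complex_of_real (exp (- pi * t * x\<^sup>2)) * ec m x)))"
    by (rule integrable_mult_right)
  moreover have "of_real (sqrt (2 * pi)) * (of_real (1 / sqrt (2 * pi)) * w) = w" for w :: complex by simp
  ultimately have i: "integrable lborel (\<lambda>x. complex_of_real (exp (- pi * t * x\<^sup>2)) * ec m x)" by (simp only:)
  have "of_real (exp (- (s\<^sup>2) / 2)) = c *\<^sub>R (of_real (1 / sqrt (2 * pi)) * integral\<^sup>L lborel (\<lambda>x. complex_of_real (exp (- pi * t * x\<^sup>2)) * ec m x))"
    using lborel_integral_real_affine[of c f 0] c unfolding If g by simp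
  also have "\<dots> = of_real (sqrt t) * integral\<^sup>L lborel (\<lambda>x. complex_of_real (exp (- pi * t * x\<^sup>2)) * ec m x)"
    by (simp add: c_def scaleR_conv_of_real real_sqrt_mult)
  finally have "integral\<^sup>L lborel (\<lambda>x. complex_of_real (exp (- pi * t * x\<^sup>2)) * ec m x) = of_real (exp (- (s\<^sup>2) / 2) / sqrt t)"
    using t by (simp add: field_simps)
  also have "- (s\<^sup>2) / 2 = - pi * of_int m ^ 2 / t"
  proof -
    have "s\<^sup>2 = (2 * pi * of_int m)\<^sup>2 / (2 * pi * t)" by (simp add: s_def power_divide c(2))
    then show ?thesis using t by (simp add: power2_eq_square field_simps)
  qed
  finally show ?thesis using has_integral_integral_lborel[OF i] by simp
qed

lemma theta_term_bound:
  assumes "\<delta> \<ge> 0" "Im \<tau> \<ge> \<delta>" "l \<ge> \<kappa> * \<bar>of_int n\<bar> - b" "\<kappa> \<ge> 0" "l \<ge> 0"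
  shows "norm (exp (of_real pi * \<i> * \<tau> * of_real l)) \<le> exp (pi * \<delta> * b) * exp (- (pi * \<delta> * \<kappa>)) ^ nat \<bar>n\<bar>"
proof -
  have "norm (exp (of_real pi * \<i> * \<tau> * of_real l)) = exp (- (pi * Im \<tau> * l))" by simp
  also have "\<dots> \<le> exp (- (pi * \<delta> * (\<kappa> * \<bar>of_int n\<bar> - b)))"
  proof -
    have "\<delta> * (\<kappa> * \<bar>of_int n\<bar> - b) \<le> \<delta> * l" using assms by (intro mult_left_mono) auto
    also have "\<dots> \<le> Im \<tau> * l" using assms by (intro mult_right_mono) auto
    finally have "pi * (\<delta> * (\<kappa> * \<bar>of_int n\<bar> - b)) \<le> pi * (Im \<tau> * l)" by (intro mult_left_mono) auto
    then show ?thesis by (simp add: mult.assoc)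
  qed
  also have "\<dots> = exp (pi * \<delta> * b) * exp (- (pi * \<delta> * \<kappa>)) ^ nat \<bar>n\<bar>"
    by (simp add: exp_of_nat_mult[symmetric] exp_add[symmetric] algebra_simps)
  finally show ?thesis .
qed

lemma theta_majorant_summable:
  assumes "\<delta> > 0" "\<kappa> > 0"
  shows "(\<lambda>n::int. C * exp (- (pi * \<delta> * \<kappa>)) ^ nat \<bar>n\<bar>) summable_on UNIV"
  by (intro summable_on_cmult_right summable_on_int_geometric) (use assms in auto)

text \<open>Linear growth of the exponents suffices for locally uniform convergence.\<close>

lemma theta_series_holomorphic:
  fixes c :: "int \<Rightarrow> complex" and l :: "int \<Rightarrow> real"
  assumes c: "\<And>n. norm (c n) \<le> C" and l: "\<And>n. l n \<ge> \<kappa> * \<bar>of_int n\<bar> - b" "\<And>n. l n \<ge> 0" and \<kappa>: "\<kappa> > 0"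
  shows "(\<lambda>\<tau>. \<Sum>\<^sub>\<infinity>n. c n * exp (of_real pi * \<i> * \<tau> * of_real (l n))) holomorphic_on {\<tau>. Im \<tau> > 0}" (is "?f holomorphic_on _")
    and "\<And>\<tau>. Im \<tau> > 0 \<Longrightarrow> (\<lambda>n. c n * exp (of_real pi * \<i> * \<tau> * of_real (l n))) summable_on UNIV"
proof -
  have C: "C \<ge> 0" using c[of 0] norm_ge_zero order_trans by blast
  have bd: "norm (c n * exp (of_real pi * \<i> * \<tau> * of_real (l n))) \<le> (C * exp (pi * \<delta> * b)) * exp (- (pi * \<delta> * \<kappa>)) ^ nat \<bar>n\<bar>"
    if "\<delta> \<ge> 0" "Im \<tau> \<ge> \<delta>" for \<delta> \<tau> n
  proof -
    have "norm (exp (of_real pi * \<i> * \<tau> * of_real (l n))) \<le> exp (pi * \<delta> * b) * exp (- (pi * \<delta> * \<kappa>)) ^ nat \<bar>n\<bar>"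
      using that \<kappa> l by (intro theta_term_bound) auto
    then have "norm (c n) * norm (exp (of_real pi * \<i> * \<tau> * of_real (l n))) \<le> C * (exp (pi * \<delta> * b) * exp (- (pi * \<delta> * \<kappa>)) ^ nat \<bar>n\<bar>)"
      using C by (intro mult_mono c) auto
    then show ?thesis by (simp only: norm_mult mult.assoc)
  qed
  show "(\<lambda>n. c n * exp (of_real pi * \<i> * \<tau> * of_real (l n))) summable_on UNIV" if "Im \<tau> > 0" for \<tau>
    by (rule abs_summable_summable, rule summable_on_comparison_test[OF theta_majorant_summable[OF that \<kappa>, of "C * exp (pi * Im \<tau> * b)"]])
       (use bd[of "Im \<tau>" \<tau>] that in auto)
  have "?f field_differentiable at \<tau>" if \<tau>: "Im \<tau> > 0" for \<tau>
  proof -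
    define \<delta> where "\<delta> = Im \<tau> / 2"
    have \<delta>: "\<delta> > 0" using \<tau> by (simp add: \<delta>_def)
    have im: "Im w \<ge> \<delta>" if "w \<in> cball \<tau> \<delta>" for w
    proof -
      have "\<bar>Im \<tau> - Im w\<bar> \<le> \<delta>" using that abs_Im_le_cmod[of "\<tau> - w"] by (simp add: dist_norm)
      then show ?thesis using abs_ge_self[of "Im \<tau> - Im w"] unfolding \<delta>_def by linarith
    qed
    have ul: "uniform_limit (cball \<tau> \<delta>) (\<lambda>X w. \<Sum>n\<in>X. c n * exp (of_real pi * \<i> * w * of_real (l n))) ?f (finite_subsets_at_top UNIV)"
      by (rule Weierstrass_m_test_general[OF bd theta_majorant_summable[OF \<delta> \<kappa>]]) (use \<delta> im in auto)
    obtain "?f holomorphic_on ball \<tau> \<delta>"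
      by (rule holomorphic_uniform_limit[OF _ ul]) (auto intro!: always_eventually continuous_intros holomorphic_intros)
    then show ?thesis using \<delta> by (auto simp: holomorphic_on_open field_differentiable_def)
  qed
  then show "?f holomorphic_on {\<tau>. Im \<tau> > 0}"
    unfolding holomorphic_on_def by (auto intro: field_differentiable_at_within)
qed

lemma ec_int_shift: "ec m (of_int n + x) = ec m x"
proof -
  have "ec m (of_int n + x) = exp (2 * of_real pi * \<i> * of_int m * of_real x) * exp (2 * of_real pi * \<i> * of_int (m * n))"
    unfolding ec_def exp_add[symmetric] by (rule arg_cong[of _ _ exp]) (simp add: algebra_simps)
  also have "exp (2 * of_real pi * \<i> * of_int (m * n)) = (1 :: complex)"
    using exp_integer_2pi[of "of_int (m * n)"] by (simp add: mult_ac)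
  finally show ?thesis by (simp add: ec_def)
qed

lemma ec_shift_continuous: "continuous_on A (\<lambda>x. ec m (c + x))" unfolding ec_def by (intro continuous_intros)

lemma integral_ec: "integral {0..1} (ec m) = (if m = 0 then 1 else 0)"
proof (cases "m = 0")
  case True
  then have "ec m = (\<lambda>_. 1)" by (auto simp: ec_def)
  then show ?thesis using True by simp
next
  case False
  have "(ec m has_integral (ec m 1 / (2 * of_real pi * \<i> * of_int m) - ec m 0 / (2 * of_real pi * \<i> * of_int m))) {0..1}"
  proof (rule fundamental_theorem_of_calculus)
    fix x :: real
    have "((\<lambda>z. exp (2 * of_real pi * \<i> * of_int m * z) / (2 * of_real pi * \<i> * of_int m)) has_field_derivative ec m x) (at (of_real x))"
      using False by (auto intro!: derivative_eq_intros simp: ec_def)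
    from has_vector_derivative_real_field[OF this]
    show "((\<lambda>x. ec m x / (2 * of_real pi * \<i> * of_int m)) has_vector_derivative ec m x) (at x within {0..1})"
      by (simp add: ec_def o_def)
  qed simp
  moreover have "ec m 1 = ec m 0" using ec_int_shift[of m 1 0] by simp
  ultimately show ?thesis using False by (simp add: integral_unique)
qed

lemma filterlim_symmetric_intervals:
  "filterlim (\<lambda>N. {- int N..int N}) (finite_subsets_at_top UNIV) sequentially"
  unfolding filterlim_finite_subsets_at_top
proof (intro allI impI)
  fix X :: "int set" assume X: "finite X \<and> X \<subseteq> UNIV"
  define M where "M = nat (Max (insert 0 (abs ` X)))"
  have "x \<in> {- int N..int N}" if "N \<ge> M" "x \<in> X" for N x
  proof -
    have "\<bar>x\<bar> \<le> Max (insert 0 (abs ` X))" using X that(2) by (intro Max_ge) auto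
    then have "\<bar>x\<bar> \<le> int N" using that(1) unfolding M_def by linarith
    then show ?thesis by auto
  qed
  then show "\<forall>\<^sub>F N in sequentially. finite {- int N..int N} \<and> X \<subseteq> {- int N..int N} \<and> {- int N..int N} \<subseteq> UNIV"
    unfolding eventually_sequentially by blast
qed

lemma abs_int_le_square: "\<bar>real_of_int n\<bar> \<le> (of_int n)\<^sup>2"
proof (cases "n = 0")
  case False
  then have "1 \<le> \<bar>real_of_int n\<bar>" by linarith
  then have "\<bar>real_of_int n\<bar> * 1 \<le> \<bar>real_of_int n\<bar> * \<bar>real_of_int n\<bar>" by (intro mult_left_mono) auto
  then show ?thesis by (simp add: power2_eq_square)
qed simp

lemma square_lower_bound:
  fixes x :: real and n :: int
  assumes "\<bar>x\<bar> \<le> R"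
  shows "(of_int n + x)\<^sup>2 \<ge> 1/2 * \<bar>of_int n\<bar> - R\<^sup>2"
proof -
  have "0 \<le> (of_int n + 2 * x)\<^sup>2" by simp
  then have "(of_int n)\<^sup>2 / 2 - x\<^sup>2 \<le> (of_int n + x)\<^sup>2" by (simp add: power2_eq_square algebra_simps)
  moreover have "x\<^sup>2 \<le> R\<^sup>2" using assms by (metis abs_ge_zero power2_abs power_mono)
  moreover have "\<bar>real_of_int n\<bar> \<le> (of_int n)\<^sup>2" by (rule abs_int_le_square)
  ultimately show ?thesis by simp
qed

text \<open>Poisson summation for the Gaussian: both sides are continuous and of period 1 in
  \<open>x\<close> with equal Fourier coefficients, the unfolded integral on the left being
  \<open>gaussian_fourier\<close>.\<close>

lemma poisson_imaginary_axis:
  assumes t: "t > 0" and x: "x \<in> {0..1}"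
  shows "(\<Sum>\<^sub>\<infinity>n::int. complex_of_real (exp (- pi * t * (of_int n + x)\<^sup>2))) =
     (\<Sum>\<^sub>\<infinity>m::int. of_real (exp (- pi * of_int m ^ 2 / t) / sqrt t) * ec m x)"
proof -
  define F where "F = (\<lambda>x. \<Sum>\<^sub>\<infinity>n::int. complex_of_real (exp (- pi * t * (of_int n + x)\<^sup>2)))"
  define a where "a = (\<lambda>m::int. exp (- pi * of_int m ^ 2 / t) / sqrt t)"
  define H where "H = (\<lambda>x. \<Sum>\<^sub>\<infinity>m::int. of_real (a m) * ec m x)"
  have gt: "complex_of_real (exp (- pi * t * (of_int n + x)\<^sup>2)) = exp (of_real pi * \<i> * (\<i> * of_real t) * of_real ((of_int n + x)\<^sup>2))" for n :: int and x
    by (simp add: exp_of_real[symmetric] mult_ac)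
  have bF: "norm (complex_of_real (exp (- pi * t * (of_int n + x)\<^sup>2))) \<le> exp (pi * t * 1) * exp (- (pi * t * (1/2))) ^ nat \<bar>n\<bar>"
    if "x \<in> {0..1}" for n :: int and x
    unfolding gt using t square_lower_bound[of x 1 n] that by (intro theta_term_bound) auto
  have "1 / t > 0" using t by simp
  have bH: "norm (of_real (a m) * ec m x) \<le> 1 / sqrt t * exp (- (pi * (1 / t) * 1)) ^ nat \<bar>m\<bar>" for m :: int and x
  proof -
    have "exp (- pi * of_int m ^ 2 / t) = norm (exp (of_real pi * \<i> * (\<i> * of_real (1 / t)) * of_real (of_int m ^ 2)))" by simp
    also have "\<dots> \<le> exp (pi * (1 / t) * 0) * exp (- (pi * (1 / t) * 1)) ^ nat \<bar>m\<bar>"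
    proof (rule theta_term_bound)
      show "1 * \<bar>real_of_int m\<bar> - 0 \<le> (of_int m)\<^sup>2" using abs_int_le_square[of m] by simp
    qed (use t in auto)
    finally have "exp (- pi * of_int m ^ 2 / t) \<le> exp (- (pi * (1 / t) * 1)) ^ nat \<bar>m\<bar>" by simp
    moreover have "norm (of_real (a m) * ec m x) = exp (- pi * of_int m ^ 2 / t) / sqrt t"
      using t by (simp add: a_def norm_mult norm_divide)
    ultimately show ?thesis using t by (simp add: divide_right_mono)
  qed
  note sF = theta_majorant_summable[of t "1/2" "exp (pi * t * 1)"]
  note sH = theta_majorant_summable[of "1 / t" 1 "1 / sqrt t"]
  have uF: "uniform_limit {0..1} (\<lambda>X x. \<Sum>n\<in>X. complex_of_real (exp (- pi * t * (of_int n + x)\<^sup>2))) F (finite_subsets_at_top UNIV)"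
    unfolding F_def using t by (intro Weierstrass_m_test_general[OF bF sF]) auto
  have uH: "uniform_limit {0..1} (\<lambda>X x. \<Sum>n\<in>X. of_real (a n) * ec n x) H (finite_subsets_at_top UNIV)"
    unfolding H_def using t by (intro Weierstrass_m_test_general[OF bH sH]) auto
  have cF: "continuous_on {0..1} F"
    by (rule uniform_limit_theorem[OF _ uF]) (auto intro!: always_eventually continuous_intros)
  have cH: "continuous_on {0..1} H"
    by (rule uniform_limit_theorem[OF _ uH]) (auto intro!: always_eventually continuous_intros)
  have F01: "F 0 = F 1"
    unfolding F_def by (rule infsum_reindex_bij_witness[of _ "\<lambda>n. n + 1" "\<lambda>n. n - 1"]) auto
  have H01: "H 0 = H 1"
    unfolding H_def by (intro infsum_cong) (use ec_int_shift[of _ 1 0] in simp)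
  have "integral {0..1} (\<lambda>x. F x * ec m x) = of_real (a m)" for m
  proof -
    define G where "G = (\<lambda>x. complex_of_real (exp (- pi * t * x\<^sup>2)) * ec m x)"
    have cG: "continuous_on A G" for A unfolding G_def by (intro continuous_intros)
    have Gi: "(G has_integral of_real (a m)) UNIV" unfolding G_def a_def by (rule gaussian_fourier[OF t])
    have "uniform_limit {0..1} (\<lambda>N x. \<Sum>n\<in>{- int N..int N}. complex_of_real (exp (- pi * t * (of_int n + x)\<^sup>2))) F sequentially"
      using filterlim_compose[OF uF filterlim_symmetric_intervals] by simp
    then have "uniform_limit {0..1} (\<lambda>N x. (\<Sum>n\<in>{- int N..int N}. complex_of_real (exp (- pi * t * (of_int n + x)\<^sup>2))) * ec m x) (\<lambda>x. F x * ec m x) sequentially"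
      by (rule uniform_lim_mult[OF _ uniform_limit_const])
         (auto intro!: compact_imp_bounded compact_continuous_image cF ec_continuous)
    then obtain I J where IJ: "\<And>N. ((\<lambda>x. (\<Sum>n\<in>{- int N..int N}. complex_of_real (exp (- pi * t * (of_int n + x)\<^sup>2))) * ec m x) has_integral I N) {0..1}"
        "((\<lambda>x. F x * ec m x) has_integral J) {0..1}" "I \<longlonglongrightarrow> J"
      by (rule uniform_limit_integral) (auto intro!: continuous_intros)
    have gi: "G integrable_on {c..d}" for c d by (intro integrable_continuous_real cG)
    have sumG: "(\<Sum>n\<in>{- int N..int N}. integral {of_int n..of_int n + 1} G) = integral {- of_nat N..of_nat N + 1} G" for N
    proof (induction N)
      case (Suc N)
      have "{- int (Suc N)..int (Suc N)} = insert (- int (Suc N)) (insert (int (Suc N)) {- int N..int N})" by auto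
      then have "(\<Sum>n\<in>{- int (Suc N)..int (Suc N)}. integral {of_int n..of_int n + 1} G) =
         integral {- of_nat (Suc N)..- of_nat N} G + (integral {of_nat N + 1..of_nat N + 2} G + integral {- of_nat N..of_nat N + 1} G)"
        using Suc by (simp add: add_ac)
      also have "\<dots> = integral {- of_nat (Suc N)..of_nat N + 2} G"
        using Henstock_Kurzweil_Integration.integral_combine[where a = "- real N" and c = "real N + 1" and b = "real N + 2" and f = G]
          Henstock_Kurzweil_Integration.integral_combine[where a = "- real (Suc N)" and c = "- real N" and b = "real N + 2" and f = G] gi
        by (simp add: add_ac)
      finally show ?case by (simp add: add_ac)
    qed simp
    have "I N = integral {- of_nat N..of_nat N + 1} G" for N
    proof -
      have "I N = integral {0..1} (\<lambda>x. \<Sum>n\<in>{- int N..int N}. (G \<circ> (+) (of_int n)) x)"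
        using integral_unique[OF IJ(1)[of N]] by (simp add: G_def sum_distrib_right ec_int_shift)
      also have "\<dots> = (\<Sum>n\<in>{- int N..int N}. integral {0..1} (G \<circ> (+) (of_int n)))"
        by (rule integral_sum) (auto simp: o_def G_def intro!: integrable_continuous_real continuous_intros ec_shift_continuous)
      also have "\<dots> = (\<Sum>n\<in>{- int N..int N}. integral {of_int n..of_int n + 1} G)"
        by (simp only: integral_shift_Icc_real) (simp add: add_ac)
      finally show ?thesis using sumG by simp
    qed
    moreover have "(\<lambda>N. integral {- real N..real N + 1} G) \<longlonglongrightarrow> of_real (a m)"
    proof (rule LIMSEQ_I)
      fix e :: real assume "e > 0"
      then obtain B where B: "B > 0" "\<And>c d. ball 0 B \<subseteq> cbox c d \<Longrightarrow> norm (integral (cbox c d) G - of_real (a m)) < e"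
        using Gi[unfolded has_integral_alt'[of G]] by auto
      have "norm (integral {- real N..real N + 1} G - of_real (a m)) < e" if "N \<ge> nat \<lceil>B\<rceil>" for N
      proof -
        have "B \<le> real N" using that by linarith
        then have "ball 0 B \<subseteq> cbox (- real N) (real N + 1)" by (auto simp: dist_real_def)
        then show ?thesis using B(2) by fastforce
      qed
      then show "\<exists>no. \<forall>N\<ge>no. norm (integral {- real N..real N + 1} G - of_real (a m)) < e" by blast
    qed
    ultimately have "I \<longlonglongrightarrow> of_real (a m)"
      using ext[of I "\<lambda>N. integral {- real N..real N + 1} G"] by metis
    then have "J = of_real (a m)" using IJ(3) LIMSEQ_unique by blast
    then show ?thesis using IJ(2) by (simp add: integral_unique)
  qed
  moreover have "integral {0..1} (\<lambda>x. H x * ec m x) = of_real (a (- m))" for m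
  proof -
    have "uniform_limit {0..1} (\<lambda>X x. (\<Sum>n\<in>X. of_real (a n) * ec n x) * ec m x) (\<lambda>x. H x * ec m x) (finite_subsets_at_top UNIV)"
      by (rule uniform_lim_mult[OF uH uniform_limit_const])
         (auto intro!: compact_imp_bounded compact_continuous_image cH ec_continuous)
    then obtain I J where IJ: "\<And>X. ((\<lambda>x. (\<Sum>n\<in>X. of_real (a n) * ec n x) * ec m x) has_integral I X) {0..1}"
        "((\<lambda>x. H x * ec m x) has_integral J) {0..1}" "(I \<longlongrightarrow> J) (finite_subsets_at_top UNIV)"
      by (rule uniform_limit_integral) (auto intro!: continuous_intros)
    have I: "I X = (\<Sum>n\<in>X. if n = - m then of_real (a n) else 0)" if "finite X" for X
    proof -
      have "I X = integral {0..1} (\<lambda>x. \<Sum>n\<in>X. of_real (a n) * ec (n + m) x)"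
        using integral_unique[OF IJ(1)[of X]] by (simp add: sum_distrib_right ec_add mult.assoc)
      also have "\<dots> = (\<Sum>n\<in>X. integral {0..1} (\<lambda>x. of_real (a n) * ec (n + m) x))"
        using that by (intro integral_sum integrable_continuous_real continuous_intros)
      also have "\<dots> = (\<Sum>n\<in>X. if n = - m then of_real (a n) else 0)"
        by (intro sum.cong refl) (auto simp: integral_ec add_eq_0_iff2)
      finally show ?thesis .
    qed
    have "((\<lambda>n. if n = - m then of_real (a n) else 0) has_sum J) UNIV"
      unfolding has_sum_def
      by (rule Lim_transform_eventually[OF IJ(3)]) (use I in \<open>auto simp: eventually_finite_subsets_at_top_weakI\<close>)
    moreover have "((\<lambda>n. if n = - m then complex_of_real (a n) else 0) has_sum of_real (a (- m))) UNIV"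
      by (rule iffD1[OF has_sum_cong_neutral has_sum_finiteI[of "{- m}" _ "\<lambda>n. of_real (a n)"]]) auto
    ultimately have "J = of_real (a (- m))" by (rule has_sum_unique)
    then show ?thesis using IJ(2) by (simp add: integral_unique)
  qed
  moreover have "a (- m) = a m" for m by (simp add: a_def)
  ultimately have "integral {0..1} (\<lambda>x. (F x - H x) * ec m x) = 0" for m
    using integral_diff[of "\<lambda>x. F x * ec m x" "{0..1}" "\<lambda>x. H x * ec m x"] cF cH
    by (simp add: left_diff_distrib integrable_continuous_real continuous_on_mult ec_continuous)
  then have "\<forall>x\<in>{0..1}. F x - H x = 0"
    by (intro fourier_coeffs_zero_imp_zero continuous_intros cF cH) (simp_all add: F01 H01)
  then show ?thesis using x by (simp add: F_def H_def a_def)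
qed

lemma Re_minus_i_pos: "Im \<tau> > 0 \<Longrightarrow> - \<i> * \<tau> \<notin> \<real>\<^sub>\<le>\<^sub>0"
  by (auto simp: complex_nonpos_Reals_iff)

text \<open>Both sides are holomorphic in \<open>\<tau>\<close> and agree on the imaginary
  axis.\<close>

theorem theta_inversion:
  fixes x :: real
  assumes \<tau>: "Im \<tau> > 0" and x: "x \<in> {0..1}"
  shows "(\<Sum>\<^sub>\<infinity>n::int. exp (of_real pi * \<i> * \<tau> * of_real ((of_int n + x)\<^sup>2))) =
    1 / csqrt (- \<i> * \<tau>) * (\<Sum>\<^sub>\<infinity>m::int. ec m x * exp (of_real pi * \<i> * (- 1 / \<tau>) * of_real ((of_int m)\<^sup>2)))"
proof -
  define f where "f = (\<lambda>\<tau>. \<Sum>\<^sub>\<infinity>n::int. 1 * exp (of_real pi * \<i> * \<tau> * of_real ((of_int n + x)\<^sup>2)))"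
  define g where "g = (\<lambda>\<tau>. \<Sum>\<^sub>\<infinity>m::int. ec m x * exp (of_real pi * \<i> * \<tau> * of_real ((of_int m)\<^sup>2)))"
  define H where "H = {\<tau>. Im \<tau> > 0}"
  have f: "f holomorphic_on H" unfolding f_def H_def
    by (rule theta_series_holomorphic[where C = 1 and \<kappa> = "1/2" and b = 1])
       (use square_lower_bound[of x 1] x in auto)
  have g: "g holomorphic_on H" unfolding g_def H_def
    by (rule theta_series_holomorphic[where C = 1 and \<kappa> = 1 and b = 0]) (use abs_int_le_square in auto)
  have inv: "(\<lambda>\<tau>. - 1 / \<tau>) holomorphic_on H"
    by (intro holomorphic_intros) (auto simp: H_def)
  have "g \<circ> (\<lambda>\<tau>. - 1 / \<tau>) holomorphic_on H"
  proof (rule holomorphic_on_compose_gen[OF inv g])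
    show "(\<lambda>\<tau>. - 1 / \<tau>) ` H \<subseteq> H"
    proof (rule image_subsetI)
      fix w assume "w \<in> H"
      then have "Im w > 0" "w \<noteq> 0" by (auto simp: H_def)
      then show "- 1 / w \<in> H" by (simp add: H_def Im_divide cmod_power2[symmetric])
    qed
  qed
  then have hol: "(\<lambda>\<tau>. f \<tau> - 1 / csqrt (- \<i> * \<tau>) * g (- 1 / \<tau>)) holomorphic_on H"
    using Re_minus_i_pos by (intro holomorphic_intros f) (auto simp: H_def o_def)
  have "f \<tau> - 1 / csqrt (- \<i> * \<tau>) * g (- 1 / \<tau>) = 0"
  proof (rule analytic_continuation[OF hol])
    show "open H" unfolding H_def by (rule open_halfspace_Im_gt)
    show "connected H" unfolding H_def by (intro convex_connected convex_halfspace_Im_gt)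
    show "(\<lambda>t. \<i> * complex_of_real t) ` {0<..} \<subseteq> H" by (auto simp: H_def)
    show "\<i> \<in> H" by (simp add: H_def)
    show "\<i> islimpt (\<lambda>t. \<i> * complex_of_real t) ` {0<..}"
      unfolding islimpt_approachable
    proof (intro allI impI)
      fix e :: real assume "e > 0"
      have d: "\<i> * complex_of_real (1 + e / 2) \<noteq> \<i>" "dist (\<i> * complex_of_real (1 + e / 2)) \<i> < e"
      proof -
        have "\<i> * complex_of_real (1 + e / 2) - \<i> = \<i> * complex_of_real (e / 2)" by (simp add: algebra_simps)
        moreover have "norm (\<i> * complex_of_real (e / 2)) = e / 2" using \<open>e > 0\<close> by (simp add: norm_mult)
        ultimately show "dist (\<i> * complex_of_real (1 + e / 2)) \<i> < e" using \<open>e > 0\<close> by (simp only: dist_norm)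
        show "\<i> * complex_of_real (1 + e / 2) \<noteq> \<i>" using \<open>e > 0\<close> by (simp add: complex_eq_iff)
      qed
      have "\<i> * complex_of_real (1 + e / 2) \<in> (\<lambda>t. \<i> * complex_of_real t) ` {0<..}"
        using \<open>e > 0\<close> by (intro imageI) simp
      with d show "\<exists>w\<in>(\<lambda>t. \<i> * complex_of_real t) ` {0<..}. w \<noteq> \<i> \<and> dist w \<i> < e"
        by blast
    qed
    show "\<tau> \<in> H" using \<tau> by (simp add: H_def)
    fix w assume "w \<in> (\<lambda>t. \<i> * complex_of_real t) ` {0<..}"
    then obtain t where t: "t > 0" "w = \<i> * complex_of_real t" by auto
    have "f w = (\<Sum>\<^sub>\<infinity>n::int. complex_of_real (exp (- pi * t * (of_int n + x)\<^sup>2)))"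
      unfolding f_def t(2) by (intro infsum_cong) (simp add: exp_of_real[symmetric] mult_ac)
    also have "\<dots> = (\<Sum>\<^sub>\<infinity>m::int. of_real (exp (- pi * of_int m ^ 2 / t) / sqrt t) * ec m x)"
      by (rule poisson_imaginary_axis[OF t(1) x])
    also have "\<dots> = (\<Sum>\<^sub>\<infinity>m::int. 1 / of_real (sqrt t) * (ec m x * exp (of_real pi * \<i> * (- 1 / w) * of_real ((of_int m)\<^sup>2))))"
    proof (intro infsum_cong)
      fix m :: int
      have "of_real pi * \<i> * (- 1 / w) * of_real ((of_int m)\<^sup>2) = complex_of_real (- pi * of_int m ^ 2 / t)"
        using t by (simp add: field_simps)
      then show "of_real (exp (- pi * of_int m ^ 2 / t) / sqrt t) * ec m x =
          1 / of_real (sqrt t) * (ec m x * exp (of_real pi * \<i> * (- 1 / w) * of_real ((of_int m)\<^sup>2)))"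
        by (simp only: exp_of_real) simp
    qed
    also have "\<dots> = 1 / of_real (sqrt t) * g (- 1 / w)"
      by (simp only: g_def infsum_cmult_right')
    also have "of_real (sqrt t) = csqrt (- \<i> * w)"
    proof -
      have "- \<i> * w = complex_of_real t" by (simp add: t(2))
      then show ?thesis using t by (simp add: csqrt_of_real)
    qed
    finally show "f w - 1 / csqrt (- \<i> * w) * g (- 1 / w) = 0" by simp
  qed
  then show ?thesis by (simp add: f_def g_def)
qed

lemma csqrt_scale:
  assumes r: "r > 0"
  shows "csqrt (of_real r * x) = of_real (sqrt r) * csqrt x"
proof (rule csqrt_unique)
  show "(of_real (sqrt r) * csqrt x)\<^sup>2 = of_real r * x"
    using r by (simp add: power_mult_distrib of_real_power[symmetric] del: of_real_power)
  show "0 < Re (of_real (sqrt r) * csqrt x) \<or> Re (of_real (sqrt r) * csqrt x) = 0 \<and> 0 \<le> Im (of_real (sqrt r) * csqrt x)"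
    using csqrt_principal[of x] r by (auto simp: zero_less_mult_iff)
qed

text \<open>A unary theta series with periodic coefficients \<open>f\<close>.\<close>

definition th :: "(int \<Rightarrow> complex) \<Rightarrow> real \<Rightarrow> complex \<Rightarrow> complex" where
  "th f \<alpha> z = (\<Sum>\<^sub>\<infinity>n. f n * exp (2 * of_real pi * \<i> * z * of_real (\<alpha> * (of_int n)\<^sup>2)))"

lemma periodic_bounded:
  fixes f :: "int \<Rightarrow> complex"
  assumes "\<And>n. f (n + M) = f n" "M > 0"
  shows "norm (f n) \<le> (\<Sum>r\<in>{0..<M}. norm (f r))"
proof -
  have "f n = f (n mod M)"
  proof -
    have n: "f (x + M * int k) = f x" for k x
    proof (induction k)
      case (Suc k) then show ?case using assms(1)[of "x + M * int k"] by (simp add: algebra_simps)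
    qed auto
    have "f (x + M * k) = f x" for x k
      using n[of x "nat k"] n[of "x + M * k" "nat (- k)"] by (cases "k \<ge> 0") auto
    from this[of "n mod M" "n div M"] show ?thesis by simp
  qed
  also have "norm (f (n mod M)) \<le> (\<Sum>r\<in>{0..<M}. norm (f r))"
    using assms(2) by (intro member_le_sum) auto
  finally show ?thesis by simp
qed

lemma th_props:
  assumes per: "\<And>n. f (n + M) = f n" "M > 0" and \<alpha>: "\<alpha> > 0"
  shows "th f \<alpha> holomorphic_on {z. Im z > 0}"
    and "\<And>z. Im z > 0 \<Longrightarrow> (\<lambda>n. f n * exp (2 * of_real pi * \<i> * z * of_real (\<alpha> * (of_int n)\<^sup>2))) summable_on UNIV"
proof -
  have e: "exp (2 * of_real pi * \<i> * z * of_real (\<alpha> * (of_int n)\<^sup>2)) = exp (of_real pi * \<i> * z * of_real (2 * \<alpha> * (of_int n)\<^sup>2))" for z n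
    by (simp add: mult_ac)
  have l: "2 * \<alpha> * (of_int n)\<^sup>2 \<ge> (2 * \<alpha>) * \<bar>of_int n\<bar> - 0" for n
    using abs_int_le_square[of n] \<alpha> by (simp add: mult_left_mono)
  note * = theta_series_holomorphic[of f "\<Sum>r\<in>{0..<M}. norm (f r)" "2 * \<alpha>" 0 "\<lambda>n. 2 * \<alpha> * (of_int n)\<^sup>2", OF periodic_bounded[of f M, OF per] l]
  show "th f \<alpha> holomorphic_on {z. Im z > 0}" unfolding th_def[abs_def] e by (rule *) (use \<alpha> in auto)
  show "(\<lambda>n. f n * exp (2 * of_real pi * \<i> * z * of_real (\<alpha> * (of_int n)\<^sup>2))) summable_on UNIV" if "Im z > 0" for z
    unfolding e by (rule *) (use \<alpha> that in auto)
qed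

text \<open>The series splits into residue classes modulo \<open>M\<close>, each of which is a
  shifted theta series.\<close>

theorem twisted_theta_inversion:
  fixes f :: "int \<Rightarrow> complex" and M :: int and \<alpha> :: real
  assumes per: "\<And>n. f (n + M) = f n" and M: "M > 0" and \<alpha>: "\<alpha> > 0" and w: "Im w > 0"
  shows "th f \<alpha> w = 1 / (of_int M * csqrt (- 2 * \<i> * of_real \<alpha> * w)) *
    th (\<lambda>m. \<Sum>r\<in>{0..<M}. f r * exp (2 * of_real pi * \<i> * (of_int (m * r) / of_int M))) (1 / (4 * \<alpha> * of_int M ^ 2)) (- 1 / w)"
proof -
  have w0: "w \<noteq> 0" using w by auto
  define W where "W = 2 * of_real \<alpha> * of_int M ^ 2 * w"
  have ImW: "Im W > 0"
  proof -
    have "W = of_real (2 * \<alpha> * of_int M ^ 2) * w" by (simp add: W_def)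
    then have "Im W = 2 * \<alpha> * of_int M ^ 2 * Im w" by simp
    then show ?thesis using \<alpha> M w by simp
  qed
  have M2: "(of_int M ^ 2 :: real) > 0" using M by simp
  have cs: "csqrt (- \<i> * W) = of_int M * csqrt (- 2 * \<i> * of_real \<alpha> * w)"
  proof -
    have "- \<i> * W = of_real (of_int M ^ 2) * (- 2 * \<i> * of_real \<alpha> * w)" by (simp add: W_def mult_ac)
    then have "csqrt (- \<i> * W) = of_real (sqrt (of_int M ^ 2)) * csqrt (- 2 * \<i> * of_real \<alpha> * w)"
      by (simp only: csqrt_scale[OF M2])
    then show ?thesis using M by simp
  qed
  have pf: "f (M * k + r) = f r" for k r
  proof -
    have n: "f (x + M * int k) = f x" for k x
    proof (induction k)
      case (Suc k) then show ?case using per[of "x + M * int k"] by (simp add: algebra_simps)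
    qed auto
    show ?thesis
      using n[of r "nat k"] n[of "r + M * k" "nat (- k)"] by (cases "k \<ge> 0") (auto simp: add_ac)
  qed
  have "(\<lambda>n. f n * exp (2 * of_real pi * \<i> * w * of_real (\<alpha> * (of_int n)\<^sup>2))) summable_on UNIV"
    by (rule th_props(2)[of f M \<alpha> w, OF per M \<alpha> w])
  then have "((\<lambda>n. f n * exp (2 * of_real pi * \<i> * w * of_real (\<alpha> * (of_int n)\<^sup>2))) has_sum th f \<alpha> w) UNIV"
    unfolding th_def by simp
  from has_sum_int_blocks_general[OF this M]
  have 1: "((\<lambda>k. \<Sum>r\<in>{0..<M}. f (M * k + r) * exp (2 * of_real pi * \<i> * w * of_real (\<alpha> * (of_int (M * k + r))\<^sup>2))) has_sum th f \<alpha> w) UNIV" .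
  have e1: "exp (2 * of_real pi * \<i> * w * of_real (\<alpha> * (of_int (M * k + r))\<^sup>2)) = exp (of_real pi * \<i> * W * of_real ((of_int k + of_int r / of_int M)\<^sup>2))" for k r
  proof (rule arg_cong[of _ _ exp])
    have "real_of_int (M * k + r) = of_int M * (of_int k + of_int r / of_int M)" using M by (simp add: field_simps)
    then have "\<alpha> * (of_int (M * k + r))\<^sup>2 = \<alpha> * of_int M ^ 2 * (of_int k + of_int r / of_int M)\<^sup>2"
      by (simp add: power_mult_distrib)
    then show "2 * of_real pi * \<i> * w * of_real (\<alpha> * (of_int (M * k + r))\<^sup>2) = of_real pi * \<i> * W * of_real ((of_int k + of_int r / of_int M)\<^sup>2)"
      by (simp only:) (simp add: W_def mult_ac)
  qed
  have e2: "exp (of_real pi * \<i> * (- 1 / W) * of_real ((of_int m)\<^sup>2)) = exp (2 * of_real pi * \<i> * (- 1 / w) * of_real (1 / (4 * \<alpha> * of_int M ^ 2) * (of_int m)\<^sup>2))" for m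
    by (rule arg_cong[of _ _ exp]) (use M \<alpha> w0 in \<open>simp add: W_def field_simps\<close>)
  have sr: "((\<lambda>k. exp (of_real pi * \<i> * W * of_real ((of_int k + x)\<^sup>2))) has_sum
      1 / csqrt (- \<i> * W) * (\<Sum>\<^sub>\<infinity>m::int. ec m x * exp (of_real pi * \<i> * (- 1 / W) * of_real ((of_int m)\<^sup>2)))) (UNIV :: int set)"
    if x: "x \<in> {0..1}" for x
  proof -
    have "(\<lambda>k. 1 * exp (of_real pi * \<i> * W * of_real ((of_int k + x)\<^sup>2))) summable_on (UNIV :: int set)"
      by (rule theta_series_holomorphic(2)[where C = 1 and \<kappa> = "1/2" and b = 1])
         (use square_lower_bound[of x 1] x ImW in auto)
    then show ?thesis unfolding theta_inversion[OF ImW x, symmetric] by simp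
  qed
  have ImW': "Im (- 1 / W) > 0"
  proof -
    have "W \<noteq> 0" using ImW by auto
    then show ?thesis using ImW by (simp add: Im_divide cmod_power2[symmetric])
  qed
  have sm: "((\<lambda>m. ec m x * exp (of_real pi * \<i> * (- 1 / W) * of_real ((of_int m)\<^sup>2))) has_sum
      (\<Sum>\<^sub>\<infinity>m::int. ec m x * exp (of_real pi * \<i> * (- 1 / W) * of_real ((of_int m)\<^sup>2)))) UNIV" for x
    by (intro has_sum_infsum theta_series_holomorphic(2)[where C = 1 and \<kappa> = 1 and b = 0])
       (use abs_int_le_square ImW' in auto)
  have "((\<lambda>k. \<Sum>r\<in>{0..<M}. f r * exp (of_real pi * \<i> * W * of_real ((of_int k + of_int r / of_int M)\<^sup>2))) has_sum
     (\<Sum>r\<in>{0..<M}. f r * (1 / csqrt (- \<i> * W) * (\<Sum>\<^sub>\<infinity>m::int. ec m (of_int r / of_int M) * exp (of_real pi * \<i> * (- 1 / W) * of_real ((of_int m)\<^sup>2)))))) UNIV"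
    by (intro has_sum_sum has_sum_cmult_right sr) (use M in auto)
  then have "th f \<alpha> w = (\<Sum>r\<in>{0..<M}. f r * (1 / csqrt (- \<i> * W) * (\<Sum>\<^sub>\<infinity>m::int. ec m (of_int r / of_int M) * exp (of_real pi * \<i> * (- 1 / W) * of_real ((of_int m)\<^sup>2)))))"
    using has_sum_unique 1 unfolding pf e1 by blast
  also have "\<dots> = 1 / csqrt (- \<i> * W) * (\<Sum>r\<in>{0..<M}. f r * (\<Sum>\<^sub>\<infinity>m::int. ec m (of_int r / of_int M) * exp (of_real pi * \<i> * (- 1 / W) * of_real ((of_int m)\<^sup>2))))"
    by (simp add: sum_distrib_left mult_ac)
  also have "(\<Sum>r\<in>{0..<M}. f r * (\<Sum>\<^sub>\<infinity>m::int. ec m (of_int r / of_int M) * exp (of_real pi * \<i> * (- 1 / W) * of_real ((of_int m)\<^sup>2)))) =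
     th (\<lambda>m. \<Sum>r\<in>{0..<M}. f r * exp (2 * of_real pi * \<i> * (of_int (m * r) / of_int M))) (1 / (4 * \<alpha> * of_int M ^ 2)) (- 1 / w)"
    unfolding th_def
  proof (rule infsumI[symmetric])
    have "((\<lambda>m. \<Sum>r\<in>{0..<M}. f r * (ec m (of_int r / of_int M) * exp (of_real pi * \<i> * (- 1 / W) * of_real ((of_int m)\<^sup>2)))) has_sum
       (\<Sum>r\<in>{0..<M}. f r * (\<Sum>\<^sub>\<infinity>m::int. ec m (of_int r / of_int M) * exp (of_real pi * \<i> * (- 1 / W) * of_real ((of_int m)\<^sup>2))))) UNIV"
      by (intro has_sum_sum has_sum_cmult_right sm) auto
    then show "((\<lambda>n. (\<Sum>r\<in>{0..<M}. f r * exp (2 * of_real pi * \<i> * (of_int (n * r) / of_int M))) * exp (2 * of_real pi * \<i> * (- 1 / w) * of_real (1 / (4 * \<alpha> * of_int M ^ 2) * (of_int n)\<^sup>2))) has_sum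
       (\<Sum>r\<in>{0..<M}. f r * (\<Sum>\<^sub>\<infinity>m::int. ec m (of_int r / of_int M) * exp (of_real pi * \<i> * (- 1 / W) * of_real ((of_int m)\<^sup>2))))) UNIV"
      unfolding e2 by (simp add: sum_distrib_right ec_def mult_ac)
  qed
  finally show ?thesis unfolding cs .
qed

section \<open>Finite Fourier transforms of quadratic phases\<close>

text \<open>Completing the square.\<close>

lemma gs_linear:
  assumes d: "d > 0" and x: "[2 * u * x = m] (mod d)"
  shows "(\<Sum>t\<in>{0..<d}. ep (u * t\<^sup>2 + m * t) d) = ep (- u * x\<^sup>2) d * gs u d"
proof -
  have "(\<Sum>t\<in>{0..<d}. ep (u * (1 * t + x)\<^sup>2) d) = gs u d"
    unfolding gs_def
  proof (rule sum_periodic_affine[of "\<lambda>t. ep (u * t\<^sup>2) d"])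
    show "ep (u * (t + d)\<^sup>2) d = ep (u * t\<^sup>2) d" for t
      using d by (intro ep_cong cong_mult cong_pow) (auto simp: cong_def)
  qed (use d in auto)
  moreover have "ep (u * t\<^sup>2 + m * t) d = ep (- u * x\<^sup>2) d * ep (u * (1 * t + x)\<^sup>2) d" for t
  proof -
    have "[u * t\<^sup>2 + m * t = u * t\<^sup>2 + (2 * u * x) * t] (mod d)"
      by (intro cong_add cong_mult cong_refl cong_sym[OF x])
    also have "u * t\<^sup>2 + (2 * u * x) * t = - u * x\<^sup>2 + u * (1 * t + x)\<^sup>2"
      by (simp add: power2_eq_square algebra_simps)
    finally have "ep (u * t\<^sup>2 + m * t) d = ep (- u * x\<^sup>2 + u * (1 * t + x)\<^sup>2) d"
      by (rule ep_cong) (use d in simp)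
    then show ?thesis by (simp only: ep_add)
  qed
  ultimately show ?thesis by (simp add: sum_distrib_left[symmetric])
qed

definition dft :: "int \<Rightarrow> (int \<Rightarrow> complex) \<Rightarrow> int \<Rightarrow> complex" where
  "dft M f m = (\<Sum>r\<in>{0..<M}. f r * ep (m * r) M)"

text \<open>The arithmetic core of the transformation law. The index is written as \<open>d * v +
  M * t\<close>: the mixed terms of the quadratic phase are integral, so the transform splits into
  one modulo \<open>M\<close>, evaluated by the hypothesis on \<open>\<kappa>1\<close>, and a
  Gauss sum modulo \<open>d\<close> with a linear term. Completing the square there leaves the
  phase \<open>e(- m\<^sup>2 * c * h / D)\<close> with \<open>h\<close> inverse to
  \<open>d\<close> modulo \<open>D\<close>. Since squares of units modulo 24 are 1,
  \<open>h\<close> may be replaced by \<open>d\<close>, and the hypothesis on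
  \<open>\<kappa>2\<close> applies.\<close>

lemma dft_quadratic_twist:
  fixes f :: "int \<Rightarrow> complex" and p Q M A D E e0 a b c d :: int
  assumes per: "\<And>n. f (n + M) = f n" and M: "M > 0" "M dvd 24" and Q: "Q > 0"
    and e0: "2 * p * M = e0 * Q" and A: "p * M\<^sup>2 = A * Q" "A > 0"
    and D: "D = 4 * A" and E: "E dvd D" "E dvd 24" "D dvd 24 * E"
    and det: "a * d - b * c = 1" and c: "24 dvd c" and d: "d > 0"
    and k1: "\<And>n. f (d * n) * ep (p * b * d * n\<^sup>2) Q = \<kappa>1 * f n"
    and k2: "\<And>m. dft M f m * ep (- m\<^sup>2 * c * d) D = \<kappa>2 * dft M f m"
  shows "dft (d * M) (\<lambda>n. f n * ep (p * b * n\<^sup>2) (Q * d)) m * ep (- m\<^sup>2 * c) (D * d) = \<kappa>1 * \<kappa>2 * gs (A * b) d * dft M f m"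
proof -
  have d24: "coprime d 24"
  proof (rule coprimeI)
    fix g assume g: "g dvd d" "g dvd 24"
    then have "g dvd a * d - b * c" using c by (meson dvd_diff dvd_mult dvd_trans)
    then show "is_unit g" using det by simp
  qed
  have dM: "coprime d M" by (rule coprime_divisors[OF dvd_refl M(2) d24])
  have dD: "coprime d D"
  proof -
    have "coprime d (24 * E)"
      using d24 coprime_divisors[OF dvd_refl E(2) d24] by (simp only: coprime_mult_right_iff)
    then show ?thesis by (rule coprime_divisors[OF dvd_refl E(3)])
  qed
  have D0: "D > 0" using D A by simp
  have Qd: "Q * d \<noteq> 0" using Q d by simp
  let ?F = "\<lambda>n. f n * ep (p * b * n\<^sup>2) (Q * d)"
  have e1: "ep (p * b * (d * v + M * t)\<^sup>2) (Q * d) = ep (p * b * d * v\<^sup>2) Q * ep (A * b * t\<^sup>2) d" for v t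
  proof -
    have "p * b * (d * v + M * t)\<^sup>2 = d * (p * b * d * v\<^sup>2) + (2 * p * M) * (b * d * v * t) + (p * M\<^sup>2) * (b * t\<^sup>2)"
      by (simp add: power2_eq_square algebra_simps)
    also have "\<dots> = d * (p * b * d * v\<^sup>2) + (Q * d) * (e0 * b * v * t) + Q * (A * b * t\<^sup>2)"
      unfolding e0 A by (simp add: algebra_simps)
    finally show ?thesis
      using ep_cancel[of d "p * b * d * v\<^sup>2" Q] ep_cancel[of Q "A * b * t\<^sup>2" d] Q d Qd
      by (simp add: ep_add mult.commute[of d Q])
  qed
  have e2: "ep (m * (d * v + M * t)) (d * M) = ep (m * v) M * ep (m * t) d" for v t
    using ep_cancel[of d "m * v" M] ep_cancel[of M "m * t" d] M d by (simp add: distrib_left ep_add mult_ac)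
  have fM: "f (x + M * t) = f x" for x t
    using periodic_mod[of f M "x + M * t", OF per] periodic_mod[of f M x, OF per] by simp
  have "dft (d * M) ?F m = (\<Sum>v\<in>{0..<M}. \<Sum>t\<in>{0..<d}. ?F (d * v + M * t) * ep (m * (d * v + M * t)) (d * M))"
    unfolding dft_def
  proof (rule sum_periodic_crt)
    fix x
    have "f (x + d * M) = f x" using fM[of x d] by (simp add: mult.commute)
    moreover have "ep (p * b * (x + d * M)\<^sup>2) (Q * d) = ep (p * b * x\<^sup>2) (Q * d)"
    proof -
      have "p * b * (x + d * M)\<^sup>2 = p * b * x\<^sup>2 + (2 * p * M) * (b * d * x) + (p * M\<^sup>2) * (b * d\<^sup>2)"
        by (simp add: power2_eq_square algebra_simps)
      also have "\<dots> = p * b * x\<^sup>2 + (Q * d) * (e0 * b * x + A * b * d)"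
        unfolding e0 A by (simp add: power2_eq_square algebra_simps)
      finally show ?thesis using Qd by (simp add: ep_add)
    qed
    moreover have "ep (m * (x + d * M)) (d * M) = ep (m * x) (d * M)"
    proof -
      have "m * (x + d * M) = m * x + (d * M) * m" by (simp add: algebra_simps)
      then have "ep (m * (x + d * M)) (d * M) = ep (m * x) (d * M) * ep (d * M * m) (d * M)" by (simp only: ep_add)
      then show ?thesis using d M(1) ep_mult_self[of "d * M" m] by simp
    qed
    ultimately show "?F (x + d * M) * ep (m * (x + d * M)) (d * M) = ?F x * ep (m * x) (d * M)" by simp
  qed (use d M dM in auto)
  also have "\<dots> = (\<Sum>v\<in>{0..<M}. \<Sum>t\<in>{0..<d}. (\<kappa>1 * (f v * ep (m * v) M)) * ep (A * b * t\<^sup>2 + m * t) d)"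
  proof (intro sum.cong refl)
    fix v t
    have "?F (d * v + M * t) * ep (m * (d * v + M * t)) (d * M) =
       (f (d * v) * ep (p * b * d * v\<^sup>2) Q) * ep (m * v) M * (ep (A * b * t\<^sup>2) d * ep (m * t) d)"
      unfolding e1 e2 fM by (simp only: mult_ac)
    then show "?F (d * v + M * t) * ep (m * (d * v + M * t)) (d * M) = (\<kappa>1 * (f v * ep (m * v) M)) * ep (A * b * t\<^sup>2 + m * t) d"
      unfolding k1 by (simp add: ep_add mult_ac)
  qed
  also have "\<dots> = \<kappa>1 * dft M f m * (\<Sum>t\<in>{0..<d}. ep (A * b * t\<^sup>2 + m * t) d)"
    unfolding dft_def sum_distrib_left[of \<kappa>1] sum_product ..
  finally have S: "dft (d * M) ?F m = \<kappa>1 * dft M f m * (\<Sum>t\<in>{0..<d}. ep (A * b * t\<^sup>2 + m * t) d)" .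
  \<comment> \<open>\<open>x\<close> solves the linear congruence of the completed square, because \<open>- c\<close> is inverse to \<open>b\<close> modulo \<open>d\<close>\<close>
  obtain \<iota> where "[D * \<iota> = 1] (mod d)" using cong_solve_coprime_int[of D d] dD by (auto simp: coprime_commute)
  then obtain s where s: "D * \<iota> = 1 + d * s" by (metis cong_iff_lin cong_sym)
  define x where "x = - 2 * c * \<iota> * m"
  have "2 * (A * b) * x = m - d * (m * (a * d * s + a - s))"
  proof -
    have "2 * (A * b) * x = - (D * \<iota>) * (b * c) * m" unfolding x_def D by (simp add: algebra_simps)
    also have "\<dots> = - (1 + d * s) * (a * d - 1) * m" using s det by (simp add: algebra_simps)
    also have "\<dots> = m - d * (m * (a * d * s + a - s))" by (simp add: algebra_simps)
    finally show ?thesis .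
  qed
  then have "[2 * (A * b) * x = m] (mod d)" by (simp add: cong_iff_dvd_diff)
  from gs_linear[OF d this] have G: "(\<Sum>t\<in>{0..<d}. ep (A * b * t\<^sup>2 + m * t) d) = ep (- (A * b) * x\<^sup>2) d * gs (A * b) d" .
  have ph: "ep (- (A * b) * x\<^sup>2) d * ep (- m\<^sup>2 * c) (D * d) = ep (- m\<^sup>2 * c * d) D"
  proof -
    define h where "h = a * (1 + d * s)\<^sup>2 - 2 * s - d * s\<^sup>2"
    have "D * (A * b) * x\<^sup>2 = b * c * (c * m\<^sup>2) * (D * \<iota>)\<^sup>2"
      unfolding x_def D by (simp add: power2_eq_square algebra_simps)
    also have "\<dots> = (a * d - 1) * (c * m\<^sup>2) * (1 + d * s)\<^sup>2" using s det by (simp add: algebra_simps)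
    finally have 1: "D * (A * b) * x\<^sup>2 + m\<^sup>2 * c = d * (m\<^sup>2 * c * h)"
      unfolding h_def by (simp add: power2_eq_square algebra_simps)
    have "ep (- (A * b) * x\<^sup>2) d * ep (- m\<^sup>2 * c) (D * d) = ep (D * (- (A * b) * x\<^sup>2)) (D * d) * ep (- m\<^sup>2 * c) (D * d)"
      using D0 by (subst ep_cancel) auto
    also have "\<dots> = ep (- (D * (A * b) * x\<^sup>2 + m\<^sup>2 * c)) (D * d)"
      unfolding ep_add[symmetric] by (simp add: algebra_simps)
    also have "\<dots> = ep (d * (- (m\<^sup>2 * c * h))) (d * D)" unfolding 1 by (simp add: mult.commute)
    also have "\<dots> = ep (- (m\<^sup>2 * c * h)) D" using d by (subst ep_cancel) auto
    also have "\<dots> = ep (- m\<^sup>2 * c * d) D"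
    proof (rule ep_cong)
      have "D dvd 1 + d * s" using s by (metis dvd_triv_left)
      then obtain j where j: "1 + d * s = D * j" by (elim dvdE)
      have "h * d - 1 = a * d * (D * j)\<^sup>2 - (D * j)\<^sup>2"
        unfolding h_def j[symmetric] by (simp add: power2_eq_square algebra_simps)
      then have "E dvd h * d - 1" using E(1) by (simp add: power2_eq_square dvd_mult2 dvd_diff)
      moreover have "24 dvd d\<^sup>2 - 1"
      proof -
        have "d mod 24 = 1 \<or> d mod 24 = 5 \<or> d mod 24 = 7 \<or> d mod 24 = 11 \<or> d mod 24 = 13 \<or> d mod 24 = 17 \<or> d mod 24 = 19 \<or> d mod 24 = 23"
        proof -
          have "odd d" "\<not> 3 dvd d" using coprime_common_divisor[OF d24, of 2] coprime_common_divisor[OF d24, of 3] by auto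
          then show ?thesis by presburger
        qed
        then have "(d mod 24)\<^sup>2 mod 24 = 1" by (elim disjE) simp_all
        then have "d\<^sup>2 mod 24 = 1 mod 24" by (simp add: power_mod)
        then show ?thesis by (simp only: mod_eq_dvd_iff)
      qed
      ultimately have "E dvd h * (d\<^sup>2 - 1) - d * (h * d - 1)" using E(2) by (meson dvd_diff dvd_mult dvd_trans)
      then have "E dvd d - h" by (simp add: power2_eq_square algebra_simps)
      then have "24 * E dvd c * (d - h)" using c by (rule mult_dvd_mono[rotated])
      then have "D dvd m\<^sup>2 * (c * (d - h))" using E(3) by (meson dvd_mult dvd_trans)
      then show "[- (m\<^sup>2 * c * h) = - m\<^sup>2 * c * d] (mod D)" by (simp add: cong_iff_dvd_diff algebra_simps)
    qed (use D0 in simp)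
    finally show ?thesis .
  qed
  have "dft (d * M) ?F m * ep (- m\<^sup>2 * c) (D * d) = \<kappa>1 * gs (A * b) d * (dft M f m * (ep (- (A * b) * x\<^sup>2) d * ep (- m\<^sup>2 * c) (D * d)))"
    unfolding S G by (simp only: mult_ac)
  also have "\<dots> = \<kappa>1 * gs (A * b) d * (\<kappa>2 * dft M f m)" unfolding ph k2 ..
  finally show ?thesis by (simp only: mult_ac)
qed

section \<open>Theta series under Gamma0(24)\<close>

lemma th_translate:
  assumes "Q > 0" "d > 0"
  shows "th f (of_int p / of_int Q) (of_int b / of_int d + w) = th (\<lambda>n. f n * ep (p * b * n\<^sup>2) (Q * d)) (of_int p / of_int Q) w"
  unfolding th_def
proof (intro infsum_cong)
  fix n :: int
  have "2 * of_real pi * \<i> * (of_int b / of_int d + w) * of_real (of_int p / of_int Q * (of_int n)\<^sup>2) =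
      2 * of_real pi * \<i> * (of_int (p * b * n\<^sup>2) / of_int (Q * d)) + 2 * of_real pi * \<i> * w * of_real (of_int p / of_int Q * (of_int n)\<^sup>2)"
    using assms by (simp add: field_simps)
  then show "f n * exp (2 * of_real pi * \<i> * (of_int b / of_int d + w) * of_real (of_int p / of_int Q * (of_int n)\<^sup>2)) =
      f n * ep (p * b * n\<^sup>2) (Q * d) * exp (2 * of_real pi * \<i> * w * of_real (of_int p / of_int Q * (of_int n)\<^sup>2))"
    by (simp only: exp_add ep_def mult.assoc)
qed

lemma inversion_dft:
  assumes per: "\<And>n. f (n + M) = f n" and M: "M > 0" and \<alpha>: "\<alpha> > 0" and w: "Im w > 0"
  shows "th f \<alpha> w = 1 / (of_int M * csqrt (- 2 * \<i> * of_real \<alpha> * w)) * th (dft M f) (1 / (4 * \<alpha> * of_int M ^ 2)) (- 1 / w)"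
proof -
  have "dft M f = (\<lambda>m. \<Sum>r\<in>{0..<M}. f r * exp (2 * of_real pi * \<i> * (of_int (m * r) / of_int M)))"
    by (simp add: dft_def[abs_def] ep_def)
  then show ?thesis using twisted_theta_inversion[of f M \<alpha> w, OF per M \<alpha> w] by simp
qed

text \<open>The automorphy factor common to all theta series; its fourth power is rational in
  \<open>z\<close>, so that no branch of a square root remains in a product of four
  series.\<close>

definition rho :: "int \<Rightarrow> int \<Rightarrow> complex \<Rightarrow> complex" where
  "rho c d z = csqrt (- \<i> * z) / (of_int d * csqrt (- \<i> * (z / (of_int d * (of_int c * z + of_int d)))))"

text \<open>The point \<open>\<gamma> z\<close> is a rational translate of a point whose negative
  reciprocal is an affine function of \<open>- 1 / z\<close>.\<close>

lemma mob_split: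
  assumes det: "a * d - b * c = 1" and d: "d > 0" and z: "Im z > 0"
  shows "mob a b c d z = of_int b / of_int d + z / (of_int d * (of_int c * z + of_int d))"
    and "Im (z / (of_int d * (of_int c * z + of_int d))) > 0"
proof -
  have nz: "of_int c * z + of_int d \<noteq> 0" by (rule mob_denom_nz[OF det z])
  have dn: "(of_int d :: complex) \<noteq> 0" using d by simp
  have "of_int a * of_int d = (1 + of_int b * of_int c :: complex)"
    using arg_cong[OF det, of "of_int :: int \<Rightarrow> complex"] by (simp add: algebra_simps)
  then have e: "(of_int a * z + of_int b) * of_int d = of_int b * (of_int c * z + of_int d) + z"
    by (simp add: algebra_simps)
  show 1: "mob a b c d z = of_int b / of_int d + z / (of_int d * (of_int c * z + of_int d))"
  proof -
    have "of_int b / of_int d + z / (of_int d * (of_int c * z + of_int d)) = (of_int b * (of_int c * z + of_int d) + z) / (of_int d * (of_int c * z + of_int d))"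
      using nz dn by (simp add: add_divide_distrib)
    also have "\<dots> = mob a b c d z" unfolding e[symmetric] mob_def using nz dn by simp
    finally show ?thesis ..
  qed
  have "Im (of_int b / of_int d :: complex) = 0" by (metis Im_complex_of_real of_real_divide of_real_of_int_eq)
  then show "Im (z / (of_int d * (of_int c * z + of_int d))) > 0"
    using Im_mob_pos[OF det z] unfolding 1 by simp
qed

lemma rho_pow4:
  assumes det: "a * d - b * c = 1" and d: "d > 0" and z: "Im z > 0"
  shows "rho c d z ^ 4 * of_int d ^ 2 = (of_int c * z + of_int d)\<^sup>2"
proof -
  have nz: "of_int c * z + of_int d \<noteq> 0" by (rule mob_denom_nz[OF det z])
  have dn: "(of_int d :: complex) \<noteq> 0" using d by simp
  have z0: "z \<noteq> 0" using z by auto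
  have c4: "csqrt x ^ 4 = x\<^sup>2" for x
  proof -
    have "csqrt x ^ 4 = (csqrt x ^ 2)\<^sup>2" by (simp only: power_mult[symmetric]) simp
    then show ?thesis by (simp only: power2_csqrt)
  qed
  have "rho c d z ^ 4 = z\<^sup>2 / (of_int d ^ 4 * (z / (of_int d * (of_int c * z + of_int d)))\<^sup>2)"
    unfolding rho_def power_divide power_mult_distrib c4 by simp
  also have "\<dots> = (of_int c * z + of_int d)\<^sup>2 / of_int d ^ 2"
    using nz dn z0 by (simp add: power_divide power_mult_distrib) (simp add: numeral_eq_Suc field_simps)
  finally show ?thesis using dn by simp
qed

text \<open>Inversion is applied to the translated series at \<open>z / (d * (c * z + d))\<close>
  and to the original series at \<open>z\<close>; on the other side both are series in \<open>- 1
  / z\<close>, with coefficients that \<open>dft_quadratic_twist\<close> compares.\<close>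

lemma theta_gamma0:
  fixes f :: "int \<Rightarrow> complex" and p Q M A D E e0 a b c d :: int
  assumes per: "\<And>n. f (n + M) = f n" and M: "M > 0" "M dvd 24" and Q: "Q > 0" "p > 0"
    and e0: "2 * p * M = e0 * Q" and A: "p * M\<^sup>2 = A * Q"
    and D: "D = 4 * A" and E: "E dvd D" "E dvd 24" "D dvd 24 * E"
    and det: "a * d - b * c = 1" and c: "24 dvd c" and d: "d > 0"
    and k1: "\<And>n. f (d * n) * ep (p * b * d * n\<^sup>2) Q = \<kappa>1 * f n"
    and k2: "\<And>m. dft M f m * ep (- m\<^sup>2 * c * d) D = \<kappa>2 * dft M f m"
    and z: "Im z > 0"
  shows "th f (of_int p / of_int Q) (mob a b c d z) = \<kappa>1 * \<kappa>2 * gs (A * b) d * rho c d z * th f (of_int p / of_int Q) z"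
proof -
  define \<alpha> where "\<alpha> = (of_int p / of_int Q :: real)"
  have \<alpha>: "\<alpha> > 0" using Q by (simp add: \<alpha>_def)
  define w where "w = z / (of_int d * (of_int c * z + of_int d))"
  have w: "Im w > 0" and mw: "mob a b c d z = of_int b / of_int d + w"
    unfolding w_def using mob_split[OF det d z] by auto
  have z0: "z \<noteq> 0" using z by auto
  have w0: "w \<noteq> 0" using w by auto
  have nz: "of_int c * z + of_int d \<noteq> 0" by (rule mob_denom_nz[OF det z])
  have dn: "(of_int d :: complex) \<noteq> 0" using d by simp
  have "A * Q > 0" using A M Q by (metis zero_less_mult_iff zero_less_power)
  then have A0: "A > 0" using Q by (simp add: zero_less_mult_iff)
  then have D0: "D > 0" using D by simp
  define F where "F = (\<lambda>n. f n * ep (p * b * n\<^sup>2) (Q * d))"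
  define K where "K = \<kappa>1 * \<kappa>2 * gs (A * b) d"
  have aM: "4 * \<alpha> * of_int M ^ 2 = of_int D"
  proof -
    have "of_int p * of_int M ^ 2 = (of_int A * of_int Q :: real)"
      using arg_cong[OF A, of "of_int :: int \<Rightarrow> real"] by simp
    then show ?thesis using Q by (simp add: \<alpha>_def D field_simps)
  qed
  have perF: "F (n + d * M) = F n" for n
  proof -
    have "f (n + M * d) = f n"
      using periodic_mod[of f M "n + M * d", OF per] periodic_mod[of f M n, OF per] by simp
    moreover have "p * b * (n + d * M)\<^sup>2 = p * b * n\<^sup>2 + (Q * d) * (e0 * b * n + A * b * d)"
    proof -
      have "p * b * (n + d * M)\<^sup>2 = p * b * n\<^sup>2 + (2 * p * M) * (b * d * n) + (p * M\<^sup>2) * (b * d\<^sup>2)"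
        by (simp add: power2_eq_square algebra_simps)
      then show ?thesis unfolding e0 A by (simp add: power2_eq_square algebra_simps)
    qed
    ultimately show ?thesis using Q d by (simp add: F_def ep_add mult.commute[of M])
  qed
  have dM: "d * M > 0" using d M by simp
  have dft: "dft (d * M) F m * ep (- m\<^sup>2 * c) (D * d) = K * dft M f m" for m
    unfolding F_def K_def
    by (rule dft_quadratic_twist[where f = f, OF per M Q(1) e0 A A0 D E det c d k1 k2])
  have "th f \<alpha> (mob a b c d z) = th F \<alpha> w"
    unfolding mw \<alpha>_def F_def by (rule th_translate[OF Q(1) d])
  also have "\<dots> = 1 / (of_int (d * M) * csqrt (- 2 * \<i> * of_real \<alpha> * w)) * th (dft (d * M) F) (1 / (4 * \<alpha> * of_int (d * M) ^ 2)) (- 1 / w)"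
    by (rule inversion_dft[of F "d * M" \<alpha> w, OF perF dM \<alpha> w])
  also have "th (dft (d * M) F) (1 / (4 * \<alpha> * of_int (d * M) ^ 2)) (- 1 / w) = K * th (dft M f) (1 / (4 * \<alpha> * of_int M ^ 2)) (- 1 / z)"
  proof -
    have e: "exp (2 * of_real pi * \<i> * (- 1 / w) * of_real (1 / (4 * \<alpha> * of_int (d * M) ^ 2) * (of_int m)\<^sup>2)) =
      ep (- m\<^sup>2 * c) (D * d) * exp (2 * of_real pi * \<i> * (- 1 / z) * of_real (1 / (4 * \<alpha> * of_int M ^ 2) * (of_int m)\<^sup>2))" for m
    proof -
      have "4 * \<alpha> * of_int (d * M) ^ 2 = of_int d ^ 2 * of_int D"
        unfolding aM[symmetric] by (simp add: power_mult_distrib)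
      then have r1: "of_real (1 / (4 * \<alpha> * of_int (d * M) ^ 2) * (of_int m)\<^sup>2) = ((of_int m)\<^sup>2 / (of_int d ^ 2 * of_int D) :: complex)"
        by simp
      have r2: "of_real (1 / (4 * \<alpha> * of_int M ^ 2) * (of_int m)\<^sup>2) = ((of_int m)\<^sup>2 / of_int D :: complex)"
        unfolding aM by simp
      have "- 1 / w = - (of_int c * of_int d) - of_int d ^ 2 / z"
        unfolding w_def using z0 nz dn by (simp add: field_simps power2_eq_square)
      then have "(- 1 / w) * ((of_int m)\<^sup>2 / (of_int d ^ 2 * of_int D)) =
         of_int (- m\<^sup>2 * c) / of_int (D * d) + (- 1 / z) * ((of_int m)\<^sup>2 / of_int D)"
        using z0 dn D0 by (simp only:) (simp add: field_simps power2_eq_square)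
      then have "2 * of_real pi * \<i> * ((- 1 / w) * ((of_int m)\<^sup>2 / (of_int d ^ 2 * of_int D))) =
         2 * of_real pi * \<i> * (of_int (- m\<^sup>2 * c) / of_int (D * d)) + 2 * of_real pi * \<i> * ((- 1 / z) * ((of_int m)\<^sup>2 / of_int D))"
        by (simp only: distrib_left)
      then have "exp (2 * of_real pi * \<i> * ((- 1 / w) * ((of_int m)\<^sup>2 / (of_int d ^ 2 * of_int D)))) =
         ep (- m\<^sup>2 * c) (D * d) * exp (2 * of_real pi * \<i> * ((- 1 / z) * ((of_int m)\<^sup>2 / of_int D)))"
        by (simp only: exp_add ep_def)
      then show ?thesis unfolding r1 r2 by (simp only: mult.assoc)
    qed
    have "dft (d * M) F m * (ep (- m\<^sup>2 * c) (D * d) * x) = K * (dft M f m * x)" for m x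
      using dft[of m] by (simp add: mult.assoc[symmetric])
    then show ?thesis unfolding th_def e by (simp only: infsum_cmult_right')
  qed
  also have "th (dft M f) (1 / (4 * \<alpha> * of_int M ^ 2)) (- 1 / z) = of_int M * csqrt (- 2 * \<i> * of_real \<alpha> * z) * th f \<alpha> z"
  proof -
    have "csqrt (- 2 * \<i> * of_real \<alpha> * z) \<noteq> 0" using z0 \<alpha> by simp
    then show ?thesis using inversion_dft[of f M \<alpha> z, OF per M(1) \<alpha> z] M(1) by simp
  qed
  also have "1 / (of_int (d * M) * csqrt (- 2 * \<i> * of_real \<alpha> * w)) * (K * (of_int M * csqrt (- 2 * \<i> * of_real \<alpha> * z) * th f \<alpha> z)) =
      K * rho c d z * th f \<alpha> z"
  proof -
    have s: "csqrt (- 2 * \<i> * of_real \<alpha> * x) = of_real (sqrt (2 * \<alpha>)) * csqrt (- \<i> * x)" for x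
      using csqrt_scale[of "2 * \<alpha>" "- \<i> * x"] \<alpha> by (simp add: mult_ac)
    have "csqrt (- \<i> * w) \<noteq> 0" "csqrt (- \<i> * z) \<noteq> 0" using w0 z0 by simp_all
    moreover have "complex_of_real (sqrt (2 * \<alpha>)) \<noteq> 0" using \<alpha> by simp
    ultimately show ?thesis
      unfolding s rho_def w_def[symmetric] using dn M(1) by (simp add: field_simps)
  qed
  finally show ?thesis by (simp add: \<alpha>_def K_def)
qed

text \<open>The coefficients of the six theta series that occur in the two eta quotients;
  \<open>c8\<close> is the even character modulo 8.\<close>

definition alt :: "int \<Rightarrow> complex" where "alt n = (if even n then 1 else - 1)"
definition odd_ind :: "int \<Rightarrow> complex" where "odd_ind n = (if even n then 0 else 1)"
definition c8 :: "int \<Rightarrow> complex" where "c8 n = of_int (chi8 n)"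

text \<open>Odd squares are congruent to 1 modulo 8.\<close>

lemma ep_odd_square:
  assumes "odd n" "Q dvd 8 * k" "Q \<noteq> 0"
  shows "ep (k * n\<^sup>2) Q = ep k Q"
proof (rule ep_cong)
  have "8 dvd n\<^sup>2 - 1"
  proof -
    obtain m where m: "n = 2 * m + 1" using assms(1) by (elim oddE)
    have "even (m * (m + 1))" by simp
    then obtain j where "m * (m + 1) = 2 * j" by (elim dvdE)
    then have "n\<^sup>2 - 1 = 8 * j" by (simp add: m power2_eq_square algebra_simps)
    then show ?thesis by simp
  qed
  then have "k * 8 dvd k * (n\<^sup>2 - 1)" by (rule mult_dvd_mono[OF dvd_refl])
  then have "Q dvd k * (n\<^sup>2 - 1)" using assms(2) by (metis dvd_trans mult.commute)
  then show "[k * n\<^sup>2 = k] (mod Q)" by (simp add: cong_iff_dvd_diff algebra_simps)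
qed (rule assms)

lemma ep_dvd: "d dvd k \<Longrightarrow> d \<noteq> 0 \<Longrightarrow> ep k d = 1" by (elim dvdE) simp

lemma theta_periods: "alt (n + 2) = alt n" "odd_ind (n + 2) = odd_ind n" "odd_ind (n + 4) = odd_ind n" "c8 (n + 8) = c8 n"
  by (simp_all add: alt_def odd_ind_def c8_def chi8_def)

lemma c8_even: "even n \<Longrightarrow> c8 n = 0"
proof -
  assume "even n"
  then have "even (n mod 8)" by presburger
  then show ?thesis using mod_8_cases[of n] by (auto simp: c8_def chi8_def)
qed

lemma c8_mult: "c8 (m * n) = c8 m * c8 n" by (simp add: c8_def chi8_mult)

lemma dft_alt_even: "even m \<Longrightarrow> dft 2 alt m = 0"
proof -
  assume "even m"
  then have "ep (m * 1) 2 = 1" by (intro ep_dvd) auto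
  moreover have "{0..<2::int} = {0, 1}" by auto
  ultimately show ?thesis by (simp add: dft_def alt_def)
qed

lemma dft_c8_even: "even m \<Longrightarrow> dft 8 c8 m = 0"
proof -
  assume "even m"
  then obtain k where k: "m = 2 * k" by (elim dvdE)
  have r: "ep (2 * k * j) 8 = ep (k * j) 4" for j using ep_cancel[of 2 "k * j" 4] by (simp add: mult.assoc)
  have "ep (k * 5) 4 = ep (k * 1) 4" "ep (k * 7) 4 = ep (k * 3) 4"
    by (rule ep_cong; simp add: cong_iff_dvd_diff)+
  moreover have "{0..<8::int} = {0,1,2,3,4,5,6,7}" by auto
  ultimately show ?thesis unfolding dft_def k r by (simp add: c8_def chi8_def)
qed

text \<open>A transform supported on odd \<open>m\<close> sees the quadratic phase only through
  \<open>m\<^sup>2 \<equiv> 1\<close> modulo 8.\<close>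

lemma phase_odd:
  assumes "\<And>m. even m \<Longrightarrow> F m = 0" "24 dvd c" "D dvd 192" "D \<noteq> 0"
  shows "F m * ep (- m\<^sup>2 * c * d) D = ep (- c * d) D * F m"
proof (cases "even m")
  case False
  have "D dvd 8 * (- c * d)"
  proof -
    obtain k where k: "c = 24 * k" using assms(2) by (elim dvdE)
    have "192 dvd 192 * (- k * d)" by (rule dvd_triv_left)
    also have "192 * (- k * d) = 8 * (- c * d)" by (simp add: k)
    finally show ?thesis using assms(3) by (rule dvd_trans[rotated])
  qed
  from ep_odd_square[OF False this assms(4)] show ?thesis by (simp add: mult_ac)
qed (use assms(1) in simp)

lemma phase_trivial:
  assumes "24 dvd c" "D dvd 24" "D \<noteq> 0"
  shows "F m * ep (- m\<^sup>2 * c * d) D = 1 * F m"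
proof -
  have "D dvd - m\<^sup>2 * c * d" using assms by (meson dvd_mult dvd_mult2 dvd_trans)
  then show ?thesis using assms(3) by (simp add: ep_dvd)
qed

context
  fixes a b c d :: int and z :: complex
  assumes det: "a * d - b * c = 1" and c: "24 dvd c" and d: "d > 0" and z: "Im z > 0"
begin

lemma odd_d: "odd d"
proof
  assume "even d"
  then have "even (a * d - b * c)" using c by (meson dvd_diff dvd_mult dvd_trans even_numeral)
  then show False using det by simp
qed

lemma th_alt_1_gamma0: "th alt (of_int 1 / of_int 1) (mob a b c d z) = 1 * ep (- c * d) 16 * gs (4 * b) d * rho c d z * th alt (of_int 1 / of_int 1) z"
proof (rule theta_gamma0[where f = alt and M = 2 and D = 16 and E = 8 and ?e0.0 = 4, OF theta_periods(1) _ _ _ _ _ _ _ _ _ _ det c d _ _ z])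
  show "alt (d * n) * ep (1 * b * d * n\<^sup>2) 1 = 1 * alt n" for n using odd_d by (simp add: alt_def ep_dvd)
  show "dft 2 alt m * ep (- m\<^sup>2 * c * d) 16 = ep (- c * d) 16 * dft 2 alt m" for m
    by (rule phase_odd[OF dft_alt_even c]) auto
qed auto

lemma th_alt_4_gamma0: "th alt (of_int 4 / of_int 1) (mob a b c d z) = 1 * ep (- c * d) 64 * gs (16 * b) d * rho c d z * th alt (of_int 4 / of_int 1) z"
proof (rule theta_gamma0[where f = alt and M = 2 and D = 64 and E = 8 and ?e0.0 = 16, OF theta_periods(1) _ _ _ _ _ _ _ _ _ _ det c d _ _ z])
  show "alt (d * n) * ep (4 * b * d * n\<^sup>2) 1 = 1 * alt n" for n using odd_d by (simp add: alt_def ep_dvd)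
  show "dft 2 alt m * ep (- m\<^sup>2 * c * d) 64 = ep (- c * d) 64 * dft 2 alt m" for m
    by (rule phase_odd[OF dft_alt_even c]) auto
qed auto

lemma th_odd_quarter_gamma0: "th odd_ind (of_int 1 / of_int 4) (mob a b c d z) = ep (1 * b * d) 4 * 1 * gs (1 * b) d * rho c d z * th odd_ind (of_int 1 / of_int 4) z"
proof (rule theta_gamma0[where f = odd_ind and M = 2 and D = 4 and E = 4 and ?e0.0 = 1, OF theta_periods(2) _ _ _ _ _ _ _ _ _ _ det c d _ _ z])
  show "odd_ind (d * n) * ep (1 * b * d * n\<^sup>2) 4 = ep (1 * b * d) 4 * odd_ind n" for n
    using odd_d ep_odd_square[of n 4 "1 * b * d"] by (auto simp: odd_ind_def)
  show "dft 2 odd_ind m * ep (- m\<^sup>2 * c * d) 4 = 1 * dft 2 odd_ind m" for m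
    by (rule phase_trivial[OF c]) auto
qed auto

lemma th_c8_three_quarters_gamma0: "th c8 (of_int 3 / of_int 4) (mob a b c d z) = (c8 d * ep (3 * b * d) 4) * ep (- c * d) 192 * gs (48 * b) d * rho c d z * th c8 (of_int 3 / of_int 4) z"
proof (rule theta_gamma0[where f = c8 and M = 8 and D = 192 and E = 24 and ?e0.0 = 12, OF theta_periods(4) _ _ _ _ _ _ _ _ _ _ det c d _ _ z])
  show "c8 (d * n) * ep (3 * b * d * n\<^sup>2) 4 = c8 d * ep (3 * b * d) 4 * c8 n" for n
    using ep_odd_square[of n 4 "3 * b * d"] by (cases "even n") (simp_all add: c8_mult c8_even)
  show "dft 8 c8 m * ep (- m\<^sup>2 * c * d) 192 = ep (- c * d) 192 * dft 8 c8 m" for m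
    by (rule phase_odd[OF dft_c8_even c]) auto
qed auto

lemma th_c8_eighth_gamma0: "th c8 (of_int 1 / of_int 8) (mob a b c d z) = (c8 d * ep (1 * b * d) 8) * ep (- c * d) 32 * gs (8 * b) d * rho c d z * th c8 (of_int 1 / of_int 8) z"
proof (rule theta_gamma0[where f = c8 and M = 8 and D = 32 and E = 8 and ?e0.0 = 2, OF theta_periods(4) _ _ _ _ _ _ _ _ _ _ det c d _ _ z])
  show "c8 (d * n) * ep (1 * b * d * n\<^sup>2) 8 = c8 d * ep (1 * b * d) 8 * c8 n" for n
    using ep_odd_square[of n 8 "1 * b * d"] by (cases "even n") (simp_all add: c8_mult c8_even)
  show "dft 8 c8 m * ep (- m\<^sup>2 * c * d) 32 = ep (- c * d) 32 * dft 8 c8 m" for m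
    by (rule phase_odd[OF dft_c8_even c]) auto
qed auto

lemma th_odd_three_eighths_gamma0: "th odd_ind (of_int 3 / of_int 8) (mob a b c d z) = ep (3 * b * d) 8 * 1 * gs (6 * b) d * rho c d z * th odd_ind (of_int 3 / of_int 8) z"
proof (rule theta_gamma0[where f = odd_ind and M = 4 and D = 24 and E = 24 and ?e0.0 = 3, OF theta_periods(3) _ _ _ _ _ _ _ _ _ _ det c d _ _ z])
  show "odd_ind (d * n) * ep (3 * b * d * n\<^sup>2) 8 = ep (3 * b * d) 8 * odd_ind n" for n
    using odd_d ep_odd_square[of n 8 "3 * b * d"] by (auto simp: odd_ind_def)
  show "dft 4 odd_ind m * ep (- m\<^sup>2 * c * d) 24 = 1 * dft 4 odd_ind m" for m
    by (rule phase_trivial[OF c]) auto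
qed auto

text \<open>Each Gauss sum differs from \<open>gs b d\<close> by the symbols \<open>u\<close> and
  \<open>v\<close> of 2 and 3, and \<open>chi 24 d\<close> is their product because the cube of
  \<open>u\<close> equals \<open>u\<close>.\<close>

lemma gauss_factors:
  defines "u \<equiv> of_int (kronecker 2 d) :: complex" and "v \<equiv> of_int (kronecker 3 d) :: complex"
  shows "gs (4 * b) d = gs b d" "gs (16 * b) d = gs b d" "gs (48 * b) d = v * gs b d" "gs (8 * b) d = u * gs b d"
    "gs (6 * b) d = u * v * gs b d" "c8 d = u" "u * u = 1" "v * v = 1" "chi 24 d = u * v" "gs b d ^ 4 = of_int d ^ 2"
proof -
  have cop: "coprime d 24"
  proof (rule coprimeI)
    fix g assume g: "g dvd d" "g dvd 24"
    then have "g dvd a * d - b * c" using c by (meson dvd_diff dvd_mult dvd_trans)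
    then show "is_unit g" using det by simp
  qed
  have bd: "coprime b d"
  proof (rule coprimeI)
    fix g assume g: "g dvd b" "g dvd d"
    then have "g dvd a * d - b * c" by (meson dvd_diff dvd_mult dvd_mult2)
    then show "is_unit g" using det by simp
  qed
  have "coprime d (2 * (2 * (2 * 3)))" using cop by simp
  then have c23: "coprime 2 d" "coprime 3 d" unfolding coprime_mult_right_iff by (simp_all add: coprime_commute)
  have g2: "gs (2 * x) d = u * gs x d" if "coprime x d" for x
    unfolding u_def by (rule gs_mult[OF d odd_d c23(1) that])
  have g3: "gs (3 * x) d = v * gs x d" if "coprime x d" for x
    unfolding v_def by (rule gs_mult[OF d odd_d c23(2) that])
  have u8: "kronecker 2 d = chi8 d"
  proof (rule kronecker_eq_multiplicative[OF _ chi8_mult _ d])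
    show "chi8 1 = 1" by (simp add: chi8_def)
    fix p :: int assume p: "prime p" "p > 0"
    then show "kronecker_prime 2 p = chi8 p"
      by (cases "p = 2") (auto simp: kronecker_prime_def Legendre_2, simp add: chi8_def)
  qed
  then show cu: "c8 d = u" by (simp add: c8_def u_def)
  have "chi8 d * chi8 d = 1" by (rule chi8_square[OF odd_d])
  then show uu: "u * u = 1" using u8 unfolding u_def by (metis of_int_1 of_int_mult)
  have cb: "coprime (2 * b) d" "coprime (2 * (2 * b)) d" "coprime (2 * (2 * (2 * b))) d" "coprime (3 * b) d"
    using c23 bd by (simp_all only: coprime_mult_left_iff)
  have w: "u * (u * x) = x" for x using uu by (simp add: mult.assoc[symmetric])
  have g4: "gs (4 * x) d = gs x d" if "coprime x d" for x
    using g2[of "2 * x"] g2[of x] that c23 w by (simp add: coprime_mult_left_iff)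
  show "gs (4 * b) d = gs b d" by (rule g4[OF bd])
  have c4: "coprime (4 * b) d" using cb(2) by simp
  show g16: "gs (16 * b) d = gs b d" using g4[OF c4] g4[OF bd] by simp
  have c16: "coprime (16 * b) d"
  proof -
    have "coprime (2 * (2 * (4 * b))) d" using c23 c4 by (simp only: coprime_mult_left_iff)
    then show ?thesis by simp
  qed
  show "gs (48 * b) d = v * gs b d" using g3[OF c16] g16 by simp
  show "gs (8 * b) d = u * gs b d" using g2[OF c4] g4[OF bd] by simp
  show "gs (6 * b) d = u * v * gs b d" using g2[OF cb(4)] g3[OF bd] by simp
  show g: "gs b d ^ 4 = of_int d ^ 2" by (rule gs_pow4[OF d odd_d bd])
  then have g0: "gs b d \<noteq> 0" using d by auto
  have "gs (24 * b) d = chi 24 d * gs b d"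
    unfolding chi_def using gs_mult[OF d odd_d _ bd, of 24] cop by (simp add: coprime_commute)
  moreover have "gs (24 * b) d = v * (u * gs b d)"
    using g3[of "8 * b"] g2[OF c4] g4[OF bd] cb(3) by simp
  ultimately show chi: "chi 24 d = u * v" using g0 by (simp add: mult.commute)
  have "chi 24 d * chi 24 d = 1"
  proof -
    have "kronecker 24 d * kronecker 24 d = 1"
    proof -
      have "\<not> 3 dvd d" using c23(2) by (auto dest: coprime_common_divisor[of 3 d 3])
      then have "chi3 d * chi3 d = 1" using mod_3_cases[of d] by (auto simp: chi3_def dvd_eq_mod_eq_0)
      moreover have "kronecker 24 d * kronecker 24 d = (chi8 d * chi8 d) * (chi4 d * chi4 d) * (chi3 d * chi3 d)"
        unfolding kronecker_24' by (simp only: mult_ac)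
      ultimately show ?thesis using chi8_square[OF odd_d] chi4_square[OF odd_d] by simp
    qed
    then show ?thesis unfolding chi_def by (metis of_int_1 of_int_mult)
  qed
  then have "(u * v) * (u * v) = 1" unfolding chi .
  moreover have "(u * v) * (u * v) = (u * u) * (v * v)" by (simp only: mult_ac)
  ultimately show "v * v = 1" using uu by simp
qed

end

section \<open>Theta series at the cusps\<close>

lemma weil_T:
  assumes M: "M > 0" "even M"
  shows "th f (1 / (2 * of_int M)) (of_int k + w) = th (\<lambda>n. f n * ep (k * n\<^sup>2) (2 * M)) (1 / (2 * of_int M)) w"
  using th_translate[of "2 * M" 1 f 1 k w] M by simp

lemma weil_T_periodic:
  fixes f :: "int \<Rightarrow> complex"
  assumes M: "M > 0" "even M" and per: "\<And>n. f (n + M) = f n"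
  shows "f (n + M) * ep (k * (n + M)\<^sup>2) (2 * M) = f n * ep (k * n\<^sup>2) (2 * M)"
proof -
  obtain j where j: "M = 2 * j" using M(2) by (elim dvdE)
  have "k * (n + M)\<^sup>2 = k * n\<^sup>2 + (2 * M) * (k * n + k * j)" by (simp add: j power2_eq_square algebra_simps)
  then show ?thesis using M(1) by (simp add: per ep_add)
qed

lemma dft_periodic:
  assumes "M > 0" shows "dft M f (m + M) = dft M f m"
proof -
  have "ep ((m + M) * r) M = ep (m * r) M" for r
    using assms by (simp add: distrib_right ep_add)
  then show ?thesis by (simp add: dft_def)
qed

text \<open>For even \<open>M\<close> the theta series of denominator \<open>2 * M\<close> with
  coefficients of period \<open>M\<close> are permuted by \<open>T\<close> and, up to the factor
  of automorphy, by \<open>S\<close>; this is the Weil representation, used for absolute values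
  only.\<close>

lemma weil_slash:
  fixes f :: "int \<Rightarrow> complex"
  assumes M: "M > 0" "even M" and det: "a * d - b * c = 1" and per: "\<And>n. f (n + M) = f n"
  shows "\<exists>g. (\<forall>n. g (n + M) = g n) \<and>
    (\<forall>z. Im z > 0 \<longrightarrow> norm (th f (1 / (2 * of_int M)) (mob a b c d z)) =
        sqrt (norm (of_int c * z + of_int d)) * norm (th g (1 / (2 * of_int M)) z))"
  using det per
proof (induction a b c d arbitrary: f rule: SL2_induct)
  case one
  then show ?case by (intro exI[of _ f]) (simp add: mob_def)
next
  case (T a b c d)
  define f' where "f' = (\<lambda>n. f n * ep (1 * n\<^sup>2) (2 * M))"
  have "f' (n + M) = f' n" for n
    unfolding f'_def by (rule weil_T_periodic[where f = f, OF M T.prems])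
  from T.IH[of f', OF this] obtain g where g: "\<forall>n. g (n + M) = g n"
    "\<forall>z. Im z > 0 \<longrightarrow> norm (th f' (1 / (2 * of_int M)) (mob a b c d z)) = sqrt (norm (of_int c * z + of_int d)) * norm (th g (1 / (2 * of_int M)) z)"
    by blast
  show ?case
  proof (intro exI[of _ g] conjI g(1) allI impI)
    fix z :: complex assume z: "Im z > 0"
    have nz: "of_int c * z + of_int d \<noteq> 0" by (rule mob_denom_nz[OF T.hyps z])
    have "mob (a + c) (b + d) c d z = of_int 1 + mob a b c d z"
      using nz by (simp add: mob_def field_simps)
    then show "norm (th f (1 / (2 * of_int M)) (mob (a + c) (b + d) c d z)) = sqrt (norm (of_int c * z + of_int d)) * norm (th g (1 / (2 * of_int M)) z)"
      using g(2) z by (simp only: weil_T[OF M] f'_def[symmetric])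
  qed
next
  case (T' a b c d)
  define f' where "f' = (\<lambda>n. f n * ep (- 1 * n\<^sup>2) (2 * M))"
  have "f' (n + M) = f' n" for n
    unfolding f'_def by (rule weil_T_periodic[where f = f, OF M T'.prems])
  from T'.IH[of f', OF this] obtain g where g: "\<forall>n. g (n + M) = g n"
    "\<forall>z. Im z > 0 \<longrightarrow> norm (th f' (1 / (2 * of_int M)) (mob a b c d z)) = sqrt (norm (of_int c * z + of_int d)) * norm (th g (1 / (2 * of_int M)) z)"
    by blast
  show ?case
  proof (intro exI[of _ g] conjI g(1) allI impI)
    fix z :: complex assume z: "Im z > 0"
    have nz: "of_int c * z + of_int d \<noteq> 0" by (rule mob_denom_nz[OF T'.hyps z])
    have "mob (a - c) (b - d) c d z = of_int (- 1) + mob a b c d z"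
      using nz by (simp add: mob_def field_simps)
    then show "norm (th f (1 / (2 * of_int M)) (mob (a - c) (b - d) c d z)) = sqrt (norm (of_int c * z + of_int d)) * norm (th g (1 / (2 * of_int M)) z)"
      using g(2) z by (simp only: weil_T[OF M] f'_def[symmetric])
  qed
next
  case (S a b c d)
  define \<alpha> where "\<alpha> = (1 / (2 * of_int M) :: real)"
  have \<alpha>: "\<alpha> > 0" using M by (simp add: \<alpha>_def)
  define f' where "f' = dft M f"
  have "f' (n + M) = f' n" for n unfolding f'_def by (rule dft_periodic[OF M(1)])
  from S.IH[of f', OF this] obtain g where g: "\<forall>n. g (n + M) = g n"
    "\<forall>z. Im z > 0 \<longrightarrow> norm (th f' \<alpha> (mob a b c d z)) = sqrt (norm (of_int c * z + of_int d)) * norm (th g \<alpha> z)"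
    unfolding \<alpha>_def by blast
  define k where "k = 1 / (of_int M * sqrt (2 * \<alpha>))"
  have k0: "k > 0" using M \<alpha> by (simp add: k_def)
  show ?case unfolding \<alpha>_def[symmetric]
  proof (intro exI[of _ "\<lambda>n. of_real k * g n"] conjI allI impI)
    show "of_real k * g (n + M) = of_real k * g n" for n using g(1) by simp
    fix z :: complex assume z: "Im z > 0"
    have det': "- c * b - - d * a = 1" using S.hyps by (simp add: algebra_simps)
    define w where "w = mob (- c) (- d) a b z"
    define v where "v = mob a b c d z"
    have w: "Im w > 0" unfolding w_def by (rule Im_mob_pos[OF det' z])
    have v: "Im v > 0" unfolding v_def by (rule Im_mob_pos[OF S.hyps z])
    have nz: "of_int c * z + of_int d \<noteq> 0" by (rule mob_denom_nz[OF S.hyps z])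
    have nz': "of_int a * z + of_int b \<noteq> 0" by (rule mob_denom_nz[OF det' z])
    have w_eq: "w = - ((of_int c * z + of_int d) / (of_int a * z + of_int b))"
    proof -
      have "of_int (- c) * z + of_int (- d) = - (of_int c * z + of_int d)" by simp
      then show ?thesis by (simp only: w_def mob_def minus_divide_left)
    qed
    have vw: "- 1 / w = v" unfolding w_eq v_def mob_def
      by (simp only: minus_divide_divide divide_divide_eq_right mult_1_left)
    have nw: "norm w = norm (of_int c * z + of_int d) / norm (of_int a * z + of_int b)"
      by (simp only: w_eq norm_divide norm_minus_cancel)
    have "4 * \<alpha> * of_int M ^ 2 = 2 * of_int M" using M by (simp add: \<alpha>_def power2_eq_square)
    then have "1 / (4 * \<alpha> * of_int M ^ 2) = \<alpha>" by (simp add: \<alpha>_def)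
    from inversion_dft[of f M \<alpha> w, OF S.prems M(1) \<alpha> w, unfolded this vw]
    have "norm (th f \<alpha> w) = 1 / (of_int M * norm (csqrt (- 2 * \<i> * of_real \<alpha> * w))) * norm (th f' \<alpha> v)"
      using M by (simp add: norm_mult norm_divide f'_def)
    also have "norm (csqrt (- 2 * \<i> * of_real \<alpha> * w)) = sqrt (2 * \<alpha>) * sqrt (norm w)"
      using \<alpha> by (simp add: norm_mult real_sqrt_mult)
    also have "1 / (of_int M * (sqrt (2 * \<alpha>) * sqrt (norm w))) * norm (th f' \<alpha> v) = k / sqrt (norm w) * norm (th f' \<alpha> v)"
      by (simp add: k_def)
    also have "norm (th f' \<alpha> v) = sqrt (norm (of_int c * z + of_int d)) * norm (th g \<alpha> z)"
      using g(2) z by (simp add: v_def)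
    also have "k / sqrt (norm w) * (sqrt (norm (of_int c * z + of_int d)) * norm (th g \<alpha> z)) = sqrt (norm (of_int a * z + of_int b)) * (k * norm (th g \<alpha> z))"
      using nz nz' by (simp add: nw real_sqrt_divide)
    also have "k * norm (th g \<alpha> z) = norm (th (\<lambda>n. of_real k * g n) \<alpha> z)"
      using k0 by (simp add: th_def mult.assoc infsum_cmult_right' norm_mult)
    finally show "norm (th f \<alpha> (mob (- c) (- d) a b z)) = sqrt (norm (of_int a * z + of_int b)) * norm (th (\<lambda>n. of_real k * g n) \<alpha> z)"
      by (simp only: w_def)
  qed
qed

lemma th_bounded:
  fixes f :: "int \<Rightarrow> complex"
  assumes per: "\<And>n. f (n + M) = f n" and M: "M > 0" and \<alpha>: "\<alpha> > 0"
  shows "\<exists>B. \<forall>z. Im z \<ge> 1 \<longrightarrow> norm (th f \<alpha> z) \<le> B"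
proof -
  let ?t = "\<lambda>z n. f n * exp (2 * of_real pi * \<i> * z * of_real (\<alpha> * (of_int n)\<^sup>2))"
  have s: "(\<lambda>n. ?t \<i> n) summable_on UNIV" by (rule th_props(2)[of f M, OF per M \<alpha>]) simp
  then have "(\<lambda>n. norm (?t \<i> n)) summable_on UNIV" by (simp only: summable_on_iff_abs_summable_on_complex)
  then obtain B where B: "((\<lambda>n. norm (?t \<i> n)) has_sum B) UNIV" by (auto simp: summable_on_def)
  have "norm (th f \<alpha> z) \<le> B" if z: "Im z \<ge> 1" for z
  proof (rule norm_infsum_le[OF _ B])
    show "(?t z has_sum th f \<alpha> z) UNIV"
      unfolding th_def by (rule has_sum_infsum[OF th_props(2)[of f M, OF per M \<alpha>]]) (use z in simp)
    fix n :: int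
    have "1 * (\<alpha> * (of_int n)\<^sup>2) \<le> Im z * (\<alpha> * (of_int n)\<^sup>2)" using z \<alpha> by (intro mult_right_mono) auto
    then show "norm (?t z n) \<le> norm (?t \<i> n)"
      by (simp add: norm_mult mult_left_mono mult_ac)
  qed
  then show ?thesis by blast
qed

text \<open>Rescaling the summation variable brings an arbitrary rational exponent to the
  denominator required by \<open>weil_slash\<close>.\<close>

lemma th_embed:
  fixes f :: "int \<Rightarrow> complex" and p Q M :: int
  assumes per: "\<And>n. f (n + M) = f n" and pos: "M > 0" "p > 0" "Q > 0"
  defines "k \<equiv> 2 * p * M" and "N \<equiv> 2 * p * Q * M\<^sup>2"
  defines "g \<equiv> (\<lambda>n. if k dvd n then f (n div k) else 0)"
  shows "g (n + N) = g n" "N > 0" "even N" "th f (of_int p / of_int Q) z = th g (1 / (2 * of_int N)) z"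
proof -
  have k0: "k > 0" using pos by (simp add: k_def)
  have N: "N = k * (M * Q)" by (simp add: N_def k_def power2_eq_square)
  show "N > 0" "even N" using pos by (simp_all add: N_def)
  have "f (x + M * Q) = f x" for x
    using periodic_mod[of f M "x + M * Q", OF per] periodic_mod[of f M x, OF per] by simp
  moreover have "(n + N) div k = n div k + M * Q" using k0 by (simp add: N)
  moreover have "k dvd n + N \<longleftrightarrow> k dvd n" by (simp add: N dvd_add_left_iff)
  ultimately show "g (n + N) = g n" by (simp add: g_def)
  let ?t = "\<lambda>n. g n * exp (2 * of_real pi * \<i> * z * of_real (1 / (2 * of_int N) * (of_int n)\<^sup>2))"
  have "th g (1 / (2 * of_int N)) z = infsum ?t (range (\<lambda>n. k * n))"
    unfolding th_def by (rule infsum_cong_neutral) (auto simp: g_def)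
  also have "\<dots> = infsum (?t \<circ> (\<lambda>n. k * n)) UNIV"
    by (rule infsum_reindex) (use k0 in \<open>auto simp: inj_on_def\<close>)
  also have "\<dots> = th f (of_int p / of_int Q) z"
    unfolding th_def
  proof (intro infsum_cong)
    fix n :: int
    have "1 / (2 * of_int N) * (of_int (k * n))\<^sup>2 = (of_int p / of_int Q * (of_int n)\<^sup>2 :: real)"
      using pos unfolding N_def k_def by (simp add: field_simps power2_eq_square)
    then show "(?t \<circ> (\<lambda>n. k * n)) n = f n * exp (2 * of_real pi * \<i> * z * of_real (of_int p / of_int Q * (of_int n)\<^sup>2))"
      using k0 by (simp only: o_def) (simp add: g_def)
  qed
  finally show "th f (of_int p / of_int Q) z = th g (1 / (2 * of_int N)) z" ..
qed

lemma theta_cusp_bound: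
  fixes f :: "int \<Rightarrow> complex" and p Q M :: int
  assumes per: "\<And>n. f (n + M) = f n" and pos: "M > 0" "p > 0" "Q > 0" and det: "a * d - b * c = 1"
  shows "\<exists>B. \<forall>z. Im z \<ge> 1 \<longrightarrow> norm (th f (of_int p / of_int Q) (mob a b c d z)) \<le> B * sqrt (norm (of_int c * z + of_int d))"
proof -
  define N where "N = 2 * p * Q * M\<^sup>2"
  define h where "h = (\<lambda>n. if 2 * p * M dvd n then f (n div (2 * p * M)) else 0)"
  note emb = th_embed[of f M p Q, OF per pos, folded N_def]
  have per_h: "h (n + N) = h n" for n unfolding h_def by (rule emb(1))
  have th_h: "th f (of_int p / of_int Q) z = th h (1 / (2 * of_int N)) z" for z unfolding h_def by (rule emb(4))
  obtain g where g: "\<forall>n. g (n + N) = g n"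
    "\<forall>z. Im z > 0 \<longrightarrow> norm (th f (of_int p / of_int Q) (mob a b c d z)) = sqrt (norm (of_int c * z + of_int d)) * norm (th g (1 / (2 * of_int N)) z)"
    using weil_slash[of N a d b c h, OF emb(2,3) det per_h] unfolding th_h[symmetric] by blast
  have N: "N > 0" by (rule emb(2))
  obtain B where "\<forall>z. Im z \<ge> 1 \<longrightarrow> norm (th g (1 / (2 * of_int N)) z) \<le> B"
    using th_bounded[of g N "1 / (2 * of_int N)"] g(1) N by auto
  then have B: "norm (th g (1 / (2 * of_int N)) z) \<le> B" if "Im z \<ge> 1" for z using that by blast
  show ?thesis
  proof (intro exI[of _ B] allI impI)
    fix z assume z: "Im z \<ge> 1"
    then have "norm (th f (of_int p / of_int Q) (mob a b c d z)) = sqrt (norm (of_int c * z + of_int d)) * norm (th g (1 / (2 * of_int N)) z)"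
      using g(2) by simp
    also have "\<dots> \<le> sqrt (norm (of_int c * z + of_int d)) * B" by (intro mult_left_mono B z) simp
    finally show "norm (th f (of_int p / of_int Q) (mob a b c d z)) \<le> B * sqrt (norm (of_int c * z + of_int d))"
      by (simp only: mult.commute)
  qed
qed

text \<open>Negative \<open>d\<close> is reduced to positive \<open>d\<close> by the matrix
  \<open>- 1\<close>, which acts trivially as the weight and the character are even.\<close>

lemma theta_product_modular:
  fixes f1 f2 f3 f4 :: "int \<Rightarrow> complex"
  assumes per: "\<And>n. f1 (n + M1) = f1 n" "\<And>n. f2 (n + M2) = f2 n" "\<And>n. f3 (n + M3) = f3 n" "\<And>n. f4 (n + M4) = f4 n"
    and M: "M1 > 0" "M2 > 0" "M3 > 0" "M4 > 0" and p: "p1 > 0" "p2 > 0" "p3 > 0" "p4 > 0" and Q: "Q1 > 0" "Q2 > 0" "Q3 > 0" "Q4 > 0"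
  defines "F \<equiv> (\<lambda>z. th f1 (of_int p1 / of_int Q1) z * th f2 (of_int p2 / of_int Q2) z * th f3 (of_int p3 / of_int Q3) z * th f4 (of_int p4 / of_int Q4) z)"
  assumes tr: "\<And>a b c d z. a * d - b * c = 1 \<Longrightarrow> 24 dvd c \<Longrightarrow> d > 0 \<Longrightarrow> Im z > 0 \<Longrightarrow> F (mob a b c d z) = chi 24 d * (of_int c * z + of_int d)\<^sup>2 * F z"
  shows "F \<in> modular_forms 2 24 (chi 24)"
  unfolding modular_forms_def mem_Collect_eq
proof (intro conjI allI impI)
  show "F holomorphic_on {z. Im z > 0}"
    unfolding F_def using M p Q
    by (intro holomorphic_intros th_props(1)[of f1 M1, OF per(1)] th_props(1)[of f2 M2, OF per(2)] th_props(1)[of f3 M3, OF per(3)] th_props(1)[of f4 M4, OF per(4)]) auto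
next
  fix a b c d :: int and z :: complex
  assume det: "a * d - b * c = 1" and c: "int 24 dvd c" and z: "Im z > 0"
  show "F ((of_int a * z + of_int b) / (of_int c * z + of_int d)) = chi 24 d * (of_int c * z + of_int d)\<^sup>2 * F z"
  proof (cases "d > 0")
    case True
    then show ?thesis using tr[OF det _ True z] c by (simp add: mob_def)
  next
    case False
    have "d \<noteq> 0"
    proof
      assume "d = 0"
      then have "c dvd 1" using det by (metis add_0 diff_0 dvd_minus_iff dvd_triv_right minus_diff_eq mult_zero_right)
      then have "24 dvd (1::int)" using c by (metis dvd_trans of_nat_numeral)
      then show False by simp
    qed
    then have d: "- d > 0" using False by simp
    have "- a * - d - - b * - c = 1" "24 dvd - c" using det c by auto
    from tr[OF this d z] have "F (mob (- a) (- b) (- c) (- d) z) = chi 24 (- d) * (of_int (- c) * z + of_int (- d))\<^sup>2 * F z" .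
    moreover have "mob (- a) (- b) (- c) (- d) z = (of_int a * z + of_int b) / (of_int c * z + of_int d)"
    proof -
      have "mob (- a) (- b) (- c) (- d) z = (- (of_int a * z + of_int b)) / (- (of_int c * z + of_int d))" by (simp add: mob_def)
      then show ?thesis by (simp only: minus_divide_divide)
    qed
    moreover have "(of_int (- c) * z + of_int (- d))\<^sup>2 = (of_int c * z + of_int d)\<^sup>2" by (simp add: power2_eq_square algebra_simps)
    moreover have "chi 24 (- d) = chi 24 d" by (simp add: chi_def kronecker_minus_arg)
    ultimately show ?thesis by simp
  qed
next
  fix a b c d :: int
  assume det: "a * d - b * c = 1"
  let ?j = "\<lambda>z. norm (of_int c * z + of_int d)"
  obtain B1 B2 B3 B4 where B: "\<And>z. Im z \<ge> 1 \<Longrightarrow> norm (th f1 (of_int p1 / of_int Q1) (mob a b c d z)) \<le> B1 * sqrt (?j z)"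
    "\<And>z. Im z \<ge> 1 \<Longrightarrow> norm (th f2 (of_int p2 / of_int Q2) (mob a b c d z)) \<le> B2 * sqrt (?j z)"
    "\<And>z. Im z \<ge> 1 \<Longrightarrow> norm (th f3 (of_int p3 / of_int Q3) (mob a b c d z)) \<le> B3 * sqrt (?j z)"
    "\<And>z. Im z \<ge> 1 \<Longrightarrow> norm (th f4 (of_int p4 / of_int Q4) (mob a b c d z)) \<le> B4 * sqrt (?j z)"
    using theta_cusp_bound[of f1, OF per(1) M(1) p(1) Q(1) det] theta_cusp_bound[of f2, OF per(2) M(2) p(2) Q(2) det]
      theta_cusp_bound[of f3, OF per(3) M(3) p(3) Q(3) det] theta_cusp_bound[of f4, OF per(4) M(4) p(4) Q(4) det] by metis
  show "\<exists>B Y. Y > 0 \<and> (\<forall>z. Im z > Y \<longrightarrow> norm (F ((of_int a * z + of_int b) / (of_int c * z + of_int d)) / (of_int c * z + of_int d)\<^sup>2) \<le> B)"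
  proof (rule exI[of _ "B1 * B2 * B3 * B4"], rule exI[of _ "1::real"], intro conjI allI impI)
    fix z :: complex assume z: "Im z > 1"
    then have z0: "Im z > 0" "Im z \<ge> 1" by simp_all
    have nz: "?j z > 0" using mob_denom_nz[OF det z0(1)] by simp
    have "norm (F (mob a b c d z)) \<le> (B1 * sqrt (?j z)) * (B2 * sqrt (?j z)) * (B3 * sqrt (?j z)) * (B4 * sqrt (?j z))"
      unfolding F_def norm_mult by (intro mult_mono' B z0 mult_nonneg_nonneg norm_ge_zero)
    also have "\<dots> = B1 * B2 * B3 * B4 * ((sqrt (?j z) * sqrt (?j z)) * (sqrt (?j z) * sqrt (?j z)))"
      by (simp only: mult_ac)
    also have "\<dots> = B1 * B2 * B3 * B4 * (?j z)\<^sup>2" by (simp add: power2_eq_square)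
    finally show "norm (F ((of_int a * z + of_int b) / (of_int c * z + of_int d)) / (of_int c * z + of_int d)\<^sup>2) \<le> B1 * B2 * B3 * B4"
      using nz by (simp add: mob_def norm_divide norm_power divide_le_eq)
  qed simp
qed

definition thetaC2 :: "complex \<Rightarrow> complex" where
  "thetaC2 z = th alt (of_int 1 / of_int 1) z * th alt (of_int 4 / of_int 1) z * th odd_ind (of_int 1 / of_int 4) z * th c8 (of_int 3 / of_int 4) z"

definition thetaC1 :: "complex \<Rightarrow> complex" where
  "thetaC1 z = th c8 (of_int 1 / of_int 8) z * th odd_ind (of_int 3 / of_int 8) z * th c8 (of_int 3 / of_int 4) z * th c8 (of_int 3 / of_int 4) z"

text \<open>The roots of unity cancel: \<open>1/4 + 3/4 = 1\<close> for the translations, and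
  \<open>1/16 + 1/64 + 1/192 = 1/12\<close> with \<open>24 dvd c\<close> for the lower left
  entry.\<close>

theorem thetaC2_modular: "thetaC2 \<in> modular_forms 2 24 (chi 24)"
  unfolding thetaC2_def[abs_def]
proof (rule theta_product_modular[where ?f1.0 = alt and ?f2.0 = alt and ?f3.0 = odd_ind and ?f4.0 = c8, OF theta_periods(1) theta_periods(1) theta_periods(2) theta_periods(4)])
  fix a b c d :: int and z :: complex
  assume det: "a * d - b * c = 1" and c: "24 dvd c" and d: "d > 0" and z: "Im z > 0"
  define u v where "u = (of_int (kronecker 2 d) :: complex)" and "v = (of_int (kronecker 3 d) :: complex)"
  note gf = gauss_factors[OF det c d z, folded u_def v_def]
  define r G where "r = rho c d z" and "G = gs b d"
  have ph: "ep (- c * d) 16 * ep (- c * d) 64 * ep (- c * d) 192 = 1" "ep (b * d) 4 * ep (3 * b * d) 4 = 1"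
  proof -
    have "ep (- c * d) 16 = ep (12 * (- c * d)) 192" "ep (- c * d) 64 = ep (3 * (- c * d)) 192"
      using ep_cancel[of 12 "- c * d" 16] ep_cancel[of 3 "- c * d" 64] by simp_all
    then have "ep (- c * d) 16 * ep (- c * d) 64 * ep (- c * d) 192 = ep (16 * (- c * d)) 192"
      by (simp add: ep_add[symmetric])
    also have "\<dots> = 1"
    proof (rule ep_dvd)
      obtain k where "c = 24 * k" using c by (elim dvdE)
      then have "16 * (- c * d) = 192 * (- 2 * k * d)" by simp
      then show "192 dvd 16 * (- c * d)" by (metis dvd_triv_left)
    qed simp
    finally show "ep (- c * d) 16 * ep (- c * d) 64 * ep (- c * d) 192 = 1" .
    have "ep (b * d) 4 * ep (3 * b * d) 4 = ep (4 * (b * d)) 4" unfolding ep_add[symmetric] by (simp add: algebra_simps)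
    then show "ep (b * d) 4 * ep (3 * b * d) 4 = 1" by (simp add: ep_dvd)
  qed
  have "r ^ 4 * of_int d ^ 2 = (of_int c * z + of_int d)\<^sup>2" unfolding r_def by (rule rho_pow4[OF det d z])
  then have rG: "r ^ 4 * G ^ 4 = (of_int c * z + of_int d)\<^sup>2" using gf(10) by (simp add: G_def)
  have alg: "(1 * e1 * G * r * X1) * (1 * e2 * G * r * X2) * (x1 * 1 * G * r * X3) * (u * x2 * e3 * (v * G) * r * X4) =
     (e1 * e2 * e3) * (x1 * x2) * (u * v) * (r ^ 4 * G ^ 4) * (X1 * X2 * X3 * X4)" for e1 e2 e3 x1 x2 X1 X2 X3 X4
    by (simp add: power4_eq_xxxx mult_ac)
  show "th alt (of_int 1 / of_int 1) (mob a b c d z) * th alt (of_int 4 / of_int 1) (mob a b c d z) * th odd_ind (of_int 1 / of_int 4) (mob a b c d z) * th c8 (of_int 3 / of_int 4) (mob a b c d z) =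
     chi 24 d * (of_int c * z + of_int d)\<^sup>2 * (th alt (of_int 1 / of_int 1) z * th alt (of_int 4 / of_int 1) z * th odd_ind (of_int 1 / of_int 4) z * th c8 (of_int 3 / of_int 4) z)"
    unfolding th_alt_1_gamma0[OF det c d z] th_alt_4_gamma0[OF det c d z] th_odd_quarter_gamma0[OF det c d z] th_c8_three_quarters_gamma0[OF det c d z]
      gf(1,2,3,6,9) r_def[symmetric] mult_1[of b] G_def[symmetric] alg rG ph by simp
qed auto

text \<open>Here the exponents are \<open>1/8 + 3/8 + 2 * 3/4 = 2\<close> and \<open>1/32 + 2 *
  1/192 = 1/24\<close>.\<close>

theorem thetaC1_modular: "thetaC1 \<in> modular_forms 2 24 (chi 24)"
  unfolding thetaC1_def[abs_def]
proof (rule theta_product_modular[where ?f1.0 = c8 and ?f2.0 = odd_ind and ?f3.0 = c8 and ?f4.0 = c8, OF theta_periods(4) theta_periods(3) theta_periods(4) theta_periods(4)])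
  fix a b c d :: int and z :: complex
  assume det: "a * d - b * c = 1" and c: "24 dvd c" and d: "d > 0" and z: "Im z > 0"
  define u v where "u = (of_int (kronecker 2 d) :: complex)" and "v = (of_int (kronecker 3 d) :: complex)"
  note gf = gauss_factors[OF det c d z, folded u_def v_def]
  define r G where "r = rho c d z" and "G = gs b d"
  have ph: "ep (- c * d) 32 * ep (- c * d) 192 * ep (- c * d) 192 = 1" "ep (1 * b * d) 8 * ep (3 * b * d) 8 * ep (3 * b * d) 4 * ep (3 * b * d) 4 = 1"
  proof -
    have "ep (- c * d) 32 = ep (6 * (- c * d)) 192"
      using ep_cancel[of 6 "- c * d" 32] by simp
    then have "ep (- c * d) 32 * ep (- c * d) 192 * ep (- c * d) 192 = ep (8 * (- c * d)) 192"
      by (simp add: ep_add[symmetric])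
    also have "\<dots> = 1"
    proof (rule ep_dvd)
      obtain k where "c = 24 * k" using c by (elim dvdE)
      then have "8 * (- c * d) = 192 * (- k * d)" by simp
      then show "192 dvd 8 * (- c * d)" by (metis dvd_triv_left)
    qed simp
    finally show "ep (- c * d) 32 * ep (- c * d) 192 * ep (- c * d) 192 = 1" .
    have "ep (3 * b * d) 4 = ep (6 * b * d) 8" using ep_cancel[of 2 "3 * b * d" 4] by (simp add: mult.assoc)
    then have "ep (1 * b * d) 8 * ep (3 * b * d) 8 * ep (3 * b * d) 4 * ep (3 * b * d) 4 = ep (8 * (2 * (b * d))) 8"
      by (simp add: ep_add[symmetric])
    then show "ep (1 * b * d) 8 * ep (3 * b * d) 8 * ep (3 * b * d) 4 * ep (3 * b * d) 4 = 1" by (simp add: ep_dvd)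
  qed
  have "r ^ 4 * of_int d ^ 2 = (of_int c * z + of_int d)\<^sup>2" unfolding r_def by (rule rho_pow4[OF det d z])
  then have rG: "r ^ 4 * G ^ 4 = (of_int c * z + of_int d)\<^sup>2" using gf(10) by (simp add: G_def)
  have alg: "(u * x1 * e1 * (u * G) * r * X1) * (x2 * 1 * (u * v * G) * r * X2) * (u * x3 * e2 * (v * G) * r * X3) * (u * x4 * e3 * (v * G) * r * X4) =
     (e1 * e2 * e3) * (x1 * x2 * x3 * x4) * ((u * u) * (u * u) * (v * v)) * (u * v) * (r ^ 4 * G ^ 4) * (X1 * X2 * X3 * X4)" for e1 e2 e3 x1 x2 x3 x4 X1 X2 X3 X4
    by (simp add: power4_eq_xxxx mult_ac)
  show "th c8 (of_int 1 / of_int 8) (mob a b c d z) * th odd_ind (of_int 3 / of_int 8) (mob a b c d z) * th c8 (of_int 3 / of_int 4) (mob a b c d z) * th c8 (of_int 3 / of_int 4) (mob a b c d z) =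
     chi 24 d * (of_int c * z + of_int d)\<^sup>2 * (th c8 (of_int 1 / of_int 8) z * th odd_ind (of_int 3 / of_int 8) z * th c8 (of_int 3 / of_int 4) z * th c8 (of_int 3 / of_int 4) z)"
    unfolding th_c8_eighth_gamma0[OF det c d z] th_odd_three_eighths_gamma0[OF det c d z] th_c8_three_quarters_gamma0[OF det c d z]
      gf(3,4,5,6,9) r_def[symmetric] G_def[symmetric] alg rG ph gf(7,8) by simp
qed auto

section \<open>Jacobi's triple product\<close>

text \<open>Euler's product and its partial products.\<close>

definition PN :: "complex \<Rightarrow> nat \<Rightarrow> complex" where "PN x N = (\<Prod>i<N. 1 - x ^ Suc i)"
definition Pq :: "complex \<Rightarrow> complex" where "Pq x = (\<Prod>n. 1 - x ^ Suc n)"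

lemma PN_Suc: "PN x (Suc N) = PN x N * (1 - x ^ Suc N)" and PN_0 [simp]: "PN x 0 = 1"
  by (simp_all add: PN_def)

lemma power_neq_1: "norm x < 1 \<Longrightarrow> x ^ Suc n \<noteq> (1::complex)"
proof
  assume "norm x < 1" "x ^ Suc n = 1"
  then have "norm x ^ Suc n = 1" by (metis norm_one norm_power)
  moreover have "norm x ^ Suc n < 1" using \<open>norm x < 1\<close> power_less_one_iff[of "norm x" "Suc n"] by simp
  ultimately show False by simp
qed

lemma PN_nonzero: "norm x < 1 \<Longrightarrow> PN x N \<noteq> 0"
  unfolding PN_def using power_neq_1[of x] by (simp del: power_Suc)

lemma convergent_product_of_summable:
  fixes a :: "nat \<Rightarrow> complex"
  assumes s: "summable (\<lambda>n. norm (a n))" and nz: "\<And>n. 1 + a n \<noteq> 0"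
  shows "(\<lambda>N. \<Prod>i<N. 1 + a i) \<longlonglongrightarrow> (\<Prod>n. 1 + a n)" "(\<Prod>n. 1 + a n) \<noteq> 0"
proof -
  have "abs_convergent_prod (\<lambda>n. 1 + a n)" using s by (simp add: abs_convergent_prod_conv_summable)
  then have c: "convergent_prod (\<lambda>n. 1 + a n)" by (rule abs_convergent_prod_imp_convergent_prod)
  from convergent_prod_LIMSEQ[OF c]
  have "(\<lambda>N. \<Prod>i<Suc N. 1 + a i) \<longlonglongrightarrow> (\<Prod>n. 1 + a n)" by (simp only: lessThan_Suc_atMost)
  then show "(\<lambda>N. \<Prod>i<N. 1 + a i) \<longlonglongrightarrow> (\<Prod>n. 1 + a n)" by (rule filterlim_sequentially_Suc[THEN iffD1])
  show "(\<Prod>n. 1 + a n) \<noteq> 0" by (rule prodinf_nonzero[OF c nz])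
qed

lemma summable_geometric_pow:
  fixes x :: complex assumes "norm x < 1" shows "summable (\<lambda>n. norm (- (x ^ Suc n)))"
  using summable_mult[OF summable_geometric[of "norm x"], of "norm x"] assms by (simp add: norm_mult norm_power)

lemma Pq_lim: "norm x < 1 \<Longrightarrow> PN x \<longlonglongrightarrow> Pq x"
  and Pq_nonzero: "norm x < 1 \<Longrightarrow> Pq x \<noteq> 0"
proof -
  assume x: "norm x < 1"
  have nz: "1 + - (x ^ Suc n) \<noteq> 0" for n using power_neq_1[OF x, of n] by simp
  note * = convergent_product_of_summable[OF summable_geometric_pow[OF x] nz]
  show "PN x \<longlonglongrightarrow> Pq x" using *(1) by (simp add: PN_def[abs_def] Pq_def)
  show "Pq x \<noteq> 0" using *(2) by (simp add: Pq_def)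
qed

text \<open>The Gaussian binomial coefficient as a quotient of products; the convention for
  \<open>k > N\<close> makes Pascal's rule hold without exceptions.\<close>

definition gb :: "complex \<Rightarrow> nat \<Rightarrow> nat \<Rightarrow> complex" where
  "gb p N k = (if k \<le> N then PN p N / (PN p k * PN p (N - k)) else 0)"

lemma gb_pascal:
  assumes p: "norm p < 1" and k: "k \<le> N"
  shows "gb p (Suc N) (Suc k) = gb p N (Suc k) + p ^ (N - k) * gb p N k"
proof (cases "k = N")
  case True
  then show ?thesis using PN_nonzero[OF p] by (simp add: gb_def)
next
  case False
  then obtain m where N: "N = Suc (k + m)" using k by (metis less_iff_Suc_add le_neq_implies_less add_Suc_right)
  have nz: "PN p j \<noteq> 0" "1 - p ^ Suc j \<noteq> 0" for j using PN_nonzero[OF p] power_neq_1[OF p, of j] by auto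
  have a: "gb p (Suc N) (Suc k) = PN p N * (1 - p ^ Suc N) / (PN p (Suc k) * PN p (Suc m))"
    by (simp add: gb_def N PN_Suc)
  have b: "gb p N (Suc k) = PN p N * (1 - p ^ Suc m) / (PN p (Suc k) * PN p (Suc m))"
    using nz by (simp add: gb_def N PN_Suc del: power_Suc)
  have c: "gb p N k = PN p N * (1 - p ^ Suc k) / (PN p (Suc k) * PN p (Suc m))"
    using nz by (simp add: gb_def N PN_Suc del: power_Suc)
  have e: "1 - p ^ Suc N = (1 - p ^ Suc m) + p ^ Suc m * (1 - p ^ Suc k)"
    by (simp add: N algebra_simps power_add)
  have "N - k = Suc m" by (simp add: N)
  then show ?thesis unfolding a b c e by (simp add: add_divide_distrib[symmetric] algebra_simps)
qed

text \<open>Triangular numbers, shifted: \<open>tri k = k * (k - 1) / 2\<close>.\<close>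

fun tri :: "nat \<Rightarrow> nat" where "tri 0 = 0" | "tri (Suc k) = tri k + k"

lemma tri_double: "2 * tri k + k = k\<^sup>2"
  by (induction k) (auto simp: power2_eq_square)

lemma q_binomial_theorem:
  assumes p: "norm p < 1"
  shows "(\<Prod>i<N. 1 + y * p ^ i) = (\<Sum>k\<le>N. p ^ tri k * gb p N k * y ^ k)"
proof (induction N)
  case 0 then show ?case by (simp add: gb_def)
next
  case (Suc N)
  have g0: "gb p n 0 = 1" for n using PN_nonzero[OF p] by (simp add: gb_def)
  have gN: "gb p N (Suc N) = 0" by (simp add: gb_def)
  have "(\<Sum>k\<le>Suc N. p ^ tri k * gb p (Suc N) k * y ^ k) = 1 + (\<Sum>k\<le>N. p ^ tri (Suc k) * gb p (Suc N) (Suc k) * y ^ Suc k)"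
    by (subst sum.atMost_Suc_shift) (simp add: g0)
  also have "(\<Sum>k\<le>N. p ^ tri (Suc k) * gb p (Suc N) (Suc k) * y ^ Suc k) =
     (\<Sum>k\<le>N. p ^ tri (Suc k) * gb p N (Suc k) * y ^ Suc k) + (\<Sum>k\<le>N. y * p ^ N * (p ^ tri k * gb p N k * y ^ k))"
    unfolding sum.distrib[symmetric]
  proof (intro sum.cong refl)
    fix k assume "k \<in> {..N}"
    then have k: "k \<le> N" by simp
    then have "p ^ N = p ^ (N - k) * p ^ k" by (simp add: power_add[symmetric])
    then show "p ^ tri (Suc k) * gb p (Suc N) (Suc k) * y ^ Suc k = p ^ tri (Suc k) * gb p N (Suc k) * y ^ Suc k + y * p ^ N * (p ^ tri k * gb p N k * y ^ k)"
      unfolding gb_pascal[OF p k] by (simp add: algebra_simps power_add)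
  qed
  also have "1 + (\<Sum>k\<le>N. p ^ tri (Suc k) * gb p N (Suc k) * y ^ Suc k) = (\<Sum>k\<le>Suc N. p ^ tri k * gb p N k * y ^ k)"
    by (subst sum.atMost_Suc_shift) (simp add: g0)
  then have "1 + ((\<Sum>k\<le>N. p ^ tri (Suc k) * gb p N (Suc k) * y ^ Suc k) + (\<Sum>k\<le>N. y * p ^ N * (p ^ tri k * gb p N k * y ^ k))) =
     (\<Sum>k\<le>N. p ^ tri k * gb p N k * y ^ k) + y * p ^ N * (\<Sum>k\<le>N. p ^ tri k * gb p N k * y ^ k)"
    by (simp add: sum_distrib_left gN add.assoc[symmetric])
  finally show ?case using Suc by (simp add: algebra_simps)
qed

text \<open>The \<open>q\<close>-binomial theorem with \<open>2 * n\<close> factors and the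
  argument shifted by \<open>n\<close> steps is a symmetric finite form of the triple product. The
  indices \<open>m\<close> and \<open>- m\<close> are combined.\<close>

lemma finite_jacobi:
  assumes x: "norm x < 1" "x \<noteq> 0" and z: "z \<noteq> 0"
  shows "(\<Prod>l<n. (1 + z * x ^ (2 * l + 1)) * (1 + x ^ (2 * l + 1) / z)) =
    (\<Sum>m\<le>n. gb (x\<^sup>2) (2 * n) (n + m) * (if m = 0 then 1 else x ^ m\<^sup>2 * (z ^ m + 1 / z ^ m)))"
proof -
  define p where "p = x\<^sup>2"
  have p: "norm p < 1" using x by (simp add: p_def norm_power power_less_one_iff)
  have p0: "p \<noteq> 0" using x by (simp add: p_def)
  \<comment> \<open>the shift by \<open>n\<close> steps that centres the product\<close>
  define y where "y = z * x / p ^ n"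
  have xp: "x ^ (2 * l + 1) = x * p ^ l" for l by (simp add: p_def power_mult[symmetric])
  have first: "(\<Prod>i<n. 1 + y * p ^ i) = z ^ n / x ^ n\<^sup>2 * (\<Prod>l<n. 1 + x ^ (2 * l + 1) / z)"
  proof -
    have "(\<Prod>i<n. 1 + y * p ^ i) = (\<Prod>l<n. 1 + y * p ^ (n - Suc l))"
      by (rule prod.nat_diff_reindex[symmetric])
    also have "\<dots> = (\<Prod>l<n. z / x ^ (2 * l + 1) * (1 + x ^ (2 * l + 1) / z))"
    proof (intro prod.cong refl)
      fix l assume "l \<in> {..<n}"
      then have "p ^ n = p ^ (n - Suc l) * (p * p ^ l)" by (simp add: power_add[symmetric] power_Suc[symmetric] del: power_Suc)
      then have "y * p ^ (n - Suc l) = z * x / (p * p ^ l)" using p0 by (simp add: y_def)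
      also have "\<dots> = z / x ^ (2 * l + 1)" unfolding xp using x by (simp add: p_def power2_eq_square)
      finally show "1 + y * p ^ (n - Suc l) = z / x ^ (2 * l + 1) * (1 + x ^ (2 * l + 1) / z)"
        using x z by (simp add: distrib_left)
    qed
    also have "\<dots> = (\<Prod>l<n. z / x ^ (2 * l + 1)) * (\<Prod>l<n. 1 + x ^ (2 * l + 1) / z)" by (rule prod.distrib)
    also have "(\<Prod>l<n. z / x ^ (2 * l + 1)) = z ^ n / x ^ n\<^sup>2"
    proof (induction n)
      case (Suc n)
      have "(Suc n)\<^sup>2 = n\<^sup>2 + (2 * n + 1)" by (simp add: power2_eq_square)
      then show ?case using Suc by (simp only: prod.lessThan_Suc power_add) (simp add: power_add)
    qed simp
    finally show ?thesis .
  qed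
  have second: "(\<Prod>i<n. 1 + y * p ^ (i + n)) = (\<Prod>l<n. 1 + z * x ^ (2 * l + 1))"
    unfolding xp using p0 by (intro prod.cong refl) (simp add: y_def power_add)
  define t where "t = (\<lambda>k. x ^ n\<^sup>2 / z ^ n * (p ^ tri k * y ^ k))"
  have t: "t k = x ^ n\<^sup>2 * x ^ k\<^sup>2 / x ^ (2 * n * k) * (z ^ k / z ^ n)" for k
  proof -
    have "p ^ tri k * x ^ k = x ^ k\<^sup>2" unfolding tri_double[of k, symmetric] by (simp add: p_def power_add power_mult)
    then have "p ^ tri k * y ^ k = x ^ k\<^sup>2 * z ^ k / x ^ (2 * n * k)"
      by (simp add: y_def power_divide power_mult_distrib p_def power_mult[symmetric] mult_ac)
    then show ?thesis by (simp add: t_def)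
  qed
  have t1: "t (n + m) = x ^ m\<^sup>2 * z ^ m" for m
  proof -
    have "n\<^sup>2 + (n + m)\<^sup>2 = m\<^sup>2 + 2 * n * (n + m)"
      by (simp add: power2_sum power2_eq_square distrib_left distrib_right)
    then have "x ^ n\<^sup>2 * x ^ (n + m)\<^sup>2 = x ^ m\<^sup>2 * x ^ (2 * n * (n + m))" by (simp only: power_add[symmetric])
    then show ?thesis unfolding t using x z by (simp add: power_add)
  qed
  have t2: "t (n - m) = x ^ m\<^sup>2 * (1 / z ^ m)" if mn: "m \<le> n" for m
  proof -
    obtain k where k: "n = k + m" using le_add_diff_inverse2[OF mn] by metis
    have "(k + m)\<^sup>2 + k\<^sup>2 = m\<^sup>2 + 2 * (k + m) * k" by (simp add: power2_sum power2_eq_square distrib_left distrib_right)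
    then have "x ^ (k + m)\<^sup>2 * x ^ k\<^sup>2 = x ^ m\<^sup>2 * x ^ (2 * (k + m) * k)" by (simp only: power_add[symmetric])
    then show ?thesis unfolding t k using x z by (simp add: power_add)
  qed
  have "(\<Prod>l<n. (1 + z * x ^ (2 * l + 1)) * (1 + x ^ (2 * l + 1) / z)) = x ^ n\<^sup>2 / z ^ n * (\<Prod>i<2 * n. 1 + y * p ^ i)"
  proof -
    have "(\<Prod>i<2 * n. 1 + y * p ^ i) = (\<Prod>i<n. 1 + y * p ^ i) * (\<Prod>i<n. 1 + y * p ^ (i + n))"
    proof -
      have "(\<Prod>i<n + j. 1 + y * p ^ i) = (\<Prod>i<n. 1 + y * p ^ i) * (\<Prod>i<j. 1 + y * p ^ (i + n))" for j
        by (induction j) (simp_all add: add.commute mult.assoc)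
      then show ?thesis by (simp only: mult_2)
    qed
    then show ?thesis unfolding first second using x z by (simp add: prod.distrib)
  qed
  also have "\<dots> = (\<Sum>k\<le>2 * n. gb p (2 * n) k * t k)"
    unfolding q_binomial_theorem[OF p] t_def by (simp add: sum_distrib_left mult_ac)
  also have "\<dots> = (\<Sum>m\<le>n. gb p (2 * n) (n + m) * (if m = 0 then 1 else x ^ m\<^sup>2 * (z ^ m + 1 / z ^ m)))"
  proof -
    have sym: "gb p (2 * n) (n - m) = gb p (2 * n) (n + m)" if "m \<le> n" for m
    proof -
      have "2 * n - (n - m) = n + m" "2 * n - (n + m) = n - m" using that by auto
      then show ?thesis using that by (simp add: gb_def mult.commute)
    qed
    have "{..2 * n} = (\<lambda>m. n + m) ` {..n} \<union> (\<lambda>m. n - m) ` {1..n}"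
    proof (intro equalityI subsetI)
      fix k assume "k \<in> {..2 * n}"
      then show "k \<in> (\<lambda>m. n + m) ` {..n} \<union> (\<lambda>m. n - m) ` {1..n}"
        by (cases "k \<ge> n") (auto intro: image_eqI[of _ _ "k - n"] image_eqI[of _ _ "n - k"])
    qed auto
    then have "(\<Sum>k\<le>2 * n. gb p (2 * n) k * t k) = (\<Sum>k\<in>(\<lambda>m. n + m) ` {..n}. gb p (2 * n) k * t k) + (\<Sum>k\<in>(\<lambda>m. n - m) ` {1..n}. gb p (2 * n) k * t k)"
      by (simp only:) (rule sum.union_disjoint; auto)
    also have "(\<Sum>k\<in>(\<lambda>m. n + m) ` {..n}. gb p (2 * n) k * t k) = (\<Sum>m\<le>n. gb p (2 * n) (n + m) * t (n + m))"
      by (subst sum.reindex) (auto simp: inj_on_def)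
    also have "(\<Sum>k\<in>(\<lambda>m. n - m) ` {1..n}. gb p (2 * n) k * t k) = (\<Sum>m\<in>{1..n}. gb p (2 * n) (n - m) * t (n - m))"
      by (subst sum.reindex) (auto simp: inj_on_def)
    also have "\<dots> = (\<Sum>m\<le>n. if m = 0 then 0 else gb p (2 * n) (n + m) * (x ^ m\<^sup>2 * (1 / z ^ m)))"
      by (rule sum.mono_neutral_cong_left) (auto simp: sym t2)
    also have "(\<Sum>m\<le>n. gb p (2 * n) (n + m) * t (n + m)) + (\<Sum>m\<le>n. if m = 0 then 0 else gb p (2 * n) (n + m) * (x ^ m\<^sup>2 * (1 / z ^ m))) =
        (\<Sum>m\<le>n. gb p (2 * n) (n + m) * (if m = 0 then 1 else x ^ m\<^sup>2 * (z ^ m + 1 / z ^ m)))"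
      unfolding sum.distrib[symmetric] t1 by (intro sum.cong refl) (simp add: distrib_left)
    finally show ?thesis .
  qed
  finally show ?thesis by (simp only: p_def)
qed

text \<open>The uniform bound is the domination needed for the passage to the limit.\<close>

lemma gb_bounded:
  assumes p: "norm p < 1"
  obtains C where "\<And>N k. norm (gb p N k) \<le> C"
proof -
  have "Bseq (PN p)" using Pq_lim[OF p] by (intro convergent_imp_Bseq convergentI)
  then obtain A where A: "A > 0" "\<And>n. norm (PN p n) \<le> A" by (auto elim: BseqE)
  have "(\<lambda>n. inverse (PN p n)) \<longlonglongrightarrow> inverse (Pq p)" by (intro tendsto_inverse Pq_lim Pq_nonzero p)
  then have "Bseq (\<lambda>n. inverse (PN p n))" by (intro convergent_imp_Bseq convergentI)
  then obtain B where B: "B > 0" "\<And>n. norm (inverse (PN p n)) \<le> B" by (auto elim: BseqE)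
  have "norm (gb p N k) \<le> A * (B * B)" for N k
  proof (cases "k \<le> N")
    case True
    then have "gb p N k = PN p N * (inverse (PN p k) * inverse (PN p (N - k)))" by (simp add: gb_def field_simps)
    then show ?thesis using A B by (simp only: norm_mult) (intro mult_mono mult_nonneg_nonneg; simp)
  qed (use A B in \<open>simp add: gb_def\<close>)
  then show ?thesis by (rule that)
qed

lemma gb_central_lim:
  assumes p: "norm p < 1"
  shows "(\<lambda>n. gb p (2 * n) (n + m)) \<longlonglongrightarrow> 1 / Pq p"
proof -
  have l: "(\<lambda>n. PN p (f n)) \<longlonglongrightarrow> Pq p" if "filterlim f at_top sequentially" for f
    using Pq_lim[OF p] that by (rule filterlim_compose)
  have "(\<lambda>n. PN p (2 * n) / (PN p (n + m) * PN p (n - m))) \<longlonglongrightarrow> Pq p / (Pq p * Pq p)"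
  proof (intro tendsto_divide tendsto_mult l)
    show "filterlim (\<lambda>n. 2 * n) at_top sequentially" by (rule filterlim_subseq) (simp add: strict_mono_def)
    show "filterlim (\<lambda>n. n + m) at_top sequentially" by (rule filterlim_subseq) (simp add: strict_mono_def)
    show "filterlim (\<lambda>n. n - m) at_top sequentially" by (rule filterlim_minus_const_nat_at_top)
  qed (use Pq_nonzero[OF p] in simp)
  moreover have "eventually (\<lambda>n. PN p (2 * n) / (PN p (n + m) * PN p (n - m)) = gb p (2 * n) (n + m)) sequentially"
    using eventually_ge_at_top[of m]
  proof eventually_elim
    case (elim n)
    have "2 * n - (n + m) = n - m" using elim by simp
    then show ?case using elim by (simp add: gb_def)
  qed
  ultimately have "(\<lambda>n. gb p (2 * n) (n + m)) \<longlonglongrightarrow> Pq p / (Pq p * Pq p)" by (rule Lim_transform_eventually)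
  then show ?thesis using Pq_nonzero[OF p] by simp
qed

text \<open>Tannery's theorem applied to \<open>finite_jacobi\<close>.\<close>

lemma jacobi_triple_product:
  assumes x: "norm x < 1" "x \<noteq> 0" and z: "z \<noteq> 0" "norm (x * z) \<le> 1" "norm x \<le> norm z"
    and L: "(\<lambda>n. \<Prod>l<n. (1 + z * x ^ (2 * l + 1)) * (1 + x ^ (2 * l + 1) / z)) \<longlonglongrightarrow> L"
  shows "(\<Sum>m. if m = 0 then 1 else x ^ m\<^sup>2 * (z ^ m + 1 / z ^ m)) = Pq (x\<^sup>2) * L"
    "summable (\<lambda>m. norm (if m = 0 then 1 else x ^ m\<^sup>2 * (z ^ m + 1 / z ^ m)))"
proof -
  define p where "p = x\<^sup>2"
  have p: "norm p < 1" using x by (simp add: p_def norm_power power_less_one_iff)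
  obtain C where C: "\<And>N k. norm (gb p N k) \<le> C" using gb_bounded[OF p] by blast
  have C0: "C \<ge> 0" using C[of 0 0] norm_ge_zero order_trans by blast
  define s where "s = (\<lambda>m. if m = 0 then 1 else x ^ m\<^sup>2 * (z ^ m + 1 / z ^ m))"
  define a where "a = (\<lambda>m n. gb p (2 * n) (n + m) * s m)"
  have sb: "norm (s m) \<le> 2 / norm x * norm x ^ m" for m
  proof (cases "m = 0")
    case True
    then show ?thesis using x by (simp add: s_def)
  next
    case False
    then have e: "m\<^sup>2 = m * (m - 1) + m" by (cases m) (auto simp: power2_eq_square)
    have "norm (x ^ m\<^sup>2 * (z ^ m + 1 / z ^ m)) = norm x ^ (m * (m - 1)) * norm ((x * z) ^ m + (x / z) ^ m)"
    proof -
      have "x ^ m\<^sup>2 * (z ^ m + 1 / z ^ m) = x ^ (m * (m - 1)) * ((x * z) ^ m + (x / z) ^ m)"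
        unfolding e power_add power_mult_distrib power_divide
        by (simp only: distrib_left mult.assoc times_divide_eq_right mult_1_right)
      then show ?thesis by (simp only: norm_mult norm_power)
    qed
    also have "norm ((x * z) ^ m + (x / z) ^ m) \<le> 1 + 1"
    proof (rule norm_triangle_mono)
      show "norm ((x * z) ^ m) \<le> 1" unfolding norm_power using z(2) by (intro power_le_one) auto
      have "norm (x / z) \<le> 1" using z by (simp add: norm_divide divide_le_eq)
      then show "norm ((x / z) ^ m) \<le> 1" unfolding norm_power by (intro power_le_one) auto
    qed
    also have "norm x ^ (m * (m - 1)) \<le> norm x ^ (m - 1)"
      using x False by (intro power_decreasing) auto
    also have "norm x ^ (m - 1) = norm x ^ m / norm x"
      using x False by (cases m) auto
    finally show ?thesis using False by (simp add: s_def mult_right_mono mult_ac)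
  qed
  have sg: "summable (\<lambda>m. 2 / norm x * norm x ^ m)" using x by (intro summable_mult summable_geometric) auto
  have ss: "summable (\<lambda>m. norm (s m))" by (rule summable_comparison_test'[OF sg, of 0]) (use sb in auto)
  have "eventually (\<lambda>(k, n). norm (a k n) \<le> C * norm (s k)) (at_top \<times>\<^sub>F sequentially)"
    unfolding a_def norm_mult using C by (intro always_eventually) (auto intro: mult_right_mono)
  moreover have "(\<lambda>n. a m n) \<longlonglongrightarrow> 1 / Pq p * s m" for m
    unfolding a_def by (intro tendsto_mult gb_central_lim[OF p] tendsto_const)
  ultimately have "(\<lambda>n. \<Sum>m. a m n) \<longlonglongrightarrow> (\<Sum>m. 1 / Pq p * s m)"
    using tannerys_theorem[of a "\<lambda>m. 1 / Pq p * s m" sequentially "\<lambda>k. C * norm (s k)"] summable_mult[OF ss, of C] by simp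
  moreover have "(\<Sum>m. a m n) = (\<Prod>l<n. (1 + z * x ^ (2 * l + 1)) * (1 + x ^ (2 * l + 1) / z))" for n
  proof -
    have "(\<Sum>m. a m n) = (\<Sum>m\<le>n. a m n)"
      by (rule suminf_finite) (auto simp: a_def gb_def)
    then show ?thesis unfolding finite_jacobi[OF x z(1)] a_def s_def p_def .
  qed
  ultimately have "(\<Sum>m. 1 / Pq p * s m) = L" using L LIMSEQ_unique by simp
  moreover have "(\<Sum>m. 1 / Pq p * s m) = 1 / Pq p * (\<Sum>m. s m)"
    by (rule suminf_mult[OF summable_norm_cancel[OF ss]])
  ultimately have "(\<Sum>m. s m) = Pq p * L" using Pq_nonzero[OF p] by (simp add: field_simps)
  then show "(\<Sum>m. if m = 0 then 1 else x ^ m\<^sup>2 * (z ^ m + 1 / z ^ m)) = Pq (x\<^sup>2) * L"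
    by (simp only: s_def p_def)
  show "summable (\<lambda>m. norm (if m = 0 then 1 else x ^ m\<^sup>2 * (z ^ m + 1 / z ^ m)))"
    using ss unfolding s_def .
qed

lemma norm_pow2_less: "norm (x::complex) < 1 \<Longrightarrow> norm (x\<^sup>2) < 1"
  by (simp add: norm_power power_less_one_iff)

text \<open>The even exponents in Euler's product form Euler's product at the square.\<close>

lemma odd_product_lim:
  assumes x: "norm x < 1"
  shows "(\<lambda>n. \<Prod>l<n. 1 - x ^ (2 * l + 1)) \<longlonglongrightarrow> Pq x / Pq (x\<^sup>2)"
proof -
  have x2: "norm (x\<^sup>2) < 1" using norm_pow2_less[OF x] .
  have split: "PN x (2 * n) = (\<Prod>l<n. 1 - x ^ (2 * l + 1)) * PN (x\<^sup>2) n" for n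
  proof (induction n)
    case (Suc n)
    have "PN x (2 * Suc n) = PN x (2 * n) * (1 - x ^ (2 * n + 1)) * (1 - x ^ (2 * n + 2))"
      by (simp add: PN_Suc)
    moreover have "x ^ (2 * n + 2) = (x\<^sup>2) ^ Suc n" by (simp only: power_mult[symmetric]) simp
    ultimately show ?case using Suc by (simp only: prod.lessThan_Suc PN_Suc) (simp only: mult_ac)
  qed simp
  have "(\<lambda>n. PN x (2 * n) / PN (x\<^sup>2) n) \<longlonglongrightarrow> Pq x / Pq (x\<^sup>2)"
  proof (intro tendsto_divide Pq_lim[OF x2] Pq_nonzero[OF x2])
    show "(\<lambda>n. PN x (2 * n)) \<longlonglongrightarrow> Pq x"
      by (rule filterlim_compose[OF Pq_lim[OF x] filterlim_subseq]) (simp add: strict_mono_def)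
  qed
  then show ?thesis unfolding split using PN_nonzero[OF x2] by simp
qed

lemma even_plus_product_lim:
  assumes y: "norm y < 1"
  shows "(\<lambda>n. \<Prod>l<n. 1 + y ^ Suc l) \<longlonglongrightarrow> Pq (y\<^sup>2) / Pq y"
proof -
  have y2: "norm (y\<^sup>2) < 1" using norm_pow2_less[OF y] .
  have split: "PN (y\<^sup>2) n = (\<Prod>l<n. 1 + y ^ Suc l) * PN y n" for n
  proof -
    have "1 - (y\<^sup>2) ^ Suc l = (1 + y ^ Suc l) * (1 - y ^ Suc l)" for l
      by (simp add: power_mult[symmetric] mult.commute[of 2] power_mult algebra_simps power2_eq_square power_mult_distrib)
    then show ?thesis unfolding PN_def by (simp only: prod.distrib)
  qed
  have "(\<lambda>n. PN (y\<^sup>2) n / PN y n) \<longlonglongrightarrow> Pq (y\<^sup>2) / Pq y"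
    by (intro tendsto_divide Pq_lim y y2 Pq_nonzero)
  then show ?thesis unfolding split using PN_nonzero[OF y] by simp
qed

text \<open>Gauss's series over the triangular numbers.\<close>

definition psi :: "complex \<Rightarrow> complex" where "psi y = (\<Sum>m. y ^ tri (Suc m))"

lemma tri_ge: "m \<le> tri (Suc m)" by simp

lemma summable_psi: "norm (y::complex) < 1 \<Longrightarrow> summable (\<lambda>m. norm (y ^ tri (Suc m)))"
  by (rule summable_comparison_test'[OF summable_geometric[of "norm y"], of 0])
     (auto simp: norm_power simp del: tri.simps intro: power_decreasing tri_ge)

theorem phi_minus_product:
  assumes x: "norm x < 1" "x \<noteq> 0"
  shows "(\<Sum>m. if m = 0 then 1 else 2 * (- 1) ^ m * x ^ m\<^sup>2) = Pq x ^ 2 / Pq (x\<^sup>2)"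
proof -
  have x2: "norm (x\<^sup>2) < 1" using norm_pow2_less[OF x(1)] .
  have "(\<lambda>n. (\<Prod>l<n. 1 - x ^ (2 * l + 1)) * (\<Prod>l<n. 1 - x ^ (2 * l + 1))) \<longlonglongrightarrow> (Pq x / Pq (x\<^sup>2)) * (Pq x / Pq (x\<^sup>2))"
    by (intro tendsto_mult odd_product_lim x)
  then have "(\<lambda>n. \<Prod>l<n. (1 + - 1 * x ^ (2 * l + 1)) * (1 + x ^ (2 * l + 1) / - 1)) \<longlonglongrightarrow> (Pq x / Pq (x\<^sup>2)) * (Pq x / Pq (x\<^sup>2))"
    by (simp add: prod.distrib)
  from jacobi_triple_product(1)[OF x _ _ _ this]
  have "(\<Sum>m. if m = 0 then 1 else x ^ m\<^sup>2 * ((- 1) ^ m + 1 / (- 1) ^ m)) = Pq (x\<^sup>2) * ((Pq x / Pq (x\<^sup>2)) * (Pq x / Pq (x\<^sup>2)))"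
    using x by simp
  moreover have "(\<lambda>m. if m = 0 then 1 else x ^ m\<^sup>2 * ((- 1) ^ m + 1 / (- 1) ^ m)) = (\<lambda>m. if m = 0 then 1 else 2 * (- 1) ^ m * x ^ m\<^sup>2)"
  proof (rule ext)
    fix m
    have "(- 1) ^ m + 1 / (- 1) ^ m = (2 * (- 1) ^ m :: complex)" by (cases "even m") simp_all
    then show "(if m = 0 then 1 else x ^ m\<^sup>2 * ((- 1) ^ m + 1 / (- 1) ^ m)) = (if m = 0 then 1 else 2 * (- 1) ^ m * x ^ m\<^sup>2)"
      by (simp only: mult.commute)
  qed
  moreover have "Pq (x\<^sup>2) * ((Pq x / Pq (x\<^sup>2)) * (Pq x / Pq (x\<^sup>2))) = Pq x ^ 2 / Pq (x\<^sup>2)"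
    using Pq_nonzero[OF x2] by (simp add: power2_eq_square)
  ultimately show ?thesis by (simp only:)
qed

text \<open>The triple product at \<open>z = x\<close>, with \<open>x\<close> a square root of
  \<open>y\<close>: every triangular exponent then occurs twice.\<close>

theorem psi_product:
  assumes y: "norm y < 1" "y \<noteq> 0"
  shows "psi y = Pq (y\<^sup>2) ^ 2 / Pq y"
proof -
  define x where "x = csqrt y"
  have xy: "x\<^sup>2 = y" by (simp add: x_def)
  have x: "norm x < 1" "x \<noteq> 0" using y by (auto simp: x_def)
  have xl: "x ^ (2 * l + 1) = x * y ^ l" for l by (simp add: xy[symmetric] power_mult[symmetric])
  have "(\<lambda>n. (\<Prod>l<n. 1 + y ^ Suc l) * (\<Prod>l<n. 1 + y ^ l)) \<longlonglongrightarrow> (Pq (y\<^sup>2) / Pq y) * (2 * (Pq (y\<^sup>2) / Pq y))"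
  proof (intro tendsto_mult even_plus_product_lim y)
    have "(\<lambda>n. 2 * (\<Prod>l<n. 1 + y ^ Suc l)) \<longlonglongrightarrow> 2 * (Pq (y\<^sup>2) / Pq y)"
      by (intro tendsto_mult even_plus_product_lim y tendsto_const)
    moreover have "2 * (\<Prod>l<n. 1 + y ^ Suc l) = (\<Prod>l<Suc n. 1 + y ^ l)" for n
      by (subst prod.lessThan_Suc_shift) simp
    ultimately have "(\<lambda>n. \<Prod>l<Suc n. 1 + y ^ l) \<longlonglongrightarrow> 2 * (Pq (y\<^sup>2) / Pq y)" by simp
    then show "(\<lambda>n. \<Prod>l<n. 1 + y ^ l) \<longlonglongrightarrow> 2 * (Pq (y\<^sup>2) / Pq y)" by (rule filterlim_sequentially_Suc[THEN iffD1])
  qed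
  moreover have "(\<Prod>l<n. 1 + y ^ Suc l) * (\<Prod>l<n. 1 + y ^ l) = (\<Prod>l<n. (1 + x * x ^ (2 * l + 1)) * (1 + x ^ (2 * l + 1) / x))" for n
    unfolding prod.distrib[symmetric] xl using x by (simp add: xy[symmetric] power2_eq_square mult.assoc[symmetric])
  ultimately have L: "(\<lambda>n. \<Prod>l<n. (1 + x * x ^ (2 * l + 1)) * (1 + x ^ (2 * l + 1) / x)) \<longlonglongrightarrow> (Pq (y\<^sup>2) / Pq y) * (2 * (Pq (y\<^sup>2) / Pq y))"
    by simp
  have xx: "norm (x * x) \<le> 1" using y by (simp add: xy[symmetric] power2_eq_square[symmetric])
  have e: "(\<Sum>m. if m = 0 then 1 else x ^ m\<^sup>2 * (x ^ m + 1 / x ^ m)) = Pq y * ((Pq (y\<^sup>2) / Pq y) * (2 * (Pq (y\<^sup>2) / Pq y)))"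
    using jacobi_triple_product(1)[OF x x(2) xx order_refl L] unfolding xy .
  have sp: "summable (\<lambda>m. y ^ tri (Suc m))" by (rule summable_norm_cancel[OF summable_psi[OF y(1)]])
  have tm: "(if m = 0 then 1 else x ^ m\<^sup>2 * (x ^ m + 1 / x ^ m)) = y ^ tri (Suc m) + (if m = 0 then 0 else y ^ tri m)" for m
  proof (cases m)
    case (Suc k)
    have "m\<^sup>2 + m = 2 * tri (Suc m)" using tri_double[of m] by simp
    then have 1: "x ^ m\<^sup>2 * x ^ m = y ^ tri (Suc m)" by (metis power_add power_mult xy)
    have "x ^ m\<^sup>2 = y ^ tri m * x ^ m" using tri_double[of m] by (metis power_add power_mult xy)
    then have 2: "x ^ m\<^sup>2 * (1 / x ^ m) = y ^ tri m" using x by simp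
    show ?thesis using Suc 1 2 by (simp add: distrib_left)
  qed simp
  have "(\<lambda>m. if m = 0 then 0 else y ^ tri m) sums psi y"
    using sums_Suc_iff[of "\<lambda>m. if m = 0 then 0 else y ^ tri m" "psi y"] summable_sums[OF sp] by (simp add: psi_def)
  with summable_sums[OF sp] have "(\<lambda>m. y ^ tri (Suc m) + (if m = 0 then 0 else y ^ tri m)) sums (psi y + psi y)"
    unfolding psi_def[symmetric] by (rule sums_add)
  then have "psi y + psi y = (\<Sum>m. if m = 0 then 1 else x ^ m\<^sup>2 * (x ^ m + 1 / x ^ m))"
    unfolding tm by (rule sums_unique)
  then have "2 * psi y = 2 * (Pq (y\<^sup>2) ^ 2 / Pq y)"
    unfolding e using Pq_nonzero[OF y(1)] by (simp add: power2_eq_square)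
  then show ?thesis by (rule mult_left_cancel[THEN iffD1, rotated]) simp
qed

text \<open>In the product of the factors at \<open>x\<close> and \<open>- x\<close> the odd
  exponents combine to the odd product at \<open>x\<^sup>2\<close>.\<close>

lemma Pq_minus:
  assumes x: "norm x < 1"
  shows "Pq (- x) * (Pq x * Pq (x ^ 4)) = Pq (x\<^sup>2) ^ 3"
proof -
  have x2: "norm (x\<^sup>2) < 1" using norm_pow2_less[OF x] .
  have x4: "(x\<^sup>2)\<^sup>2 = x ^ 4" by (simp add: power_mult[symmetric])
  have a: "(\<lambda>n. (\<Prod>l<n. 1 - x ^ (2 * l + 1)) * (\<Prod>l<n. 1 - (- x) ^ (2 * l + 1))) \<longlonglongrightarrow> (Pq x / Pq (x\<^sup>2)) * (Pq (- x) / Pq ((- x)\<^sup>2))"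
    by (intro tendsto_mult odd_product_lim) (use x in auto)
  have "(1 - x ^ (2 * l + 1)) * (1 - (- x) ^ (2 * l + 1)) = 1 - (x\<^sup>2) ^ (2 * l + 1)" for l
    by (simp add: power_mult[symmetric] algebra_simps power2_eq_square power_mult_distrib)
  then have "(\<lambda>n. \<Prod>l<n. 1 - (x\<^sup>2) ^ (2 * l + 1)) \<longlonglongrightarrow> (Pq x / Pq (x\<^sup>2)) * (Pq (- x) / Pq (x\<^sup>2))"
    using a unfolding prod.distrib[symmetric] by simp
  then have "(Pq x / Pq (x\<^sup>2)) * (Pq (- x) / Pq (x\<^sup>2)) = Pq (x\<^sup>2) / Pq (x ^ 4)"
    using odd_product_lim[OF x2] LIMSEQ_unique unfolding x4 by blast
  moreover have "Pq (x ^ 4) \<noteq> 0" using Pq_nonzero[OF norm_pow2_less[OF x2]] unfolding x4 .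
  ultimately show ?thesis using Pq_nonzero[OF x2] by (simp add: field_simps power3_eq_cube power2_eq_square)
qed

lemma psi_minus_product:
  assumes x: "norm x < 1" "x \<noteq> 0"
  shows "psi (- x) = Pq x * Pq (x ^ 4) / Pq (x\<^sup>2)"
proof -
  have x2: "norm (x\<^sup>2) < 1" using norm_pow2_less[OF x(1)] .
  have x4: "norm (x ^ 4) < 1" using x by (simp add: norm_power power_less_one_iff)
  have "psi (- x) = Pq (x\<^sup>2) ^ 2 / Pq (- x)" using psi_product[of "- x"] x by simp
  moreover have "Pq (- x) = Pq (x\<^sup>2) ^ 3 / (Pq x * Pq (x ^ 4))"
    using Pq_minus[OF x(1)] Pq_nonzero[OF x(1)] Pq_nonzero[OF x4] by (simp add: field_simps)
  ultimately show ?thesis using Pq_nonzero[OF x2] by (simp add: power3_eq_cube power2_eq_square)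
qed

section \<open>Eta quotients as products of theta series\<close>

lemma infsum_int_even:
  fixes T :: "int \<Rightarrow> complex"
  assumes ev: "\<And>n. T (- n) = T n" and s: "summable (\<lambda>m. norm (T (int m)))"
  shows "(\<Sum>\<^sub>\<infinity>n. T n) = (\<Sum>m. if m = 0 then T 0 else 2 * T (int m))"
proof -
  define S where "S = (\<Sum>m. T (int m))"
  have sm: "(\<lambda>m. T (int m)) sums S" unfolding S_def by (rule summable_sums[OF summable_norm_cancel[OF s]])
  have h: "((\<lambda>m. T (int m)) has_sum S) UNIV" by (rule norm_summable_imp_has_sum[OF s sm])
  have sm': "(\<lambda>m. T (int (Suc m))) sums (S - T 0)"
    using sm sums_Suc_iff[of "\<lambda>m. T (int m)" "S - T 0"] by simp
  have s': "summable (\<lambda>m. norm (T (int (Suc m))))" using s summable_Suc_iff[of "\<lambda>m. norm (T (int m))"] by simp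
  have "((\<lambda>m. T (int (Suc m))) has_sum (S - T 0)) UNIV" by (rule norm_summable_imp_has_sum[OF s' sm'])
  moreover have "T (int (Suc m)) = T (- int m - 1)" for m
  proof -
    have "- int m - 1 = - int (Suc m)" by simp
    then show ?thesis by (simp only: ev)
  qed
  ultimately have "((\<lambda>m. T (- int m - 1)) has_sum (S - T 0)) UNIV" by simp
  from has_sum_int_split[OF h this] have "(\<Sum>\<^sub>\<infinity>n. T n) = S + (S - T 0)" by (rule infsumI)
  moreover have "(\<lambda>m. 2 * T (int m) - (if m = 0 then T 0 else 0)) sums (2 * S - T 0)"
    by (intro sums_diff sums_mult sm sums_single)
  then have "(\<lambda>m. if m = 0 then T 0 else 2 * T (int m)) sums (2 * S - T 0)"
    by (rule sums_cong[THEN iffD1, rotated]) auto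
  ultimately show ?thesis by (simp add: sums_iff)
qed

lemma infsum_int_odd_support:
  fixes T :: "int \<Rightarrow> complex"
  assumes ev: "\<And>n. T (- n) = T n" and z: "\<And>n. even n \<Longrightarrow> T n = 0" and s: "summable (\<lambda>m. norm (T (2 * int m + 1)))"
  shows "(\<Sum>\<^sub>\<infinity>n. T n) = 2 * (\<Sum>m. T (2 * int m + 1))"
proof -
  define S where "S = (\<Sum>m. T (2 * int m + 1))"
  have h: "((\<lambda>m. T (2 * int m + 1)) has_sum S) UNIV"
    unfolding S_def by (rule norm_summable_imp_has_sum[OF s summable_sums[OF summable_norm_cancel[OF s]]])
  moreover have "T (2 * int m + 1) = T (2 * (- int m - 1) + 1)" for m
    using ev[of "2 * int m + 1"] by (simp add: algebra_simps)
  ultimately have "((\<lambda>m. T (2 * (- int m - 1) + 1)) has_sum S) UNIV" by simp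
  from has_sum_int_split[of "\<lambda>j. T (2 * j + 1)", OF h this]
  have "((T \<circ> (\<lambda>j. 2 * j + 1)) has_sum (S + S)) UNIV" by (simp add: o_def)
  then have "(T has_sum (S + S)) (range (\<lambda>j. 2 * j + 1))"
    by (subst has_sum_reindex) (auto simp: inj_on_def)
  then have "(T has_sum (S + S)) UNIV"
  proof (rule has_sum_cong_neutral[THEN iffD1, rotated -1])
    fix n :: int assume "n \<in> UNIV - range (\<lambda>j. 2 * j + 1)"
    have "even n"
    proof (rule ccontr)
      assume "odd n"
      then obtain k where "n = 2 * k + 1" by (elim oddE)
      then show False using \<open>n \<in> UNIV - range (\<lambda>j. 2 * j + 1)\<close> by auto
    qed
    then show "T n = 0" by (rule z)
  qed auto
  then show ?thesis by (simp add: infsumI S_def)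
qed

lemma qq_mult_nat: "qq (of_nat k * z) = qq z ^ k"
  by (simp add: qq_def exp_of_nat_mult[symmetric] mult_ac)

lemma norm_qq_less: "Im z > 0 \<Longrightarrow> norm (qq z) < 1" by (simp add: qq_def)
lemma qq_nonzero [simp]: "qq z \<noteq> 0" by (simp add: qq_def)
lemma qq_add: "qq (z + w) = qq z * qq w" by (simp add: qq_def distrib_left exp_add)

text \<open>Odd squares are \<open>8 t + 1\<close> with \<open>t\<close> triangular, so theta
  series over odd indices are values of \<open>psi\<close>.\<close>

lemma odd_square_tri: "(2 * int m + 1)\<^sup>2 = 8 * int (tri (Suc m)) + 1"
proof -
  have "int (2 * tri (Suc m) + Suc m) = int ((Suc m)\<^sup>2)" by (simp only: tri_double)
  then have "2 * int (tri (Suc m)) + (int m + 1) = (int m + 1)\<^sup>2" by (simp del: tri.simps add: algebra_simps)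
  then show ?thesis by (simp del: tri.simps add: power2_eq_square algebra_simps)
qed

lemma odd_term:
  "exp (2 * of_real pi * \<i> * z * of_real (\<alpha> * (of_int (2 * int m + 1))\<^sup>2)) = qq (of_real \<alpha> * z) * qq (8 * of_real \<alpha> * z) ^ tri (Suc m)"
proof -
  have "(of_int (2 * int m + 1))\<^sup>2 = (8 * of_nat (tri (Suc m)) + 1 :: real)"
    using arg_cong[OF odd_square_tri[of m], of "of_int :: int \<Rightarrow> real"] by (simp del: tri.simps)
  then have "z * of_real (\<alpha> * (of_int (2 * int m + 1))\<^sup>2) = of_real \<alpha> * z + of_nat (tri (Suc m)) * (8 * of_real \<alpha> * z)"
    by (simp del: tri.simps add: algebra_simps)
  then show ?thesis by (simp only: qq_mult_nat[symmetric] qq_add[symmetric]) (simp only: qq_def mult.assoc)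
qed

lemma chi8_odd: "chi8 (2 * int m + 1) = (- 1) ^ tri (Suc m)"
proof (induction m rule: less_induct)
  case (less m)
  show ?case
  proof (cases "m < 4")
    case True
    then have "m = 0 \<or> m = 1 \<or> m = 2 \<or> m = 3" by auto
    then show ?thesis by (auto simp: chi8_def numeral_eq_Suc)
  next
    case False
    then obtain k where k: "m = k + 4" by (metis add.commute le_Suc_ex not_less)
    have "chi8 (2 * int m + 1) = chi8 ((2 * int k + 1) + 8)" by (simp add: k algebra_simps)
    also have "\<dots> = chi8 (2 * int k + 1)"
    proof -
      have "chi8 (x + 8) = chi8 x" for x by (simp add: chi8_def)
      then show ?thesis by this
    qed
    also have "\<dots> = (- 1) ^ tri (Suc k)" using less k by simp
    also have "\<dots> = (- 1) ^ tri (Suc m)"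
    proof -
      have "tri (Suc m) = tri (Suc k) + 2 * (2 * k + 5)" by (simp add: k numeral_eq_Suc)
      then show ?thesis by (simp only: power_add power_mult) simp
    qed
    finally show ?thesis .
  qed
qed

lemma
  assumes z: "Im z > 0" and \<alpha>: "\<alpha> > 0"
  shows th_odd_ind: "th odd_ind \<alpha> z = 2 * qq (of_real \<alpha> * z) * psi (qq (8 * of_real \<alpha> * z))"
    and th_c8: "th c8 \<alpha> z = 2 * qq (of_real \<alpha> * z) * psi (- qq (8 * of_real \<alpha> * z))"
proof -
  define y where "y = qq (8 * of_real \<alpha> * z)"
  have "Im (8 * of_real \<alpha> * z) > 0"
  proof -
    have "8 * of_real \<alpha> * z = of_real (8 * \<alpha>) * z" by simp
    then have "Im (8 * of_real \<alpha> * z) = 8 * \<alpha> * Im z" by (simp only: times_complex.sel) simp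
    then show ?thesis using z \<alpha> by simp
  qed
  then have y: "norm y < 1" unfolding y_def by (rule norm_qq_less)
  have *: "th f \<alpha> z = 2 * qq (of_real \<alpha> * z) * psi (\<epsilon> * y)"
    if f: "\<And>n. f (- n) = f n" "\<And>n. even n \<Longrightarrow> f n = 0" "\<And>m. f (2 * int m + 1) = \<epsilon> ^ tri (Suc m)" and e: "norm \<epsilon> = 1" for f \<epsilon>
  proof -
    define T where "T = (\<lambda>n. f n * exp (2 * of_real pi * \<i> * z * of_real (\<alpha> * (of_int n)\<^sup>2)))"
    have T: "T (2 * int m + 1) = qq (of_real \<alpha> * z) * (\<epsilon> * y) ^ tri (Suc m)" for m
      unfolding T_def odd_term f(3) y_def power_mult_distrib by (simp only: mult_ac)
    have ey: "norm (\<epsilon> * y) < 1" using y e by (simp add: norm_mult)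
    have s: "summable (\<lambda>m. norm (T (2 * int m + 1)))"
      unfolding T norm_mult by (intro summable_mult summable_psi ey)
    have "th f \<alpha> z = (\<Sum>\<^sub>\<infinity>n. T n)" by (simp only: th_def T_def)
    also have "\<dots> = 2 * (\<Sum>m. T (2 * int m + 1))"
      by (rule infsum_int_odd_support[OF _ _ s]) (simp_all add: T_def f)
    also have "(\<Sum>m. T (2 * int m + 1)) = qq (of_real \<alpha> * z) * psi (\<epsilon> * y)"
      unfolding T psi_def by (rule suminf_mult[OF summable_norm_cancel[OF summable_psi[OF ey]]])
    finally show ?thesis by (simp only: mult.assoc)
  qed
  show "th odd_ind \<alpha> z = 2 * qq (of_real \<alpha> * z) * psi (qq (8 * of_real \<alpha> * z))"
    using *[of odd_ind 1] by (simp add: odd_ind_def y_def)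
  show "th c8 \<alpha> z = 2 * qq (of_real \<alpha> * z) * psi (- qq (8 * of_real \<alpha> * z))"
  proof -
    have "c8 (- n) = c8 n" for n
      using chi8_mult[of "- 1" n] by (simp add: c8_def chi8_def[of "- 1"])
    moreover have "c8 n = 0" if "even n" for n using that by (rule c8_even)
    moreover have "c8 (2 * int m + 1) = (- 1) ^ tri (Suc m)" for m
      unfolding c8_def chi8_odd by simp
    ultimately show ?thesis using *[of c8 "- 1"] by (simp add: y_def)
  qed
qed

text \<open>Jacobi's theta series with alternating and with constant signs, as functions of the
  nome.\<close>

definition phim :: "complex \<Rightarrow> complex" where "phim x = (\<Sum>m. if m = 0 then 1 else 2 * (- 1) ^ m * x ^ m\<^sup>2)"
definition phip :: "complex \<Rightarrow> complex" where "phip x = (\<Sum>m. if m = 0 then 1 else 2 * x ^ m\<^sup>2)"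

lemma summable_squares: "norm (x::complex) < 1 \<Longrightarrow> summable (\<lambda>m. norm (x ^ m\<^sup>2))"
proof (rule summable_comparison_test'[OF summable_geometric[of "norm x"], of 0])
  fix n :: nat assume x: "norm x < 1"
  have "norm x ^ n\<^sup>2 \<le> norm x ^ n" using x by (intro power_decreasing) (auto simp: power2_nat_le_imp_le)
  then show "norm (norm (x ^ n\<^sup>2)) \<le> norm x ^ n" by (simp add: norm_power)
qed auto

lemma square_term: "exp (2 * of_real pi * \<i> * z * of_real (of_nat k * (of_int (int m))\<^sup>2)) = (qq z ^ k) ^ m\<^sup>2"
  by (simp add: qq_def exp_of_nat_mult[symmetric] power_mult[symmetric] mult_ac)

lemma th_alt:
  assumes z: "Im z > 0" and k: "k > 0"
  shows "th alt (of_nat k) z = phim (qq z ^ k)"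
proof -
  define T where "T = (\<lambda>n. alt n * exp (2 * of_real pi * \<i> * z * of_real (of_nat k * (of_int n)\<^sup>2)))"
  have q: "norm (qq z ^ k) < 1" using norm_qq_less[OF z] k by (simp add: norm_power power_less_one_iff)
  have a: "alt (int m) = (- 1) ^ m" for m by (simp add: alt_def)
  have T: "T (int m) = (- 1) ^ m * (qq z ^ k) ^ m\<^sup>2" for m
    unfolding T_def square_term a ..
  have s: "summable (\<lambda>m. norm (T (int m)))"
    unfolding T using summable_squares[OF q] by (simp add: norm_mult norm_power)
  have "th alt (of_nat k) z = (\<Sum>\<^sub>\<infinity>n. T n)" by (simp only: th_def T_def)
  also have "\<dots> = (\<Sum>m. if m = 0 then T 0 else 2 * T (int m))"
    by (rule infsum_int_even[OF _ s]) (simp add: T_def alt_def)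
  also have "\<dots> = phim (qq z ^ k)"
    unfolding phim_def by (rule suminf_cong) (auto simp: T mult.assoc, simp add: T_def alt_def)
  finally show ?thesis .
qed

lemma phi_eq_phip:
  assumes z: "Im z > 0" and k: "k > 0"
  shows "phi (of_nat k * z) = phip (qq z ^ k)"
proof -
  define T where "T = (\<lambda>n. qq (of_nat k * z) ^ nat (n\<^sup>2))"
  have q: "norm (qq z ^ k) < 1" using norm_qq_less[OF z] k by (simp add: norm_power power_less_one_iff)
  have T: "T (int m) = (qq z ^ k) ^ m\<^sup>2" for m
    unfolding T_def qq_mult_nat by (simp add: nat_power_eq)
  have s: "summable (\<lambda>m. norm (T (int m)))"
    unfolding T using summable_squares[OF q] by (simp add: norm_mult norm_power)
  have "phi (of_nat k * z) = (\<Sum>\<^sub>\<infinity>n. T n)" by (simp only: phi_def T_def)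
  also have "\<dots> = (\<Sum>m. if m = 0 then T 0 else 2 * T (int m))"
    by (rule infsum_int_even[OF _ s]) (simp add: T_def)
  also have "\<dots> = phip (qq z ^ k)"
    unfolding phip_def by (rule suminf_cong) (auto simp: T, simp add: T_def)
  finally show ?thesis .
qed

lemma eta_eq:
  "eta (of_nat k * z) = exp (2 * of_real pi * \<i> * z / 24) ^ k * Pq (qq z ^ k)"
proof -
  have "exp (of_real pi * \<i> * (of_nat k * z) / 12) = exp (2 * of_real pi * \<i> * z / 24) ^ k"
    by (simp add: exp_of_nat_mult[symmetric] field_simps)
  moreover have "exp (2 * of_real pi * \<i> * of_nat (Suc n) * (of_nat k * z)) = (qq z ^ k) ^ Suc n" for n
    unfolding power_mult[symmetric] qq_def exp_of_nat_mult[symmetric] by (simp add: algebra_simps)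
  ultimately show ?thesis unfolding eta_def Pq_def by simp
qed

text \<open>Every factor \<open>psi\<close> or \<open>phim\<close> is a quotient of Euler
  products, and the powers of \<open>e(z / 24)\<close> in the eta functions add up to
  \<open>q\<^sup>2\<close> and to \<open>q\<close>.\<close>

lemma eta_quotients:
  assumes z: "Im z > 0"
  defines "q \<equiv> qq z"
  shows "C1 z = q\<^sup>2 * psi (- q) * psi (q ^ 3) * psi (- (q ^ 6)) ^ 2"
    "C2 z = q * phim q * phim (q ^ 4) * psi (q\<^sup>2) * psi (- (q ^ 6))"
proof -
  have q: "norm q < 1" "q \<noteq> 0" using norm_qq_less[OF z] by (simp_all add: q_def)
  have qk: "norm (q ^ k) < 1" if "k > 0" for k using q that by (simp add: norm_power power_less_one_iff)
  have qk0: "q ^ k \<noteq> 0" for k using q by simp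
  define e where "e = exp (2 * of_real pi * \<i> * z / 24)"
  have e0: "e \<noteq> 0" by (simp add: e_def)
  have e24: "q = e ^ 24" unfolding q_def qq_def e_def exp_of_nat_mult[symmetric] by (rule arg_cong[of _ _ exp]) simp
  have P: "Pq (q ^ k) \<noteq> 0" if "k > 0" for k using Pq_nonzero[OF qk[OF that]] .
  have eta: "eta z = e * Pq q" "eta (2 * z) = e ^ 2 * Pq (q ^ 2)" "eta (3 * z) = e ^ 3 * Pq (q ^ 3)" "eta (4 * z) = e ^ 4 * Pq (q ^ 4)"
    "eta (6 * z) = e ^ 6 * Pq (q ^ 6)" "eta (8 * z) = e ^ 8 * Pq (q ^ 8)" "eta (12 * z) = e ^ 12 * Pq (q ^ 12)" "eta (24 * z) = e ^ 24 * Pq (q ^ 24)"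
    using eta_eq[of 1 z] eta_eq[of 2 z] eta_eq[of 3 z] eta_eq[of 4 z] eta_eq[of 6 z] eta_eq[of 8 z] eta_eq[of 12 z] eta_eq[of 24 z]
    by (simp_all add: e_def q_def)
  have ps: "psi (- q) = Pq q * Pq (q ^ 4) / Pq (q ^ 2)" "psi (q ^ 3) = Pq (q ^ 6) ^ 2 / Pq (q ^ 3)"
    "psi (- (q ^ 6)) = Pq (q ^ 6) * Pq (q ^ 24) / Pq (q ^ 12)" "psi (q\<^sup>2) = Pq (q ^ 4) ^ 2 / Pq (q ^ 2)"
    using psi_minus_product[OF q] psi_product[OF qk qk0, of 3] psi_minus_product[OF qk qk0, of 6] psi_product[OF qk qk0, of 2]
    by (simp_all add: power_mult[symmetric])
  have ph: "phim q = Pq q ^ 2 / Pq (q ^ 2)" "phim (q ^ 4) = Pq (q ^ 4) ^ 2 / Pq (q ^ 8)"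
    unfolding phim_def using phi_minus_product[OF q] phi_minus_product[OF qk qk0, of 4] by (simp_all add: power_mult[symmetric])
  show "C1 z = q\<^sup>2 * psi (- q) * psi (q ^ 3) * psi (- (q ^ 6)) ^ 2"
  proof -
    have "C1 z = (e * e ^ 4 * (e ^ 6) ^ 4 * (e ^ 24) ^ 2 / (e ^ 2 * e ^ 3 * (e ^ 12) ^ 2)) *
       (Pq q * Pq (q ^ 4) * Pq (q ^ 6) ^ 4 * Pq (q ^ 24) ^ 2 / (Pq (q ^ 2) * Pq (q ^ 3) * Pq (q ^ 12) ^ 2))"
    proof -
      have "(a1 * p1) * (a4 * p4) * (a6 * p6) ^ 4 * (a24 * p24) ^ 2 / ((a2 * p2) * (a3 * p3) * (a12 * p12) ^ 2) =
        (a1 * a4 * a6 ^ 4 * a24 ^ 2 / (a2 * a3 * a12 ^ 2)) * (p1 * p4 * p6 ^ 4 * p24 ^ 2 / (p2 * p3 * p12 ^ 2))"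
        for a1 a2 a3 a4 a6 a12 a24 p1 p2 p3 p4 p6 p12 p24 :: complex
        by (simp add: power_mult_distrib mult_ac)
      then show ?thesis unfolding C1_def eta .
    qed
    also have "e * e ^ 4 * (e ^ 6) ^ 4 * (e ^ 24) ^ 2 / (e ^ 2 * e ^ 3 * (e ^ 12) ^ 2) = q\<^sup>2"
    proof -
      have "e * e ^ 4 * (e ^ 6) ^ 4 * (e ^ 24) ^ 2 = (e ^ 24)\<^sup>2 * (e ^ 2 * e ^ 3 * (e ^ 12) ^ 2)"
        unfolding power_mult[symmetric] power_add[symmetric] power_Suc[symmetric] by simp
      moreover have "e ^ 2 * e ^ 3 * (e ^ 12) ^ 2 \<noteq> 0" using e0 by simp
      ultimately show ?thesis unfolding e24 by (simp only: nonzero_mult_div_cancel_right not_False_eq_True)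
    qed
    also have "Pq q * Pq (q ^ 4) * Pq (q ^ 6) ^ 4 * Pq (q ^ 24) ^ 2 / (Pq (q ^ 2) * Pq (q ^ 3) * Pq (q ^ 12) ^ 2) =
       psi (- q) * psi (q ^ 3) * psi (- (q ^ 6)) ^ 2"
      unfolding ps by (simp add: power_divide power_mult_distrib power2_eq_square power4_eq_xxxx mult_ac)
    finally show ?thesis by (simp only: mult.assoc)
  qed
  show "C2 z = q * phim q * phim (q ^ 4) * psi (q\<^sup>2) * psi (- (q ^ 6))"
  proof -
    have "C2 z = (e ^ 2 * (e ^ 4) ^ 4 * e ^ 6 * e ^ 24 / ((e ^ 2) ^ 2 * e ^ 8 * e ^ 12)) *
       (Pq q ^ 2 * Pq (q ^ 4) ^ 4 * Pq (q ^ 6) * Pq (q ^ 24) / (Pq (q ^ 2) ^ 2 * Pq (q ^ 8) * Pq (q ^ 12)))"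
    proof -
      have "(a1 * p1) ^ 2 * (a4 * p4) ^ 4 * (a6 * p6) * (a24 * p24) / ((a2 * p2) ^ 2 * (a8 * p8) * (a12 * p12)) =
        (a1 ^ 2 * a4 ^ 4 * a6 * a24 / (a2 ^ 2 * a8 * a12)) * (p1 ^ 2 * p4 ^ 4 * p6 * p24 / (p2 ^ 2 * p8 * p12))"
        for a1 a2 a4 a6 a8 a12 a24 p1 p2 p4 p6 p8 p12 p24 :: complex
        by (simp add: power_mult_distrib mult_ac)
      then show ?thesis unfolding C2_def eta .
    qed
    also have "e ^ 2 * (e ^ 4) ^ 4 * e ^ 6 * e ^ 24 / ((e ^ 2) ^ 2 * e ^ 8 * e ^ 12) = q"
    proof -
      have "e ^ 2 * (e ^ 4) ^ 4 * e ^ 6 * e ^ 24 = e ^ 24 * ((e ^ 2) ^ 2 * e ^ 8 * e ^ 12)"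
        unfolding power_mult[symmetric] power_add[symmetric] by simp
      moreover have "(e ^ 2) ^ 2 * e ^ 8 * e ^ 12 \<noteq> 0" using e0 by simp
      ultimately show ?thesis unfolding e24 by (simp only: nonzero_mult_div_cancel_right not_False_eq_True)
    qed
    also have "Pq q ^ 2 * Pq (q ^ 4) ^ 4 * Pq (q ^ 6) * Pq (q ^ 24) / (Pq (q ^ 2) ^ 2 * Pq (q ^ 8) * Pq (q ^ 12)) =
       phim q * phim (q ^ 4) * psi (q\<^sup>2) * psi (- (q ^ 6))"
      unfolding ps ph by (simp add: power_divide power_mult_distrib power2_eq_square power4_eq_xxxx mult_ac)
    finally show ?thesis by (simp only: mult.assoc)
  qed
qed

lemma theta_eq_eta_quotients:
  assumes z: "Im z > 0"
  shows "C1 z = thetaC1 z / 16" "C2 z = thetaC2 z / 4"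
proof -
  have A: "th alt (of_int 1 / of_int 1) z = phim (qq z)" "th alt (of_int 4 / of_int 1) z = phim (qq z ^ 4)"
    using th_alt[OF z, of 1] th_alt[OF z, of 4] by simp_all
  have Q: "8 * complex_of_real (of_int 1 / of_int 4) * z = of_nat 2 * z" "8 * complex_of_real (of_int 3 / of_int 4) * z = of_nat 6 * z"
    "8 * complex_of_real (of_int 1 / of_int 8) * z = of_nat 1 * z" "8 * complex_of_real (of_int 3 / of_int 8) * z = of_nat 3 * z"
    by simp_all
  have pos: "(of_int 1 / of_int 4 :: real) > 0" "(of_int 3 / of_int 4 :: real) > 0" "(of_int 1 / of_int 8 :: real) > 0" "(of_int 3 / of_int 8 :: real) > 0"
    by simp_all
  note B = th_odd_ind[OF z pos(1), unfolded Q qq_mult_nat] th_odd_ind[OF z pos(4), unfolded Q qq_mult_nat]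
    th_c8[OF z pos(2), unfolded Q qq_mult_nat] th_c8[OF z pos(3), unfolded Q qq_mult_nat]
  have e2: "qq (complex_of_real (of_int 1 / of_int 4) * z) * qq (complex_of_real (of_int 3 / of_int 4) * z) = qq z"
    unfolding qq_add[symmetric] by (rule arg_cong[of _ _ qq]) (simp add: field_simps)
  have e1: "qq (complex_of_real (of_int 1 / of_int 8) * z) * qq (complex_of_real (of_int 3 / of_int 8) * z) *
      qq (complex_of_real (of_int 3 / of_int 4) * z) * qq (complex_of_real (of_int 3 / of_int 4) * z) = qq z ^ 2"
    unfolding qq_add[symmetric] qq_mult_nat[symmetric] by (rule arg_cong[of _ _ qq]) (simp add: field_simps)
  have alg1: "2 * a * X * (2 * b * Y) * (2 * c * Z) * (2 * c * Z) = 16 * ((a * b * c * c) * X * Y * Z ^ 2)" for a b c X Y Z :: complex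
    by (simp add: power2_eq_square)
  have alg2: "U * V * (2 * a * X) * (2 * b * Y) = 4 * ((a * b) * U * V * X * Y)" for a b X Y U V :: complex
    by simp
  show "C1 z = thetaC1 z / 16"
    unfolding thetaC1_def B alg1 e1 eta_quotients(1)[OF z] by simp
  show "C2 z = thetaC2 z / 4"
    unfolding thetaC2_def A B alg2 e2 eta_quotients(2)[OF z] by simp
qed

section \<open>Expansions modulo the ninth power of q\<close>

text \<open>A polynomial stands for a power series modulo \<open>q ^ 9\<close>; an estimate on the
  disc of radius \<open>1/2\<close> is all that the vanishing theorem needs, and it is stable
  under sums and products.\<close>

definition agree :: "(complex \<Rightarrow> complex) \<Rightarrow> complex poly \<Rightarrow> bool" where
  "agree f p \<longleftrightarrow> (\<exists>C. \<forall>q. norm q \<le> 1 / 2 \<longrightarrow> norm (f q - poly p q) \<le> C * norm q ^ 9)"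

lemma agreeI: "(\<And>q. norm q \<le> 1 / 2 \<Longrightarrow> norm (f q - poly p q) \<le> C * norm q ^ 9) \<Longrightarrow> agree f p"
  unfolding agree_def by blast

lemma agree_poly: "agree (poly p) p" by (rule agreeI[where C = 0]) simp

lemma agree_add: "agree f p \<Longrightarrow> agree g r \<Longrightarrow> agree (\<lambda>q. f q + g q) (p + r)"
proof -
  assume "agree f p" "agree g r"
  then obtain C D where C: "\<And>q. norm q \<le> 1 / 2 \<Longrightarrow> norm (f q - poly p q) \<le> C * norm q ^ 9"
    and D: "\<And>q. norm q \<le> 1 / 2 \<Longrightarrow> norm (g q - poly r q) \<le> D * norm q ^ 9" unfolding agree_def by blast
  show ?thesis
  proof (rule agreeI[where C = "C + D"])
    fix q :: complex assume q: "norm q \<le> 1 / 2"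
    have "f q + g q - poly (p + r) q = (f q - poly p q) + (g q - poly r q)" by simp
    also have "norm \<dots> \<le> C * norm q ^ 9 + D * norm q ^ 9" by (rule norm_triangle_mono[OF C[OF q] D[OF q]])
    finally show "norm (f q + g q - poly (p + r) q) \<le> (C + D) * norm q ^ 9" by (simp add: distrib_right)
  qed
qed

lemma poly_bounded_half_disc: "\<exists>B. \<forall>q::complex. norm q \<le> 1 / 2 \<longrightarrow> norm (poly p q) \<le> B"
proof -
  have "compact (poly p ` cball 0 (1 / 2))" by (intro compact_continuous_image continuous_intros compact_cball)
  then obtain B where "\<forall>x\<in>poly p ` cball 0 (1 / 2). norm x \<le> B" by (auto dest!: compact_imp_bounded simp: bounded_iff)
  then show ?thesis by (intro exI[of _ B]) auto
qed

lemma agree_mult: "agree f p \<Longrightarrow> agree g r \<Longrightarrow> agree (\<lambda>q. f q * g q) (p * r)"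
proof -
  assume "agree f p" "agree g r"
  then obtain C D where C: "\<And>q. norm q \<le> 1 / 2 \<Longrightarrow> norm (f q - poly p q) \<le> C * norm q ^ 9"
    and D: "\<And>q. norm q \<le> 1 / 2 \<Longrightarrow> norm (g q - poly r q) \<le> D * norm q ^ 9" unfolding agree_def by blast
  obtain A B where A: "\<And>q. norm q \<le> 1 / 2 \<Longrightarrow> norm (poly p q) \<le> A" and B: "\<And>q. norm q \<le> 1 / 2 \<Longrightarrow> norm (poly r q) \<le> B"
    using poly_bounded_half_disc by metis
  have D0: "D \<ge> 0"
  proof -
    have "0 \<le> D * norm (1 / 2 :: complex) ^ 9" by (rule order_trans[OF norm_ge_zero D]) (simp add: norm_divide)
    then show ?thesis by (simp add: zero_le_mult_iff norm_divide)
  qed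
  show ?thesis
  proof (rule agreeI[where C = "C * (B + D) + A * D"])
    fix q :: complex assume q: "norm q \<le> 1 / 2"
    have g: "norm (g q) \<le> B + D"
    proof -
      have "norm (g q) \<le> norm (poly r q) + norm (g q - poly r q)" using norm_triangle_ineq[of "poly r q" "g q - poly r q"] by simp
      also have "\<dots> \<le> B + D * norm q ^ 9" using B[OF q] D[OF q] by (rule add_mono)
      also have "D * norm q ^ 9 \<le> D * 1" using q D0 by (intro mult_left_mono power_le_one) auto
      finally show ?thesis by simp
    qed
    have "f q * g q - poly (p * r) q = (f q - poly p q) * g q + poly p q * (g q - poly r q)" by (simp add: algebra_simps)
    also have "norm \<dots> \<le> (C * norm q ^ 9) * (B + D) + A * (D * norm q ^ 9)"
      using C[OF q] D[OF q] A[OF q] g by (intro norm_triangle_mono) (auto simp: norm_mult intro!: mult_mono' )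
    also have "\<dots> = (C * (B + D) + A * D) * norm q ^ 9" by (simp add: algebra_simps)
    finally show "norm (f q * g q - poly (p * r) q) \<le> (C * (B + D) + A * D) * norm q ^ 9" .
  qed
qed

lemma agree_cmult: "agree f p \<Longrightarrow> agree (\<lambda>q. c * f q) ([:c:] * p)"
  using agree_mult[OF agree_poly[of "[:c:]"], of f p] by simp

lemma agree_low_order_zero:
  assumes f: "agree f p" and c: "\<And>k. k < 9 \<Longrightarrow> poly.coeff p k = 0"
  shows "\<exists>C. \<forall>q. norm q \<le> 1 / 2 \<longrightarrow> norm (f q) \<le> C * norm q ^ 9"
proof -
  obtain C where C: "\<And>q. norm q \<le> 1 / 2 \<Longrightarrow> norm (f q - poly p q) \<le> C * norm q ^ 9" using f unfolding agree_def by blast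
  have "norm (f q) \<le> (C + (\<Sum>i\<le>Polynomial.degree p. norm (poly.coeff p i))) * norm q ^ 9" if q: "norm q \<le> 1 / 2" for q
  proof -
    have "norm (poly p q) \<le> (\<Sum>i\<le>Polynomial.degree p. norm (poly.coeff p i) * norm q ^ 9)"
      unfolding poly_altdef
    proof (rule sum_norm_le)
      fix i
      show "norm (poly.coeff p i * q ^ i) \<le> norm (poly.coeff p i) * norm q ^ 9"
      proof (cases "i < 9")
        case False
        then have "norm q ^ i \<le> norm q ^ 9" using q by (intro power_decreasing) auto
        then show ?thesis by (simp add: norm_mult norm_power mult_left_mono)
      qed (simp add: c)
    qed
    moreover have "norm (f q) \<le> norm (f q - poly p q) + norm (poly p q)"
      using norm_triangle_ineq[of "f q - poly p q" "poly p q"] by simp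
    ultimately show ?thesis using C[OF q] by (simp add: distrib_right sum_distrib_right)
  qed
  then show ?thesis by blast
qed

text \<open>The tail is compared with its value at \<open>1/2\<close>.\<close>

lemma agree_series:
  fixes c :: "nat \<Rightarrow> complex" and e :: "nat \<Rightarrow> nat"
  assumes s: "summable (\<lambda>m. norm (c m) * (1 / 2) ^ e m)" and e: "\<And>m. m \<ge> K \<Longrightarrow> e m \<ge> 9"
  shows "agree (\<lambda>q. \<Sum>m. c m * q ^ e m) (\<Sum>m<K. Polynomial.monom (c m) (e m))"
proof (rule agreeI)
  fix q :: complex assume q: "norm q \<le> 1 / 2"
  have "summable (\<lambda>m. norm (c m * q ^ e m))"
    by (rule summable_comparison_test'[OF s, of 0]) (use q in \<open>auto simp: norm_mult norm_power intro!: mult_left_mono power_mono\<close>)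
  then have sq: "summable (\<lambda>m. c m * q ^ e m)" by (rule summable_norm_cancel)
  have sK: "summable (\<lambda>m. norm (c (m + K)) * (1 / 2) ^ e (m + K))"
    using s by (rule summable_ignore_initial_segment)
  have "(\<Sum>m. c m * q ^ e m) - poly (\<Sum>m<K. Polynomial.monom (c m) (e m)) q = (\<Sum>m. c (m + K) * q ^ e (m + K))"
    using suminf_split_initial_segment[OF sq, of K] by (simp add: poly_sum poly_monom)
  also have "norm \<dots> \<le> (\<Sum>m. norm (c (m + K)) * (1 / 2) ^ e (m + K) * (2 ^ 9 * norm q ^ 9))"
  proof (rule norm_suminf_le)
    show "summable (\<lambda>m. norm (c (m + K)) * (1 / 2) ^ e (m + K) * (2 ^ 9 * norm q ^ 9))" using sK by (rule summable_mult2)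
    fix m
    obtain j where j: "e (m + K) = 9 + j" using e[of "m + K"] by (metis le_add2 le_Suc_ex)
    have "norm q ^ j \<le> (1 / 2) ^ j" using q by (intro power_mono) auto
    then have "norm q ^ 9 * norm q ^ j \<le> norm q ^ 9 * (1 / 2) ^ j" by (rule mult_left_mono) simp
    then have "norm q ^ e (m + K) \<le> (1 / 2) ^ e (m + K) * (2 ^ 9 * norm q ^ 9)"
      unfolding j power_add by (simp add: mult_ac power_one_over)
    then show "norm (c (m + K) * q ^ e (m + K)) \<le> norm (c (m + K)) * (1 / 2) ^ e (m + K) * (2 ^ 9 * norm q ^ 9)"
      by (simp add: norm_mult norm_power mult_left_mono mult.assoc)
  qed
  also have "\<dots> = (\<Sum>m. norm (c (m + K)) * (1 / 2) ^ e (m + K)) * (2 ^ 9 * norm q ^ 9)" by (rule suminf_mult2[OF sK, symmetric])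
  finally show "norm ((\<Sum>m. c m * q ^ e m) - poly (\<Sum>m<K. Polynomial.monom (c m) (e m)) q) \<le> ((\<Sum>m. norm (c (m + K)) * (1 / 2) ^ e (m + K)) * 2 ^ 9) * norm q ^ 9"
    by (simp only: mult.assoc)
qed

lemma summable_half_powers:
  assumes "\<And>m. norm (c m :: complex) \<le> B" "\<And>m. m \<le> e m"
  shows "summable (\<lambda>m. norm (c m) * (1 / 2 :: real) ^ e m)"
proof (rule summable_comparison_test'[of "\<lambda>m. B * (1 / 2) ^ m" 0])
  show "summable (\<lambda>m. B * (1 / 2 :: real) ^ m)" by (intro summable_mult summable_geometric) simp
  fix m
  have "B \<ge> 0" using assms(1)[of 0] norm_ge_zero order_trans by blast
  moreover have "(1 / 2 :: real) ^ e m \<le> (1 / 2) ^ m" using assms(2) by (intro power_decreasing) auto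
  ultimately show "norm (norm (c m) * (1 / 2 :: real) ^ e m) \<le> B * (1 / 2) ^ m"
    using assms(1) by (simp add: mult_mono)
qed

lemma square_ge: "k > 0 \<Longrightarrow> m \<le> k * m\<^sup>2" for m k :: nat
  by (cases k; cases m) (auto simp: power2_eq_square)

lemma agree_phip:
  assumes k: "k > 0" and K: "\<And>m. m \<ge> K \<Longrightarrow> k * m\<^sup>2 \<ge> 9"
  shows "agree (\<lambda>q. phip (q ^ k)) (\<Sum>m<K. Polynomial.monom (if m = 0 then 1 else 2) (k * m\<^sup>2))"
proof -
  have "phip (q ^ k) = (\<Sum>m. (if m = 0 then 1 else 2) * q ^ (k * m\<^sup>2))" for q
    unfolding phip_def by (rule suminf_cong) (auto simp: power_mult)
  moreover have "agree (\<lambda>q. \<Sum>m. (if m = 0 then 1 else 2) * q ^ (k * m\<^sup>2)) (\<Sum>m<K. Polynomial.monom (if m = 0 then 1 else 2) (k * m\<^sup>2))"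
    by (rule agree_series[OF summable_half_powers[where B = 2] K]) (use square_ge[OF k] in auto)
  ultimately show ?thesis by simp
qed

lemma agree_phim:
  assumes k: "k > 0" and K: "\<And>m. m \<ge> K \<Longrightarrow> k * m\<^sup>2 \<ge> 9"
  shows "agree (\<lambda>q. phim (q ^ k)) (\<Sum>m<K. Polynomial.monom (if m = 0 then 1 else 2 * (- 1) ^ m) (k * m\<^sup>2))"
proof -
  have "phim (q ^ k) = (\<Sum>m. (if m = 0 then 1 else 2 * (- 1) ^ m) * q ^ (k * m\<^sup>2))" for q
    unfolding phim_def by (rule suminf_cong) (auto simp: power_mult)
  moreover have "agree (\<lambda>q. \<Sum>m. (if m = 0 then 1 else 2 * (- 1) ^ m) * q ^ (k * m\<^sup>2)) (\<Sum>m<K. Polynomial.monom (if m = 0 then 1 else 2 * (- 1) ^ m) (k * m\<^sup>2))"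
    by (rule agree_series[OF summable_half_powers[where B = 2] K]) (use square_ge[OF k] in \<open>auto simp: norm_mult norm_power\<close>)
  ultimately show ?thesis by simp
qed

lemma agree_psi:
  assumes k: "k > 0" and K: "\<And>m. m \<ge> K \<Longrightarrow> k * tri (Suc m) \<ge> 9" and \<epsilon>: "norm \<epsilon> = 1"
  shows "agree (\<lambda>q. psi (\<epsilon> * q ^ k)) (\<Sum>m<K. Polynomial.monom (\<epsilon> ^ tri (Suc m)) (k * tri (Suc m)))"
proof -
  have "psi (\<epsilon> * q ^ k) = (\<Sum>m. \<epsilon> ^ tri (Suc m) * q ^ (k * tri (Suc m)))" for q
    unfolding psi_def by (rule suminf_cong) (simp add: power_mult_distrib power_mult del: tri.simps)
  moreover have "agree (\<lambda>q. \<Sum>m. \<epsilon> ^ tri (Suc m) * q ^ (k * tri (Suc m))) (\<Sum>m<K. Polynomial.monom (\<epsilon> ^ tri (Suc m)) (k * tri (Suc m)))"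
  proof (rule agree_series[OF summable_half_powers[where B = 1] K])
    show "norm (\<epsilon> ^ tri (Suc m)) \<le> 1" for m using \<epsilon> by (simp add: norm_power del: tri.simps)
    show "m \<le> k * tri (Suc m)" for m
    proof -
      have "m \<le> tri (Suc m)" by (rule tri_ge)
      also have "\<dots> \<le> k * tri (Suc m)" using k by simp
      finally show ?thesis .
    qed
  qed
  ultimately show ?thesis by simp
qed

text \<open>The Eisenstein series as a function of \<open>q\<close>.\<close>

definition eis_series :: "int \<Rightarrow> int \<Rightarrow> complex \<Rightarrow> complex" where
  "eis_series t1 t2 q = eisenstein_const t1 t2 + (\<Sum>n. sigma (chi t1) (chi t2) (Suc n) * q ^ Suc n)"

lemma agree_eis:
  assumes t: "(t1, t2) \<in> {(24, 1), (1, 24), (- 8, - 3), (- 3, - 8)}"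
  shows "agree (eis_series t1 t2) ([:eisenstein_const t1 t2:] + (\<Sum>n<8. Polynomial.monom (sigma (chi t1) (chi t2) (Suc n)) (Suc n)))"
proof -
  let ?s = "\<lambda>n. sigma (chi t1) (chi t2) (Suc n)"
  obtain z where z: "Im z > 0" "qq z = 3 / 4" by (rule qq_surj[of "3 / 4"]) auto
  have "summable (\<lambda>n. ?s n * (3 / 4) ^ Suc n)" using eisenstein_modular(2)[OF t z(1)] z(2) by simp
  then have "summable (\<lambda>n. (?s n * (3 / 4)) * (3 / 4) ^ n)" by (simp add: mult_ac)
  then have "summable (\<lambda>n. norm ((?s n * (3 / 4)) * (1 / 2 :: complex) ^ n))" by (rule powser_insidea) (simp add: norm_divide)
  then have "summable (\<lambda>n. 2 / 3 * norm ((?s n * (3 / 4)) * (1 / 2 :: complex) ^ n))" by (rule summable_mult)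
  then have "summable (\<lambda>n. norm (?s n) * (1 / 2) ^ Suc n)" by (simp add: norm_mult norm_power norm_divide mult.commute)
  then have "agree (\<lambda>q. \<Sum>n. ?s n * q ^ Suc n) (\<Sum>n<8. Polynomial.monom (?s n) (Suc n))" by (rule agree_series) auto
  from agree_add[OF agree_poly[of "[:eisenstein_const t1 t2:]"] this]
  show ?thesis by (simp add: eis_series_def[abs_def])
qed

lemma eis_series_qq: "eisenstein t1 t2 z = eis_series t1 t2 (qq z)"
  by (simp add: eisenstein_def eis_series_def)

lemma sigma_eval:
  assumes "n > 0"
  shows "sigma a b n = (\<Sum>m<n. if Suc m dvd n then a (int (Suc m)) * b (int (n div Suc m)) * of_nat (Suc m) else 0)"
proof -
  have "{m. 1 \<le> m \<and> m dvd n} = Suc ` {m \<in> {..<n}. Suc m dvd n}"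
  proof (intro equalityI subsetI)
    fix x assume "x \<in> {m. 1 \<le> m \<and> m dvd n}"
    then have x: "1 \<le> x" "x dvd n" "x \<le> n" using assms by (auto dest: dvd_imp_le)
    show "x \<in> Suc ` {m \<in> {..<n}. Suc m dvd n}" by (rule image_eqI[of _ _ "x - 1"]) (use x in auto)
  qed auto
  then have "sigma a b n = (\<Sum>m\<in>{m \<in> {..<n}. Suc m dvd n}. a (int (Suc m)) * b (int (n div Suc m)) * of_nat (Suc m))"
    unfolding sigma_def by (simp only: sum.reindex inj_Suc inj_on_subset[OF inj_Suc subset_UNIV] o_def)
  then show ?thesis by (simp only: sum.inter_filter finite_lessThan)
qed

lemma sigma_small:
  "sigma a b (Suc 0) = a 1 * b 1" "sigma a b 2 = a 1 * b 2 + 2 * (a 2 * b 1)" "sigma a b 3 = a 1 * b 3 + 3 * (a 3 * b 1)"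
  "sigma a b 4 = a 1 * b 4 + 2 * (a 2 * b 2) + 4 * (a 4 * b 1)" "sigma a b 5 = a 1 * b 5 + 5 * (a 5 * b 1)"
  "sigma a b 6 = a 1 * b 6 + 2 * (a 2 * b 3) + 3 * (a 3 * b 2) + 6 * (a 6 * b 1)" "sigma a b 7 = a 1 * b 7 + 7 * (a 7 * b 1)"
  "sigma a b 8 = a 1 * b 8 + 2 * (a 2 * b 4) + 4 * (a 4 * b 2) + 8 * (a 8 * b 1)"
  by (simp_all add: sigma_eval lessThan_nat_numeral mult_ac add_ac numeral_2_eq_2[symmetric])

text \<open>The expansions of the four Eisenstein series up to \<open>q ^ 8\<close>.\<close>

definition pE1 :: "complex poly" where "pE1 = [:-3, 1, 1, 1, 1, 6, 1, -6, 1:]"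
definition pE2 :: "complex poly" where "pE2 = [:0, 1, 2, 3, 4, 6, 6, 6, 8:]"
definition pE3 :: "complex poly" where "pE3 = [:0, 1, -1, 3, 1, -6, -3, -6, -1:]"
definition pE4 :: "complex poly" where "pE4 = [:0, 1, -2, 1, 4, -6, -2, 6, -8:]"

lemma sum_8: "(\<Sum>n<8::nat. f n) = f 0 + f 1 + f 2 + f 3 + f 4 + f 5 + f 6 + (f 7 :: 'a :: comm_monoid_add)"
  by (simp add: lessThan_nat_numeral add_ac)

lemma monom_list: "[:a:] + (\<Sum>n<8. Polynomial.monom (f n) (Suc n)) = [:a, f 0, f 1, f 2, f 3, f 4, f 5, f 6, f 7:]"
  unfolding sum_8 by (simp add: numeral_eq_Suc monom_Suc monom_0)

lemma agree_E:
  "agree (eis_series 24 1) pE1" "agree (eis_series 1 24) pE2" "agree (eis_series (- 8) (- 3)) pE3" "agree (eis_series (- 3) (- 8)) pE4"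
proof -
  have c8: "cm8 0 = 0" "cm8 1 = 1" "cm8 2 = 0" "cm8 3 = 1" "cm8 4 = 0" "cm8 5 = - 1" "cm8 6 = 0" "cm8 7 = - 1" "cm8 8 = 0"
    by (simp_all add: cm8_def chi8_def chi4_def)
  have c3: "cm3 0 = 0" "cm3 1 = 1" "cm3 2 = - 1" "cm3 3 = 0" "cm3 4 = 1" "cm3 5 = - 1" "cm3 6 = 0" "cm3 7 = 1" "cm3 8 = - 1"
    by (simp_all add: cm3_def chi3_def)
  note simps = sigma_small numeral_2_eq_2[symmetric] c8 c3 c24_values c1_def
  have "[:eisenstein_const 24 1:] + (\<Sum>n<8. Polynomial.monom (sigma (chi 24) (chi 1) (Suc n)) (Suc n)) = pE1"
    unfolding monom_list sigma_chi pE1_def eisenstein_const_def by (simp add: simps)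
  then show "agree (eis_series 24 1) pE1" using agree_eis[of 24 1] by simp
  have "[:eisenstein_const 1 24:] + (\<Sum>n<8. Polynomial.monom (sigma (chi 1) (chi 24) (Suc n)) (Suc n)) = pE2"
    unfolding monom_list sigma_chi pE2_def eisenstein_const_def by (simp add: simps)
  then show "agree (eis_series 1 24) pE2" using agree_eis[of 1 24] by simp
  have "[:eisenstein_const (- 8) (- 3):] + (\<Sum>n<8. Polynomial.monom (sigma (chi (- 8)) (chi (- 3)) (Suc n)) (Suc n)) = pE3"
    unfolding monom_list sigma_chi pE3_def eisenstein_const_def by (simp add: simps)
  then show "agree (eis_series (- 8) (- 3)) pE3" using agree_eis[of "- 8" "- 3"] by simp
  have "[:eisenstein_const (- 3) (- 8):] + (\<Sum>n<8. Polynomial.monom (sigma (chi (- 3)) (chi (- 8)) (Suc n)) (Suc n)) = pE4"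
    unfolding monom_list sigma_chi pE4_def eisenstein_const_def by (simp add: simps)
  then show "agree (eis_series (- 3) (- 8)) pE4" using agree_eis[of "- 3" "- 8"] by simp
qed

text \<open>The expansions of the theta function at \<open>q\<close>, \<open>q ^ 2\<close>,
  \<open>q ^ 3\<close> and \<open>q ^ 6\<close>.\<close>

definition pF1 :: "complex poly" where "pF1 = [:1, 2, 0, 0, 2:]"
definition pF2 :: "complex poly" where "pF2 = [:1, 0, 2, 0, 0, 0, 0, 0, 2:]"
definition pF3 :: "complex poly" where "pF3 = [:1, 0, 0, 2:]"
definition pF6 :: "complex poly" where "pF6 = [:1, 0, 0, 0, 0, 0, 2:]"

lemma square_ge_9: "m \<ge> 3 \<Longrightarrow> m\<^sup>2 \<ge> 9" for m :: nat
  using power_mono[of 3 m 2] by simp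

lemma square_ge_4: "m \<ge> 2 \<Longrightarrow> m\<^sup>2 \<ge> 4" for m :: nat
  using power_mono[of 2 m 2] by simp

lemma agree_F:
  "agree (\<lambda>q. phip (q ^ 1)) pF1" "agree (\<lambda>q. phip (q ^ 2)) pF2" "agree (\<lambda>q. phip (q ^ 3)) pF3" "agree (\<lambda>q. phip (q ^ 6)) pF6"
proof -
  have "(\<Sum>m<3. Polynomial.monom (if m = 0 then 1 else 2) (1 * m\<^sup>2)) = pF1" "(\<Sum>m<3. Polynomial.monom (if m = 0 then 1 else 2) (2 * m\<^sup>2)) = pF2"
    "(\<Sum>m<2. Polynomial.monom (if m = 0 then 1 else 2) (3 * m\<^sup>2)) = pF3" "(\<Sum>m<2. Polynomial.monom (if m = 0 then 1 else 2) (6 * m\<^sup>2)) = pF6"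
    by (simp_all add: numeral_eq_Suc monom_Suc monom_0 pF1_def pF2_def pF3_def pF6_def)
  moreover have "agree (\<lambda>q. phip (q ^ 1)) (\<Sum>m<3. Polynomial.monom (if m = 0 then 1 else 2) (1 * m\<^sup>2))"
    by (rule agree_phip) (use square_ge_9 in auto)
  moreover have "agree (\<lambda>q. phip (q ^ 2)) (\<Sum>m<3. Polynomial.monom (if m = 0 then 1 else 2) (2 * m\<^sup>2))"
    by (rule agree_phip) (auto dest: square_ge_9)
  moreover have "agree (\<lambda>q. phip (q ^ 3)) (\<Sum>m<2. Polynomial.monom (if m = 0 then 1 else 2) (3 * m\<^sup>2))"
    by (rule agree_phip) (auto dest: square_ge_4)
  moreover have "agree (\<lambda>q. phip (q ^ 6)) (\<Sum>m<2. Polynomial.monom (if m = 0 then 1 else 2) (6 * m\<^sup>2))"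
    by (rule agree_phip) (auto dest: square_ge_4)
  ultimately show "agree (\<lambda>q. phip (q ^ 1)) pF1" "agree (\<lambda>q. phip (q ^ 2)) pF2" "agree (\<lambda>q. phip (q ^ 3)) pF3" "agree (\<lambda>q. phip (q ^ 6)) pF6"
    by simp_all
qed

text \<open>The two eta quotients as functions of \<open>q\<close>, and their expansions as
  products of truncated theta series.\<close>

definition ser1 :: "complex \<Rightarrow> complex" where "ser1 q = q\<^sup>2 * psi (- q) * psi (q ^ 3) * psi (- (q ^ 6)) * psi (- (q ^ 6))"
definition ser2 :: "complex \<Rightarrow> complex" where "ser2 q = q * phim q * phim (q ^ 4) * psi (q\<^sup>2) * psi (- (q ^ 6))"

definition pC1 :: "complex poly" where "pC1 = [:0, 0, 1:] * [:1, -1, 0, -1, 0, 0, 1:] * [:1, 0, 0, 1:] * [:1, 0, 0, 0, 0, 0, -1:] * [:1, 0, 0, 0, 0, 0, -1:]"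
definition pC2 :: "complex poly" where "pC2 = [:0, 1:] * [:1, -2, 0, 0, 2:] * [:1, 0, 0, 0, -2:] * [:1, 0, 1, 0, 0, 0, 1:] * [:1, 0, 0, 0, 0, 0, -1:]"

lemma tri_ge_10: "m \<ge> 4 \<Longrightarrow> tri (Suc m) \<ge> 10"
proof -
  have "tri (Suc m) \<ge> tri (Suc 4)" if "m \<ge> 4" using that by (induction m rule: dec_induct) auto
  then show "m \<ge> 4 \<Longrightarrow> tri (Suc m) \<ge> 10" by (simp add: numeral_eq_Suc)
qed

lemma tri_ge_6: "m \<ge> 3 \<Longrightarrow> tri (Suc m) \<ge> 6"
proof -
  have "tri (Suc m) \<ge> tri (Suc 3)" if "m \<ge> 3" using that by (induction m rule: dec_induct) auto
  then show "m \<ge> 3 \<Longrightarrow> tri (Suc m) \<ge> 6" by (simp add: numeral_eq_Suc)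
qed

lemma tri_ge_3: "m \<ge> 2 \<Longrightarrow> tri (Suc m) \<ge> 3"
proof -
  have "tri (Suc m) \<ge> tri (Suc 2)" if "m \<ge> 2" using that by (induction m rule: dec_induct) auto
  then show "m \<ge> 2 \<Longrightarrow> tri (Suc m) \<ge> 3" by (simp add: numeral_eq_Suc)
qed

lemma agree_C: "agree ser1 pC1" "agree ser2 pC2"
proof -
  have P: "(\<Sum>m<4. Polynomial.monom ((- 1) ^ tri (Suc m)) (1 * tri (Suc m))) = [:1, -1, 0, -1, 0, 0, 1 :: complex:]"
    "(\<Sum>m<2. Polynomial.monom (1 ^ tri (Suc m)) (3 * tri (Suc m))) = [:1, 0, 0, 1 :: complex:]"
    "(\<Sum>m<2. Polynomial.monom ((- 1) ^ tri (Suc m)) (6 * tri (Suc m))) = [:1, 0, 0, 0, 0, 0, -1 :: complex:]"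
    "(\<Sum>m<3. Polynomial.monom (1 ^ tri (Suc m)) (2 * tri (Suc m))) = [:1, 0, 1, 0, 0, 0, 1 :: complex:]"
    "(\<Sum>m<3. Polynomial.monom (if m = 0 then 1 else 2 * (- 1) ^ m) (1 * m\<^sup>2)) = [:1, -2, 0, 0, 2 :: complex:]"
    "(\<Sum>m<2. Polynomial.monom (if m = 0 then 1 else 2 * (- 1) ^ m) (4 * m\<^sup>2)) = [:1, 0, 0, 0, -2 :: complex:]"
    by (simp_all add: numeral_eq_Suc monom_Suc monom_0)
  have a1: "agree (\<lambda>q. psi (- q)) [:1, -1, 0, -1, 0, 0, 1:]"
    using agree_psi[of 1 4 "- 1"] tri_ge_10 unfolding P by (fastforce simp del: tri.simps)
  have a3: "agree (\<lambda>q. psi (q ^ 3)) [:1, 0, 0, 1:]"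
    using agree_psi[of 3 2 "1"] tri_ge_3 unfolding P by (fastforce simp del: tri.simps)
  have a6: "agree (\<lambda>q. psi (- (q ^ 6))) [:1, 0, 0, 0, 0, 0, -1:]"
    using agree_psi[of 6 2 "- 1"] tri_ge_3 unfolding P by (fastforce simp del: tri.simps)
  have a2: "agree (\<lambda>q. psi (q\<^sup>2)) [:1, 0, 1, 0, 0, 0, 1:]"
    using agree_psi[of 2 3 "1"] tri_ge_6 unfolding P by (fastforce simp del: tri.simps)
  have m1: "agree (\<lambda>q. phim q) [:1, -2, 0, 0, 2:]"
    using agree_phim[of 1 3] square_ge_9 unfolding P by fastforce
  have m4: "agree (\<lambda>q. phim (q ^ 4)) [:1, 0, 0, 0, -2:]"
    using agree_phim[of 4 2] square_ge_4 unfolding P by fastforce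
  have q: "agree (\<lambda>q. q\<^sup>2) [:0, 0, 1:]" "agree (\<lambda>q. q) [:0, 1:]"
    using agree_poly[of "[:0, 0, 1:]"] agree_poly[of "[:0, 1:]"] by (simp_all add: agree_def power2_eq_square)
  show "agree ser1 pC1" unfolding ser1_def[abs_def] pC1_def by (intro agree_mult q a1 a3 a6)
  show "agree ser2 pC2" unfolding ser2_def[abs_def] pC2_def by (intro agree_mult q m1 m4 a2 a6)
qed

section \<open>Comparison of coefficients\<close>

lemma modular_formsD:
  assumes "f \<in> modular_forms k N \<epsilon>"
  shows "f holomorphic_on {z. Im z > 0}"
    and "\<And>a b c d z. a * d - b * c = (1::int) \<Longrightarrow> int N dvd c \<Longrightarrow> Im z > 0 \<Longrightarrow>
        f (mob a b c d z) = \<epsilon> d * (of_int c * z + of_int d) ^ k * f z"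
    and "\<And>a b c d. a * d - b * c = (1::int) \<Longrightarrow>
        \<exists>B Y. Y > 0 \<and> (\<forall>z. Im z > Y \<longrightarrow> norm (f (mob a b c d z) / (of_int c * z + of_int d) ^ k) \<le> B)"
  using assms unfolding modular_forms_def mob_def by auto

lemma modular_formsI:
  assumes "f holomorphic_on {z. Im z > 0}"
    and "\<And>a b c d z. a * d - b * c = (1::int) \<Longrightarrow> int N dvd c \<Longrightarrow> Im z > 0 \<Longrightarrow>
        f (mob a b c d z) = \<epsilon> d * (of_int c * z + of_int d) ^ k * f z"
    and "\<And>a b c d. a * d - b * c = (1::int) \<Longrightarrow>
        \<exists>B Y. Y > 0 \<and> (\<forall>z. Im z > Y \<longrightarrow> norm (f (mob a b c d z) / (of_int c * z + of_int d) ^ k) \<le> B)"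
  shows "f \<in> modular_forms k N \<epsilon>"
  using assms unfolding modular_forms_def mob_def by blast

lemma modular_forms_add:
  assumes f: "f \<in> modular_forms k N \<epsilon>" and g: "g \<in> modular_forms k N \<epsilon>"
  shows "(\<lambda>z. f z + g z) \<in> modular_forms k N \<epsilon>"
proof (rule modular_formsI)
  show "(\<lambda>z. f z + g z) holomorphic_on {z. Im z > 0}"
    by (intro holomorphic_intros modular_formsD(1)[OF f] modular_formsD(1)[OF g])
  show "f (mob a b c d z) + g (mob a b c d z) = \<epsilon> d * (of_int c * z + of_int d) ^ k * (f z + g z)"
    if "a * d - b * c = 1" "int N dvd c" "Im z > 0" for a b c d z
    unfolding modular_formsD(2)[OF f that] modular_formsD(2)[OF g that] by (simp add: distrib_left)
  fix a b c d :: int assume det: "a * d - b * c = 1"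
  obtain B1 Y1 where 1: "Y1 > 0" "\<And>z. Im z > Y1 \<Longrightarrow> norm (f (mob a b c d z) / (of_int c * z + of_int d) ^ k) \<le> B1"
    using modular_formsD(3)[OF f det] by blast
  obtain B2 Y2 where 2: "Y2 > 0" "\<And>z. Im z > Y2 \<Longrightarrow> norm (g (mob a b c d z) / (of_int c * z + of_int d) ^ k) \<le> B2"
    using modular_formsD(3)[OF g det] by blast
  have "norm ((f (mob a b c d z) + g (mob a b c d z)) / (of_int c * z + of_int d) ^ k) \<le> B1 + B2"
    if "Im z > max Y1 Y2" for z
    unfolding add_divide_distrib using that by (intro norm_triangle_mono 1 2) auto
  then show "\<exists>B Y. Y > 0 \<and> (\<forall>z. Im z > Y \<longrightarrow> norm ((f (mob a b c d z) + g (mob a b c d z)) / (of_int c * z + of_int d) ^ k) \<le> B)"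
    using max.strict_coboundedI1[OF 1(1), of Y2] by blast
qed

lemma modular_forms_cmult:
  assumes f: "f \<in> modular_forms k N \<epsilon>"
  shows "(\<lambda>z. s * f z) \<in> modular_forms k N \<epsilon>"
proof (rule modular_formsI)
  show "(\<lambda>z. s * f z) holomorphic_on {z. Im z > 0}"
    by (intro holomorphic_intros modular_formsD(1)[OF f])
  show "s * f (mob a b c d z) = \<epsilon> d * (of_int c * z + of_int d) ^ k * (s * f z)"
    if "a * d - b * c = 1" "int N dvd c" "Im z > 0" for a b c d z
    unfolding modular_formsD(2)[OF f that] by simp
  fix a b c d :: int assume det: "a * d - b * c = 1"
  obtain B Y where 1: "Y > 0" "\<And>z. Im z > Y \<Longrightarrow> norm (f (mob a b c d z) / (of_int c * z + of_int d) ^ k) \<le> B"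
    using modular_formsD(3)[OF f det] by blast
  have "norm (s * f (mob a b c d z) / (of_int c * z + of_int d) ^ k) \<le> norm s * B" if "Im z > Y" for z
    using 1(2)[OF that] by (simp add: norm_mult mult_left_mono flip: times_divide_eq_right)
  then show "\<exists>B Y. Y > 0 \<and> (\<forall>z. Im z > Y \<longrightarrow> norm (s * f (mob a b c d z) / (of_int c * z + of_int d) ^ k) \<le> B)"
    using 1(1) by blast
qed

lemma modular_forms_cong:
  assumes f: "f \<in> modular_forms k N \<epsilon>" and e: "\<And>z. Im z > 0 \<Longrightarrow> f z = g z"
  shows "g \<in> modular_forms k N \<epsilon>"
proof (rule modular_formsI)
  show "g holomorphic_on {z. Im z > 0}"
    by (rule holomorphic_cong[THEN iffD1, OF refl _ modular_formsD(1)[OF f]]) (use e in auto)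
  show "g (mob a b c d z) = \<epsilon> d * (of_int c * z + of_int d) ^ k * g z"
    if "a * d - b * c = 1" "int N dvd c" "Im z > 0" for a b c d z
    using modular_formsD(2)[OF f that] e[OF that(3)] e[OF Im_mob_pos[OF that(1,3)]] by simp
  fix a b c d :: int assume det: "a * d - b * c = 1"
  obtain B Y where 1: "Y > 0" "\<And>z. Im z > Y \<Longrightarrow> norm (f (mob a b c d z) / (of_int c * z + of_int d) ^ k) \<le> B"
    using modular_formsD(3)[OF f det] by blast
  have "norm (g (mob a b c d z) / (of_int c * z + of_int d) ^ k) \<le> B" if "Im z > Y" for z
    using 1(2)[OF that] e[OF Im_mob_pos[OF det, of z]] that 1(1) by simp
  then show "\<exists>B Y. Y > 0 \<and> (\<forall>z. Im z > Y \<longrightarrow> norm (g (mob a b c d z) / (of_int c * z + of_int d) ^ k) \<le> B)"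
    using 1(1) by blast
qed

lemma norm_chi_24:
  assumes "a * d - b * c = (1::int)" "24 dvd c"
  shows "norm (chi 24 d) = 1"
proof -
  obtain k where k: "c = 24 * k" using assms(2) by (elim dvdE)
  have "a * d = 1 + 24 * (b * k)" using assms(1) by (simp add: k algebra_simps)
  then have "c24 (a * d) = c24 1" using periodic_mult[of c24 24 1 "b * k", OF c_per(1)] by simp
  then have "norm (c24 a) * norm (c24 d) = 1" by (simp add: c_mult(1) c24_values norm_mult[symmetric])
  moreover have "norm (c24 a) * norm (c24 d) \<le> 1 * norm (c24 d)" by (intro mult_right_mono norm_c_le) auto
  ultimately show ?thesis using norm_c_le(1)[of d] unfolding chi_24_eq by linarith
qed

text \<open>The valence bound in terms of the definition of modular forms.\<close>

theorem vanishing_order_9: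
  assumes F: "F \<in> modular_forms 2 24 (chi 24)"
    and ord: "\<And>z. Im z > 1 \<Longrightarrow> norm (F z) \<le> C * norm (qq z) ^ 9" and w: "Im w > 0"
  shows "F w = 0"
proof (rule valence_bound_24[OF modular_formsD(1)[OF F] _ _ _ w])
  fix a b c d :: int and z :: complex
  assume h: "a * d - b * c = 1" "24 dvd c" "Im z > 0"
  then have "F (mob a b c d z) = chi 24 d * (of_int c * z + of_int d)\<^sup>2 * F z" using modular_formsD(2)[OF F h(1)] by simp
  then show "norm (F (mob a b c d z)) = (norm (of_int c * z + of_int d))\<^sup>2 * norm (F z)"
    using norm_chi_24[OF h(1,2)] by (simp add: norm_mult norm_power)
next
  fix a b c d :: int assume "a * d - b * c = 1"
  from modular_formsD(3)[OF F this]
  show "\<exists>B Y. \<forall>z. Im z > Y \<longrightarrow> norm (F (mob a b c d z) / (of_int c * z + of_int d)\<^sup>2) \<le> B" by blast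
next
  fix z assume "Im z > 1"
  from ord[OF this] show "norm (F z) \<le> C * exp (- (2 * pi * 9 * Im z))"
    by (simp add: qq_def exp_of_nat_mult[symmetric] mult.assoc)
qed

lemma norm_qq_small: "Im z > 1 \<Longrightarrow> norm (qq z) \<le> 1 / 2"
proof -
  assume z: "Im z > 1"
  have "1 * 1 \<le> (2 * pi) * Im z" using z pi_gt3 by (intro mult_mono) auto
  then have "norm (qq z) \<le> exp (- 1)" by (simp add: qq_def)
  also have "exp (- 1 :: real) \<le> 1 / 2" using exp_ge_add_one_self[of 1] by (simp add: exp_minus field_simps)
  finally show ?thesis .
qed

lemma C_modular: "C1 \<in> modular_forms 2 24 (chi 24)" "C2 \<in> modular_forms 2 24 (chi 24)"
proof -
  show "C1 \<in> modular_forms 2 24 (chi 24)"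
    by (rule modular_forms_cong[OF modular_forms_cmult[OF thetaC1_modular, of "1 / 16"]]) (simp add: theta_eq_eta_quotients)
  show "C2 \<in> modular_forms 2 24 (chi 24)"
    by (rule modular_forms_cong[OF modular_forms_cmult[OF thetaC2_modular, of "1 / 4"]]) (simp add: theta_eq_eta_quotients)
qed

text \<open>Only the linear system of nine coefficients distinguishes the eight
  identities.\<close>

lemma identity_from_coefficients:
  fixes a1 a2 a3 a4 :: nat and b1 b2 b3 b4 x1 x2 z :: complex
  assumes pos: "a1 > 0" "a2 > 0" "a3 > 0" "a4 > 0"
    and f: "agree (\<lambda>q. phip (q ^ a1)) f1" "agree (\<lambda>q. phip (q ^ a2)) f2" "agree (\<lambda>q. phip (q ^ a3)) f3" "agree (\<lambda>q. phip (q ^ a4)) f4"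
    and modular: "phi4 a1 a2 a3 a4 \<in> modular_forms 2 24 (chi 24)" and z: "Im z > 0"
    and coeffs: "\<And>k. k < 9 \<Longrightarrow> poly.coeff (f1 * f2 * f3 * f4) k = poly.coeff ([:b1:] * pE1 + [:b2:] * pE2 + [:b3:] * pE3 + [:b4:] * pE4 + [:x1:] * pC1 + [:x2:] * pC2) k"
  shows "phi4 a1 a2 a3 a4 z = b1 * eisenstein 24 1 z + b2 * eisenstein 1 24 z + b3 * eisenstein (- 8) (- 3) z + b4 * eisenstein (- 3) (- 8) z + x1 * C1 z + x2 * C2 z"
proof -
  define G where "G = (\<lambda>z. b1 * eisenstein 24 1 z + b2 * eisenstein 1 24 z + b3 * eisenstein (- 8) (- 3) z + b4 * eisenstein (- 3) (- 8) z + x1 * C1 z + x2 * C2 z)"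
  define F where "F = (\<lambda>z. phi4 a1 a2 a3 a4 z + - 1 * G z)"
  have E: "eisenstein 24 1 \<in> modular_forms 2 24 (chi 24)" "eisenstein 1 24 \<in> modular_forms 2 24 (chi 24)"
    "eisenstein (- 8) (- 3) \<in> modular_forms 2 24 (chi 24)" "eisenstein (- 3) (- 8) \<in> modular_forms 2 24 (chi 24)"
    by (intro eisenstein_modular(1); simp)+
  have FM: "F \<in> modular_forms 2 24 (chi 24)"
    unfolding F_def G_def by (intro modular_forms_add modular_forms_cmult modular E C_modular)
  define H where "H = (\<lambda>q. phip (q ^ a1) * phip (q ^ a2) * phip (q ^ a3) * phip (q ^ a4) + - 1 *
    (b1 * eis_series 24 1 q + b2 * eis_series 1 24 q + b3 * eis_series (- 8) (- 3) q + b4 * eis_series (- 3) (- 8) q + x1 * ser1 q + x2 * ser2 q))"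
  have FH: "F z = H (qq z)" if "Im z > 0" for z
    unfolding F_def G_def H_def phi4_def eis_series_qq eta_quotients[OF that] ser1_def ser2_def
      phi_eq_phip[OF that pos(1)] phi_eq_phip[OF that pos(2)] phi_eq_phip[OF that pos(3)] phi_eq_phip[OF that pos(4)]
    by (simp only: power2_eq_square[of "psi (- (qq z ^ 6))"] mult.assoc)
  define S where "S = [:b1:] * pE1 + [:b2:] * pE2 + [:b3:] * pE3 + [:b4:] * pE4 + [:x1:] * pC1 + [:x2:] * pC2"
  have "agree H (f1 * f2 * f3 * f4 + [:- 1:] * S)"
    unfolding H_def S_def by (intro agree_add agree_mult agree_cmult agree_E agree_C f)
  moreover have "poly.coeff (f1 * f2 * f3 * f4 + [:- 1:] * S) k = 0" if "k < 9" for k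
    using coeffs[OF that] unfolding S_def[symmetric] by simp
  ultimately obtain C where C: "\<And>q. norm q \<le> 1 / 2 \<Longrightarrow> norm (H q) \<le> C * norm q ^ 9"
    using agree_low_order_zero by blast
  have "F z = 0"
  proof (rule vanishing_order_9[OF FM _ z])
    fix z assume z: "Im z > 1"
    then have "F z = H (qq z)" by (intro FH) simp
    then show "norm (F z) \<le> C * norm (qq z) ^ 9" using C[OF norm_qq_small[OF z]] by simp
  qed
  then have "phi4 a1 a2 a3 a4 z - G z = 0" by (simp add: F_def)
  then show ?thesis by (simp only: G_def right_minus_eq)
qed

lemma coeff_const_mult: "poly.coeff ([:c:] * p) k = c * poly.coeff (p :: complex poly) k" by simp

lemma less_9_cases: "k < 9 \<Longrightarrow> k = 0 \<or> k = 1 \<or> k = 2 \<or> k = 3 \<or> k = 4 \<or> k = 5 \<or> k = 6 \<or> k = 7 \<or> k = (8::nat)"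
  by auto

lemma pC_expand:
  "k < 9 \<Longrightarrow> poly.coeff pC1 k = poly.coeff [:0, 0, 1, -1, 0, 0, -1, 0, -2:] k"
  "k < 9 \<Longrightarrow> poly.coeff pC2 k = poly.coeff [:0, 1, -2, 1, -2, 0, 4, 0, 4:] k"
  unfolding pC1_def pC2_def by (drule less_9_cases; elim disjE; simp add: numeral_eq_Suc)+

lemma phi_expand:
  assumes k: "k < 9"
  shows "poly.coeff (pF1 * pF1 * pF1 * pF6) k = poly.coeff ([:- 1/3:] * pE1 + [:4:] * pE2 + [:1:] * pE3 + [:- 4/3:] * pE4 + [:8:] * pC1 + [:8/3:] * pC2) k"
    "poly.coeff (pF1 * pF1 * pF2 * pF3) k = poly.coeff ([:- 1/3:] * pE1 + [:4:] * pE2 + [:- 1:] * pE3 + [:4/3:] * pE4 + [:0:] * pC1 + [:0:] * pC2) k"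
    "poly.coeff (pF1 * pF2 * pF2 * pF6) k = poly.coeff ([:- 1/3:] * pE1 + [:2:] * pE2 + [:1:] * pE3 + [:- 2/3:] * pE4 + [:0:] * pC1 + [:0:] * pC2) k"
    "poly.coeff (pF1 * pF3 * pF3 * pF6) k = poly.coeff ([:- 1/3:] * pE1 + [:4/3:] * pE2 + [:- 1/3:] * pE3 + [:4/3:] * pE4 + [:0:] * pC1 + [:0:] * pC2) k"
    "poly.coeff (pF1 * pF6 * pF6 * pF6) k = poly.coeff ([:- 1/3:] * pE1 + [:2/3:] * pE2 + [:- 1/3:] * pE3 + [:2/3:] * pE4 + [:8/3:] * pC1 + [:4/3:] * pC2) k"
    "poly.coeff (pF2 * pF2 * pF2 * pF3) k = poly.coeff ([:- 1/3:] * pE1 + [:2:] * pE2 + [:- 1:] * pE3 + [:2/3:] * pE4 + [:0:] * pC1 + [:- 4/3:] * pC2) k"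
    "poly.coeff (pF2 * pF3 * pF3 * pF3) k = poly.coeff ([:- 1/3:] * pE1 + [:4/3:] * pE2 + [:1/3:] * pE3 + [:- 4/3:] * pE4 + [:- 8/3:] * pC1 + [:0:] * pC2) k"
    "poly.coeff (pF2 * pF3 * pF6 * pF6) k = poly.coeff ([:- 1/3:] * pE1 + [:2/3:] * pE2 + [:1/3:] * pE3 + [:- 2/3:] * pE4 + [:0:] * pC1 + [:0:] * pC2) k"
  using less_9_cases[OF k]
  unfolding coeff_add coeff_const_mult pC_expand[OF k] pF1_def pF2_def pF3_def pF6_def pE1_def pE2_def pE3_def pE4_def
  by - (elim disjE; simp add: numeral_eq_Suc)+

theorem theorem3p4:
  fixes a1 a2 a3 a4 :: nat
    and b1 b2 b3 b4 x1 x2 z :: complex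
  assumes row: "((a1, a2, a3, a4), (b1, b2, b3, b4, x1, x2)) \<in>
    {((1, 1, 1, 6), (- 1/3, 4,    1,     - 4/3, 8,     8/3)),
     ((1, 1, 2, 3), (- 1/3, 4,    - 1,   4/3,   0,     0)),
     ((1, 2, 2, 6), (- 1/3, 2,    1,     - 2/3, 0,     0)),
     ((1, 3, 3, 6), (- 1/3, 4/3,  - 1/3, 4/3,   0,     0)),
     ((1, 6, 6, 6), (- 1/3, 2/3,  - 1/3, 2/3,   8/3,   4/3)),
     ((2, 2, 2, 3), (- 1/3, 2,    - 1,   2/3,   0,     - 4/3)),
     ((2, 3, 3, 3), (- 1/3, 4/3,  1/3,   - 4/3, - 8/3, 0)),
     ((2, 3, 6, 6), (- 1/3, 2/3,  1/3,   - 2/3, 0,     0))}"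
    and modular: "phi4 a1 a2 a3 a4 \<in> modular_forms 2 24 (chi 24)"
    and z: "Im z > 0"
  shows "phi4 a1 a2 a3 a4 z =
    b1 * eisenstein 24 1 z + b2 * eisenstein 1 24 z +
    b3 * eisenstein (- 8) (- 3) z + b4 * eisenstein (- 3) (- 8) z +
    x1 * C1 z + x2 * C2 z"
proof -
  note id = identity_from_coefficients[OF _ _ _ _ _ _ _ _ modular z]
  from row consider
      "a1 = 1" "a2 = 1" "a3 = 1" "a4 = 6" "b1 = - 1/3" "b2 = 4" "b3 = 1" "b4 = - 4/3" "x1 = 8" "x2 = 8/3"
    | "a1 = 1" "a2 = 1" "a3 = 2" "a4 = 3" "b1 = - 1/3" "b2 = 4" "b3 = - 1" "b4 = 4/3" "x1 = 0" "x2 = 0"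
    | "a1 = 1" "a2 = 2" "a3 = 2" "a4 = 6" "b1 = - 1/3" "b2 = 2" "b3 = 1" "b4 = - 2/3" "x1 = 0" "x2 = 0"
    | "a1 = 1" "a2 = 3" "a3 = 3" "a4 = 6" "b1 = - 1/3" "b2 = 4/3" "b3 = - 1/3" "b4 = 4/3" "x1 = 0" "x2 = 0"
    | "a1 = 1" "a2 = 6" "a3 = 6" "a4 = 6" "b1 = - 1/3" "b2 = 2/3" "b3 = - 1/3" "b4 = 2/3" "x1 = 8/3" "x2 = 4/3"
    | "a1 = 2" "a2 = 2" "a3 = 2" "a4 = 3" "b1 = - 1/3" "b2 = 2" "b3 = - 1" "b4 = 2/3" "x1 = 0" "x2 = - 4/3"
    | "a1 = 2" "a2 = 3" "a3 = 3" "a4 = 3" "b1 = - 1/3" "b2 = 4/3" "b3 = 1/3" "b4 = - 4/3" "x1 = - 8/3" "x2 = 0"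
    | "a1 = 2" "a2 = 3" "a3 = 6" "a4 = 6" "b1 = - 1/3" "b2 = 2/3" "b3 = 1/3" "b4 = - 2/3" "x1 = 0" "x2 = 0"
    by (elim insertE emptyE) (simp_all only: prod.inject)
  then show ?thesis
  proof cases
    case 1
    show ?thesis by (rule id[where ?f1.0 = pF1 and ?f2.0 = pF1 and ?f3.0 = pF1 and ?f4.0 = pF6]; unfold 1) (simp_all only: agree_F phi_expand(1) zero_less_one zero_less_numeral)
  next
    case 2
    show ?thesis by (rule id[where ?f1.0 = pF1 and ?f2.0 = pF1 and ?f3.0 = pF2 and ?f4.0 = pF3]; unfold 2) (simp_all only: agree_F phi_expand(2) zero_less_one zero_less_numeral)
  next
    case 3
    show ?thesis by (rule id[where ?f1.0 = pF1 and ?f2.0 = pF2 and ?f3.0 = pF2 and ?f4.0 = pF6]; unfold 3) (simp_all only: agree_F phi_expand(3) zero_less_one zero_less_numeral)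
  next
    case 4
    show ?thesis by (rule id[where ?f1.0 = pF1 and ?f2.0 = pF3 and ?f3.0 = pF3 and ?f4.0 = pF6]; unfold 4) (simp_all only: agree_F phi_expand(4) zero_less_one zero_less_numeral)
  next
    case 5
    show ?thesis by (rule id[where ?f1.0 = pF1 and ?f2.0 = pF6 and ?f3.0 = pF6 and ?f4.0 = pF6]; unfold 5) (simp_all only: agree_F phi_expand(5) zero_less_one zero_less_numeral)
  next
    case 6
    show ?thesis by (rule id[where ?f1.0 = pF2 and ?f2.0 = pF2 and ?f3.0 = pF2 and ?f4.0 = pF3]; unfold 6) (simp_all only: agree_F phi_expand(6) zero_less_one zero_less_numeral)
  next
    case 7
    show ?thesis by (rule id[where ?f1.0 = pF2 and ?f2.0 = pF3 and ?f3.0 = pF3 and ?f4.0 = pF3]; unfold 7) (simp_all only: agree_F phi_expand(7) zero_less_one zero_less_numeral)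
  next
    case 8
    show ?thesis by (rule id[where ?f1.0 = pF2 and ?f2.0 = pF3 and ?f3.0 = pF6 and ?f4.0 = pF6]; unfold 8) (simp_all only: agree_F phi_expand(8) zero_less_one zero_less_numeral)
  qed
qed

end
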